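(* Let $1\le p,q,p_1,p_2,q_1,q_2\le\infty$ and $\tau\in[0,1]$. Then $$\forall\sigma\in M^{p,q}(\mathbb{R}^{2d})\Longrightarrow OP_\tau(\sigma):\mathcal{M}^{p_1,q_1}(\mathbb{R}^d)\longrightarrow M^{p_2,q_2}(\mathbb{R}^d)$$ if and only if $$p_1,q_1,p_2',q_2'\le q'\qquad\text{and}\qquad\frac1{p_1}+\frac1{p_2'}\ge\frac1{p'}+\frac1{q'},\quad\frac1{q_1}+\frac1{q_2'}\ge\frac1{p'}+\frac1{q'}.$$
   Context: $p'$ denotes the conjugate exponent, $1/p+1/p'=1$, with $1/\infty=0$. $\langle\cdot,\cdot\rangle$ extends $\langle f,g\rangle=\int f\bar g$ to $\mathcal{S}'\times\mathcal{S}$. $\tau$-Wigner distribution: $W_\tau(f_1,f_2)(x,\xi)=\int_{\mathbb{R}^d}f_1(x+\tau t)\overline{f_2(x-(1-\tau)t)}e^{-2\pi i\xi\cdot t}\,dt$. $\tau$-pseudodifferential operator with symbol $\sigma\in\mathcal{S}'(\mathbb{R}^{2d})$: $\langle OP_\tau(\sigma)f,g\rangle=\langle\sigma,W_\tau(g,f)\rangle$ for $f,g\in\mathcal{S}(\mathbb{R}^d)$. Modulation spaces: for $f\in\mathcal{S}'(\mathbb{R}^n)$ and a fixed nonzero $\phi\in\mathcal{S}(\mathbb{R}^n)$, $V_\phi f(x,\xi)=\langle f,M_\xi T_x\phi\rangle$ with $T_xg(t)=g(t-x)$, $M_\xi g(t)=e^{2\pi it\cdot\xi}g(t)$. $M^{p,q}(\mathbb{R}^n)$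 is the set of $f\in\mathcal{S}'(\mathbb{R}^n)$ with $\|f\|_{M^{p,q}}=\big(\int(\int|V_\phi f(x,\xi)|^pdx)^{q/p}d\xi\big)^{1/q}<\infty$ (usual modification if $p$ or $q$ is $\infty$; different $\phi$ give equivalent norms). $\mathcal{M}^{p,q}(\mathbb{R}^n)$ is the closure of $\mathcal{S}(\mathbb{R}^n)$ in $M^{p,q}(\mathbb{R}^n)$. The notation "$\forall\sigma\in X\Longrightarrow OP_\tau(\sigma):\mathcal{M}^{p_1,q_1}\to M^{p_2,q_2}$" means that for every $\sigma\in X$ there is $C_\sigma$ with $\|OP_\tau(\sigma)f\|_{M^{p_2,q_2}}\le C_\sigma\|f\|_{M^{p_1,q_1}}$ for all $f\in\mathcal{S}(\mathbb{R}^d)$. *)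

theory Defs
  imports "HOL-Analysis.Analysis" "HOL-Probability.Essential_Supremum"
begin

section \<open>Schwartz functions and tempered distributions\<close>

definition iter_partial :: "'a::euclidean_space list \<Rightarrow> ('a \<Rightarrow> complex) \<Rightarrow> 'a \<Rightarrow> complex" where
  "iter_partial bs f = foldr (\<lambda>b g x. frechet_derivative g (at x) b) bs f"

definition schwartz_seminorm :: "nat \<Rightarrow> 'a::euclidean_space list \<Rightarrow> ('a \<Rightarrow> complex) \<Rightarrow> real" where
  "schwartz_seminorm k bs f = (SUP x. (1 + norm x) ^ k * norm (iter_partial bs f x))"

definition schwartz :: "('a::euclidean_space \<Rightarrow> complex) set" where
  "schwartz = {f. \<forall>bs\<in>lists Basis.
     (\<forall>x. iter_partial bs f differentiable at x) \<and>
     (\<forall>k. bdd_above (range (\<lambda>x. (1 + norm x) ^ k * norm (iter_partial bs f x))))}"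

definition schwartz_topology :: "('a::euclidean_space \<Rightarrow> complex) topology" where
  "schwartz_topology = topology_generated_by
     {{g \<in> schwartz. schwartz_seminorm k bs (\<lambda>x. g x - f x) < e} | f k bs e.
        f \<in> schwartz \<and> bs \<in> lists Basis \<and> 0 < e}"

text \<open>The duality bracket extends \<open>\<langle>f, g\<rangle> = \<integral> f (cnj g)\<close>, so it is conjugate linear in its second
  argument. A tempered distribution \<open>u\<close> is represented by the functional \<open>g \<mapsto> \<langle>u, g\<rangle>\<close> itself, i.e.
  by a continuous conjugate-linear functional on the Schwartz space. Membership in
  \<open>extensional schwartz\<close> only fixes the irrelevant values at non-Schwartz functions, so that
  equality of functionals is equality of distributions.\<close>

definition tempered :: "(('a::euclidean_space \<Rightarrow> complex) \<Rightarrow> complex) set" where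
  "tempered = {u \<in> extensional schwartz.
     (\<forall>f\<in>schwartz. \<forall>g\<in>schwartz. u (\<lambda>x. f x + g x) = u f + u g) \<and>
     (\<forall>c. \<forall>f\<in>schwartz. u (\<lambda>x. c * f x) = cnj c * u f) \<and>
     continuous_map schwartz_topology euclidean u}"

definition distribution_of :: "('a::euclidean_space \<Rightarrow> complex) \<Rightarrow> ('a \<Rightarrow> complex) \<Rightarrow> complex" where
  "distribution_of f = (\<lambda>g\<in>schwartz. \<integral>x. f x * cnj (g x) \<partial>lborel)"

section \<open>Modulation spaces\<close>

definition translation :: "'a::euclidean_space \<Rightarrow> ('a \<Rightarrow> complex) \<Rightarrow> 'a \<Rightarrow> complex" where
  "translation x g = (\<lambda>t. g (t - x))"

definition modulation :: "'a::euclidean_space \<Rightarrow> ('a \<Rightarrow> complex) \<Rightarrow> 'a \<Rightarrow> complex" where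
  "modulation \<xi> g = (\<lambda>t. exp (2 * pi * \<i> * of_real (t \<bullet> \<xi>)) * g t)"

definition stft ::
  "('a::euclidean_space \<Rightarrow> complex) \<Rightarrow> (('a \<Rightarrow> complex) \<Rightarrow> complex) \<Rightarrow> 'a \<Rightarrow> 'a \<Rightarrow> complex" where
  "stft \<phi> u x \<xi> = u (modulation \<xi> (translation x \<phi>))"

text \<open>Only used for exponents \<open>a > 0\<close>.\<close>

definition ennreal_powr :: "ennreal \<Rightarrow> real \<Rightarrow> ennreal" where
  "ennreal_powr x a = (if x = \<infinity> then \<infinity> else ennreal (enn2real x powr a))"

definition Lp_norm :: "'a measure \<Rightarrow> ennreal \<Rightarrow> ('a \<Rightarrow> ennreal) \<Rightarrow> ennreal" where
  "Lp_norm M p F =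
     (if p = \<infinity> then esssup M F
      else ennreal_powr (\<integral>\<^sup>+x. ennreal_powr (F x) (enn2real p) \<partial>M) (1 / enn2real p))"

definition modulation_norm ::
  "('a::euclidean_space \<Rightarrow> complex) \<Rightarrow> ennreal \<Rightarrow> ennreal \<Rightarrow> (('a \<Rightarrow> complex) \<Rightarrow> complex) \<Rightarrow> ennreal" where
  "modulation_norm \<phi> p q u =
     Lp_norm lborel q (\<lambda>\<xi>. Lp_norm lborel p (\<lambda>x. ennreal (norm (stft \<phi> u x \<xi>))))"

definition modulation_space ::
  "('a::euclidean_space \<Rightarrow> complex) \<Rightarrow> ennreal \<Rightarrow> ennreal \<Rightarrow> (('a \<Rightarrow> complex) \<Rightarrow> complex) set" where
  "modulation_space \<phi> p q = {u \<in> tempered. modulation_norm \<phi> p q u < \<infinity>}"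

text \<open>With the conventions \<open>inverse 0 = \<infinity>\<close> and \<open>inverse \<infinity> = 0\<close> of \<^typ>\<open>ennreal\<close> this includes the
  endpoints \<open>p = 1\<close> and \<open>p = \<infinity>\<close>.\<close>

definition conj_exponent :: "ennreal \<Rightarrow> ennreal" where
  "conj_exponent p = inverse (1 - inverse p)"

lemma conj_exponent_iff:
  assumes "1 \<le> p"
  shows "1 / p + 1 / r = 1 \<longleftrightarrow> r = conj_exponent p"
proof -
  have le: "1 / p \<le> 1"
  proof (cases "p = \<infinity>")
    case False
    then have "p / p = 1"
      using assms by (intro ennreal_divide_self) (auto simp: less_top)
    then show ?thesis
      using divide_right_mono_ennreal[OF assms, of p] by simp
  qed simp
  then have fin: "1 / p \<noteq> top"
    by (metis ennreal_one_neq_top top.extremum_unique)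
  have "1 / p + 1 / r = 1 \<longleftrightarrow> 1 / r = 1 - 1 / p"
    using le fin by (metis add_diff_inverse_ennreal ennreal_add_diff_cancel_left)
  also have "\<dots> \<longleftrightarrow> r = 1 / (1 - 1 / p)"
    by (metis one_divide_one_divide_ennreal)
  finally show ?thesis
    by (simp add: conj_exponent_def divide_ennreal_def)
qed

section \<open>The cross-Wigner distribution and pseudodifferential operators\<close>

definition tau_wigner ::
  "real \<Rightarrow> ('a::euclidean_space \<Rightarrow> complex) \<Rightarrow> ('a \<Rightarrow> complex) \<Rightarrow> 'a \<times> 'a \<Rightarrow> complex" where
  "tau_wigner \<tau> f1 f2 = (\<lambda>(x, \<xi>).
     \<integral>t. f1 (x + \<tau> *\<^sub>R t) * cnj (f2 (x - (1 - \<tau>) *\<^sub>R t)) * exp (- 2 * pi * \<i> * of_real (\<xi> \<bullet> t)) \<partial>lborel)"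

definition tau_op ::
  "real \<Rightarrow> (('a::euclidean_space \<times> 'a \<Rightarrow> complex) \<Rightarrow> complex) \<Rightarrow> ('a \<Rightarrow> complex) \<Rightarrow> ('a \<Rightarrow> complex) \<Rightarrow> complex" where
  "tau_op \<tau> \<sigma> f = (\<lambda>g\<in>schwartz. \<sigma> (tau_wigner \<tau> g f))"

end

theory Submission
  imports Defs "HOL-Probability.Sinc_Integral" "HOL-Probability.Characteristic_Functions"
begin

text \<open>Sufficiency. Moyal's identity gives \<open>\<parallel>\<Gamma>\<parallel>\<^sup>2 \<sigma>(F) = \<integral> V\<^sub>\<Gamma> \<sigma> \<cdot> cnj (V\<^sub>\<Gamma> F)\<close> for the window
  \<open>\<Gamma> = W\<^sub>\<tau>(\<phi>, \<phi>)\<close>, and \<open>V\<^sub>\<Gamma> W\<^sub>\<tau>(g, f)\<close> is, up to a phase, the product of \<open>V\<^sub>\<phi> g\<close> and the conjugate of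
  \<open>V\<^sub>\<phi> f\<close> at two points depending linearly on the argument. Hence \<open>\<bar>V\<^sub>\<phi> (OP\<^sub>\<tau>(\<sigma>) f)\<bar>\<close> is dominated by a
  bilinear integral of \<open>\<bar>V\<^sub>\<Gamma> \<sigma>\<bar>\<close> and \<open>\<bar>V\<^sub>\<phi> f\<bar>\<close>, which a four-fold Hoelder inequality and Minkowski's
  inequality bound in mixed norms at the extremal exponents; since short-time Fourier transforms
  are locally almost constant, mixed norms decrease as the exponents increase, and this covers the
  remaining cases.

  Necessity. Let \<open>g\<close> be the Gaussian and \<open>\<pi>\<^sub>m g\<close> its translate (or modulation) by \<open>m e\<close>. The symbol
  \<open>\<Sum> u\<^sub>n v\<^sub>k W\<^sub>\<tau>(\<pi>\<^sub>m g, \<pi>\<^sub>m' g)\<close>, where \<open>(m, m')\<close> is \<open>(n, n + k)\<close> or \<open>(n + k, n)\<close>, lies in \<open>M\<^sup>p\<^sup>,\<^sup>q\<close> if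
  \<open>u\<close> is \<open>p\<close>-summable and \<open>v\<close> is \<open>q\<close>-summable. All inner products \<open>\<langle>\<pi>\<^sub>i g, \<pi>\<^sub>j g\<rangle>\<close> are nonnegative, so pairing
  the image of \<open>\<Sum>\<^sub>j\<^sub><\<^sub>N \<pi>\<^sub>j g\<close> with \<open>\<Sum>\<^sub>i\<^sub><\<^sub>M \<pi>\<^sub>i g\<close> bounds the partial sums of \<open>u\<^sub>n v\<^sub>k\<close> by powers of \<open>N\<close> and
  \<open>M\<close>. Power sequences at the edge of summability, or \<open>u\<close> a unit mass, give the conditions.\<close>

text \<open>Exponents enter through their reciprocals in [0, 1]: conjugation is \<theta> \<mapsto> 1
  - \<theta>, Hoelder's condition is additive, endpoints fit the same statements, and the conditions
  of the theorem are linear. The symbol is only a continuous functional, so the inversion formula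
  must be pushed through it; this rests on Riemann sums that converge in every Schwartz seminorm.
  The multilinear estimate works for P \<le> Q, since Minkowski's inequality exchanges two of the
  norms only in that order; for P > Q the symbol norm is first weakened to equal exponents, where
  the sum conditions follow from the individual ones. In the converse direction the constant depends
  on the symbol. No uniformity over symbols is required, because one symbol with weights just beyond
  the threshold of summability tests all scales N and M at once. Gaussians are used because their
  shifts along a time line or a frequency line have nonnegative inner products: nothing cancels, and
  every finite partial sum is a lower bound.\<close>

text \<open>The value at \<open>a = 0\<close> differs from \<^const>\<open>ennreal_powr\<close> at \<open>\<infinity>\<close>; with it Hoelder's inequality for the
  weights \<open>a\<close> and \<open>1 - a\<close> holds at the endpoints as well.\<close>

definition epow :: "ennreal \<Rightarrow> real \<Rightarrow> ennreal" where
  "epow x a = (if a = 0 then 1 else ennreal_powr x a)"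

lemma epow_0 [simp]: "epow x 0 = 1"
  by (simp add: epow_def)

lemma epow_1 [simp]: "epow x 1 = x"
  by (cases x) (auto simp: epow_def ennreal_powr_def)

lemma epow_top [simp]: "a \<noteq> 0 \<Longrightarrow> epow \<infinity> a = \<infinity>"
  by (simp add: epow_def ennreal_powr_def)

lemma epow_zero [simp]: "a \<noteq> 0 \<Longrightarrow> epow 0 a = 0"
  by (simp add: epow_def ennreal_powr_def)

lemma epow_one [simp]: "epow 1 a = 1"
  by (simp add: epow_def ennreal_powr_def)

lemma epow_ennreal: "0 \<le> r \<Longrightarrow> a \<noteq> 0 \<Longrightarrow> epow (ennreal r) a = ennreal (r powr a)"
  by (simp add: epow_def ennreal_powr_def)

lemma epow_mult: "0 \<le> a \<Longrightarrow> epow (x * y) a = epow x a * epow y a"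
proof (cases "a = 0")
  case False
  assume "0 \<le> a"
  show ?thesis
  proof (cases "x = 0 \<or> y = 0")
    case True
    then show ?thesis using False by auto
  next
    case nz: False
    show ?thesis
    proof (cases x)
      case (real r) note x = this
      show ?thesis
      proof (cases y)
        case (real s)
        then show ?thesis using x False
          by (simp add: epow_ennreal powr_mult flip: ennreal_mult)
      next
        case top
        then show ?thesis using x nz False
          by (auto simp: ennreal_mult_top epow_ennreal epow_top[simplified] powr_eq_0_iff)
      qed
    next
      case top
      have "epow y a \<noteq> 0"
        using nz False by (cases y) (auto simp: epow_ennreal epow_top[simplified])
      then show ?thesis using top nz False
        by (auto simp: ennreal_top_mult epow_top[simplified])
    qed
  qed
qed simp

lemma epow_add: "0 \<le> a \<Longrightarrow> 0 \<le> b \<Longrightarrow> epow x (a + b) = epow x a * epow x b"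
proof (cases "a = 0 \<or> b = 0")
  case False
  assume "0 \<le> a" "0 \<le> b"
  then show ?thesis using False
    by (cases x) (auto simp: epow_ennreal powr_add epow_top[simplified] simp flip: ennreal_mult)
qed auto

lemma epow_epow: "0 \<le> a \<Longrightarrow> 0 \<le> b \<Longrightarrow> epow (epow x a) b = epow x (a * b)"
  by (cases "a = 0 \<or> b = 0"; cases x) (auto simp: epow_ennreal powr_powr epow_top[simplified])

lemma epow_mono: "0 \<le> a \<Longrightarrow> x \<le> y \<Longrightarrow> epow x a \<le> epow y a"
  by (cases "a = 0"; cases x; cases y)
    (auto simp: epow_ennreal powr_mono2 epow_top[simplified] top_unique)

lemma epow_inv: "0 < a \<Longrightarrow> epow (epow x a) (1 / a) = x" "0 < a \<Longrightarrow> epow (epow x (1 / a)) a = x"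
  by (simp_all add: epow_epow)

lemma epow_le_iff: "0 < a \<Longrightarrow> epow x a \<le> y \<longleftrightarrow> x \<le> epow y (1 / a)"
  by (metis epow_inv epow_mono divide_nonneg_nonneg less_imp_le zero_le_one)

lemma epow_eq_top_iff: "0 < a \<Longrightarrow> epow x a = \<infinity> \<longleftrightarrow> x = \<infinity>"
  by (cases x) (auto simp: epow_ennreal epow_top[simplified])

lemma epow_eq_0_iff: "0 < a \<Longrightarrow> epow x a = 0 \<longleftrightarrow> x = 0"
  by (cases x) (auto simp: epow_ennreal epow_top[simplified])

lemma epow_lt_top: "x < \<infinity> \<Longrightarrow> 0 \<le> a \<Longrightarrow> epow x a < \<infinity>"
  by (cases "a = 0"; cases x) (auto simp: epow_ennreal)

lemma epow_measurable [measurable]: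
  assumes [measurable]: "f \<in> borel_measurable M"
  shows "(\<lambda>x. epow (f x) a) \<in> borel_measurable M"
proof (cases "a = 0")
  case False
  have [measurable]: "{x \<in> space M. f x = \<infinity>} \<in> sets M"
    by (rule borel_measurable_eq) auto
  have "(\<lambda>x. if f x = \<infinity> then \<infinity> else ennreal (enn2real (f x) powr a)) \<in> borel_measurable M"
    by (intro measurable_If) auto
  then show ?thesis using False by (simp add: epow_def ennreal_powr_def)
qed simp

text \<open>For a > 0 the power map is an order isomorphism of [0, \<infinity>] with inverse power 1
  / a (\<open>epow_le_iff\<close>), hence it preserves suprema; no continuity argument is
  involved.\<close>

lemma epow_SUP:
  fixes f :: "nat \<Rightarrow> ennreal"
  assumes a: "0 < a"
  shows "epow (SUP i. f i) a = (SUP i. epow (f i) a)"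
proof (rule antisym)
  have "(SUP i. f i) \<le> epow (SUP i. epow (f i) a) (1 / a)"
    using a by (intro SUP_least) (auto simp: epow_le_iff[symmetric] intro: SUP_upper)
  then show "epow (SUP i. f i) a \<le> (SUP i. epow (f i) a)"
    using a by (simp add: epow_le_iff)
  show "(SUP i. epow (f i) a) \<le> epow (SUP i. f i) a"
    using a by (intro SUP_least epow_mono) (auto intro: SUP_upper)
qed

text \<open>Weighted inequality of the arithmetic and geometric mean. At the extreme values a zero
  argument kills the left side and an infinite one makes the right side infinite, so only positive
  reals need the classical inequality.\<close>

lemma epow_young:
  assumes "0 \<le> a" "0 \<le> b" "a + b = 1"
  shows "epow x a * epow y b \<le> ennreal a * x + ennreal b * y"
proof (cases "a = 0 \<or> b = 0")
  case True
  then show ?thesis using assms by auto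
next
  case False
  then have ab: "0 < a" "0 < b" using assms by auto
  show ?thesis
  proof (cases "x = 0 \<or> y = 0 \<or> x = \<infinity> \<or> y = \<infinity>")
    case True
    then show ?thesis using ab by (auto simp: ennreal_mult_top ennreal_top_mult)
  next
    case nz: False
    then obtain r s where "x = ennreal r" "y = ennreal s" "0 < r" "0 < s"
      by (cases x; cases y) (auto simp: less_le)
    then show ?thesis
      using Youngs_inequality_0[of a b r s] assms ab
      by (simp add: epow_ennreal flip: ennreal_mult ennreal_plus)
  qed
qed

section \<open>Lebesgue norms indexed by the reciprocal exponent\<close>

text \<open>Young's inequality is integrated after both functions have been normalised to integral
  one. Normalising is possible only for integrals in (0, \<infinity>), which is why the other values
  are treated first.\<close>

lemma nn_holder:
  assumes [measurable]: "f \<in> borel_measurable M" "g \<in> borel_measurable M"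
    and ab: "0 \<le> a" "0 \<le> b" "a + b = 1"
  shows "(\<integral>\<^sup>+x. epow (f x) a * epow (g x) b \<partial>M) \<le> epow (\<integral>\<^sup>+x. f x \<partial>M) a * epow (\<integral>\<^sup>+x. g x \<partial>M) b"
proof (cases "a = 0 \<or> b = 0")
  case True
  then show ?thesis using ab by auto
next
  case False
  then have ab': "0 < a" "0 < b" using ab by auto
  let ?A = "\<integral>\<^sup>+x. f x \<partial>M" and ?B = "\<integral>\<^sup>+x. g x \<partial>M"
  consider "?A = 0" | "?B = 0" | "?A \<noteq> 0" "?B \<noteq> 0" "?A = \<infinity> \<or> ?B = \<infinity>"
    | "?A \<noteq> 0" "?B \<noteq> 0" "?A \<noteq> \<infinity>" "?B \<noteq> \<infinity>" by blast
  then show ?thesis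
  proof cases
    case 1
    then have "AE x in M. f x = 0" by (simp add: nn_integral_0_iff_AE)
    then have "(\<integral>\<^sup>+x. epow (f x) a * epow (g x) b \<partial>M) = (\<integral>\<^sup>+x. 0 \<partial>M)"
      using ab' by (intro nn_integral_cong_AE) (auto elim!: eventually_mono)
    then show ?thesis by simp
  next
    case 2
    then have "AE x in M. g x = 0" by (simp add: nn_integral_0_iff_AE)
    then have "(\<integral>\<^sup>+x. epow (f x) a * epow (g x) b \<partial>M) = (\<integral>\<^sup>+x. 0 \<partial>M)"
      using ab' by (intro nn_integral_cong_AE) (auto elim!: eventually_mono)
    then show ?thesis by simp
  next
    case 3
    then have "epow ?A a * epow ?B b = \<infinity>"
      using ab' by (auto simp: ennreal_mult_eq_top_iff epow_eq_0_iff epow_eq_top_iff[simplified])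
    then show ?thesis by simp
  next
    case 4
    then obtain A B where AB: "?A = ennreal A" "?B = ennreal B" "0 < A" "0 < B"
      by (cases ?A; cases ?B) (auto simp: less_le)
    \<comment> \<open>The normalisation factor: \<open>epow\<close> is multiplicative, so dividing
      \<open>f\<close> by A and \<open>g\<close> by B divides the integrand by exactly this
      constant.\<close>
    let ?c = "ennreal (A powr a * B powr b)"
    have eq: "epow (f x) a * epow (g x) b =
        ?c * (epow (f x * ennreal (1/A)) a * epow (g x * ennreal (1/B)) b)" for x
    proof -
      have "?c * (epow (ennreal (1/A)) a * epow (ennreal (1/B)) b) = 1"
        using AB ab' by (simp add: epow_ennreal powr_divide flip: ennreal_mult)
      then show ?thesis using ab'
        by (simp add: epow_mult) (metis mult.assoc mult.commute mult.left_neutral)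
    qed
    have "(\<integral>\<^sup>+x. epow (f x) a * epow (g x) b \<partial>M)
        = ?c * (\<integral>\<^sup>+x. epow (f x * ennreal (1/A)) a * epow (g x * ennreal (1/B)) b \<partial>M)"
      by (subst eq) (simp add: nn_integral_cmult)
    also have "\<dots> \<le> ?c * (\<integral>\<^sup>+x. ennreal a * (f x * ennreal (1/A)) + ennreal b * (g x * ennreal (1/B)) \<partial>M)"
      by (intro mult_left_mono nn_integral_mono epow_young ab) auto
    also have "\<dots> = ?c * (ennreal a * (?A * ennreal (1/A)) + ennreal b * (?B * ennreal (1/B)))"
      by (simp add: nn_integral_add nn_integral_cmult nn_integral_multc)
    also have "\<dots> = ?c"
      using AB ab by (simp flip: ennreal_mult ennreal_plus)
    also have "\<dots> = epow ?A a * epow ?B b"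
      using AB ab' by (simp add: epow_ennreal flip: ennreal_mult)
    finally show ?thesis .
  qed
qed

text \<open>The parameter \<theta> stands for 1 / p, so that \<theta> = 0 is the supremum norm, 1 -
  \<theta> belongs to the conjugate exponent, and a product of functions has the sum of their
  parameters.\<close>

definition Nm :: "'a measure \<Rightarrow> real \<Rightarrow> ('a \<Rightarrow> ennreal) \<Rightarrow> ennreal" where
  "Nm M \<theta> F = (if \<theta> = 0 then esssup M F else epow (\<integral>\<^sup>+x. epow (F x) (1 / \<theta>) \<partial>M) \<theta>)"

lemma Lp_norm_eq_Nm:
  assumes "1 \<le> p"
  shows "Lp_norm M p F = Nm M (enn2real (inverse p)) F"
proof (cases "p = \<infinity>")
  case False
  then obtain r where r: "p = ennreal r" "1 \<le> r"
    using assms by (cases p) (auto simp: ennreal_1[symmetric] simp del: ennreal_1)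
  then have "inverse p = ennreal (1 / r)"
    by (simp add: inverse_ennreal inverse_eq_divide)
  then show ?thesis using r
    by (simp add: Lp_norm_def Nm_def epow_def)
qed (simp add: Lp_norm_def Nm_def)

lemma Nm_pos: "0 < \<theta> \<Longrightarrow> Nm M \<theta> F = epow (\<integral>\<^sup>+x. epow (F x) (1 / \<theta>) \<partial>M) \<theta>"
  by (simp add: Nm_def)

lemma Nm_1: "Nm M 1 F = (\<integral>\<^sup>+x. F x \<partial>M)"
  by (simp add: Nm_def)

lemma epow_Nm: "0 < \<theta> \<Longrightarrow> epow (Nm M \<theta> F) (1 / \<theta>) = (\<integral>\<^sup>+x. epow (F x) (1 / \<theta>) \<partial>M)"
  by (simp add: Nm_def epow_epow)

lemma Nm_mono_AE:
  assumes "0 \<le> \<theta>" "F \<in> borel_measurable M" "AE x in M. F x \<le> G x"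
  shows "Nm M \<theta> F \<le> Nm M \<theta> G"
proof (cases "\<theta> = 0")
  case False
  then show ?thesis using assms
    by (auto simp: Nm_def intro!: epow_mono nn_integral_mono_AE elim!: eventually_mono)
qed (use assms in \<open>auto simp: Nm_def intro!: esssup_AE_mono\<close>)

lemma Nm_mono:
  "0 \<le> \<theta> \<Longrightarrow> F \<in> borel_measurable M \<Longrightarrow> (\<And>x. F x \<le> G x) \<Longrightarrow> Nm M \<theta> F \<le> Nm M \<theta> G"
  by (intro Nm_mono_AE) auto

lemma Nm_cmult_le:
  assumes "0 \<le> \<theta>" "F \<in> borel_measurable M"
  shows "Nm M \<theta> (\<lambda>x. c * F x) \<le> c * Nm M \<theta> F"
proof (cases "\<theta> = 0")
  case True
  have "AE x in M. c * F x \<le> c * esssup M F"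
    using esssup_AE[of F M] by eventually_elim (auto intro: mult_left_mono)
  then show ?thesis using True assms by (auto simp: Nm_def intro!: esssup_I)
next
  case False
  then show ?thesis using assms
    by (simp add: Nm_def epow_mult nn_integral_cmult epow_inv)
qed

text \<open>The reverse inequality is \<open>Nm_cmult_le\<close> for the factor 1 / c applied to the
  function c F, which is possible for finite positive c.\<close>

lemma Nm_cmult:
  assumes "0 \<le> \<theta>" "F \<in> borel_measurable M" "0 \<le> c"
  shows "Nm M \<theta> (\<lambda>x. ennreal c * F x) = ennreal c * Nm M \<theta> F"
proof (cases "c = 0")
  case True
  have "Nm M \<theta> (\<lambda>x. 0 * F x) \<le> 0 * Nm M \<theta> F"
    by (rule Nm_cmult_le) (use assms in auto)
  then show ?thesis using True by simp
next
  case False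
  then have c: "0 < c" using assms by simp
  have "ennreal c * Nm M \<theta> F = ennreal c * Nm M \<theta> (\<lambda>x. ennreal (1/c) * (ennreal c * F x))"
    using c by (simp add: mult.assoc[symmetric] ennreal_mult[symmetric])
  also have "\<dots> \<le> ennreal c * (ennreal (1/c) * Nm M \<theta> (\<lambda>x. ennreal c * F x))"
    using assms by (intro mult_left_mono Nm_cmult_le) auto
  also have "\<dots> = Nm M \<theta> (\<lambda>x. ennreal c * F x)"
    using c by (simp add: mult.assoc[symmetric] ennreal_mult[symmetric])
  finally show ?thesis using Nm_cmult_le[of \<theta> F M "ennreal c"] assms by (intro antisym) auto
qed

lemma Nm_const_one_le: "Nm M 0 (\<lambda>_. 1) \<le> 1"
  by (auto simp: Nm_def intro!: esssup_I)

lemma esssup_epow: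
  assumes "0 < r" "F \<in> borel_measurable M"
  shows "esssup M (\<lambda>x. epow (F x) r) = epow (esssup M F) r"
proof (rule antisym)
  have "AE x in M. epow (F x) r \<le> epow (esssup M F) r"
    using esssup_AE[of F M] by eventually_elim (use assms in \<open>auto intro: epow_mono\<close>)
  then show "esssup M (\<lambda>x. epow (F x) r) \<le> epow (esssup M F) r"
    using assms by (auto intro!: esssup_I)
  have "AE x in M. F x \<le> epow (esssup M (\<lambda>x. epow (F x) r)) (1 / r)"
    using esssup_AE[of "\<lambda>x. epow (F x) r" M] by eventually_elim (use assms in \<open>simp add: epow_le_iff\<close>)
  then show "epow (esssup M F) r \<le> esssup M (\<lambda>x. epow (F x) r)"
    using assms by (auto simp: epow_le_iff intro!: esssup_I)
qed

lemma Nm_epow: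
  assumes "0 < r" "0 \<le> \<theta>" "F \<in> borel_measurable M"
  shows "Nm M \<theta> (\<lambda>x. epow (F x) r) = epow (Nm M (\<theta> / r) F) r"
  using assms by (auto simp: Nm_def esssup_epow epow_epow)

text \<open>After taking the power 1 / (a + b) this is \<open>nn_holder\<close> with the weights a /
  (a + b) and b / (a + b). If a or b vanishes, the corresponding factor is replaced by its essential
  supremum.\<close>

lemma Nm_gen_holder:
  assumes [measurable]: "F \<in> borel_measurable M" "G \<in> borel_measurable M"
    and ab: "0 \<le> a" "0 \<le> b"
  shows "Nm M (a + b) (\<lambda>x. F x * G x) \<le> Nm M a F * Nm M b G"
proof -
  have *: "Nm M b (\<lambda>x. F x * G x) \<le> Nm M 0 F * Nm M b G"
    if [measurable]: "F \<in> borel_measurable M" "G \<in> borel_measurable M" and "0 \<le> b" for F G b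
  proof -
    have "AE x in M. F x * G x \<le> esssup M F * G x"
      using esssup_AE[of F M] by eventually_elim (auto intro: mult_right_mono)
    then have "Nm M b (\<lambda>x. F x * G x) \<le> Nm M b (\<lambda>x. esssup M F * G x)"
      using that by (intro Nm_mono_AE) auto
    also have "\<dots> \<le> esssup M F * Nm M b G"
      using that by (intro Nm_cmult_le) auto
    finally show ?thesis by (simp add: Nm_def)
  qed
  consider "a = 0" | "b = 0" | "0 < a" "0 < b" using ab by force
  then show ?thesis
  proof cases
    case 1
    then show ?thesis using *[of F G b] ab by simp
  next
    case 2
    then show ?thesis using *[of G F a] ab by (simp add: mult.commute)
  next
    case 3
    let ?s = "a + b"
    have eq: "epow (F x * G x) (1 / ?s) = epow (epow (F x) (1 / a)) (a / ?s) * epow (epow (G x) (1 / b)) (b / ?s)" for x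
      using 3 by (simp add: epow_mult epow_epow)
    have "Nm M ?s (\<lambda>x. F x * G x) \<le> epow (epow (\<integral>\<^sup>+x. epow (F x) (1 / a) \<partial>M) (a / ?s) * epow (\<integral>\<^sup>+x. epow (G x) (1 / b) \<partial>M) (b / ?s)) ?s"
      using 3 by (simp add: Nm_def eq) (intro epow_mono nn_holder, auto simp: add_divide_distrib[symmetric])
    also have "\<dots> = Nm M a F * Nm M b G"
      using 3 by (simp add: epow_mult epow_epow Nm_def)
    finally show ?thesis .
  qed
qed

lemma Nm_holder:
  assumes "F \<in> borel_measurable M" "G \<in> borel_measurable M" "0 \<le> a" "a \<le> 1"
  shows "(\<integral>\<^sup>+x. F x * G x \<partial>M) \<le> Nm M a F * Nm M (1 - a) G"
  using Nm_gen_holder[of F M G a "1 - a"] assms by (simp add: Nm_1)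

section \<open>Duality, Minkowski's inequality and the exchange of norms\<close>

lemma ennreal_mult_right_le_imp_le:
  fixes a b c :: ennreal
  assumes "a * c \<le> b * c" "c \<noteq> 0" "c < \<infinity>"
  shows "a \<le> b"
  using assms ennreal_mult_le_mult_iff[of c a b] by (simp add: mult.commute)

lemma Nm_0_le_iff:
  assumes "g \<in> borel_measurable M"
  shows "Nm M 0 g \<le> z \<longleftrightarrow> (AE x in M. g x \<le> z)"
  using assms esssup_AE[of g M] by (auto simp: Nm_def elim!: eventually_mono intro: order_trans)

text \<open>The case \<theta> = 0 is the delicate one: an essential supremum exceeds y exactly if
  the superlevel set at y has positive measure, and the measure of a section depends measurably on
  the parameter by \<sigma>-finiteness.\<close>

lemma Nm_measurable_section:
  assumes "sigma_finite_measure M"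
    and [measurable]: "(\<lambda>(x, t). F x t) \<in> borel_measurable (N \<Otimes>\<^sub>M M)"
  shows "(\<lambda>x. Nm M \<theta> (F x)) \<in> borel_measurable N"
proof -
  interpret sigma_finite_measure M by fact
  show ?thesis
  proof (cases "\<theta> = 0")
    case False
    then show ?thesis unfolding Nm_def by simp
  next
    case True
    have "{x \<in> space N. y < esssup M (F x)} \<in> sets N" for y
    proof -
      have Fx: "F x \<in> borel_measurable M" if "x \<in> space N" for x
        using measurable_compose[OF measurable_Pair1'[OF that] assms(2)] by simp
      have "y < esssup M (F x) \<longleftrightarrow> 0 < emeasure M {t \<in> space M. y < F x t}" if "x \<in> space N" for x
      proof
        assume "y < esssup M (F x)"
        then show "0 < emeasure M {t \<in> space M. y < F x t}"
          using esssup_pos_measure[OF Fx[OF that]] by simp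
      next
        assume *: "0 < emeasure M {t \<in> space M. y < F x t}"
        show "y < esssup M (F x)"
        proof (rule ccontr)
          assume "\<not> y < esssup M (F x)"
          then have "AE t in M. F x t \<le> y"
            using esssup_AE[of "F x" M] by (auto elim!: eventually_mono)
          then have "emeasure M {t \<in> space M. \<not> F x t \<le> y} = 0"
            using Fx[OF that] by (subst (asm) AE_iff_measurable[OF _ refl]) auto
          then show False using * by (simp add: not_le)
        qed
      qed
      then have "{x \<in> space N. y < esssup M (F x)} = {x \<in> space N. 0 < emeasure M {t \<in> space M. y < F x t}}"
        by auto
      also have "\<dots> \<in> sets N" by measurable
      finally show ?thesis .
    qed
    then show ?thesis using True
      by (auto simp: Nm_def intro!: borel_measurableI_greater)
  qed
qed

lemma Nm_lborel_measurable [measurable (raw)]: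
  "(\<lambda>(x, t). F x t) \<in> borel_measurable (N \<Otimes>\<^sub>M lborel) \<Longrightarrow> (\<lambda>x. Nm lborel \<theta> (F x)) \<in> borel_measurable N"
  by (rule Nm_measurable_section) (auto intro: lborel.sigma_finite_measure_axioms)

text \<open>Converse of Hoelder's inequality. For 0 < \<theta> < 1 the extremal test function is a
  power of k itself; for \<theta> = 1 it is the constant one, and for \<theta> = 0 the indicator of
  a superlevel set.\<close>

lemma Nm_duality:
  assumes "sigma_finite_measure M" and k [measurable]: "k \<in> borel_measurable M"
    and \<theta>: "0 \<le> \<theta>" "\<theta> \<le> 1"
    and dual: "\<And>h. h \<in> borel_measurable M \<Longrightarrow> (\<integral>\<^sup>+x. k x * h x \<partial>M) \<le> A * Nm M (1 - \<theta>) h"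
  shows "Nm M \<theta> k \<le> A"
proof -
  interpret sigma_finite_measure M by fact
  obtain B :: "nat \<Rightarrow> 'a set" where B: "range B \<subseteq> sets M" "(\<Union>i. B i) = space M"
    "\<And>i. emeasure M (B i) \<noteq> \<infinity>" "incseq B"
    using sigma_finite_incseq by metis
  have Bm [measurable]: "B i \<in> sets M" for i using B(1) by auto
  consider "\<theta> = 0" | "\<theta> = 1" | "0 < \<theta>" "\<theta> < 1" using \<theta> by force
  then show ?thesis
  proof cases
    case 1
    show ?thesis
    proof (rule ccontr)
      assume "\<not> ?thesis"
      then have "A < esssup M k" using 1 by (simp add: Nm_def)
      then obtain c where c: "A < c" "c < esssup M k" using dense by blast
      \<comment> \<open>The superlevel set is cut down to finite measure, so that its measure can be
        cancelled at the end.\<close>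
      let ?E = "\<lambda>i. {x \<in> space M. c < k x} \<inter> B i"
      have "{x \<in> space M. c < k x} = (\<Union>i. ?E i)" using B(2) by auto
      moreover have "0 < emeasure M {x \<in> space M. c < k x}"
        using esssup_pos_measure[OF k c(2)] .
      ultimately have "\<not> (\<forall>i. ?E i \<in> null_sets M)"
        using null_sets_UN[of ?E M] null_setsD1[of "\<Union>i. ?E i" M] by fastforce
      then obtain i where i: "?E i \<notin> null_sets M" by blast
      have pos: "emeasure M (?E i) \<noteq> 0" using i by (auto simp: null_sets_def)
      have fin: "emeasure M (?E i) \<noteq> \<infinity>"
        using emeasure_mono[of "?E i" "B i" M] B(3)[of i] by (auto simp: top_unique)
      have "c * emeasure M (?E i) = (\<integral>\<^sup>+x. c * indicator (?E i) x \<partial>M)"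
        by (simp add: nn_integral_cmult)
      also have "\<dots> \<le> (\<integral>\<^sup>+x. k x * indicator (?E i) x \<partial>M)"
        by (intro nn_integral_mono) (auto simp: indicator_def less_imp_le)
      also have "\<dots> \<le> A * Nm M 1 (indicator (?E i))"
        using dual[of "indicator (?E i)"] 1 by simp
      also have "Nm M 1 (indicator (?E i)) = emeasure M (?E i)"
        by (simp add: Nm_1)
      finally have "c * emeasure M (?E i) \<le> A * emeasure M (?E i)" .
      then have "c \<le> A"
        using ennreal_mult_le_mult_iff[of "emeasure M (?E i)" c A] pos fin by (simp add: mult.commute)
      then show False using c by simp
    qed
  next
    case 2
    have "(\<integral>\<^sup>+x. k x \<partial>M) \<le> A * Nm M 0 (\<lambda>_. 1)"
      using dual[of "\<lambda>_. 1"] 2 by simp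
    also have "\<dots> \<le> A * 1" by (intro mult_left_mono Nm_const_one_le) auto
    finally show ?thesis using 2 by (simp add: Nm_1)
  next
    case 3
    \<comment> \<open>Truncation in height and in support makes the integral of K^(1/\<theta>)
      finite. Without this the final division by a power of that integral would be
      illegitimate.\<close>
    define K where "K n x = min (k x) (of_nat n) * indicator (B n) x" for n x
    have [measurable]: "K n \<in> borel_measurable M" for n
      unfolding K_def by simp
    have K_le: "K n x \<le> k x" for n x by (auto simp: K_def indicator_def)
    have incK: "incseq K"
      unfolding incseq_def le_fun_def K_def
      using B(4) by (auto simp: incseq_def indicator_def min_le_iff_disj intro: order_trans)
    have SUPK: "(SUP n. K n x) = k x" if "x \<in> space M" for x
    proof (rule antisym)
      show "(SUP n. K n x) \<le> k x" by (intro SUP_least K_le)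
      have "x \<in> (\<Union>i. B i)" using B(2) that by simp
      then obtain i where i: "x \<in> B i" by blast
      show "k x \<le> (SUP n. K n x)"
      proof (rule dense_le)
        fix y assume "y < k x"
        then have "y < \<infinity>" by (auto simp: less_top[symmetric])
        then obtain m where m: "y < of_nat m"
          using ennreal_Ex_less_of_nat[of y] by auto
        have "y \<le> K (max i m) x"
          using \<open>y < k x\<close> m i B(4)
          by (auto simp: K_def incseq_def indicator_def min_def less_imp_le max_def
              intro: order_trans[OF less_imp_le[OF m]])
        then show "y \<le> (SUP n. K n x)" by (rule order_trans) (auto intro: SUP_upper)
      qed
    qed
    have le: "epow (\<integral>\<^sup>+x. epow (K n x) (1/\<theta>) \<partial>M) \<theta> \<le> A" for n
    proof -
      let ?I = "\<integral>\<^sup>+x. epow (K n x) (1/\<theta>) \<partial>M"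
      have "?I \<le> (\<integral>\<^sup>+x. epow (of_nat n) (1/\<theta>) * indicator (B n) x \<partial>M)"
        using 3 by (intro nn_integral_mono) (auto simp: K_def indicator_def intro!: epow_mono)
      also have "\<dots> = epow (of_nat n) (1/\<theta>) * emeasure M (B n)"
        by (simp add: nn_integral_cmult)
      also have "\<dots> < \<infinity>"
        using B(3)[of n] epow_lt_top[of "of_nat n" "1/\<theta>"] 3 by (auto simp: ennreal_mult_less_top less_top of_nat_less_top)
      finally have fin: "?I < \<infinity>" .
      have "?I \<le> (\<integral>\<^sup>+x. k x * epow (K n x) (1/\<theta> - 1) \<partial>M)"
      proof (intro nn_integral_mono)
        fix x
        have "epow (K n x) (1/\<theta>) = epow (K n x) (1 + (1/\<theta> - 1))" by simp
        also have "\<dots> = epow (K n x) 1 * epow (K n x) (1/\<theta> - 1)"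
          using 3 by (subst epow_add) (auto simp: field_simps)
        also have "\<dots> \<le> k x * epow (K n x) (1/\<theta> - 1)"
          by (intro mult_right_mono) (auto simp: K_le)
        finally show "epow (K n x) (1/\<theta>) \<le> k x * epow (K n x) (1/\<theta> - 1)" .
      qed
      \<comment> \<open>The test function K^(1/\<theta> - 1) has a dual norm that is again a power
        of the integral ?I, so the estimate closes up and ?I^(1 - \<theta>) can be
        cancelled.\<close>
      also have "\<dots> \<le> A * Nm M (1 - \<theta>) (\<lambda>x. epow (K n x) (1/\<theta> - 1))"
        by (rule dual) simp
      also have "Nm M (1 - \<theta>) (\<lambda>x. epow (K n x) (1/\<theta> - 1)) = epow ?I (1 - \<theta>)"
      proof -
        have "(1/\<theta> - 1) * (1 / (1 - \<theta>)) = 1/\<theta>" using 3 by (simp add: field_simps)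
        then have "epow (epow (K n x) (1/\<theta> - 1)) (1 / (1 - \<theta>)) = epow (K n x) (1/\<theta>)" for x
          using 3 by (subst epow_epow) (auto simp: field_simps)
        then show ?thesis using 3 by (simp add: Nm_def)
      qed
      finally have I: "?I \<le> A * epow ?I (1 - \<theta>)" .
      show ?thesis
      proof (cases "?I = 0")
        case False
        have "?I = epow ?I (\<theta> + (1 - \<theta>))" by simp
        also have "\<dots> = epow ?I \<theta> * epow ?I (1 - \<theta>)" using 3 by (subst epow_add) auto
        finally have "epow ?I \<theta> * epow ?I (1 - \<theta>) \<le> A * epow ?I (1 - \<theta>)" using I by simp
        then show ?thesis
          by (rule ennreal_mult_right_le_imp_le)
            (use False fin 3 epow_eq_0_iff[of "1 - \<theta>" ?I] epow_lt_top[OF fin, of "1 - \<theta>"] in auto)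
      qed (use 3 in simp)
    qed
    have "Nm M \<theta> k = epow (\<integral>\<^sup>+x. (SUP n. epow (K n x) (1/\<theta>)) \<partial>M) \<theta>"
      using 3 SUPK by (simp add: Nm_def epow_SUP[symmetric] cong: nn_integral_cong)
    also have "\<dots> = epow (SUP n. \<integral>\<^sup>+x. epow (K n x) (1/\<theta>) \<partial>M) \<theta>"
      using 3 incK
      by (subst nn_integral_monotone_convergence_SUP) (auto simp: incseq_def le_fun_def intro!: epow_mono)
    also have "\<dots> = (SUP n. epow (\<integral>\<^sup>+x. epow (K n x) (1/\<theta>) \<partial>M) \<theta>)"
      using 3 by (simp add: epow_SUP)
    also have "\<dots> \<le> A" by (intro SUP_least le)
    finally show ?thesis .
  qed
qed

text \<open>By duality it suffices to pair with h: Tonelli moves the pairing inside the t-integral,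
  where Hoelder's inequality applies for each t. This argument covers \<theta> = 0 and \<theta> = 1
  as well.\<close>

lemma Nm_minkowski:
  fixes f :: "'a \<Rightarrow> 'b \<Rightarrow> ennreal"
  assumes M: "sigma_finite_measure M" and N: "sigma_finite_measure N"
    and f [measurable]: "(\<lambda>(x, t). f x t) \<in> borel_measurable (M \<Otimes>\<^sub>M N)"
    and \<theta>: "0 \<le> \<theta>" "\<theta> \<le> 1"
  shows "Nm M \<theta> (\<lambda>x. \<integral>\<^sup>+t. f x t \<partial>N) \<le> (\<integral>\<^sup>+t. Nm M \<theta> (\<lambda>x. f x t) \<partial>N)"
proof -
  interpret M: sigma_finite_measure M by fact
  interpret N: sigma_finite_measure N by fact
  interpret P: pair_sigma_finite M N ..
  have [measurable]: "(\<lambda>(t, x). f x t) \<in> borel_measurable (N \<Otimes>\<^sub>M M)"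
    by (subst measurable_pair_swap_iff) simp
  have fx: "(\<lambda>x. f x t) \<in> borel_measurable M" if "t \<in> space N" for t
    using that by measurable
  have [measurable]: "(\<lambda>t. Nm M \<theta> (\<lambda>x. f x t)) \<in> borel_measurable N"
    by (rule Nm_measurable_section[OF M]) simp
  show ?thesis
  proof (rule Nm_duality[OF M _ \<theta>])
    show "(\<lambda>x. \<integral>\<^sup>+t. f x t \<partial>N) \<in> borel_measurable M" by simp
  next
    fix h :: "'a \<Rightarrow> ennreal" assume [measurable]: "h \<in> borel_measurable M"
    have "(\<integral>\<^sup>+x. (\<integral>\<^sup>+t. f x t \<partial>N) * h x \<partial>M) = (\<integral>\<^sup>+x. (\<integral>\<^sup>+t. f x t * h x \<partial>N) \<partial>M)"
      by (intro nn_integral_cong nn_integral_multc[symmetric]) measurable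
    also have "\<dots> = (\<integral>\<^sup>+t. (\<integral>\<^sup>+x. f x t * h x \<partial>M) \<partial>N)"
      by (rule P.Fubini'[symmetric]) simp
    also have "\<dots> \<le> (\<integral>\<^sup>+t. Nm M \<theta> (\<lambda>x. f x t) * Nm M (1 - \<theta>) h \<partial>N)"
      by (intro nn_integral_mono Nm_holder fx \<theta>) simp_all
    also have "\<dots> = (\<integral>\<^sup>+t. Nm M \<theta> (\<lambda>x. f x t) \<partial>N) * Nm M (1 - \<theta>) h"
      by (simp add: nn_integral_multc)
    finally show "(\<integral>\<^sup>+x. (\<integral>\<^sup>+t. f x t \<partial>N) * h x \<partial>M)
      \<le> (\<integral>\<^sup>+t. Nm M \<theta> (\<lambda>x. f x t) \<partial>N) * Nm M (1 - \<theta>) h" .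
  qed
qed

text \<open>Minkowski's inequality with exponent \<open>P / Q\<close>, applied to \<open>f\<close> raised to the power \<open>1 / Q\<close>.\<close>

lemma Nm_swap:
  assumes M: "sigma_finite_measure M" and N: "sigma_finite_measure N"
    and f [measurable]: "(\<lambda>(x, t). f x t) \<in> borel_measurable (M \<Otimes>\<^sub>M N)"
    and PQ: "0 \<le> P" "P \<le> Q" "0 < Q"
  shows "Nm M P (\<lambda>x. Nm N Q (f x)) \<le> Nm N Q (\<lambda>t. Nm M P (\<lambda>x. f x t))"
proof -
  interpret M: sigma_finite_measure M by fact
  interpret N: sigma_finite_measure N by fact
  have fx: "(\<lambda>x. f x t) \<in> borel_measurable M" if "t \<in> space N" for t
    using that by measurable
  have "Nm M P (\<lambda>x. Nm N Q (f x)) = Nm M P (\<lambda>x. epow (\<integral>\<^sup>+t. epow (f x t) (1/Q) \<partial>N) Q)"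
    using PQ by (simp add: Nm_def)
  also have "\<dots> = epow (Nm M (P / Q) (\<lambda>x. \<integral>\<^sup>+t. epow (f x t) (1/Q) \<partial>N)) Q"
    using PQ by (intro Nm_epow) auto
  also have "\<dots> \<le> epow (\<integral>\<^sup>+t. Nm M (P / Q) (\<lambda>x. epow (f x t) (1/Q)) \<partial>N) Q"
    using PQ by (intro epow_mono Nm_minkowski[OF M N]) auto
  also have "(\<integral>\<^sup>+t. Nm M (P / Q) (\<lambda>x. epow (f x t) (1/Q)) \<partial>N) = (\<integral>\<^sup>+t. epow (Nm M P (\<lambda>x. f x t)) (1/Q) \<partial>N)"
    using PQ fx by (intro nn_integral_cong) (simp add: Nm_epow)
  also have "epow \<dots> Q = Nm N Q (\<lambda>t. Nm M P (\<lambda>x. f x t))"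
    using PQ by (simp add: Nm_def)
  finally show ?thesis .
qed

text \<open>Here both norms are essential suprema and no power is available. The inequality is
  Fubini's theorem for null sets: almost everywhere in x and t may be read in either order.\<close>

lemma Nm_swap_top:
  assumes M: "sigma_finite_measure M" and N: "sigma_finite_measure N"
    and f [measurable]: "(\<lambda>(x, t). f x t) \<in> borel_measurable (M \<Otimes>\<^sub>M N)"
  shows "Nm M 0 (\<lambda>x. Nm N 0 (f x)) \<le> Nm N 0 (\<lambda>t. Nm M 0 (\<lambda>x. f x t))" (is "_ \<le> ?R")
proof -
  interpret M: sigma_finite_measure M by fact
  interpret N: sigma_finite_measure N by fact
  interpret P: pair_sigma_finite M N ..
  have [measurable]: "(\<lambda>(t, x). f x t) \<in> borel_measurable (N \<Otimes>\<^sub>M M)"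
    by (subst measurable_pair_swap_iff) simp
  have fx: "(\<lambda>x. f x t) \<in> borel_measurable M" if "t \<in> space N" for t
    using that by measurable
  have ft: "(\<lambda>t. f x t) \<in> borel_measurable N" if "x \<in> space M" for x
    using that by measurable
  have [measurable]: "(\<lambda>x. Nm N 0 (f x)) \<in> borel_measurable M"
    by (rule Nm_measurable_section[OF N]) simp
  have "AE t in N. AE x in M. f x t \<le> ?R"
    using esssup_AE[of "\<lambda>t. Nm M 0 (\<lambda>x. f x t)" N]
  proof eventually_elim
    fix t assume *: "Nm M 0 (\<lambda>x. f x t) \<le> esssup N (\<lambda>t. Nm M 0 (\<lambda>x. f x t))"
    show "AE x in M. f x t \<le> ?R"
      using esssup_AE[of "\<lambda>x. f x t" M]
    proof eventually_elim
      fix x assume "f x t \<le> esssup M (\<lambda>x. f x t)"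
      also have "\<dots> \<le> ?R" using * by (simp add: Nm_def)
      finally show "f x t \<le> ?R" .
    qed
  qed
  then have "AE x in M. AE t in N. f x t \<le> ?R"
    by (subst P.AE_commute) (auto)
  then have "AE x in M. Nm N 0 (f x) \<le> ?R"
    using AE_space
  proof eventually_elim
    fix x assume "AE t in N. f x t \<le> ?R" "x \<in> space M"
    then show "Nm N 0 (f x) \<le> ?R" using ft[of x] by (auto simp: Nm_def intro!: esssup_I)
  qed
  then show ?thesis
    by (subst Nm_def) (auto intro!: esssup_I)
qed

lemma Nm_swap_le:
  assumes "sigma_finite_measure M" "sigma_finite_measure N"
    and "(\<lambda>(x, t). f x t) \<in> borel_measurable (M \<Otimes>\<^sub>M N)" "0 \<le> P" "P \<le> Q"
  shows "Nm M P (\<lambda>x. Nm N Q (f x)) \<le> Nm N Q (\<lambda>t. Nm M P (\<lambda>x. f x t))"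
  using Nm_swap[OF assms] Nm_swap_top[OF assms(1-3)] assms(4,5) by (cases "Q = 0") auto

text \<open>For \<theta> > 0 the outer power undoes the inner one and Tonelli remains. For \<theta>
  = 0 the two sides are compared through their sets of upper bounds.\<close>

lemma Nm_pair_measure:
  assumes M: "sigma_finite_measure M" and N: "sigma_finite_measure N"
    and f [measurable]: "f \<in> borel_measurable (M \<Otimes>\<^sub>M N)" and "0 \<le> \<theta>"
  shows "Nm (M \<Otimes>\<^sub>M N) \<theta> f = Nm M \<theta> (\<lambda>x. Nm N \<theta> (\<lambda>y. f (x, y)))"
proof -
  interpret M: sigma_finite_measure M by fact
  interpret N: sigma_finite_measure N by fact
  interpret P: pair_sigma_finite M N ..
  show ?thesis
  proof (cases "\<theta> = 0")
    case False
    then show ?thesis using \<open>0 \<le> \<theta>\<close>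
      by (simp add: Nm_def epow_inv N.nn_integral_fst[symmetric])
  next
    case True
    have ft: "(\<lambda>t. f (x, t)) \<in> borel_measurable N" if "x \<in> space M" for x
      using that by measurable
    have [measurable]: "(\<lambda>x. Nm N 0 (\<lambda>y. f (x, y))) \<in> borel_measurable M"
      by (rule Nm_measurable_section[OF N]) simp
    have "Nm (M \<Otimes>\<^sub>M N) 0 f \<le> z \<longleftrightarrow> Nm M 0 (\<lambda>x. Nm N 0 (\<lambda>y. f (x, y))) \<le> z" for z
    proof -
      have "Nm (M \<Otimes>\<^sub>M N) 0 f \<le> z \<longleftrightarrow> (AE x in M. AE y in N. f (x, y) \<le> z)"
        using P.AE_pair_iff[of "\<lambda>x y. f (x, y) \<le> z"] by (subst Nm_0_le_iff) (auto simp: case_prod_beta')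
      also have "\<dots> \<longleftrightarrow> (AE x in M. Nm N 0 (\<lambda>y. f (x, y)) \<le> z)"
        using Nm_0_le_iff[OF ft] by (intro AE_cong) auto
      also have "\<dots> \<longleftrightarrow> Nm M 0 (\<lambda>x. Nm N 0 (\<lambda>y. f (x, y))) \<le> z"
        by (subst Nm_0_le_iff) auto
      finally show ?thesis .
    qed
    then show ?thesis using True by (metis order_antisym order_refl)
  qed
qed

text \<open>With equal exponents the exchange inequality \<open>Nm_swap_le\<close> holds in both
  directions, so the order of the two iterated norms is immaterial.\<close>

lemma Nm_lborel_prod:
  fixes f :: "'a::euclidean_space \<times> 'b::euclidean_space \<Rightarrow> ennreal"
  assumes "f \<in> borel_measurable borel" "0 \<le> \<theta>"
  shows "Nm lborel \<theta> f = Nm lborel \<theta> (\<lambda>x. Nm lborel \<theta> (\<lambda>y. f (x, y)))"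
    and "Nm lborel \<theta> f = Nm lborel \<theta> (\<lambda>y. Nm lborel \<theta> (\<lambda>x. f (x, y)))"
proof -
  have sf: "sigma_finite_measure (lborel :: 'c::euclidean_space measure)" by unfold_locales
  have m: "f \<in> borel_measurable (lborel \<Otimes>\<^sub>M lborel)" using assms(1) by (simp add: lborel_prod)
  show 1: "Nm lborel \<theta> f = Nm lborel \<theta> (\<lambda>x. Nm lborel \<theta> (\<lambda>y. f (x, y)))"
    using Nm_pair_measure[OF sf sf m assms(2)] by (simp add: lborel_prod)
  have m1: "(\<lambda>(x, t). f (x, t)) \<in> borel_measurable (lborel \<Otimes>\<^sub>M lborel)" using m by simp
  have m2: "(\<lambda>(x, t). f (t, x)) \<in> borel_measurable (lborel \<Otimes>\<^sub>M lborel)"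
    using m by (subst measurable_pair_swap_iff) simp
  show "Nm lborel \<theta> f = Nm lborel \<theta> (\<lambda>y. Nm lborel \<theta> (\<lambda>x. f (x, y)))"
    unfolding 1 using Nm_swap_le[OF sf sf m1 assms(2) order_refl] Nm_swap_le[OF sf sf m2 assms(2) order_refl]
    by (intro antisym) auto
qed

lemma Nm_distr:
  assumes [measurable]: "T \<in> measurable M M" "F \<in> borel_measurable M" and d: "distr M M T = M"
  shows "Nm M \<theta> (\<lambda>x. F (T x)) = Nm M \<theta> F"
proof (cases "\<theta> = 0")
  case True
  have "(AE x in M. F (T x) \<le> z) \<longleftrightarrow> (AE x in M. F x \<le> z)" for z
    by (subst (2) d[symmetric], subst AE_distr_iff) auto
  then show ?thesis using True by (simp add: Nm_def esssup_eq_AE)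
next
  case False
  then show ?thesis
    by (simp add: Nm_def, subst (2) d[symmetric], subst nn_integral_distr) auto
qed

lemma lborel_distr_reflect:
  "distr lborel borel (\<lambda>x. c - x) = (lborel :: 'a::euclidean_space measure)"
  using lborel_affine[of "-1" c] by (simp add: density_1)

lemma Nm_shift:
  fixes F :: "'a::euclidean_space \<Rightarrow> ennreal"
  assumes [measurable]: "F \<in> borel_measurable borel"
  shows "Nm lborel \<theta> (\<lambda>x. F (x + c)) = Nm lborel \<theta> F"
    and "Nm lborel \<theta> (\<lambda>x. F (c + x)) = Nm lborel \<theta> F"
    and "Nm lborel \<theta> (\<lambda>x. F (x - c)) = Nm lborel \<theta> F"
    and "Nm lborel \<theta> (\<lambda>x. F (c - x)) = Nm lborel \<theta> F"
proof -
  have d: "distr lborel lborel T = distr lborel borel T" for T :: "'a \<Rightarrow> 'a"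
    by (intro distr_cong) auto
  have p: "distr lborel borel (\<lambda>x. a + x) = (lborel :: 'a measure)" for a :: 'a
    using lborel_distr_plus[of a] by simp
  have *: "Nm lborel \<theta> (\<lambda>x. F (c + x)) = Nm lborel \<theta> F" for c
    by (rule Nm_distr[of "\<lambda>x. c + x"]) (simp_all add: d p)
  show "Nm lborel \<theta> (\<lambda>x. F (c + x)) = Nm lborel \<theta> F" by (rule *)
  show "Nm lborel \<theta> (\<lambda>x. F (x + c)) = Nm lborel \<theta> F"
    using *[of c] by (simp add: add.commute)
  show "Nm lborel \<theta> (\<lambda>x. F (x - c)) = Nm lborel \<theta> F"
    using *[of "- c"] by simp
  show "Nm lborel \<theta> (\<lambda>x. F (c - x)) = Nm lborel \<theta> F"
    by (rule Nm_distr[of "\<lambda>x. c - x"]) (simp_all add: d lborel_distr_reflect)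
qed

lemma nn_integral_shift:
  fixes F :: "'a::euclidean_space \<Rightarrow> ennreal"
  assumes "F \<in> borel_measurable borel"
  shows "(\<integral>\<^sup>+x. F (x + c) \<partial>lborel) = (\<integral>\<^sup>+x. F x \<partial>lborel)"
    and "(\<integral>\<^sup>+x. F (c + x) \<partial>lborel) = (\<integral>\<^sup>+x. F x \<partial>lborel)"
    and "(\<integral>\<^sup>+x. F (x - c) \<partial>lborel) = (\<integral>\<^sup>+x. F x \<partial>lborel)"
    and "(\<integral>\<^sup>+x. F (c - x) \<partial>lborel) = (\<integral>\<^sup>+x. F x \<partial>lborel)"
  using Nm_shift[OF assms, of 1 c] by (simp_all add: Nm_1)

section \<open>A multilinear estimate along skew directions\<close>

lemma Nm_four_holder:
  assumes [measurable]: "S \<in> borel_measurable M" "F \<in> borel_measurable M" "h \<in> borel_measurable M"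
    and par: "0 \<le> P" "0 < \<kappa>" "\<kappa> \<le> \<alpha>" "\<kappa> \<le> \<beta>" "P + \<alpha> + \<beta> = 1 + \<kappa>"
  shows "(\<integral>\<^sup>+x. S x * F x * h x \<partial>M) \<le> Nm M P S
      * (epow (\<integral>\<^sup>+x. epow (F x) (1 / \<alpha>) * epow (h x) (1 / \<beta>) \<partial>M) \<kappa>
      * (epow (Nm M \<alpha> F) (1 - \<kappa> / \<alpha>) * epow (Nm M \<beta> h) (1 - \<kappa> / \<beta>)))"
proof -
  \<comment> \<open>F is split into the powers \<kappa> / \<alpha> and 1 - \<kappa> / \<alpha>, and
    h likewise. The first two pieces are kept together in X1 with parameter \<kappa>, since only
    their joint integral is controlled later; the rest has parameters \<alpha> - \<kappa> and
    \<beta> - \<kappa>. Together with P these four numbers add up to one.\<close>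
  define X1 where "X1 x = epow (epow (F x) (1 / \<alpha>) * epow (h x) (1 / \<beta>)) \<kappa>" for x
  define X2 where "X2 x = epow (F x) (1 - \<kappa> / \<alpha>)" for x
  define X3 where "X3 x = epow (h x) (1 - \<kappa> / \<beta>)" for x
  have [measurable]: "X1 \<in> borel_measurable M" "X2 \<in> borel_measurable M" "X3 \<in> borel_measurable M"
    unfolding X1_def X2_def X3_def by simp_all
  have spl: "y = epow y (\<kappa> / a) * epow y (1 - \<kappa> / a)" if "\<kappa> \<le> a" for y a
  proof -
    have "epow y 1 = epow y (\<kappa> / a + (1 - \<kappa> / a))" by simp
    also have "\<dots> = epow y (\<kappa> / a) * epow y (1 - \<kappa> / a)"
      using par that by (intro epow_add) auto
    finally show ?thesis by simp
  qed
  have "S x * F x * h x = S x * (X1 x * (X2 x * X3 x))" for x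
    using spl[of \<alpha> "F x"] spl[of \<beta> "h x"] par
    by (simp add: X1_def X2_def X3_def epow_mult epow_epow) (metis mult.assoc mult.left_commute)
  then have "(\<integral>\<^sup>+x. S x * F x * h x \<partial>M) = Nm M (P + (\<kappa> + ((\<alpha> - \<kappa>) + (\<beta> - \<kappa>)))) (\<lambda>x. S x * (X1 x * (X2 x * X3 x)))"
    using par by (simp add: Nm_1[symmetric] algebra_simps)
  also have "\<dots> \<le> Nm M P S * Nm M (\<kappa> + ((\<alpha> - \<kappa>) + (\<beta> - \<kappa>))) (\<lambda>x. X1 x * (X2 x * X3 x))"
    using par by (intro Nm_gen_holder) auto
  also have "\<dots> \<le> Nm M P S * (Nm M \<kappa> X1 * Nm M ((\<alpha> - \<kappa>) + (\<beta> - \<kappa>)) (\<lambda>x. X2 x * X3 x))"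
    using par by (intro Nm_gen_holder mult_left_mono) auto
  also have "\<dots> \<le> Nm M P S * (Nm M \<kappa> X1 * (Nm M (\<alpha> - \<kappa>) X2 * Nm M (\<beta> - \<kappa>) X3))"
    using par by (intro Nm_gen_holder mult_left_mono) auto
  also have "\<dots> \<le> Nm M P S * (epow (\<integral>\<^sup>+x. epow (F x) (1 / \<alpha>) * epow (h x) (1 / \<beta>) \<partial>M) \<kappa>
      * (epow (Nm M \<alpha> F) (1 - \<kappa> / \<alpha>) * epow (Nm M \<beta> h) (1 - \<kappa> / \<beta>)))"
  proof (intro mult_left_mono mult_mono)
    \<comment> \<open>For a = \<kappa> the remaining factor is the zeroth power, that is the
      constant one, measured in the supremum norm; this is where the convention
      \<open>epow x 0 = 1\<close> pays off.\<close>
    have *: "Nm M (a - \<kappa>) (\<lambda>x. epow (G x) (1 - \<kappa> / a)) \<le> epow (Nm M a G) (1 - \<kappa> / a)"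
      if "\<kappa> \<le> a" "G \<in> borel_measurable M" for a G
    proof (cases "a = \<kappa>")
      case True
      then show ?thesis using par Nm_const_one_le by simp
    next
      case False
      then have "0 < 1 - \<kappa> / a" "(a - \<kappa>) / (1 - \<kappa> / a) = a" using par that by (auto simp: field_simps)
      then show ?thesis using False par that by (simp add: Nm_epow)
    qed
    show "Nm M (\<alpha> - \<kappa>) X2 \<le> epow (Nm M \<alpha> F) (1 - \<kappa> / \<alpha>)"
      unfolding X2_def using par by (intro *) auto
    show "Nm M (\<beta> - \<kappa>) X3 \<le> epow (Nm M \<beta> h) (1 - \<kappa> / \<beta>)"
      unfolding X3_def using par by (intro *) auto
    show "Nm M \<kappa> X1 \<le> epow (\<integral>\<^sup>+x. epow (F x) (1 / \<alpha>) * epow (h x) (1 / \<beta>) \<partial>M) \<kappa>"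
      unfolding X1_def using par by (simp add: Nm_epow Nm_1)
  qed auto
  finally show ?thesis .
qed

text \<open>The map (x, s) \<mapsto> (x + c s, x + c' s) preserves volume since the difference of c
  and c' is 1 or -1. It is carried out as a translation in x followed by a translation or reflection
  in s.\<close>

lemma nn_integral_skew:
  fixes A B :: "'a::euclidean_space \<Rightarrow> ennreal"
  assumes [measurable]: "A \<in> borel_measurable borel" "B \<in> borel_measurable borel"
    and c: "\<bar>c - c'\<bar> = 1"
  shows "(\<integral>\<^sup>+s. \<integral>\<^sup>+x. A (x + c *\<^sub>R s) * B (x + c' *\<^sub>R s) \<partial>lborel \<partial>lborel)
    = (\<integral>\<^sup>+x. A x \<partial>lborel) * (\<integral>\<^sup>+x. B x \<partial>lborel)"
proof -
  have "(\<integral>\<^sup>+s. \<integral>\<^sup>+x. A (x + c *\<^sub>R s) * B (x + c' *\<^sub>R s) \<partial>lborel \<partial>lborel)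
    = (\<integral>\<^sup>+s. \<integral>\<^sup>+x. A (x + (c - c') *\<^sub>R s) * B x \<partial>lborel \<partial>lborel)"
  proof (rule nn_integral_cong)
    fix s :: 'a
    show "(\<integral>\<^sup>+x. A (x + c *\<^sub>R s) * B (x + c' *\<^sub>R s) \<partial>lborel) = (\<integral>\<^sup>+x. A (x + (c - c') *\<^sub>R s) * B x \<partial>lborel)"
      by (subst nn_integral_shift(1)[of "\<lambda>x. A (x + (c - c') *\<^sub>R s) * B x" "c' *\<^sub>R s", symmetric])
        (auto simp: algebra_simps)
  qed
  also have "\<dots> = (\<integral>\<^sup>+x. \<integral>\<^sup>+s. A (x + (c - c') *\<^sub>R s) * B x \<partial>lborel \<partial>lborel)"
    by (rule lborel_pair.Fubini') simp
  also have "\<dots> = (\<integral>\<^sup>+x. (\<integral>\<^sup>+s. A s \<partial>lborel) * B x \<partial>lborel)"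
  proof (intro nn_integral_cong)
    fix x :: 'a
    have "(\<integral>\<^sup>+s. A (x + (c - c') *\<^sub>R s) \<partial>lborel) = (\<integral>\<^sup>+s. A s \<partial>lborel)"
    proof -
      have "c - c' = 1 \<or> c - c' = -1" using c by linarith
      then show ?thesis
        using nn_integral_shift(2)[of A x] nn_integral_shift(4)[of A x] by auto
    qed
    then show "(\<integral>\<^sup>+s. A (x + (c - c') *\<^sub>R s) * B x \<partial>lborel) = (\<integral>\<^sup>+s. A s \<partial>lborel) * B x"
      by (simp add: nn_integral_multc)
  qed
  also have "\<dots> = (\<integral>\<^sup>+x. A x \<partial>lborel) * (\<integral>\<^sup>+x. B x \<partial>lborel)"
    by (simp add: nn_integral_cmult)
  finally show ?thesis .
qed

text \<open>The extremal case of the conditions for one pair of variables: P and Q belong to the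
  symbol, \<alpha> to the input, and \<beta> to the test function dual to the output, which
  therefore has parameter 1 - \<beta>.\<close>

locale exponents =
  fixes P Q \<alpha> \<beta> :: real
  assumes PQ: "0 \<le> P" "P \<le> Q" "Q \<le> 1"
    and \<alpha>\<beta>: "1 - Q \<le> \<alpha>" "1 - Q \<le> \<beta>" "\<alpha> + \<beta> = (1 - P) + (1 - Q)"
begin

text \<open>For fixed s the four-factor inequality is applied in x; its last two factors are
  constants in s by translation invariance. Hoelder in s with the parameters Q and \<kappa> = 1 - Q
  then leaves the joint factor. For Q = 1 there is no joint factor, and ordinary Hoelder in x
  suffices.\<close>

lemma skew_trilinear:
  fixes S :: "'a::euclidean_space \<Rightarrow> 'a \<Rightarrow> ennreal"
  assumes [measurable]: "(\<lambda>(x, s). S x s) \<in> borel_measurable (borel \<Otimes>\<^sub>M borel)"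
      "F \<in> borel_measurable borel" "h \<in> borel_measurable borel"
    and c: "\<bar>c - c'\<bar> = 1"
  shows "(\<integral>\<^sup>+s. \<integral>\<^sup>+x. S x s * F (x + c *\<^sub>R s) * h (x + c' *\<^sub>R s) \<partial>lborel \<partial>lborel)
    \<le> Nm lborel Q (\<lambda>s. Nm lborel P (\<lambda>x. S x s)) * Nm lborel \<alpha> F * Nm lborel \<beta> h"
proof (cases "Q = 1")
  case True
  have "(\<integral>\<^sup>+x. S x s * F (x + c *\<^sub>R s) * h (x + c' *\<^sub>R s) \<partial>lborel)
    \<le> Nm lborel P (\<lambda>x. S x s) * (Nm lborel \<alpha> F * Nm lborel \<beta> h)" for s
  proof -
    have "(\<integral>\<^sup>+x. S x s * (F (x + c *\<^sub>R s) * h (x + c' *\<^sub>R s)) \<partial>lborel)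
      \<le> Nm lborel P (\<lambda>x. S x s) * Nm lborel (\<alpha> + \<beta>) (\<lambda>x. F (x + c *\<^sub>R s) * h (x + c' *\<^sub>R s))"
      using Nm_holder[of "\<lambda>x. S x s" lborel "\<lambda>x. F (x + c *\<^sub>R s) * h (x + c' *\<^sub>R s)" P] PQ \<alpha>\<beta> True by simp
    also have "\<dots> \<le> Nm lborel P (\<lambda>x. S x s) * (Nm lborel \<alpha> (\<lambda>x. F (x + c *\<^sub>R s)) * Nm lborel \<beta> (\<lambda>x. h (x + c' *\<^sub>R s)))"
      using \<alpha>\<beta> True by (intro mult_left_mono Nm_gen_holder) auto
    finally show ?thesis by (simp add: Nm_shift mult.assoc)
  qed
  then have "(\<integral>\<^sup>+s. \<integral>\<^sup>+x. S x s * F (x + c *\<^sub>R s) * h (x + c' *\<^sub>R s) \<partial>lborel \<partial>lborel)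
    \<le> (\<integral>\<^sup>+s. Nm lborel P (\<lambda>x. S x s) * (Nm lborel \<alpha> F * Nm lborel \<beta> h) \<partial>lborel)"
    by (intro nn_integral_mono)
  also have "\<dots> = (\<integral>\<^sup>+s. Nm lborel P (\<lambda>x. S x s) \<partial>lborel) * (Nm lborel \<alpha> F * Nm lborel \<beta> h)"
    by (simp add: nn_integral_multc)
  finally show ?thesis using True by (simp add: Nm_1 mult.assoc)
next
  case False
  define \<kappa> where "\<kappa> = 1 - Q"
  have par: "0 \<le> P" "0 < \<kappa>" "\<kappa> \<le> \<alpha>" "\<kappa> \<le> \<beta>" "P + \<alpha> + \<beta> = 1 + \<kappa>"
    using PQ \<alpha>\<beta> False by (auto simp: \<kappa>_def)
  let ?A = "\<lambda>x. epow (F x) (1 / \<alpha>)" and ?B = "\<lambda>x. epow (h x) (1 / \<beta>)"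
  let ?I = "\<lambda>s. \<integral>\<^sup>+x. ?A (x + c *\<^sub>R s) * ?B (x + c' *\<^sub>R s) \<partial>lborel"
  let ?R = "epow (Nm lborel \<alpha> F) (1 - \<kappa> / \<alpha>) * epow (Nm lborel \<beta> h) (1 - \<kappa> / \<beta>)"
  have "(\<integral>\<^sup>+x. S x s * F (x + c *\<^sub>R s) * h (x + c' *\<^sub>R s) \<partial>lborel)
    \<le> Nm lborel P (\<lambda>x. S x s) * epow (?I s) \<kappa> * ?R" for s
    using Nm_four_holder[of "\<lambda>x. S x s" lborel "\<lambda>x. F (x + c *\<^sub>R s)" "\<lambda>x. h (x + c' *\<^sub>R s)" P \<kappa> \<alpha> \<beta>] par
    by (simp add: Nm_shift mult.assoc)
  then have "(\<integral>\<^sup>+s. \<integral>\<^sup>+x. S x s * F (x + c *\<^sub>R s) * h (x + c' *\<^sub>R s) \<partial>lborel \<partial>lborel)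
    \<le> (\<integral>\<^sup>+s. Nm lborel P (\<lambda>x. S x s) * epow (?I s) \<kappa> * ?R \<partial>lborel)"
    by (intro nn_integral_mono)
  also have "\<dots> = (\<integral>\<^sup>+s. Nm lborel P (\<lambda>x. S x s) * epow (?I s) \<kappa> \<partial>lborel) * ?R"
    by (rule nn_integral_multc) simp
  also have "\<dots> \<le> (Nm lborel Q (\<lambda>s. Nm lborel P (\<lambda>x. S x s)) * Nm lborel \<kappa> (\<lambda>s. epow (?I s) \<kappa>)) * ?R"
    unfolding \<kappa>_def using PQ by (intro mult_right_mono Nm_holder) auto
  \<comment> \<open>The norm with parameter \<kappa> turns the power \<kappa> of the inner integral
    into the full double integral over s and x, which \<open>nn_integral_skew\<close>
    decouples.\<close>
  also have "Nm lborel \<kappa> (\<lambda>s. epow (?I s) \<kappa>) = epow ((\<integral>\<^sup>+x. ?A x \<partial>lborel) * (\<integral>\<^sup>+x. ?B x \<partial>lborel)) \<kappa>"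
    using par nn_integral_skew[of ?A ?B c c'] c by (subst Nm_epow) (auto simp: Nm_1)
  also have "\<dots> = epow (Nm lborel \<alpha> F) (\<kappa> / \<alpha>) * epow (Nm lborel \<beta> h) (\<kappa> / \<beta>)"
    using par by (simp add: epow_mult Nm_def epow_epow)
  also have "Nm lborel Q (\<lambda>s. Nm lborel P (\<lambda>x. S x s)) * (epow (Nm lborel \<alpha> F) (\<kappa> / \<alpha>) * epow (Nm lborel \<beta> h) (\<kappa> / \<beta>)) * ?R
    = Nm lborel Q (\<lambda>s. Nm lborel P (\<lambda>x. S x s)) * (epow (Nm lborel \<alpha> F) (\<kappa> / \<alpha>) * epow (Nm lborel \<alpha> F) (1 - \<kappa> / \<alpha>))
      * (epow (Nm lborel \<beta> h) (\<kappa> / \<beta>) * epow (Nm lborel \<beta> h) (1 - \<kappa> / \<beta>))"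
    by (simp add: ac_simps)
  also have "\<dots> = Nm lborel Q (\<lambda>s. Nm lborel P (\<lambda>x. S x s)) * Nm lborel \<alpha> F * Nm lborel \<beta> h"
    using par by (simp add: epow_add[symmetric])
  finally show ?thesis .
qed

text \<open>Dual form of the trilinear estimate: after pairing with h, the translation y = x + c' s
  restores the symmetric form.\<close>

lemma skew_bilinear:
  fixes S :: "'a::euclidean_space \<Rightarrow> 'a \<Rightarrow> ennreal"
  assumes S [measurable]: "(\<lambda>(x, s). S x s) \<in> borel_measurable (borel \<Otimes>\<^sub>M borel)"
      and F [measurable]: "F \<in> borel_measurable borel"
    and c: "\<bar>c - c'\<bar> = 1"
  shows "Nm lborel (1 - \<beta>) (\<lambda>y. \<integral>\<^sup>+s. S (y - c' *\<^sub>R s) s * F (y + (c - c') *\<^sub>R s) \<partial>lborel)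
    \<le> Nm lborel Q (\<lambda>s. Nm lborel P (\<lambda>x. S x s)) * Nm lborel \<alpha> F"
proof (rule Nm_duality)
  have [measurable]: "(\<lambda>z. S (f z) (g z)) \<in> borel_measurable N"
    if [measurable]: "f \<in> measurable N borel" "g \<in> measurable N borel" for f g and N :: "'b measure"
    using measurable_compose[OF measurable_Pair[OF that] S] by simp
  have m [measurable]: "(\<lambda>(y, s). S (y - c' *\<^sub>R s) s * F (y + (c - c') *\<^sub>R s)) \<in> borel_measurable (borel \<Otimes>\<^sub>M borel)"
    unfolding case_prod_beta' by measurable
  show "(\<lambda>y. \<integral>\<^sup>+s. S (y - c' *\<^sub>R s) s * F (y + (c - c') *\<^sub>R s) \<partial>lborel) \<in> borel_measurable lborel"
    by measurable
  fix h :: "'a \<Rightarrow> ennreal" assume h: "h \<in> borel_measurable lborel"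
  then have [measurable]: "h \<in> borel_measurable borel" by simp
  have "(\<integral>\<^sup>+y. (\<integral>\<^sup>+s. S (y - c' *\<^sub>R s) s * F (y + (c - c') *\<^sub>R s) \<partial>lborel) * h y \<partial>lborel)
    = (\<integral>\<^sup>+y. \<integral>\<^sup>+s. S (y - c' *\<^sub>R s) s * F (y + (c - c') *\<^sub>R s) * h y \<partial>lborel \<partial>lborel)"
    by (intro nn_integral_cong nn_integral_multc[symmetric]) measurable
  also have "\<dots> = (\<integral>\<^sup>+s. \<integral>\<^sup>+y. S (y - c' *\<^sub>R s) s * F (y + (c - c') *\<^sub>R s) * h y \<partial>lborel \<partial>lborel)"
    by (rule lborel_pair.Fubini'[symmetric]) measurable
  also have "\<dots> = (\<integral>\<^sup>+s. \<integral>\<^sup>+x. S x s * F (x + c *\<^sub>R s) * h (x + c' *\<^sub>R s) \<partial>lborel \<partial>lborel)"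
  proof (rule nn_integral_cong)
    fix s :: 'a
    show "(\<integral>\<^sup>+y. S (y - c' *\<^sub>R s) s * F (y + (c - c') *\<^sub>R s) * h y \<partial>lborel)
      = (\<integral>\<^sup>+x. S x s * F (x + c *\<^sub>R s) * h (x + c' *\<^sub>R s) \<partial>lborel)"
      by (subst nn_integral_shift(1)[of "\<lambda>y. S (y - c' *\<^sub>R s) s * F (y + (c - c') *\<^sub>R s) * h y" "c' *\<^sub>R s", symmetric])
        (auto simp: algebra_simps)
  qed
  also have "\<dots> \<le> Nm lborel Q (\<lambda>s. Nm lborel P (\<lambda>x. S x s)) * Nm lborel \<alpha> F * Nm lborel \<beta> h"
    by (rule skew_trilinear) (use c in auto)
  finally show "(\<integral>\<^sup>+y. (\<integral>\<^sup>+s. S (y - c' *\<^sub>R s) s * F (y + (c - c') *\<^sub>R s) \<partial>lborel) * h y \<partial>lborel)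
    \<le> Nm lborel Q (\<lambda>s. Nm lborel P (\<lambda>x. S x s)) * Nm lborel \<alpha> F * Nm lborel (1 - (1 - \<beta>)) h"
    by simp
qed (use PQ \<alpha>\<beta> in \<open>auto intro: lborel.sigma_finite_measure_axioms\<close>)

end

section \<open>Mixed norms\<close>

definition MN :: "real \<Rightarrow> real \<Rightarrow> ('a::euclidean_space \<Rightarrow> 'b::euclidean_space \<Rightarrow> ennreal) \<Rightarrow> ennreal" where
  "MN \<theta>1 \<theta>2 F = Nm lborel \<theta>2 (\<lambda>\<xi>. Nm lborel \<theta>1 (\<lambda>x. F x \<xi>))"

lemma lborel_sf: "sigma_finite_measure (lborel :: 'a::euclidean_space measure)"
  by (rule lborel.sigma_finite_measure_axioms)

lemma measurable_curried_swap:
  "(\<lambda>(x, y). F x y) \<in> borel_measurable (M \<Otimes>\<^sub>M N) \<Longrightarrow> (\<lambda>(y, x). F x y) \<in> borel_measurable (N \<Otimes>\<^sub>M M)"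
  by (subst measurable_pair_swap_iff) simp

text \<open>Used as a local measurability rule, so that \<open>measurable\<close> can treat
  compositions with functions given in curried form.\<close>

lemma measurable_curried_comp:
  assumes "(\<lambda>(x, y). F x y) \<in> borel_measurable (borel \<Otimes>\<^sub>M borel)"
    and "f \<in> measurable N borel" "g \<in> measurable N borel"
  shows "(\<lambda>z. F (f z) (g z)) \<in> borel_measurable N"
  using measurable_compose[OF measurable_Pair[OF assms(2,3)] assms(1)] by simp

lemma MN_inner_measurable:
  assumes [measurable]: "(\<lambda>(x, y). F x y) \<in> borel_measurable (borel \<Otimes>\<^sub>M borel)"
  shows "(\<lambda>\<xi>. Nm lborel \<theta> (\<lambda>x. F x \<xi>)) \<in> borel_measurable borel"
proof -
  have [measurable]: "(\<lambda>(y, x). F x y) \<in> borel_measurable (borel \<Otimes>\<^sub>M borel)"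
    by (rule measurable_curried_swap) simp
  show ?thesis by measurable
qed

lemma MN_mono:
  assumes F: "(\<lambda>(x, y). F x y) \<in> borel_measurable (borel \<Otimes>\<^sub>M borel)" and "0 \<le> \<theta>1" "0 \<le> \<theta>2"
    and le: "\<And>x y. F x y \<le> G x y"
  shows "MN \<theta>1 \<theta>2 F \<le> MN \<theta>1 \<theta>2 G"
  unfolding MN_def
proof (intro Nm_mono)
  show "(\<lambda>x. F x \<xi>) \<in> borel_measurable lborel" for \<xi>
    using measurable_curried_comp[OF F, of "\<lambda>x. x" lborel "\<lambda>_. \<xi>"] by simp
  show "(\<lambda>\<xi>. Nm lborel \<theta>1 (\<lambda>x. F x \<xi>)) \<in> borel_measurable lborel"
    using MN_inner_measurable[OF F] by simp
qed (use assms in auto)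

lemma MN_cmult_le:
  assumes F: "(\<lambda>(x, y). F x y) \<in> borel_measurable (borel \<Otimes>\<^sub>M borel)" and "0 \<le> \<theta>1" "0 \<le> \<theta>2" "0 \<le> c"
  shows "MN \<theta>1 \<theta>2 (\<lambda>x y. ennreal c * F x y) = ennreal c * MN \<theta>1 \<theta>2 F"
proof -
  have [measurable]: "(\<lambda>x. F x \<xi>) \<in> borel_measurable lborel" for \<xi>
    using measurable_curried_comp[OF F, of "\<lambda>x. x" lborel "\<lambda>_. \<xi>"] by simp
  show ?thesis unfolding MN_def
    using MN_inner_measurable[OF F] assms by (simp add: Nm_cmult)
qed

text \<open>Young's inequality for convolution with an integrable kernel: Minkowski's inequality in
  each of the two norms, together with their invariance under translation.\<close>

lemma MN_conv:
  fixes F :: "'a::euclidean_space \<Rightarrow> 'b::euclidean_space \<Rightarrow> ennreal"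
  assumes F: "(\<lambda>(x, y). F x y) \<in> borel_measurable (borel \<Otimes>\<^sub>M borel)"
    and G: "(\<lambda>(x, y). G x y) \<in> borel_measurable (borel \<Otimes>\<^sub>M borel)"
    and \<theta>: "0 \<le> \<theta>1" "\<theta>1 \<le> 1" "0 \<le> \<theta>2" "\<theta>2 \<le> 1"
  shows "MN \<theta>1 \<theta>2 (\<lambda>x \<xi>. \<integral>\<^sup>+\<eta>. \<integral>\<^sup>+y. F (x - y) (\<xi> - \<eta>) * G y \<eta> \<partial>lborel \<partial>lborel)
    \<le> (\<integral>\<^sup>+\<eta>. \<integral>\<^sup>+y. G y \<eta> \<partial>lborel \<partial>lborel) * MN \<theta>1 \<theta>2 F"
proof -
  note [measurable (raw)] = measurable_curried_comp[OF F] measurable_curried_comp[OF G]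
  note MN_inner_measurable[OF F, measurable]
  define N where "N \<xi> = Nm lborel \<theta>1 (\<lambda>x. F x \<xi>)" for \<xi>
  have [measurable]: "N \<in> borel_measurable borel" unfolding N_def by measurable
  have 1: "Nm lborel \<theta>1 (\<lambda>x. \<integral>\<^sup>+\<eta>. \<integral>\<^sup>+y. F (x - y) (\<xi> - \<eta>) * G y \<eta> \<partial>lborel \<partial>lborel)
    \<le> (\<integral>\<^sup>+\<eta>. N (\<xi> - \<eta>) * (\<integral>\<^sup>+y. G y \<eta> \<partial>lborel) \<partial>lborel)" for \<xi>
  proof -
    have "Nm lborel \<theta>1 (\<lambda>x. \<integral>\<^sup>+\<eta>. \<integral>\<^sup>+y. F (x - y) (\<xi> - \<eta>) * G y \<eta> \<partial>lborel \<partial>lborel)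
      \<le> (\<integral>\<^sup>+\<eta>. Nm lborel \<theta>1 (\<lambda>x. \<integral>\<^sup>+y. F (x - y) (\<xi> - \<eta>) * G y \<eta> \<partial>lborel) \<partial>lborel)"
      by (rule Nm_minkowski[OF lborel_sf lborel_sf _ \<theta>(1,2)]) measurable
    also have "\<dots> \<le> (\<integral>\<^sup>+\<eta>. \<integral>\<^sup>+y. Nm lborel \<theta>1 (\<lambda>x. F (x - y) (\<xi> - \<eta>) * G y \<eta>) \<partial>lborel \<partial>lborel)"
      by (intro nn_integral_mono Nm_minkowski[OF lborel_sf lborel_sf _ \<theta>(1,2)]) measurable
    also have "\<dots> \<le> (\<integral>\<^sup>+\<eta>. \<integral>\<^sup>+y. N (\<xi> - \<eta>) * G y \<eta> \<partial>lborel \<partial>lborel)"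
    proof (intro nn_integral_mono)
      fix \<eta> :: 'b and y :: 'a
      have "Nm lborel \<theta>1 (\<lambda>x. G y \<eta> * F (x - y) (\<xi> - \<eta>)) \<le> G y \<eta> * Nm lborel \<theta>1 (\<lambda>x. F (x - y) (\<xi> - \<eta>))"
        using \<theta> by (intro Nm_cmult_le) measurable
      also have "Nm lborel \<theta>1 (\<lambda>x. F (x - y) (\<xi> - \<eta>)) = N (\<xi> - \<eta>)"
        unfolding N_def by (rule Nm_shift(3)) measurable
      finally show "Nm lborel \<theta>1 (\<lambda>x. F (x - y) (\<xi> - \<eta>) * G y \<eta>) \<le> N (\<xi> - \<eta>) * G y \<eta>"
        by (simp add: mult.commute)
    qed
    also have "\<dots> = (\<integral>\<^sup>+\<eta>. N (\<xi> - \<eta>) * (\<integral>\<^sup>+y. G y \<eta> \<partial>lborel) \<partial>lborel)"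
      by (intro nn_integral_cong nn_integral_cmult) measurable
    finally show ?thesis .
  qed
  have "MN \<theta>1 \<theta>2 (\<lambda>x \<xi>. \<integral>\<^sup>+\<eta>. \<integral>\<^sup>+y. F (x - y) (\<xi> - \<eta>) * G y \<eta> \<partial>lborel \<partial>lborel)
    \<le> Nm lborel \<theta>2 (\<lambda>\<xi>. \<integral>\<^sup>+\<eta>. N (\<xi> - \<eta>) * (\<integral>\<^sup>+y. G y \<eta> \<partial>lborel) \<partial>lborel)"
    unfolding MN_def using \<theta> by (intro Nm_mono 1) measurable
  also have "\<dots> \<le> (\<integral>\<^sup>+\<eta>. Nm lborel \<theta>2 (\<lambda>\<xi>. N (\<xi> - \<eta>) * (\<integral>\<^sup>+y. G y \<eta> \<partial>lborel)) \<partial>lborel)"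
    by (rule Nm_minkowski[OF lborel_sf lborel_sf _ \<theta>(3,4)]) measurable
  also have "\<dots> \<le> (\<integral>\<^sup>+\<eta>. (\<integral>\<^sup>+y. G y \<eta> \<partial>lborel) * MN \<theta>1 \<theta>2 F \<partial>lborel)"
  proof (intro nn_integral_mono)
    fix \<eta> :: 'b
    have "Nm lborel \<theta>2 (\<lambda>\<xi>. (\<integral>\<^sup>+y. G y \<eta> \<partial>lborel) * N (\<xi> - \<eta>)) \<le> (\<integral>\<^sup>+y. G y \<eta> \<partial>lborel) * Nm lborel \<theta>2 (\<lambda>\<xi>. N (\<xi> - \<eta>))"
      using \<theta> by (intro Nm_cmult_le) measurable
    also have "Nm lborel \<theta>2 (\<lambda>\<xi>. N (\<xi> - \<eta>)) = MN \<theta>1 \<theta>2 F"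
      unfolding MN_def N_def[symmetric] by (rule Nm_shift(3)) measurable
    finally show "Nm lborel \<theta>2 (\<lambda>\<xi>. N (\<xi> - \<eta>) * (\<integral>\<^sup>+y. G y \<eta> \<partial>lborel)) \<le> (\<integral>\<^sup>+y. G y \<eta> \<partial>lborel) * MN \<theta>1 \<theta>2 F"
      by (simp add: mult.commute)
  qed
  also have "\<dots> = (\<integral>\<^sup>+\<eta>. \<integral>\<^sup>+y. G y \<eta> \<partial>lborel \<partial>lborel) * MN \<theta>1 \<theta>2 F"
    by (rule nn_integral_multc) measurable
  finally show ?thesis .
qed

text \<open>A function that is nearly constant on unit balls is dominated pointwise by its mean over
  such a ball, hence by its norm. Norms between \<theta> and the supremum then follow by taking out
  a power of this pointwise bound.\<close>

lemma Nm_embed: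
  assumes \<theta>: "0 \<le> \<theta>'" "\<theta>' \<le> \<theta>" and "0 \<le> C"
  obtains D where "D < \<infinity>"
    "\<And>k :: 'a::euclidean_space \<Rightarrow> ennreal. k \<in> borel_measurable borel \<Longrightarrow>
      (\<And>x y. dist x y \<le> 1 \<Longrightarrow> k x \<le> ennreal C * k y) \<Longrightarrow> Nm lborel \<theta>' k \<le> D * Nm lborel \<theta> k"
proof (cases "\<theta> = 0")
  case True
  then show ?thesis using \<theta> by (intro that[of 1]) auto
next
  case False
  then have pos: "0 < \<theta>" using \<theta> by auto
  define v where "v = emeasure lborel (ball (0::'a) 1)"
  have "unit_ball_vol (real DIM('a)) \<noteq> 0"
    using unit_ball_vol_pos[of "real DIM('a)"] by linarith
  then have v: "v \<noteq> 0" "v \<noteq> \<infinity>"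
    using emeasure_lborel_ball_finite[of "0::'a" 1] by (simp_all add: v_def emeasure_ball)
  \<comment> \<open>Averaging k^(1/\<theta>) over a unit ball of volume v and taking the power
    \<theta> costs the factor C v^(-\<theta>).\<close>
  define E where "E = ennreal C * epow (1 / v) \<theta>"
  have "1 / v < \<infinity>" using v by (auto simp: ennreal_divide_eq_top_iff less_top[symmetric])
  then have E: "E < \<infinity>" using pos epow_lt_top[of "1 / v" \<theta>] by (auto simp: E_def ennreal_mult_less_top)
  show ?thesis
  proof (rule that[of "epow E (1 - \<theta>' / \<theta>)"])
    show "epow E (1 - \<theta>' / \<theta>) < \<infinity>" using E \<theta> pos by (intro epow_lt_top) auto
  next
    fix k :: "'a \<Rightarrow> ennreal" assume [measurable]: "k \<in> borel_measurable borel"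
      and mod: "\<And>x y. dist x y \<le> 1 \<Longrightarrow> k x \<le> ennreal C * k y"
    have sup: "k x \<le> E * Nm lborel \<theta> k" for x
    proof -
      have "epow (k x) (1/\<theta>) * v = epow (k x) (1/\<theta>) * emeasure lborel (ball x 1)"
        by (simp add: v_def emeasure_ball)
      also have "\<dots> = (\<integral>\<^sup>+y. epow (k x) (1/\<theta>) * indicator (ball x 1) y \<partial>lborel)"
        by (subst nn_integral_cmult_indicator) auto
      also have "\<dots> \<le> (\<integral>\<^sup>+y. epow (ennreal C) (1/\<theta>) * epow (k y) (1/\<theta>) \<partial>lborel)"
        using pos by (intro nn_integral_mono) (auto simp: indicator_def epow_mult[symmetric] intro!: epow_mono mod)
      also have "\<dots> = epow (ennreal C) (1/\<theta>) * (\<integral>\<^sup>+y. epow (k y) (1/\<theta>) \<partial>lborel)"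
        by (simp add: nn_integral_cmult)
      finally have "epow (k x) (1/\<theta>) * v \<le> epow (ennreal C) (1/\<theta>) * (\<integral>\<^sup>+y. epow (k y) (1/\<theta>) \<partial>lborel)" .
      then have "epow (k x) (1/\<theta>) * v * (1 / v) \<le> epow (ennreal C) (1/\<theta>) * (\<integral>\<^sup>+y. epow (k y) (1/\<theta>) \<partial>lborel) * (1 / v)"
        by (rule mult_right_mono) simp
      moreover have "v * (1 / v) = 1" using v by (simp add: ennreal_times_divide less_top)
      ultimately have "epow (k x) (1/\<theta>) \<le> epow (ennreal C) (1/\<theta>) * (\<integral>\<^sup>+y. epow (k y) (1/\<theta>) \<partial>lborel) * (1 / v)"
        by (metis mult.assoc mult.right_neutral)
      then have "k x \<le> epow (epow (ennreal C) (1/\<theta>) * (\<integral>\<^sup>+y. epow (k y) (1/\<theta>) \<partial>lborel) * (1 / v)) \<theta>"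
        using pos by (simp add: epow_le_iff)
      also have "\<dots> = E * Nm lborel \<theta> k"
        using pos by (simp add: epow_mult epow_inv E_def Nm_def ac_simps)
      finally show ?thesis .
    qed
    show "Nm lborel \<theta>' k \<le> epow E (1 - \<theta>' / \<theta>) * Nm lborel \<theta> k"
    proof (cases "\<theta>' = 0")
      case True
      then show ?thesis using sup by (auto simp: Nm_0_le_iff)
    next
      case False
      then have pos': "0 < \<theta>'" using \<theta> by auto
      let ?N = "Nm lborel \<theta> k"
      \<comment> \<open>k^(1/\<theta>') is written as k^r k^(1/\<theta>) with r \<ge> 0; the first
        factor is estimated by the pointwise bound, the second is integrated.\<close>
      define r where "r = 1/\<theta>' - 1/\<theta>"
      have r: "0 \<le> r" "1/\<theta>' = r + 1/\<theta>" using pos pos' \<theta> by (auto simp: r_def field_simps)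
      have "(\<integral>\<^sup>+x. epow (k x) (1/\<theta>') \<partial>lborel) \<le> (\<integral>\<^sup>+x. epow (E * ?N) r * epow (k x) (1/\<theta>) \<partial>lborel)"
        unfolding r(2) using r(1) pos
        by (intro nn_integral_mono) (auto simp: epow_add intro!: mult_right_mono epow_mono sup)
      also have "\<dots> = epow (E * ?N) r * epow ?N (1/\<theta>)"
        using pos by (simp add: nn_integral_cmult epow_Nm)
      finally have "Nm lborel \<theta>' k \<le> epow (epow (E * ?N) r * epow ?N (1/\<theta>)) \<theta>'"
        using pos' by (simp add: Nm_def epow_mono)
      also have "\<dots> = epow E (r * \<theta>') * epow ?N (r * \<theta>' + (1/\<theta>) * \<theta>')"
        using r(1) pos pos' by (simp add: epow_mult epow_epow epow_add mult.assoc)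
      also have "r * \<theta>' + (1/\<theta>) * \<theta>' = 1" using pos pos' by (simp add: r_def field_simps)
      also have "r * \<theta>' = 1 - \<theta>' / \<theta>" using pos pos' by (simp add: r_def field_simps)
      finally show ?thesis by simp
    qed
  qed
qed

text \<open>The one-variable embedding is used twice. For the second use, the inner norms form a
  function of \<xi> that is again nearly constant on unit balls, with the same C.\<close>

lemma MN_embed:
  assumes \<theta>: "0 \<le> \<theta>1'" "\<theta>1' \<le> \<theta>1" "0 \<le> \<theta>2'" "\<theta>2' \<le> \<theta>2" and "0 \<le> C"
  obtains D where "D < \<infinity>"
    "\<And>k :: 'a::euclidean_space \<Rightarrow> 'b::euclidean_space \<Rightarrow> ennreal.
      (\<lambda>(x, y). k x y) \<in> borel_measurable (borel \<Otimes>\<^sub>M borel) \<Longrightarrow>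
      (\<And>x y \<xi> \<eta>. dist x y \<le> 1 \<Longrightarrow> dist \<xi> \<eta> \<le> 1 \<Longrightarrow> k x \<xi> \<le> ennreal C * k y \<eta>) \<Longrightarrow>
      MN \<theta>1' \<theta>2' k \<le> D * MN \<theta>1 \<theta>2 k"
proof -
  obtain D1 where D1: "D1 < \<infinity>" "\<And>k :: 'a \<Rightarrow> ennreal. k \<in> borel_measurable borel \<Longrightarrow>
      (\<And>x y. dist x y \<le> 1 \<Longrightarrow> k x \<le> ennreal C * k y) \<Longrightarrow> Nm lborel \<theta>1' k \<le> D1 * Nm lborel \<theta>1 k"
    using Nm_embed[OF \<theta>(1,2) \<open>0 \<le> C\<close>] by blast
  obtain D2 where D2: "D2 < \<infinity>" "\<And>k :: 'b \<Rightarrow> ennreal. k \<in> borel_measurable borel \<Longrightarrow>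
      (\<And>x y. dist x y \<le> 1 \<Longrightarrow> k x \<le> ennreal C * k y) \<Longrightarrow> Nm lborel \<theta>2' k \<le> D2 * Nm lborel \<theta>2 k"
    using Nm_embed[OF \<theta>(3,4) \<open>0 \<le> C\<close>] by blast
  show ?thesis
  proof (rule that[of "D1 * D2"])
    show "D1 * D2 < \<infinity>" using D1 D2 by (simp add: ennreal_mult_less_top)
  next
    fix k :: "'a \<Rightarrow> 'b \<Rightarrow> ennreal"
    assume k: "(\<lambda>(x, y). k x y) \<in> borel_measurable (borel \<Otimes>\<^sub>M borel)"
      and mod: "\<And>x y \<xi> \<eta>. dist x y \<le> 1 \<Longrightarrow> dist \<xi> \<eta> \<le> 1 \<Longrightarrow> k x \<xi> \<le> ennreal C * k y \<eta>"
    note [measurable (raw)] = measurable_curried_comp[OF k]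
    note MN_inner_measurable[OF k, measurable]
    have th1: "0 \<le> \<theta>1" "0 \<le> \<theta>2" using \<theta> by auto
    have "MN \<theta>1' \<theta>2' k \<le> Nm lborel \<theta>2' (\<lambda>\<xi>. D1 * Nm lborel \<theta>1 (\<lambda>x. k x \<xi>))"
      unfolding MN_def using \<theta> by (intro Nm_mono D1(2) mod) auto
    also have "\<dots> \<le> D1 * Nm lborel \<theta>2' (\<lambda>\<xi>. Nm lborel \<theta>1 (\<lambda>x. k x \<xi>))"
      using \<theta> by (intro Nm_cmult_le) auto
    also have "\<dots> \<le> D1 * (D2 * Nm lborel \<theta>2 (\<lambda>\<xi>. Nm lborel \<theta>1 (\<lambda>x. k x \<xi>)))"
    proof (intro mult_left_mono D2(2))
      fix \<xi> \<eta> :: 'b assume *: "dist \<xi> \<eta> \<le> 1"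
      have "Nm lborel \<theta>1 (\<lambda>x. k x \<xi>) \<le> Nm lborel \<theta>1 (\<lambda>x. ennreal C * k x \<eta>)"
        using th1 * by (intro Nm_mono mod) auto
      also have "\<dots> \<le> ennreal C * Nm lborel \<theta>1 (\<lambda>x. k x \<eta>)"
        using th1 by (intro Nm_cmult_le) auto
      finally show "Nm lborel \<theta>1 (\<lambda>x. k x \<xi>) \<le> ennreal C * Nm lborel \<theta>1 (\<lambda>x. k x \<eta>)" .
    qed auto
    finally show "MN \<theta>1' \<theta>2' k \<le> D1 * D2 * MN \<theta>1 \<theta>2 k" by (simp add: MN_def mult.assoc)
  qed
qed

section \<open>Schwartz functions\<close>

definition pd :: "'a::euclidean_space \<Rightarrow> ('a \<Rightarrow> complex) \<Rightarrow> 'a \<Rightarrow> complex" where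
  "pd b f = (\<lambda>x. frechet_derivative f (at x) b)"

lemma iter_partial_Nil [simp]: "iter_partial [] f = f"
  by (simp add: iter_partial_def)

lemma iter_partial_Cons [simp]: "iter_partial (b # bs) f = pd b (iter_partial bs f)"
  by (simp add: iter_partial_def pd_def)

text \<open>The last entry of the list is the derivative applied first; this form is the one for
  inductions that start by differentiating f itself.\<close>

lemma iter_partial_snoc: "iter_partial (bs @ [b]) f = iter_partial bs (pd b f)"
  by (induction bs) auto

lemma pd_eqI: "(\<And>x. (f has_derivative f' x) (at x)) \<Longrightarrow> pd b f = (\<lambda>x. f' x b)"
  unfolding pd_def by (rule ext) (metis frechet_derivative_at)

lemma iter_partial_schwartz:
  assumes "f \<in> schwartz" "bs \<in> lists Basis"
  shows "iter_partial bs f \<in> schwartz"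
proof -
  have app: "iter_partial as (iter_partial bs f) = iter_partial (as @ bs) f" for as
    by (induction as) auto
  show ?thesis using assms by (auto simp: schwartz_def app)
qed

lemma schwartz_pd: "f \<in> schwartz \<Longrightarrow> b \<in> Basis \<Longrightarrow> pd b f \<in> schwartz"
  using iter_partial_schwartz[of f "[b]"] by simp

lemma schwartz_differentiable: "f \<in> schwartz \<Longrightarrow> f differentiable at x"
  by (force simp: schwartz_def dest: bspec[of _ _ "[]"])

lemma schwartz_has_derivative:
  "f \<in> schwartz \<Longrightarrow> (f has_derivative frechet_derivative f (at x)) (at x)"
  using schwartz_differentiable frechet_derivative_works by blast

lemma schwartz_bound:
  assumes "f \<in> schwartz"
  obtains C where "0 \<le> C" "\<And>x. (1 + norm x) ^ k * norm (f x) \<le> C"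
proof -
  have "bdd_above (range (\<lambda>x. (1 + norm x) ^ k * norm (f x)))"
    using assms by (force simp: schwartz_def dest: bspec[of _ _ "[]"])
  then obtain C where C: "\<And>x. (1 + norm x) ^ k * norm (f x) \<le> C"
    by (auto simp: bdd_above_def)
  moreover have "0 \<le> C" using C[of 0] by (rule order_trans[rotated]) simp
  ultimately show ?thesis using that by blast
qed

text \<open>A class of differentiable, rapidly decreasing functions that is closed under partial
  derivatives consists of Schwartz functions. Membership proofs thereby reduce to first derivatives,
  and no Leibniz or chain rule for iterated derivatives is ever formulated.\<close>

lemma schwartz_coinduct:
  assumes "f \<in> X"
    and diff: "\<And>f x. f \<in> X \<Longrightarrow> f differentiable at x"
    and bd: "\<And>f k. f \<in> X \<Longrightarrow> \<exists>C. \<forall>x. (1 + norm x) ^ k * norm (f x) \<le> C"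
    and closed: "\<And>f b. f \<in> X \<Longrightarrow> b \<in> Basis \<Longrightarrow> pd b f \<in> X"
  shows "f \<in> schwartz"
proof -
  have "iter_partial bs f \<in> X" if "bs \<in> lists Basis" for bs
    using that by (induction bs) (auto simp: assms)
  then show ?thesis
    using diff bd by (fastforce simp: schwartz_def bdd_above_def)
qed

lemma schwartz_continuous: "f \<in> schwartz \<Longrightarrow> continuous_on A f"
  by (meson schwartz_differentiable differentiable_imp_continuous_within continuous_at_imp_continuous_on)

lemma schwartz_borel [measurable_dest]: "f \<in> schwartz \<Longrightarrow> f \<in> borel_measurable borel"
  by (intro borel_measurable_continuous_onI schwartz_continuous)

lemma pd_lincomb:
  assumes "f \<in> schwartz" "g \<in> schwartz"
  shows "pd b (\<lambda>x. c * f x + d * g x) = (\<lambda>x. c * pd b f x + d * pd b g x)"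
  unfolding pd_def[of b f] pd_def[of b g]
  by (rule pd_eqI) (use assms in \<open>auto intro!: derivative_eq_intros schwartz_has_derivative\<close>)

lemma schwartz_lincomb:
  assumes "f \<in> schwartz" "g \<in> schwartz"
  shows "(\<lambda>x. c * f x + d * g x) \<in> schwartz"
proof (rule schwartz_coinduct[where X = "{\<lambda>x. c * f x + d * g x | f g. f \<in> schwartz \<and> g \<in> schwartz}"])
  show "(\<lambda>x. c * f x + d * g x) \<in> {\<lambda>x. c * f x + d * g x | f g. f \<in> schwartz \<and> g \<in> schwartz}"
    using assms by blast
next
  fix h assume "h \<in> {\<lambda>x. c * f x + d * g x | f g. f \<in> schwartz \<and> g \<in> schwartz}"
  then obtain f g where h: "h = (\<lambda>x. c * f x + d * g x)" "f \<in> schwartz" "g \<in> schwartz" by auto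
  show "h differentiable at x" for x
    unfolding h using h by (intro derivative_intros schwartz_differentiable)
  show "\<exists>C. \<forall>x. (1 + norm x) ^ k * norm (h x) \<le> C" for k
  proof -
    obtain C D where C: "\<And>x. (1 + norm x) ^ k * norm (f x) \<le> C" and D: "\<And>x. (1 + norm x) ^ k * norm (g x) \<le> D"
      using h schwartz_bound by metis
    have "(1 + norm x) ^ k * norm (h x) \<le> norm c * C + norm d * D" for x
    proof -
      have "(1 + norm x) ^ k * norm (h x) \<le> (1 + norm x) ^ k * (norm c * norm (f x) + norm d * norm (g x))"
        unfolding h by (intro mult_left_mono order_trans[OF norm_triangle_ineq]) (auto simp: norm_mult)
      also have "\<dots> = norm c * ((1 + norm x) ^ k * norm (f x)) + norm d * ((1 + norm x) ^ k * norm (g x))"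
        by (simp add: algebra_simps)
      also have "\<dots> \<le> norm c * C + norm d * D"
        using C D by (intro add_mono mult_left_mono) auto
      finally show ?thesis .
    qed
    then show ?thesis by blast
  qed
  show "pd b h \<in> {\<lambda>x. c * f x + d * g x | f g. f \<in> schwartz \<and> g \<in> schwartz}" if "b \<in> Basis" for b
    unfolding h using pd_lincomb[OF h(2,3)] schwartz_pd[OF h(2) that] schwartz_pd[OF h(3) that] by auto
qed

lemma schwartz_add: "f \<in> schwartz \<Longrightarrow> g \<in> schwartz \<Longrightarrow> (\<lambda>x. f x + g x) \<in> schwartz"
  using schwartz_lincomb[of f g 1 1] by simp

lemma schwartz_diff: "f \<in> schwartz \<Longrightarrow> g \<in> schwartz \<Longrightarrow> (\<lambda>x. f x - g x) \<in> schwartz"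
  using schwartz_lincomb[of f g 1 "-1"] by simp

lemma schwartz_cmult: "f \<in> schwartz \<Longrightarrow> (\<lambda>x. c * f x) \<in> schwartz"
  using schwartz_lincomb[of f f c 0] by simp

lemma schwartz_zero: "(\<lambda>x. 0) \<in> schwartz"
proof (rule schwartz_coinduct[where X = "{\<lambda>x. 0}"])
  fix f :: "'a \<Rightarrow> complex" and b assume "f \<in> {\<lambda>x. 0}"
  then show "pd b f \<in> {\<lambda>x. 0}" by (simp add: pd_def)
qed auto

lemma schwartz_sum: "(\<And>i. i \<in> I \<Longrightarrow> f i \<in> schwartz) \<Longrightarrow> (\<lambda>x. \<Sum>i\<in>I. f i x) \<in> schwartz"
  by (induction I rule: infinite_finite_induct) (auto simp: schwartz_zero schwartz_add)

lemma pd_sum: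
  assumes "\<And>i. i \<in> I \<Longrightarrow> f i \<in> schwartz"
  shows "pd b (\<lambda>x. \<Sum>i\<in>I. f i x) = (\<lambda>x. \<Sum>i\<in>I. pd b (f i) x)"
  unfolding pd_def[of b "f _"]
  by (rule pd_eqI) (use assms in \<open>auto intro!: derivative_eq_intros schwartz_has_derivative\<close>)

lemma iter_partial_cmult:
  assumes "f \<in> schwartz" "bs \<in> lists Basis"
  shows "iter_partial bs (\<lambda>x. c * f x) = (\<lambda>x. c * iter_partial bs f x)"
  using assms(2)
proof (induction bs)
  case (Cons b bs)
  then show ?case
    using pd_lincomb[of "iter_partial bs f" "iter_partial bs f" b c 0] assms by (simp add: iter_partial_schwartz)
qed simp

lemma iter_partial_add:
  assumes "f \<in> schwartz" "g \<in> schwartz" "bs \<in> lists Basis"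
  shows "iter_partial bs (\<lambda>x. f x + g x) = (\<lambda>x. iter_partial bs f x + iter_partial bs g x)"
  using assms(3)
proof (induction bs)
  case (Cons b bs)
  then show ?case
    using pd_lincomb[of "iter_partial bs f" "iter_partial bs g" b 1 1] assms by (simp add: iter_partial_schwartz)
qed simp

lemma iter_partial_diff:
  assumes "f \<in> schwartz" "g \<in> schwartz" "bs \<in> lists Basis"
  shows "iter_partial bs (\<lambda>x. f x - g x) = (\<lambda>x. iter_partial bs f x - iter_partial bs g x)"
  using iter_partial_add[OF assms(1) schwartz_cmult[OF assms(2), of "-1"] assms(3)]
  by (simp add: iter_partial_cmult[OF assms(2,3), of "-1", simplified])

lemma iter_partial_sum:
  assumes "\<And>i. i \<in> I \<Longrightarrow> f i \<in> schwartz" "bs \<in> lists Basis"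
  shows "iter_partial bs (\<lambda>x. \<Sum>i\<in>I. f i x) = (\<lambda>x. \<Sum>i\<in>I. iter_partial bs (f i) x)"
  using assms(2)
  by (induction bs) (simp_all add: pd_sum assms(1) iter_partial_schwartz)

lemma pd_cnj:
  assumes "f \<in> schwartz"
  shows "pd b (\<lambda>x. cnj (f x)) = (\<lambda>x. cnj (pd b f x))"
  unfolding pd_def[of b f]
  by (rule pd_eqI) (use assms in \<open>auto intro!: derivative_eq_intros schwartz_has_derivative\<close>)

lemma schwartz_cnj:
  assumes "f \<in> schwartz"
  shows "(\<lambda>x. cnj (f x)) \<in> schwartz"
proof (rule schwartz_coinduct[where X = "{\<lambda>x. cnj (f x) | f. f \<in> schwartz}"])
  show "(\<lambda>x. cnj (f x)) \<in> {\<lambda>x. cnj (f x) | f. f \<in> schwartz}" using assms by blast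
next
  fix h :: "'a \<Rightarrow> complex" assume "h \<in> {\<lambda>x. cnj (f x) | f. f \<in> schwartz}"
  then obtain f where h: "h = (\<lambda>x. cnj (f x))" "f \<in> schwartz" by auto
  show "h differentiable at x" for x
    unfolding h using schwartz_has_derivative[OF h(2), of x] has_derivative_cnj differentiableI by blast
  show "\<exists>C. \<forall>x. (1 + norm x) ^ k * norm (h x) \<le> C" for k
    unfolding h using schwartz_bound[OF h(2)] by (metis complex_mod_cnj)
  show "pd b h \<in> {\<lambda>x. cnj (f x) | f. f \<in> schwartz}" if "b \<in> Basis" for b
    unfolding h using pd_cnj[OF h(2)] schwartz_pd[OF h(2) that] by auto
qed

lemma schwartz_coord:
  assumes "f \<in> schwartz"
  shows "(\<lambda>x. of_real (x \<bullet> v) * f x) \<in> schwartz"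
\<comment> \<open>The products alone are not closed under differentiation: the coordinate factor
  leaves behind a multiple of f. The second summand g absorbs it.\<close>
proof (rule schwartz_coinduct[where X = "{\<lambda>x. of_real (x \<bullet> v) * f x + g x | f g. f \<in> schwartz \<and> g \<in> schwartz}"])
  show "(\<lambda>x. of_real (x \<bullet> v) * f x) \<in> {\<lambda>x. of_real (x \<bullet> v) * f x + g x | f g. f \<in> schwartz \<and> g \<in> schwartz}"
    using assms schwartz_zero by force
next
  fix h :: "'a \<Rightarrow> complex"
  assume "h \<in> {\<lambda>x. of_real (x \<bullet> v) * f x + g x | f g. f \<in> schwartz \<and> g \<in> schwartz}"
  then obtain f g where h: "h = (\<lambda>x. of_real (x \<bullet> v) * f x + g x)" "f \<in> schwartz" "g \<in> schwartz" by auto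
  have der: "(h has_derivative (\<lambda>u. of_real (x \<bullet> v) * frechet_derivative f (at x) u
      + (of_real (u \<bullet> v) * f x + frechet_derivative g (at x) u))) (at x)" for x
    unfolding h by (auto intro!: derivative_eq_intros schwartz_has_derivative h(2,3))
  show "h differentiable at x" for x using der differentiableI by blast
  show "\<exists>C. \<forall>x. (1 + norm x) ^ k * norm (h x) \<le> C" for k
  proof -
    obtain C D where C: "\<And>x. (1 + norm x) ^ Suc k * norm (f x) \<le> C" and D: "\<And>x. (1 + norm x) ^ k * norm (g x) \<le> D"
      using h schwartz_bound by metis
    have "(1 + norm x) ^ k * norm (h x) \<le> norm v * C + D" for x
    proof -
      have "norm (h x) \<le> norm (complex_of_real (x \<bullet> v)) * norm (f x) + norm (g x)"
        unfolding h by (rule order_trans[OF norm_triangle_ineq]) (auto simp: norm_mult)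
      also have "\<dots> \<le> norm v * (1 + norm x) * norm (f x) + norm (g x)"
        using Cauchy_Schwarz_ineq2[of x v]
        by (intro add_mono mult_right_mono) (auto simp: algebra_simps intro: add_increasing)
      finally have "(1 + norm x) ^ k * norm (h x) \<le> (1 + norm x) ^ k * (norm v * (1 + norm x) * norm (f x) + norm (g x))"
        by (intro mult_left_mono) auto
      also have "\<dots> = norm v * ((1 + norm x) ^ Suc k * norm (f x)) + (1 + norm x) ^ k * norm (g x)"
        by (simp add: algebra_simps)
      also have "\<dots> \<le> norm v * C + D"
        using C D by (intro add_mono mult_left_mono) auto
      finally show ?thesis .
    qed
    then show ?thesis by blast
  qed
  show "pd b h \<in> {\<lambda>x. of_real (x \<bullet> v) * f x + g x | f g. f \<in> schwartz \<and> g \<in> schwartz}" if "b \<in> Basis" for b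
  proof -
    have "pd b h = (\<lambda>x. of_real (x \<bullet> v) * pd b f x + (of_real (b \<bullet> v) * f x + 1 * pd b g x))"
      using pd_eqI[OF der, of b] by (simp add: pd_def)
    moreover have "(\<lambda>x. of_real (b \<bullet> v) * f x + 1 * pd b g x) \<in> schwartz"
      using h that by (intro schwartz_lincomb schwartz_pd)
    ultimately show ?thesis
      using schwartz_pd[OF h(2) that]
      by (intro CollectI exI[of _ "pd b f"] exI[of _ "\<lambda>x. of_real (b \<bullet> v) * f x + 1 * pd b g x"] conjI)
  qed
qed

lemma one_plus_norm_mult: "1 + norm (x + y :: 'a::real_normed_vector) \<le> (1 + norm x) * (1 + norm y)"
proof -
  have "(1 + norm x) * (1 + norm y) = 1 + norm x + norm y + norm x * norm y" by (simp add: algebra_simps)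
  then show ?thesis
    using norm_triangle_ineq[of x y] mult_nonneg_nonneg[OF norm_ge_zero[of x] norm_ge_zero[of y]] by linarith
qed

text \<open>Translations, reflections, sections \<open>t \<mapsto> f (x, t)\<close> and restrictions to the diagonal are all
  compositions with injective affine maps.\<close>

lemma pd_affine:
  assumes "f \<in> schwartz" and L: "bounded_linear L"
  shows "pd b (\<lambda>x. f (L x + c)) = (\<lambda>x. \<Sum>b'\<in>Basis. of_real (L b \<bullet> b') * pd b' f (L x + c))"
    and "(\<lambda>x. f (L x + c)) differentiable at x"
proof -
  have der: "((\<lambda>x. f (L x + c)) has_derivative (\<lambda>u. frechet_derivative f (at (L x + c)) (L u))) (at x)" for x
  proof -
    have "((\<lambda>x. L x + c) has_derivative L) (at x)"
      using bounded_linear_imp_has_derivative[OF L] by (auto intro!: derivative_eq_intros)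
    then show ?thesis
      using diff_chain_at[of "\<lambda>x. L x + c" L x f] schwartz_has_derivative[OF assms(1), of "L x + c"]
      by (simp add: o_def)
  qed
  then show "(\<lambda>x. f (L x + c)) differentiable at x" using differentiableI by blast
  show "pd b (\<lambda>x. f (L x + c)) = (\<lambda>x. \<Sum>b'\<in>Basis. of_real (L b \<bullet> b') * pd b' f (L x + c))"
  proof (subst pd_eqI[OF der], rule ext)
    fix x
    interpret D: bounded_linear "frechet_derivative f (at (L x + c))"
      using schwartz_has_derivative[OF assms(1)] has_derivative_bounded_linear by blast
    have "frechet_derivative f (at (L x + c)) (L b)
        = frechet_derivative f (at (L x + c)) (\<Sum>b'\<in>Basis. (L b \<bullet> b') *\<^sub>R b')"
      by (simp add: euclidean_representation)
    also have "\<dots> = (\<Sum>b'\<in>Basis. of_real (L b \<bullet> b') * pd b' f (L x + c))"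
      by (simp add: D.sum D.scaleR pd_def scaleR_conv_of_real)
    finally show "frechet_derivative f (at (L x + c)) (L b)
      = (\<Sum>b'\<in>Basis. of_real (L b \<bullet> b') * pd b' f (L x + c))" .
  qed
qed

text \<open>The lower bound on L converts decay in \<open>L x + c\<close> into decay in x.
  Derivatives stay in the class because they are combinations of partial derivatives of f composed
  with the same affine map.\<close>

lemma schwartz_affine:
  fixes L :: "'a::euclidean_space \<Rightarrow> 'b::euclidean_space"
  assumes "f \<in> schwartz" and L: "bounded_linear L" and B: "\<And>x. norm x \<le> B * norm (L x)"
  shows "(\<lambda>x. f (L x + c)) \<in> schwartz"
proof (rule schwartz_coinduct[where X = "{\<lambda>x. f (L x + c) | f. f \<in> schwartz}"])
  show "(\<lambda>x. f (L x + c)) \<in> {\<lambda>x. f (L x + c) | f. f \<in> schwartz}" using assms by blast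
next
  fix h assume "h \<in> {\<lambda>x. f (L x + c) | f. f \<in> schwartz}"
  then obtain f where h: "h = (\<lambda>x. f (L x + c))" "f \<in> schwartz" by auto
  show "h differentiable at x" for x
    unfolding h using h L by (intro pd_affine)
  show "\<exists>C. \<forall>x. (1 + norm x) ^ k * norm (h x) \<le> C" for k
  proof -
    obtain C where C: "\<And>x. (1 + norm x) ^ k * norm (f x) \<le> C"
      using h schwartz_bound by metis
    \<comment> \<open>From 1 + |x| \<le> (1 + |B|) (1 + |L x|) and the submultiplicativity of 1 +
      norm under the shift by c.\<close>
    define A where "A = (1 + \<bar>B\<bar>) * (1 + norm c)"
    have "(1 + norm x) ^ k * norm (h x) \<le> A ^ k * C" for x
    proof -
      have "norm x \<le> \<bar>B\<bar> * norm (L x)"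
        using B[of x] by (rule order_trans) (auto intro: mult_right_mono)
      moreover have "(1 + \<bar>B\<bar>) * (1 + norm (L x)) = 1 + \<bar>B\<bar> + norm (L x) + \<bar>B\<bar> * norm (L x)"
        by (simp add: algebra_simps)
      ultimately have "1 + norm x \<le> (1 + \<bar>B\<bar>) * (1 + norm (L x))"
        using norm_ge_zero[of "L x"] by linarith
      also have "\<dots> \<le> (1 + \<bar>B\<bar>) * ((1 + norm (L x + c)) * (1 + norm c))"
        using one_plus_norm_mult[of "L x + c" "- c"] by (intro mult_left_mono) auto
      finally have "1 + norm x \<le> A * (1 + norm (L x + c))" by (simp add: A_def ac_simps)
      then have "(1 + norm x) ^ k * norm (h x) \<le> (A * (1 + norm (L x + c))) ^ k * norm (h x)"
        by (intro mult_right_mono power_mono) auto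
      also have "\<dots> = A ^ k * ((1 + norm (L x + c)) ^ k * norm (f (L x + c)))"
        by (simp add: h power_mult_distrib)
      also have "\<dots> \<le> A ^ k * C"
        using C by (intro mult_left_mono) (auto simp: A_def)
      finally show ?thesis .
    qed
    then show ?thesis by blast
  qed
  show "pd b h \<in> {\<lambda>x. f (L x + c) | f. f \<in> schwartz}" if "b \<in> Basis" for b
  proof -
    have "pd b h = (\<lambda>x. (\<lambda>y. \<Sum>b'\<in>Basis. of_real (L b \<bullet> b') * pd b' f y) (L x + c))"
      unfolding h using pd_affine[OF h(2) L] by simp
    moreover have "(\<lambda>y. \<Sum>b'\<in>Basis. of_real (L b \<bullet> b') * pd b' f y) \<in> schwartz"
      using h by (intro schwartz_sum schwartz_cmult schwartz_pd) auto
    ultimately show ?thesis by (auto intro!: exI[where x = "\<lambda>y. \<Sum>b'\<in>Basis. of_real (L b \<bullet> b') * pd b' f y"])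
  qed
qed

lemma schwartz_translation: "f \<in> schwartz \<Longrightarrow> translation y f \<in> schwartz"
  using schwartz_affine[of f "\<lambda>x. x" 1 "- y"] by (simp add: translation_def bounded_linear_ident)

lemma pd_translation:
  assumes "f \<in> schwartz" "b \<in> Basis"
  shows "pd b (translation y f) = translation y (pd b f)"
  using pd_affine(1)[OF assms(1) bounded_linear_ident, of b "- y"] assms(2)
  by (simp add: translation_def fun_eq_iff inner_Basis if_distrib[of of_real] if_distrib[of "\<lambda>c. c * _"] cong: if_cong)

section \<open>Modulations, tensor products and products\<close>

definition ex2 :: "real \<Rightarrow> complex" where "ex2 r = exp (2 * pi * \<i> * of_real r)"

lemma ex2_cis: "ex2 r = cis (2 * pi * r)"
  by (simp add: ex2_def cis_conv_exp mult_ac)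

lemma norm_ex2 [simp]: "norm (ex2 r) = 1"
  by (simp add: ex2_cis)

lemma ex2_add: "ex2 (r + s) = ex2 r * ex2 s"
  by (simp add: ex2_cis cis_mult distrib_left)

lemma cnj_ex2: "cnj (ex2 r) = ex2 (- r)"
  by (simp add: ex2_cis cis_cnj)

lemma ex2_0 [simp]: "ex2 0 = 1" by (simp add: ex2_def)

lemma ex2_mult_minus [simp]: "ex2 r * ex2 (- r) = 1"
  by (simp_all flip: ex2_add)

lemma ex2_borel [measurable]: "f \<in> borel_measurable M \<Longrightarrow> (\<lambda>x. ex2 (f x)) \<in> borel_measurable M"
  unfolding ex2_def by measurable

lemma modulation_eq: "modulation \<xi> f = (\<lambda>t. ex2 (t \<bullet> \<xi>) * f t)"
  by (simp add: modulation_def ex2_def)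

lemma modulation_has_derivative:
  assumes "f \<in> schwartz"
  shows "(modulation \<xi> f has_derivative (\<lambda>u. ex2 (x \<bullet> \<xi>) *
    (2 * pi * \<i> * of_real (u \<bullet> \<xi>) * f x + frechet_derivative f (at x) u))) (at x)"
proof -
  have "((\<lambda>x. 2 * pi * \<i> * complex_of_real (x \<bullet> \<xi>)) has_derivative (\<lambda>u. 2 * pi * \<i> * complex_of_real (u \<bullet> \<xi>))) (at x)"
    by (auto intro!: derivative_eq_intros)
  from has_derivative_compose[OF this has_field_derivative_imp_has_derivative[OF DERIV_exp]]
  have "((\<lambda>x. ex2 (x \<bullet> \<xi>)) has_derivative (\<lambda>u. ex2 (x \<bullet> \<xi>) * (2 * pi * \<i> * of_real (u \<bullet> \<xi>)))) (at x)"
    by (simp add: ex2_def)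
  from has_derivative_mult[OF this schwartz_has_derivative[OF assms]]
  show ?thesis by (simp add: modulation_eq algebra_simps)
qed

lemma pd_modulation:
  assumes "f \<in> schwartz"
  shows "pd b (modulation \<xi> f) = modulation \<xi> (\<lambda>x. 2 * pi * \<i> * of_real (b \<bullet> \<xi>) * f x + 1 * pd b f x)"
  using pd_eqI[OF modulation_has_derivative[OF assms], of b] by (simp add: modulation_eq pd_def)

lemma schwartz_modulation:
  assumes "f \<in> schwartz"
  shows "modulation \<xi> f \<in> schwartz"
proof (rule schwartz_coinduct[where X = "modulation \<xi> ` schwartz"])
  show "modulation \<xi> f \<in> modulation \<xi> ` schwartz" using assms by blast
next
  fix h assume "h \<in> modulation \<xi> ` schwartz"
  then obtain f where h: "h = modulation \<xi> f" "f \<in> schwartz" by auto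
  show "h differentiable at x" for x
    unfolding h using modulation_has_derivative[OF h(2)] differentiableI by blast
  show "\<exists>C. \<forall>x. (1 + norm x) ^ k * norm (h x) \<le> C" for k
    using schwartz_bound[OF h(2), of k] unfolding h by (metis modulation_eq mult_1 norm_ex2 norm_mult)
  show "pd b h \<in> modulation \<xi> ` schwartz" if "b \<in> Basis" for b
    unfolding h pd_modulation[OF h(2)] using h(2) schwartz_pd[OF h(2) that]
    by (intro imageI schwartz_lincomb)
qed

lemma schwartz_tensor:
  fixes f :: "'a::euclidean_space \<Rightarrow> complex" and g :: "'b::euclidean_space \<Rightarrow> complex"
  assumes "f \<in> schwartz" "g \<in> schwartz"
  shows "(\<lambda>z. f (fst z) * g (snd z)) \<in> schwartz"
proof (rule schwartz_coinduct[where X = "{\<lambda>z. f (fst z) * g (snd z) | f g. f \<in> schwartz \<and> g \<in> schwartz}"])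
  show "(\<lambda>z. f (fst z) * g (snd z)) \<in> {\<lambda>z. f (fst z) * g (snd z) | f g. f \<in> schwartz \<and> g \<in> schwartz}"
    using assms by blast
next
  fix h :: "'a \<times> 'b \<Rightarrow> complex"
  assume "h \<in> {\<lambda>z. f (fst z) * g (snd z) | f g. f \<in> schwartz \<and> g \<in> schwartz}"
  then obtain f g where h: "h = (\<lambda>z. f (fst z) * g (snd z))" "f \<in> schwartz" "g \<in> schwartz" by auto
  have f1: "((\<lambda>z. f (fst z)) has_derivative (\<lambda>u. frechet_derivative f (at (fst z)) (fst u))) (at z)" for z :: "'a \<times> 'b"
    by (rule has_derivative_compose[OF has_derivative_fst[OF has_derivative_ident] schwartz_has_derivative[OF h(2)]])
  have g1: "((\<lambda>z. g (snd z)) has_derivative (\<lambda>u. frechet_derivative g (at (snd z)) (snd u))) (at z)" for z :: "'a \<times> 'b"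
    by (rule has_derivative_compose[OF has_derivative_snd[OF has_derivative_ident] schwartz_has_derivative[OF h(3)]])
  have der: "(h has_derivative (\<lambda>u. f (fst z) * frechet_derivative g (at (snd z)) (snd u)
      + frechet_derivative f (at (fst z)) (fst u) * g (snd z))) (at z)" for z
    unfolding h by (rule has_derivative_mult[OF f1 g1])
  show "h differentiable at x" for x using der differentiableI by blast
  show "\<exists>C. \<forall>z. (1 + norm z) ^ k * norm (h z) \<le> C" for k
  proof -
    obtain C D where C: "0 \<le> C" "\<And>x. (1 + norm x) ^ k * norm (f x) \<le> C" and D: "\<And>x. (1 + norm x) ^ k * norm (g x) \<le> D"
      using h schwartz_bound by metis
    have "(1 + norm z) ^ k * norm (h z) \<le> C * D" for z
    proof -
      have "1 + norm z \<le> (1 + norm (fst z)) * (1 + norm (snd z))"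
        using one_plus_norm_mult[of "(fst z, 0)" "(0, snd z)"] by (simp add: norm_Pair)
      then have "(1 + norm z) ^ k * norm (h z) \<le> ((1 + norm (fst z)) * (1 + norm (snd z))) ^ k * norm (h z)"
        by (intro mult_right_mono power_mono) auto
      also have "\<dots> = ((1 + norm (fst z)) ^ k * norm (f (fst z))) * ((1 + norm (snd z)) ^ k * norm (g (snd z)))"
        by (simp add: h power_mult_distrib norm_mult)
      also have "\<dots> \<le> C * D" using C D by (intro mult_mono) auto
      finally show ?thesis .
    qed
    then show ?thesis by blast
  qed
  show "pd b h \<in> {\<lambda>z. f (fst z) * g (snd z) | f g. f \<in> schwartz \<and> g \<in> schwartz}" if bB: "b \<in> Basis" for b
  proof -
    have 0: "frechet_derivative f (at x) 0 = 0" "frechet_derivative g (at y) 0 = 0" for x y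
      by (rule linear_0[OF bounded_linear.linear[OF has_derivative_bounded_linear[OF schwartz_has_derivative[OF h(2)]]]],
        rule linear_0[OF bounded_linear.linear[OF has_derivative_bounded_linear[OF schwartz_has_derivative[OF h(3)]]]])
    consider u where "b = (u, 0)" "u \<in> Basis" | v where "b = (0, v)" "v \<in> Basis"
      using bB by (auto simp: Basis_prod_def)
    then show ?thesis
    proof cases
      case 1
      then have "pd b h = (\<lambda>z. pd u f (fst z) * g (snd z))"
        using pd_eqI[OF der, of b] 0 by (simp add: pd_def)
      then show ?thesis using schwartz_pd[OF h(2) 1(2)] h(3) by blast
    next
      case 2
      then have "pd b h = (\<lambda>z. f (fst z) * pd v g (snd z))"
        using pd_eqI[OF der, of b] 0 by (simp add: pd_def)
      then show ?thesis using schwartz_pd[OF h(3) 2(2)] h(2) by blast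
    qed
  qed
qed

text \<open>A product is the restriction of a tensor product to the diagonal, and the diagonal
  embedding is linear and bounded below.\<close>

lemma schwartz_mult:
  fixes f g :: "'a::euclidean_space \<Rightarrow> complex"
  assumes "f \<in> schwartz" "g \<in> schwartz"
  shows "(\<lambda>x. f x * g x) \<in> schwartz"
proof -
  have "norm x \<le> 1 * norm (x, x)" for x :: 'a by (simp add: norm_Pair real_le_rsqrt)
  moreover have "bounded_linear (\<lambda>x::'a. (x, x))" by (intro bounded_linear_Pair bounded_linear_ident)
  ultimately show ?thesis
    using schwartz_affine[OF schwartz_tensor[OF assms], of "\<lambda>x. (x, x)" 1 0] by simp
qed

lemma pd_mult:
  assumes "f \<in> schwartz" "g \<in> schwartz"
  shows "pd b (\<lambda>x. f x * g x) = (\<lambda>x. f x * pd b g x + pd b f x * g x)"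
  unfolding pd_def[of b f] pd_def[of b g]
  by (rule pd_eqI) (use assms in \<open>auto intro!: derivative_eq_intros schwartz_has_derivative\<close>)

lemma schwartz_section:
  assumes "H \<in> schwartz"
  shows "(\<lambda>t. H (x, t)) \<in> schwartz"
proof -
  have "bounded_linear (\<lambda>t. (0, t))" by (intro bounded_linear_Pair bounded_linear_ident bounded_linear_zero)
  then show ?thesis
    using schwartz_affine[OF assms, of "\<lambda>t. (0, t)" 1 "(x, 0)"] by (simp add: norm_Pair)
qed

text \<open>One constant for all seminorms of weight K and order at most L. These bounds are
  directed in (K, L), and as a predicate they support induction on L without suprema over lists of
  derivatives.\<close>

definition sbd :: "nat \<Rightarrow> nat \<Rightarrow> real \<Rightarrow> ('a::euclidean_space \<Rightarrow> complex) \<Rightarrow> bool" where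
  "sbd K L C f \<longleftrightarrow> (\<forall>bs\<in>lists Basis. length bs \<le> L \<longrightarrow>
    (\<forall>x. (1 + norm x) ^ K * norm (iter_partial bs f x) \<le> C))"

lemma sbd_0: "sbd K 0 C f \<longleftrightarrow> (\<forall>x. (1 + norm x) ^ K * norm (f x) \<le> C)"
  by (auto simp: sbd_def)

lemma sbd_Suc: "sbd K (Suc L) C f \<longleftrightarrow>
  (\<forall>x. (1 + norm x) ^ K * norm (f x) \<le> C) \<and> (\<forall>b\<in>Basis. sbd K L C (pd b f))"
proof (intro iffI conjI ballI allI)
  assume f: "sbd K (Suc L) C f"
  show "(1 + norm x) ^ K * norm (f x) \<le> C" for x
    using f by (auto simp: sbd_def dest: bspec[of _ _ "[]"])
  show "sbd K L C (pd b f)" if "b \<in> Basis" for b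
    unfolding sbd_def
  proof (intro ballI impI allI)
    fix bs x assume "bs \<in> lists (Basis :: 'a set)" "length bs \<le> L"
    then show "(1 + norm x) ^ K * norm (iter_partial bs (pd b f) x) \<le> C"
      using f that by (auto simp: sbd_def iter_partial_snoc dest!: bspec[of _ _ "bs @ [b]"])
  qed
next
  assume f: "(\<forall>x. (1 + norm x) ^ K * norm (f x) \<le> C) \<and> (\<forall>b\<in>Basis. sbd K L C (pd b f))"
  show "sbd K (Suc L) C f"
    unfolding sbd_def
  proof (intro ballI impI allI)
    fix bs x assume bs: "bs \<in> lists (Basis :: 'a set)" "length bs \<le> Suc L"
    show "(1 + norm x) ^ K * norm (iter_partial bs f x) \<le> C"
    proof (cases bs rule: rev_cases)
      case (snoc bs' b)
      then show ?thesis using f bs by (auto simp: sbd_def iter_partial_snoc)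
    qed (use f in auto)
  qed
qed

lemma sbd_mono:
  assumes "sbd K L C f" "K' \<le> K" "L' \<le> L" "C \<le> C'"
  shows "sbd K' L' C' f"
  unfolding sbd_def
proof (intro ballI impI allI)
  fix bs x assume bs: "bs \<in> lists (Basis :: 'a set)" "length bs \<le> L'"
  have "(1 + norm x) ^ K' * norm (iter_partial bs f x) \<le> (1 + norm x) ^ K * norm (iter_partial bs f x)"
    using assms by (intro mult_right_mono power_increasing) auto
  also have "\<dots> \<le> C" using assms bs by (auto simp: sbd_def)
  finally show "(1 + norm x) ^ K' * norm (iter_partial bs f x) \<le> C'" using assms by simp
qed

lemma sbd_nonneg: "sbd K L C f \<Longrightarrow> 0 \<le> C"
  by (drule sbd_mono[of K L C f K 0 C, OF _ order_refl le0 order_refl])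
    (simp add: sbd_0, rule order_trans[rotated], erule spec[of _ 0], simp)

lemma sbd_exists:
  assumes "f \<in> schwartz"
  obtains C where "0 < C" "sbd K L C f"
proof -
  have "\<exists>C. sbd K L C f" using assms
  proof (induction L arbitrary: f)
    case 0
    then show ?case using schwartz_bound[OF 0, of K] by (auto simp: sbd_0)
  next
    case (Suc L)
    obtain C0 where C0: "0 \<le> C0" "\<And>x. (1 + norm x) ^ K * norm (f x) \<le> C0"
      using schwartz_bound[OF Suc.prems] by blast
    have "\<forall>b\<in>Basis. \<exists>C. sbd K L C (pd b f)" using Suc schwartz_pd by blast
    then obtain C where C: "\<And>b. b \<in> Basis \<Longrightarrow> sbd K L (C b) (pd b f)" by metis
    have nn: "0 \<le> C b" if "b \<in> Basis" for b using sbd_nonneg[OF C[OF that]] .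
    let ?C = "C0 + (\<Sum>b\<in>Basis. C b)"
    have "0 \<le> (\<Sum>b\<in>Basis. C b)" using nn by (intro sum_nonneg)
    then have "(1 + norm x) ^ K * norm (f x) \<le> ?C" for x using C0(2)[of x] by linarith
    moreover have "sbd K L ?C (pd b f)" if "b \<in> Basis" for b
    proof (rule sbd_mono[OF C[OF that]])
      have "C b \<le> (\<Sum>b\<in>Basis. C b)" using nn that by (intro member_le_sum) auto
      then show "C b \<le> ?C" using C0 by simp
    qed auto
    ultimately show ?case unfolding sbd_Suc by blast
  qed
  then obtain C where C: "sbd K L C f" by blast
  show ?thesis
    by (rule that[of "C + 1"]) (use sbd_nonneg[OF C] in \<open>auto intro: sbd_mono[OF C]\<close>)
qed

lemma sbd_add:
  assumes "f \<in> schwartz" "g \<in> schwartz" "sbd K L C f" "sbd K L D g"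
  shows "sbd K L (C + D) (\<lambda>x. f x + g x)"
  unfolding sbd_def
proof (intro ballI impI allI)
  fix bs x assume bs: "bs \<in> lists (Basis :: 'a set)" "length bs \<le> L"
  have "(1 + norm x) ^ K * norm (iter_partial bs f x + iter_partial bs g x)
    \<le> (1 + norm x) ^ K * (norm (iter_partial bs f x) + norm (iter_partial bs g x))"
    by (intro mult_left_mono norm_triangle_ineq) auto
  also have "\<dots> \<le> C + D" using assms(3,4) bs unfolding distrib_left by (intro add_mono) (auto simp: sbd_def)
  finally show "(1 + norm x) ^ K * norm (iter_partial bs (\<lambda>x. f x + g x) x) \<le> C + D"
    using bs by (simp add: iter_partial_add assms)
qed

lemma sbd_cmult:
  assumes "f \<in> schwartz" "sbd K L C f" "norm c * C \<le> D"
  shows "sbd K L D (\<lambda>x. c * f x)"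
  unfolding sbd_def
proof (intro ballI impI allI)
  fix bs x assume bs: "bs \<in> lists (Basis :: 'a set)" "length bs \<le> L"
  have "norm c * ((1 + norm x) ^ K * norm (iter_partial bs f x)) \<le> norm c * C"
    using assms bs by (intro mult_left_mono) (auto simp: sbd_def)
  then show "(1 + norm x) ^ K * norm (iter_partial bs (\<lambda>x. c * f x) x) \<le> D"
    using bs assms by (simp add: iter_partial_cmult norm_mult ac_simps)
qed

lemma iter_partial_zero:
  assumes "bs \<in> lists Basis"
  shows "iter_partial bs (\<lambda>x. 0) = (\<lambda>x. 0)"
  using iter_partial_cmult[OF schwartz_zero assms, of 0] by simp

section \<open>Tempered distributions\<close>

lemma schwartz_seminorm_le:
  assumes "\<And>x. (1 + norm x) ^ k * norm (iter_partial bs f x) \<le> C"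
  shows "schwartz_seminorm k bs f \<le> C"
  unfolding schwartz_seminorm_def by (intro cSUP_least assms) auto

lemma schwartz_seminorm_upper:
  assumes "f \<in> schwartz" "bs \<in> lists Basis"
  shows "(1 + norm x) ^ k * norm (iter_partial bs f x) \<le> schwartz_seminorm k bs f"
  unfolding schwartz_seminorm_def
  using assms by (intro cSUP_upper) (auto simp: schwartz_def)

text \<open>The topology is generated by seminorm balls around arbitrary centres. Such a ball that
  contains zero also contains a small ball around zero, and finite intersections are handled by the
  directedness of \<open>sbd\<close>.\<close>

lemma openin_schwartz_nbhd_zero:
  assumes "openin schwartz_topology U" "(\<lambda>x. 0) \<in> U"
  shows "\<exists>K L e. (0::real) < e \<and> (\<forall>f\<in>schwartz. sbd K L e f \<longrightarrow> f \<in> U)"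
proof -
  have "generate_topology_on {{g \<in> schwartz. schwartz_seminorm k bs (\<lambda>x. g x - f x) < e} | f k bs e.
        f \<in> schwartz \<and> bs \<in> lists Basis \<and> 0 < e} U"
    using assms(1) by (simp add: schwartz_topology_def openin_topology_generated_by_iff)
  then show ?thesis using assms(2)
  proof (induction rule: generate_topology_on.induct)
    case Empty
    then show ?case by simp
  next
    case (Int A B)
    then obtain K L e K' L' e' where *: "0 < e" "\<forall>f\<in>schwartz. sbd K L e f \<longrightarrow> f \<in> A"
      "0 < e'" "\<forall>f\<in>schwartz. sbd K' L' e' f \<longrightarrow> f \<in> B" by blast
    then have "f \<in> A \<inter> B" if "f \<in> schwartz" "sbd (max K K') (max L L') (min e e') f" for f
      using that sbd_mono[OF that(2), of K L e] sbd_mono[OF that(2), of K' L' e'] by auto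
    then show ?case using * by (intro exI[of _ "max K K'"] exI[of _ "max L L'"] exI[of _ "min e e'"]) auto
  next
    case (UN T)
    then obtain A where "A \<in> T" "(\<lambda>x. 0) \<in> A" by blast
    then show ?case using UN(2)[of A] by blast
  next
    case (Basis s)
    then obtain f k bs e where s: "s = {g \<in> schwartz. schwartz_seminorm k bs (\<lambda>x. g x - f x) < e}"
      "f \<in> schwartz" "bs \<in> lists Basis" "0 < e" by blast
    have zf: "(\<lambda>x. 0 - f x) \<in> schwartz" using s schwartz_zero by (intro schwartz_diff)
    let ?n = "schwartz_seminorm k bs (\<lambda>x. 0 - f x)"
    have n: "?n < e" using Basis s by simp
    \<comment> \<open>Half of the gap between the radius and the seminorm of the centre serves as
      the new radius.\<close>
    have aux: "(e - m) / 2 + m < e" if "m < e" for m :: real using that by (simp add: field_simps)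
    have "g \<in> s" if g: "g \<in> schwartz" "sbd k (length bs) ((e - ?n) / 2) g" for g
    proof -
      have "schwartz_seminorm k bs (\<lambda>x. g x - f x) \<le> (e - ?n) / 2 + ?n"
      proof (rule schwartz_seminorm_le)
        fix x
        have eq: "iter_partial bs (\<lambda>x. g x - f x) x = iter_partial bs g x + iter_partial bs (\<lambda>x. 0 - f x) x"
          using iter_partial_add[OF g(1) zf s(3)] by simp
        have "(1 + norm x) ^ k * norm (iter_partial bs (\<lambda>x. g x - f x) x)
          \<le> (1 + norm x) ^ k * (norm (iter_partial bs g x) + norm (iter_partial bs (\<lambda>x. 0 - f x) x))"
          unfolding eq by (intro mult_left_mono norm_triangle_ineq) auto
        also have "\<dots> \<le> (e - ?n) / 2 + ?n"
          unfolding distrib_left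
          using g(2) s(3) by (intro add_mono schwartz_seminorm_upper[OF zf]) (auto simp: sbd_def)
        finally show "(1 + norm x) ^ k * norm (iter_partial bs (\<lambda>x. g x - f x) x) \<le> (e - ?n) / 2 + ?n" .
      qed
      also have "\<dots> < e" using aux[OF n] .
      finally show ?thesis using s g by simp
    qed
    then show ?case using n by (intro exI[of _ k] exI[of _ "length bs"] exI[of _ "(e - ?n) / 2"]) auto
  qed
qed

lemma tempered_add: "u \<in> tempered \<Longrightarrow> f \<in> schwartz \<Longrightarrow> g \<in> schwartz \<Longrightarrow> u (\<lambda>x. f x + g x) = u f + u g"
  by (simp add: tempered_def)

lemma tempered_cmult: "u \<in> tempered \<Longrightarrow> f \<in> schwartz \<Longrightarrow> u (\<lambda>x. c * f x) = cnj c * u f"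
  by (simp add: tempered_def)

lemma tempered_diff: "u \<in> tempered \<Longrightarrow> f \<in> schwartz \<Longrightarrow> g \<in> schwartz \<Longrightarrow> u (\<lambda>x. f x - g x) = u f - u g"
  using tempered_add[of u f "\<lambda>x. (-1) * g x"] tempered_cmult[of u g "-1"] schwartz_cmult[of g "-1"] by simp

lemma tempered_sum:
  assumes "u \<in> tempered" "\<And>i. i \<in> I \<Longrightarrow> f i \<in> schwartz" "finite I"
  shows "u (\<lambda>x. \<Sum>i\<in>I. f i x) = (\<Sum>i\<in>I. u (f i))"
  using assms(3,2)
proof (induction I rule: finite_induct)
  case empty
  then show ?case using tempered_cmult[OF assms(1) schwartz_zero, of 0] by simp
next
  case (insert i I)
  then show ?case by (simp add: tempered_add[OF assms(1)] schwartz_sum)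
qed

text \<open>Continuity at zero gives an \<open>sbd\<close>-ball of radius e that u maps into the
  unit disc; rescaling f by e / c turns this into a linear bound with constant 1 / e.\<close>

lemma tempered_bound:
  fixes u :: "('a::euclidean_space \<Rightarrow> complex) \<Rightarrow> complex"
  assumes u: "u \<in> tempered"
  obtains K L C where "0 < C" "\<And>f c. f \<in> schwartz \<Longrightarrow> 0 < c \<Longrightarrow> sbd K L c f \<Longrightarrow> norm (u f) \<le> C * c"
proof -
  let ?U = "{f \<in> topspace schwartz_topology. u f \<in> ball 0 1}"
  have "openin schwartz_topology ?U"
    using u by (intro openin_continuous_map_preimage[of _ euclidean]) (auto simp: tempered_def)
  moreover have "u (\<lambda>x. 0) = 0" using tempered_cmult[OF u schwartz_zero, of 0] by simp
  moreover have "(\<lambda>x::'a. 0::complex) \<in> topspace schwartz_topology"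
  proof -
    have "schwartz_seminorm 0 [] (\<lambda>x::'a. (0::complex)) < 1"
      by (rule le_less_trans[OF schwartz_seminorm_le[of _ _ _ 0]]) auto
    then show ?thesis
      unfolding schwartz_topology_def topology_generated_by_topspace
      using schwartz_zero
      by (intro UnionI[of "{g \<in> schwartz. schwartz_seminorm 0 [] (\<lambda>x. g x - (\<lambda>x. 0) x) < 1}"] CollectI
          exI[of _ "\<lambda>x. 0"] exI[of _ "0::nat"] exI[of _ "[]"] exI[of _ "1::real"]) auto
  qed
  ultimately obtain K L e where e: "0 < e" "\<forall>f\<in>schwartz. sbd K L e f \<longrightarrow> f \<in> ?U"
    using openin_schwartz_nbhd_zero[of ?U] by auto
  show ?thesis
  proof (rule that[of "1 / e" K L])
    fix f :: "'a \<Rightarrow> complex" and c assume f: "f \<in> schwartz" "0 < c" "sbd K L c f"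
    have "sbd K L e (\<lambda>x. of_real (e / c) * f x)"
      by (rule sbd_cmult[OF f(1,3)]) (use f e in \<open>simp add: norm_divide\<close>)
    then have "norm (u (\<lambda>x. of_real (e / c) * f x)) < 1"
      using e(2)[rule_format, OF schwartz_cmult[OF f(1)], of "of_real (e / c)"] by (simp add: dist_norm)
    then have "(e / c) * norm (u f) < 1"
      using f e unfolding tempered_cmult[OF u f(1)] norm_mult complex_mod_cnj norm_of_real by simp
    then show "norm (u f) \<le> 1 / e * c" using f e by (simp add: field_simps)
  qed (use e in auto)
qed

text \<open>Only finitely many lists of basis vectors have length at most L, so an
  \<open>sbd\<close>-ball around f0 contains a finite intersection of generating sets; linearity
  transports the bound from zero to f0.\<close>

lemma tempered_intro:
  assumes ext: "u \<in> extensional schwartz"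
    and add: "\<And>f g. f \<in> schwartz \<Longrightarrow> g \<in> schwartz \<Longrightarrow> u (\<lambda>x. f x + g x) = u f + u g"
    and cm: "\<And>c f. f \<in> schwartz \<Longrightarrow> u (\<lambda>x. c * f x) = cnj c * u f"
    and C: "0 \<le> C" "\<And>f c. f \<in> schwartz \<Longrightarrow> 0 < c \<Longrightarrow> sbd K L c f \<Longrightarrow> norm (u f) \<le> C * c"
  shows "u \<in> tempered"
proof -
  have sub: "topspace schwartz_topology \<subseteq> schwartz"
    unfolding schwartz_topology_def topology_generated_by_topspace by auto
  have "openin schwartz_topology {f \<in> topspace schwartz_topology. u f \<in> V}" if "open V" for V
  proof (subst openin_subopen, intro ballI)
    fix f0 assume "f0 \<in> {f \<in> topspace schwartz_topology. u f \<in> V}"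
    then have f0: "f0 \<in> schwartz" "u f0 \<in> V" using sub by auto
    obtain r where r: "0 < r" "ball (u f0) r \<subseteq> V" using \<open>open V\<close> f0 open_contains_ball by blast
    \<comment> \<open>The summand 1 keeps the quotient meaningful for C = 0 and makes the final
      inequality strict.\<close>
    define e where "e = r / (C + 1)"
    have e: "0 < e" using r C by (simp add: e_def)
    let ?I = "{bs. set bs \<subseteq> (Basis :: 'a set) \<and> length bs \<le> L}"
    let ?N = "\<lambda>bs. {g \<in> schwartz. schwartz_seminorm K bs (\<lambda>x. g x - f0 x) < e}"
    have fin: "finite ?I" by (rule finite_lists_length_le) simp
    have ne: "?I \<noteq> {}" by (auto intro: exI[of _ "[]"])
    have 1: "openin schwartz_topology (\<Inter>bs\<in>?I. ?N bs)"
    proof (intro openin_INT2 fin ne)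
      fix bs assume "bs \<in> ?I"
      then show "openin schwartz_topology (?N bs)"
        unfolding schwartz_topology_def using f0 e
        by (intro topology_generated_by_Basis CollectI exI[of _ f0] exI[of _ K] exI[of _ bs] exI[of _ e]) auto
    qed
    have 2: "f0 \<in> (\<Inter>bs\<in>?I. ?N bs)"
    proof (intro INT_I CollectI conjI f0)
      fix bs assume bs: "bs \<in> ?I"
      have "schwartz_seminorm K bs (\<lambda>x. f0 x - f0 x) \<le> 0"
        using bs by (intro schwartz_seminorm_le) (auto simp: iter_partial_zero in_lists_conv_set subset_iff)
      then show "schwartz_seminorm K bs (\<lambda>x. f0 x - f0 x) < e" using e by simp
    qed
    have 3: "g \<in> {f \<in> topspace schwartz_topology. u f \<in> V}" if g: "g \<in> (\<Inter>bs\<in>?I. ?N bs)" for g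
    proof -
      have gS: "g \<in> schwartz" using g ne by blast
      have d: "(\<lambda>x. g x - f0 x) \<in> schwartz" using gS f0 by (intro schwartz_diff)
      have "sbd K L e (\<lambda>x. g x - f0 x)"
        unfolding sbd_def
      proof (intro ballI impI allI)
        fix bs x assume bs: "bs \<in> lists (Basis :: 'a set)" "length bs \<le> L"
        then have "g \<in> ?N bs" using g by auto
        then show "(1 + norm x) ^ K * norm (iter_partial bs (\<lambda>x. g x - f0 x) x) \<le> e"
          using schwartz_seminorm_upper[OF d bs(1), of x K] by simp
      qed
      then have "norm (u (\<lambda>x. g x - f0 x)) \<le> C * e" using C(2)[OF d e] by simp
      also have "\<dots> < r" using r C by (simp add: e_def field_simps)
      finally have "norm (u (\<lambda>x. g x + (-1) * f0 x)) < r" by simp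
      then have "norm (u g - u f0) < r"
        using add[OF gS schwartz_cmult[OF f0(1), of "-1"]] cm[OF f0(1), of "-1"] by simp
      then have "u g \<in> V" using r by (auto simp: dist_norm norm_minus_commute)
      moreover have "g \<in> topspace schwartz_topology"
        using openin_subset[OF 1] g by blast
      ultimately show ?thesis by simp
    qed
    show "\<exists>T. openin schwartz_topology T \<and> f0 \<in> T \<and> T \<subseteq> {f \<in> topspace schwartz_topology. u f \<in> V}"
      using 1 2 3 by blast
  qed
  then have "continuous_map schwartz_topology euclidean u"
    by (auto simp: continuous_map_def)
  then show ?thesis using assms by (simp add: tempered_def)
qed

section \<open>Continuity of translations and modulations\<close>

lemma sbd_translation:
  assumes "f \<in> schwartz" "sbd K L C f"
  shows "sbd K L ((1 + norm y) ^ K * C) (translation y f)"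
  using assms
proof (induction L arbitrary: f)
  have base: "(1 + norm x) ^ K * norm (translation y f x) \<le> (1 + norm y) ^ K * C"
    if "\<forall>x. (1 + norm x) ^ K * norm (f x) \<le> C" for f :: "'a \<Rightarrow> complex" and x
  proof -
    have "(1 + norm x) ^ K * norm (f (x - y)) \<le> ((1 + norm (x - y)) * (1 + norm y)) ^ K * norm (f (x - y))"
      using one_plus_norm_mult[of "x - y" y] by (intro mult_right_mono power_mono) auto
    also have "\<dots> = (1 + norm y) ^ K * ((1 + norm (x - y)) ^ K * norm (f (x - y)))"
      by (simp add: power_mult_distrib)
    also have "\<dots> \<le> (1 + norm y) ^ K * C" using that by (intro mult_left_mono) auto
    finally show ?thesis by (simp add: translation_def)
  qed
  {
    case 0
    then show ?case using base by (simp add: sbd_0)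
  next
    case (Suc L)
    then show ?case using base by (simp add: sbd_Suc pd_translation schwartz_pd)
  }
qed

text \<open>A derivative falling on the exponential brings down a factor of size at most 2 \<pi>
  |\<xi>|, so each order costs one factor 1 + 2 \<pi> |\<xi>|.\<close>

lemma sbd_modulation:
  assumes "f \<in> schwartz" "sbd K L C f"
  shows "sbd K L ((1 + 2 * pi * norm \<xi>) ^ L * C) (modulation \<xi> f)"
  using assms
proof (induction L arbitrary: f C)
  case 0
  then show ?case by (simp add: sbd_0 modulation_eq norm_mult)
next
  case (Suc L)
  let ?a = "1 + 2 * pi * norm \<xi>"
  have C: "0 \<le> C" using sbd_nonneg[OF Suc(3)] .
  have "1 \<le> ?a ^ Suc L" by (rule one_le_power) simp
  from mult_right_mono[OF this C] have "C \<le> ?a ^ Suc L * C" by simp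
  then have "(1 + norm x) ^ K * norm (modulation \<xi> f x) \<le> ?a ^ Suc L * C" for x
    using Suc(3) by (auto simp: sbd_Suc modulation_eq norm_mult intro: order_trans)
  moreover have "sbd K L (?a ^ Suc L * C) (pd b (modulation \<xi> f))" if b: "b \<in> Basis" for b
  proof -
    have f1: "sbd K L C f" using sbd_mono[OF Suc(3), of K L C] by simp
    have f2: "sbd K L C (pd b f)" using Suc(3) b by (simp add: sbd_Suc)
    have "\<bar>b \<bullet> \<xi>\<bar> \<le> norm \<xi>" using Basis_le_norm[OF b, of \<xi>] by (simp add: inner_commute)
    then have "norm (2 * pi * \<i> * of_real (b \<bullet> \<xi>)) * C \<le> 2 * pi * norm \<xi> * C"
      using C by (intro mult_right_mono) (auto simp: norm_mult)
    then have "sbd K L (2 * pi * norm \<xi> * C + C) (\<lambda>x. 2 * pi * \<i> * of_real (b \<bullet> \<xi>) * f x + 1 * pd b f x)"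
      using Suc.prems b f1 f2
      by (intro sbd_add schwartz_cmult schwartz_pd sbd_cmult[of f] sbd_cmult[of "pd b f"]) auto
    from Suc.IH[OF schwartz_lincomb[OF Suc.prems(1) schwartz_pd[OF Suc.prems(1) b]] this] show ?thesis
      unfolding pd_modulation[OF Suc.prems(1)] by (rule sbd_mono) (simp_all add: algebra_simps)
  qed
  ultimately show ?case by (simp add: sbd_Suc)
qed

lemma norm_ex2_minus_one: "norm (ex2 r - 1) \<le> 2 * pi * \<bar>r\<bar>"
proof -
  have "norm (ex2 r - 1) = 2 * \<bar>sin (2 * pi * r / 2)\<bar>"
    using dist_exp_i_1[of "2 * pi * r"] by (simp add: ex2_def mult_ac)
  also have "\<dots> \<le> 2 * \<bar>2 * pi * r / 2\<bar>"
    by (intro mult_left_mono abs_sin_x_le_abs_x) auto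
  finally show ?thesis by (simp add: abs_mult)
qed

text \<open>The exponential differs from one by at most 2 \<pi> |x| |\<eta>|. Smallness in \<eta> is
  therefore bought with one additional power of the weight, which explains \<open>Suc K\<close> in
  the hypothesis.\<close>

lemma sbd_modulation_diff:
  assumes "f \<in> schwartz" "norm \<eta> \<le> 1" "sbd (Suc K) L C f"
  shows "sbd K L (real (Suc L) * (1 + 2 * pi) ^ Suc L * norm \<eta> * C) (\<lambda>x. modulation \<eta> f x - f x)"
  using assms(1,3)
proof (induction L arbitrary: f)
  have base: "(1 + norm x) ^ K * norm (modulation \<eta> f x - f x) \<le> 2 * pi * norm \<eta> * C"
    if f: "\<forall>x. (1 + norm x) ^ Suc K * norm (f x) \<le> C" for f :: "'a \<Rightarrow> complex" and x
  proof -
    have "norm (modulation \<eta> f x - f x) = norm (ex2 (x \<bullet> \<eta>) - 1) * norm (f x)"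
      by (simp add: modulation_eq norm_mult[symmetric] algebra_simps)
    also have "\<dots> \<le> 2 * pi * norm \<eta> * (1 + norm x) * norm (f x)"
    proof (intro mult_right_mono)
      have "norm (ex2 (x \<bullet> \<eta>) - 1) \<le> 2 * pi * \<bar>x \<bullet> \<eta>\<bar>" by (rule norm_ex2_minus_one)
      also have "\<dots> \<le> 2 * pi * (norm x * norm \<eta>)"
        by (intro mult_left_mono Cauchy_Schwarz_ineq2) auto
      also have "\<dots> \<le> 2 * pi * ((1 + norm x) * norm \<eta>)"
        by (intro mult_left_mono mult_right_mono) auto
      finally show "norm (ex2 (x \<bullet> \<eta>) - 1) \<le> 2 * pi * norm \<eta> * (1 + norm x)" by (simp add: ac_simps)
    qed auto
    finally have "(1 + norm x) ^ K * norm (modulation \<eta> f x - f x)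
      \<le> (1 + norm x) ^ K * (2 * pi * norm \<eta> * (1 + norm x) * norm (f x))"
      by (intro mult_left_mono) auto
    also have "\<dots> = 2 * pi * norm \<eta> * ((1 + norm x) ^ Suc K * norm (f x))" by simp
    also have "\<dots> \<le> 2 * pi * norm \<eta> * C" using f by (intro mult_left_mono) auto
    finally show ?thesis .
  qed
  have le: "2 * pi * norm \<eta> * C \<le> real (Suc L) * (1 + 2 * pi) ^ Suc L * norm \<eta> * C" if "0 \<le> C" for L
  proof -
    have "2 * pi \<le> (1 + 2 * pi) ^ 1" by simp
    also have "\<dots> \<le> (1 + 2 * pi) ^ Suc L" by (intro power_increasing) auto
    also have "\<dots> \<le> real (Suc L) * (1 + 2 * pi) ^ Suc L"
      using mult_right_mono[of 1 "real (Suc L)" "(1 + 2 * pi) ^ Suc L"] by simp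
    finally show ?thesis using that by (intro mult_right_mono) auto
  qed
  {
    case 0
    have "(1 + norm x) ^ K * norm (modulation \<eta> f x - f x) \<le> real (Suc 0) * (1 + 2 * pi) ^ Suc 0 * norm \<eta> * C" for x
      using base[of f x] 0(2) le[OF sbd_nonneg[OF 0(2)], of 0] unfolding sbd_0 by (meson order_trans)
    then show ?case unfolding sbd_0 by blast
  next
    case (Suc L)
    have C: "0 \<le> C" using sbd_nonneg[OF Suc(3)] .
    have *: "(1 + norm x) ^ K * norm (modulation \<eta> f x - f x) \<le> real (Suc (Suc L)) * (1 + 2 * pi) ^ Suc (Suc L) * norm \<eta> * C" for x
      using base[of f x] Suc(3) le[OF C, of "Suc L"] unfolding sbd_Suc by (meson order_trans)
    have "sbd K L (real (Suc (Suc L)) * (1 + 2 * pi) ^ Suc (Suc L) * norm \<eta> * C) (pd b (\<lambda>x. modulation \<eta> f x - f x))"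
      if b: "b \<in> Basis" for b
    proof -
      have eq: "pd b (\<lambda>x. modulation \<eta> f x - f x)
        = (\<lambda>x. modulation \<eta> (\<lambda>x. 2 * pi * \<i> * of_real (b \<bullet> \<eta>) * f x) x + (modulation \<eta> (pd b f) x - pd b f x))"
      proof -
        have "pd b (\<lambda>x. modulation \<eta> f x - f x) = (\<lambda>x. pd b (modulation \<eta> f) x - pd b f x)"
          using pd_lincomb[OF schwartz_modulation[OF Suc.prems(1), of \<eta>] Suc.prems(1), of b 1 "-1"] by simp
        then show ?thesis
          unfolding pd_modulation[OF Suc.prems(1)] by (simp add: modulation_eq algebra_simps)
      qed
      have f1: "sbd K L C f" using sbd_mono[OF Suc(3), of K L C] by simp
      have f2: "sbd (Suc K) L C (pd b f)" using Suc(3) b by (simp add: sbd_Suc)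
      have "\<bar>b \<bullet> \<eta>\<bar> \<le> norm \<eta>" using Basis_le_norm[OF b, of \<eta>] by (simp add: inner_commute)
      then have "norm (2 * pi * \<i> * of_real (b \<bullet> \<eta>)) * C \<le> 2 * pi * norm \<eta> * C"
        using C by (intro mult_right_mono) (auto simp: norm_mult)
      then have "sbd K L (2 * pi * norm \<eta> * C) (\<lambda>x. 2 * pi * \<i> * of_real (b \<bullet> \<eta>) * f x)"
        by (intro sbd_cmult[OF Suc.prems(1) f1])
      from sbd_modulation[OF schwartz_cmult[OF Suc.prems(1)] this, of \<eta>]
      have 1: "sbd K L ((1 + 2 * pi * norm \<eta>) ^ L * (2 * pi * norm \<eta> * C)) (modulation \<eta> (\<lambda>x. 2 * pi * \<i> * of_real (b \<bullet> \<eta>) * f x))" .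
      have "(1 + 2 * pi * norm \<eta>) ^ L * (2 * pi * norm \<eta> * C) \<le> (1 + 2 * pi) ^ L * ((1 + 2 * pi) * norm \<eta> * C)"
      proof (rule mult_mono)
        show "(1 + 2 * pi * norm \<eta>) ^ L \<le> (1 + 2 * pi) ^ L"
          using mult_left_mono[OF assms(2), of "2 * pi"] by (intro power_mono) auto
        show "2 * pi * norm \<eta> * C \<le> (1 + 2 * pi) * norm \<eta> * C"
          using C by (intro mult_right_mono) auto
      qed (use C in auto)
      then have 1: "sbd K L ((1 + 2 * pi) ^ Suc L * norm \<eta> * C) (modulation \<eta> (\<lambda>x. 2 * pi * \<i> * of_real (b \<bullet> \<eta>) * f x))"
        by (intro sbd_mono[OF 1]) (auto simp: algebra_simps)
      have 2: "sbd K L (real (Suc L) * (1 + 2 * pi) ^ Suc L * norm \<eta> * C) (\<lambda>x. modulation \<eta> (pd b f) x - pd b f x)"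
        by (rule Suc.IH[OF _ f2]) (use Suc.prems b in \<open>auto intro: schwartz_pd\<close>)
      have "sbd K L ((1 + 2 * pi) ^ Suc L * norm \<eta> * C + real (Suc L) * (1 + 2 * pi) ^ Suc L * norm \<eta> * C) (pd b (\<lambda>x. modulation \<eta> f x - f x))"
        unfolding eq using Suc.prems b
        by (intro sbd_add 1 2 schwartz_modulation schwartz_cmult schwartz_diff schwartz_pd) auto
      then show ?thesis
      proof (rule sbd_mono)
        have "(1 + 2 * pi) ^ Suc L * norm \<eta> * C + real (Suc L) * (1 + 2 * pi) ^ Suc L * norm \<eta> * C
          = real (Suc (Suc L)) * (1 + 2 * pi) ^ Suc L * norm \<eta> * C" by (simp add: algebra_simps)
        also have "\<dots> \<le> real (Suc (Suc L)) * (1 + 2 * pi) ^ Suc (Suc L) * norm \<eta> * C"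
          using C by (intro mult_right_mono mult_left_mono power_increasing) auto
        finally show "(1 + 2 * pi) ^ Suc L * norm \<eta> * C + real (Suc L) * (1 + 2 * pi) ^ Suc L * norm \<eta> * C
          \<le> real (Suc (Suc L)) * (1 + 2 * pi) ^ Suc (Suc L) * norm \<eta> * C" .
      qed auto
    qed
    then show ?case using * by (simp add: sbd_Suc)
  }
qed

text \<open>Mean value theorem on the segment from x - y to x. Smallness in y is bought with one
  additional derivative, and the dimension enters when the derivative is expanded in the
  basis.\<close>

lemma sbd_translation_diff:
  fixes f :: "'a::euclidean_space \<Rightarrow> complex"
  assumes "f \<in> schwartz" "norm y \<le> 1" "sbd K (Suc L) C f"
  shows "sbd K L (2 ^ K * DIM('a) * norm y * C) (\<lambda>x. translation y f x - f x)"
  using assms(1,3)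
proof (induction L arbitrary: f)
  have base: "(1 + norm x) ^ K * norm (translation y f x - f x) \<le> 2 ^ K * DIM('a) * norm y * C"
    if f: "f \<in> schwartz" "sbd K (Suc L) C f" for f :: "'a \<Rightarrow> complex" and x L
  proof -
    have C: "0 \<le> C" using sbd_nonneg[OF f(2)] .
    have bd: "norm (frechet_derivative f (at z) v) \<le> DIM('a) * norm v * (C / (1 + norm z) ^ K)" for z v
    proof -
      interpret D: bounded_linear "frechet_derivative f (at z)"
        using schwartz_has_derivative[OF f(1)] has_derivative_bounded_linear by blast
      have "frechet_derivative f (at z) v = frechet_derivative f (at z) (\<Sum>b\<in>Basis. (v \<bullet> b) *\<^sub>R b)"
        by (simp add: euclidean_representation)
      also have "\<dots> = (\<Sum>b\<in>Basis. of_real (v \<bullet> b) * pd b f z)"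
        by (simp add: D.sum D.scaleR pd_def scaleR_conv_of_real)
      also have "norm \<dots> \<le> (\<Sum>b\<in>(Basis::'a set). norm v * (C / (1 + norm z) ^ K))"
      proof (intro sum_norm_le)
        fix b :: 'a assume b: "b \<in> Basis"
        have "sbd K 0 C (pd b f)" using f(2) b by (intro sbd_mono[of K L C _ K 0 C]) (auto simp: sbd_Suc)
        then have "norm (pd b f z) \<le> C / (1 + norm z) ^ K"
          by (simp add: sbd_0 field_simps add_pos_nonneg)
        then show "norm (complex_of_real (v \<bullet> b) * pd b f z) \<le> norm v * (C / (1 + norm z) ^ K)"
          unfolding norm_mult norm_of_real using Basis_le_norm[OF b, of v] by (intro mult_mono) auto
      qed
      finally show ?thesis by (simp add: mult.assoc)
    qed
    have seg: "norm (f (x + (- y)) - f x) \<le> norm (- y) * (DIM('a) * (C * 2 ^ K / (1 + norm x) ^ K))"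
    proof (rule differentiable_bound_segment[where G = UNIV and f' = "\<lambda>z. frechet_derivative f (at z)"])
      fix t :: real assume t: "t \<in> {0..1}"
      have aux: "1 + a \<le> 2 * (1 + b)" if "c \<le> 1" "a \<le> b + c" "0 \<le> b" for a b c :: real using that by simp
      let ?z = "x + t *\<^sub>R (- y)"
      have "norm (t *\<^sub>R (- y)) \<le> 1" using t assms(2) mult_le_one[of t "norm y"] by simp
      then have "1 + norm x \<le> 2 * (1 + norm ?z)"
        using aux norm_triangle_ineq4[of ?z "t *\<^sub>R (- y)"] norm_ge_zero[of ?z] unfolding add_diff_cancel_right' by blast
      \<comment> \<open>Points of the segment are at distance at most one from x, so the weight
        changes by at most a factor 2 per power; this is the origin of \<open>2 ^ K\<close>.\<close>
      then have "(1 + norm x) ^ K \<le> (2 * (1 + norm ?z)) ^ K" by (intro power_mono) auto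
      then have le: "C / (1 + norm ?z) ^ K \<le> C * 2 ^ K / (1 + norm x) ^ K"
      proof -
        have p: "0 < (1 + norm ?z) ^ K" "0 < (1 + norm x) ^ K"
          by (auto intro!: zero_less_power add_pos_nonneg)
        have "C * (1 + norm x) ^ K \<le> C * (2 * (1 + norm ?z)) ^ K"
          using C \<open>(1 + norm x) ^ K \<le> (2 * (1 + norm ?z)) ^ K\<close> by (rule mult_left_mono[rotated])
        then show ?thesis
          using p by (simp only: pos_divide_le_eq pos_le_divide_eq power_mult_distrib times_divide_eq_left mult.assoc)
      qed
      show "onorm (frechet_derivative f (at ?z)) \<le> DIM('a) * (C * 2 ^ K / (1 + norm x) ^ K)"
      proof (rule onorm_le)
        fix v
        have "norm (frechet_derivative f (at ?z) v) \<le> DIM('a) * norm v * (C / (1 + norm ?z) ^ K)" by (rule bd)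
        also have "\<dots> \<le> DIM('a) * norm v * (C * 2 ^ K / (1 + norm x) ^ K)"
          using le by (intro mult_left_mono) auto
        finally show "norm (frechet_derivative f (at ?z) v) \<le> DIM('a) * (C * 2 ^ K / (1 + norm x) ^ K) * norm v"
          by (simp add: ac_simps)
      qed
    qed (auto intro!: schwartz_has_derivative f)
    have "(1 + norm x) ^ K * norm (f (x - y) - f x) \<le> (1 + norm x) ^ K * (norm y * (DIM('a) * (C * 2 ^ K / (1 + norm x) ^ K)))"
      using seg by (intro mult_left_mono) auto
    also have "\<dots> = 2 ^ K * DIM('a) * norm y * C"
    proof -
      have "0 < 1 + norm x" by (intro add_pos_nonneg) auto
      then have "(1 + norm x) ^ K \<noteq> 0" by simp
      moreover have "w * (n * (d * (c * k / w))) = k * d * n * c" if "w \<noteq> 0" for w n d c k :: real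
        using that by simp
      ultimately show ?thesis by (simp only: of_nat_mult of_nat_power of_nat_numeral)
    qed
    finally show ?thesis by (simp add: translation_def)
  qed
  {
    case 0
    then show ?case using base by (simp add: sbd_0)
  next
    case (Suc L)
    have "sbd K L (2 ^ K * DIM('a) * norm y * C) (pd b (\<lambda>x. translation y f x - f x))" if b: "b \<in> Basis" for b
    proof -
      have "pd b (\<lambda>x. translation y f x - f x) = (\<lambda>x. translation y (pd b f) x - pd b f x)"
        using pd_lincomb[OF schwartz_translation[OF Suc.prems(1), of y] Suc.prems(1), of b 1 "-1"]
        by (simp add: pd_translation Suc.prems b)
      then show ?thesis using Suc.IH[of "pd b f"] Suc.prems b by (simp add: sbd_Suc schwartz_pd)
    qed
    then show ?case using base[OF Suc.prems] by (simp add: sbd_Suc)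
  }
qed

lemma schwartz_uminus: "f \<in> schwartz \<Longrightarrow> (\<lambda>x. - f x) \<in> schwartz"
  using schwartz_cmult[of f "-1"] by simp

section \<open>Integrals of Schwartz functions\<close>

text \<open>Two powers of 1 + norm per dimension, so that each coordinate receives a factor 1 / (1 +
  x_b^2) and the weight is integrable by a product argument.\<close>

definition wt :: "'a::euclidean_space \<Rightarrow> real" where
  "wt x = 1 / (1 + norm x) ^ (2 * DIM('a))"

lemma wt_pos: "0 < wt x"
  by (auto simp: wt_def intro!: divide_pos_pos zero_less_power add_pos_nonneg)

lemma wt_nonneg [simp]: "0 \<le> wt x"
  using wt_pos[of x] by simp

lemma wt_continuous: "continuous_on A wt"
  unfolding wt_def
  by (intro continuous_intros) (metis add_nonneg_eq_0_iff norm_ge_zero one_neq_zero power_eq_0_iff zero_le_one)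

lemma wt_borel [measurable]: "wt \<in> borel_measurable borel"
  by (intro borel_measurable_continuous_onI wt_continuous)

text \<open>Peetre's inequality: a bounded translation changes the weight only by a constant factor.
  It supplies all dominating functions and the local near-constancy below.\<close>

lemma wt_peetre: "wt (x + y :: 'a) \<le> (1 + norm y) ^ (2 * DIM('a)) * wt (x :: 'a::euclidean_space)"
proof -
  let ?n = "2 * DIM('a)"
  have p: "0 < 1 + norm z" for z :: 'a by (intro add_pos_nonneg) auto
  have "(1 + norm x) ^ ?n \<le> ((1 + norm (x + y)) * (1 + norm y)) ^ ?n"
    using one_plus_norm_mult[of "x + y" "- y"] by (intro power_mono) auto
  then have "(1 + norm x) ^ ?n \<le> (1 + norm y) ^ ?n * (1 + norm (x + y)) ^ ?n"
    by (simp add: power_mult_distrib mult.commute)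
  then show ?thesis
    using zero_less_power[OF p[of x], of ?n] zero_less_power[OF p[of "x + y"], of ?n]
    by (simp add: wt_def divide_simps)
qed

lemma integrable_inverse_1_plus_sq: "integrable lborel (\<lambda>x::real. inverse (1 + x\<^sup>2))"
  using integrable_inverse_1_plus_square by (simp add: set_integrable_def einterval_def)

lemma wt_integrable [simp]: "integrable lborel (wt :: 'a::euclidean_space \<Rightarrow> real)"
proof -
  have le: "wt x \<le> (\<Prod>b\<in>Basis. inverse (1 + (x \<bullet> b)\<^sup>2))" for x :: 'a
  proof -
    have "(\<Prod>b\<in>(Basis::'a set). 1 + (x \<bullet> b)\<^sup>2) \<le> (\<Prod>b\<in>(Basis::'a set). (1 + norm x)\<^sup>2)"
    proof (intro prod_mono conjI)
      fix b :: 'a assume "b \<in> Basis"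
      then have "\<bar>x \<bullet> b\<bar>\<^sup>2 \<le> (norm x)\<^sup>2" by (intro power_mono Basis_le_norm) auto
      then have "1 + (x \<bullet> b)\<^sup>2 \<le> 1 + (norm x)\<^sup>2" by simp
      also have "\<dots> \<le> (1 + norm x)\<^sup>2" by (simp add: power2_sum)
      finally show "1 + (x \<bullet> b)\<^sup>2 \<le> (1 + norm x)\<^sup>2" .
    qed auto
    also have "\<dots> = (1 + norm x) ^ (2 * DIM('a))" by (simp add: power_mult[symmetric])
    finally have "(\<Prod>b\<in>(Basis::'a set). 1 + (x \<bullet> b)\<^sup>2) \<le> (1 + norm x) ^ (2 * DIM('a))" .
    moreover have "0 < (\<Prod>b\<in>(Basis::'a set). 1 + (x \<bullet> b)\<^sup>2)"
      by (intro prod_pos) (auto intro: add_pos_nonneg)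
    ultimately have "1 / (1 + norm x) ^ (2 * DIM('a)) \<le> 1 / (\<Prod>b\<in>(Basis::'a set). 1 + (x \<bullet> b)\<^sup>2)"
      by (intro divide_left_mono) auto
    then show ?thesis by (simp add: wt_def prod_inversef[symmetric] inverse_eq_divide prod_dividef)
  qed
  have "(\<integral>\<^sup>+x. ennreal (wt (x::'a)) \<partial>lborel) \<le> (\<integral>\<^sup>+x. (\<Prod>b\<in>(Basis::'a set). ennreal (inverse (1 + (x \<bullet> b)\<^sup>2))) \<partial>lborel)"
    using le by (intro nn_integral_mono) (auto simp: prod_ennreal intro: ennreal_leI)
  also have "\<dots> = (\<Prod>b\<in>(Basis::'a set). (\<integral>\<^sup>+x. ennreal (inverse (1 + x\<^sup>2)) \<partial>lborel))"
    by (rule nn_integral_lborel_prod) auto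
  also have "\<dots> < \<infinity>"
    using integrable_inverse_1_plus_sq
    by (auto simp: integrable_iff_bounded ennreal_prod_eq_top less_top[symmetric] prod_constant power_eq_top_ennreal)
  finally show ?thesis by (simp add: integrable_iff_bounded)
qed

lemma integrable_wt_bound:
  fixes f :: "'a::euclidean_space \<Rightarrow> 'b::{banach, second_countable_topology}"
  assumes [measurable]: "f \<in> borel_measurable borel" and "\<And>x. norm (f x) \<le> C * wt x"
  shows "integrable lborel f"
proof (rule Bochner_Integration.integrable_bound)
  show "integrable lborel (\<lambda>x. C * wt x)" by simp
  show "AE x in lborel. norm (f x) \<le> norm (C * wt x)"
    using assms(2) by (intro AE_I2) (auto intro: order_trans[OF _ abs_ge_self])
qed simp

lemma schwartz_wt_bound:
  fixes f :: "'a::euclidean_space \<Rightarrow> complex"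
  assumes "f \<in> schwartz"
  obtains C where "0 \<le> C" "\<And>x. (1 + norm x) ^ k * norm (f x) \<le> C * wt x"
proof -
  obtain C where C: "0 \<le> C" "\<And>x. (1 + norm x) ^ (k + 2 * DIM('a)) * norm (f x) \<le> C"
    using schwartz_bound[OF assms] by blast
  have "(1 + norm x) ^ k * norm (f x) \<le> C * wt x" for x
  proof -
    have "0 < (1 + norm x) ^ (2 * DIM('a))" by (intro zero_less_power add_pos_nonneg) auto
    then show ?thesis using C(2)[of x] by (simp add: wt_def power_add field_simps)
  qed
  then show ?thesis using C that by blast
qed

lemma schwartz_wt_bound0:
  assumes "f \<in> schwartz"
  obtains C where "0 \<le> C" "\<And>x. norm (f x) \<le> C * wt x"
  using schwartz_wt_bound[OF assms, of 0] by auto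

lemma schwartz_integrable: "f \<in> schwartz \<Longrightarrow> integrable lborel f"
  by (metis schwartz_wt_bound0 integrable_wt_bound schwartz_borel)

text \<open>Differentiation under the integral sign in the Frechet sense. The domination of the
  partial derivatives is local in y; the mean value theorem on the unit ball turns it into a
  domination of the difference quotients.\<close>

lemma integral_pd:
  fixes K :: "'m \<Rightarrow> 'a::euclidean_space \<Rightarrow> complex"
  assumes diff: "\<And>m y. K m differentiable at y"
    and int: "\<And>y. integrable M (\<lambda>m. K m y)"
    and meas: "\<And>b. b \<in> Basis \<Longrightarrow> (\<lambda>m. pd b (K m) x) \<in> borel_measurable M"
    and B: "integrable M B" "\<And>b m y. b \<in> Basis \<Longrightarrow> dist y x < 1 \<Longrightarrow> norm (pd b (K m) y) \<le> B m"
  shows "((\<lambda>x. \<integral>m. K m x \<partial>M) has_derivative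
      (\<lambda>h. \<Sum>b\<in>Basis. of_real (h \<bullet> b) * (\<integral>m. pd b (K m) x \<partial>M))) (at x)"
proof -
  define K' where "K' m y h = (\<Sum>b\<in>Basis. of_real (h \<bullet> b) * pd b (K m) y)" for m y h
  have der: "(K m has_derivative K' m y) (at y)" for m y
  proof -
    have d: "(K m has_derivative frechet_derivative (K m) (at y)) (at y)"
      using diff frechet_derivative_works by blast
    then interpret D: bounded_linear "frechet_derivative (K m) (at y)"
      by (rule has_derivative_bounded_linear)
    have "frechet_derivative (K m) (at y) h = K' m y h" for h
    proof -
      have "frechet_derivative (K m) (at y) h = frechet_derivative (K m) (at y) (\<Sum>b\<in>Basis. (h \<bullet> b) *\<^sub>R b)"
        by (simp add: euclidean_representation)
      also have "\<dots> = K' m y h"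
        by (simp add: D.sum D.scaleR pd_def scaleR_conv_of_real K'_def)
      finally show ?thesis .
    qed
    then show ?thesis using d by (metis ext)
  qed
  have K'_le: "norm (K' m y h) \<le> DIM('a) * B m * norm h" if "dist y x < 1" for m y h
  proof -
    have "norm (K' m y h) \<le> (\<Sum>b\<in>(Basis::'a set). norm h * B m)"
      unfolding K'_def
    proof (intro sum_norm_le)
      fix b :: 'a assume b: "b \<in> Basis"
      have "norm (complex_of_real (h \<bullet> b) * pd b (K m) y) = \<bar>h \<bullet> b\<bar> * norm (pd b (K m) y)"
        by (simp add: norm_mult)
      also have "\<dots> \<le> norm h * B m"
        using b that by (intro mult_mono Basis_le_norm B) auto
      finally show "norm (complex_of_real (h \<bullet> b) * pd b (K m) y) \<le> norm h * B m" .
    qed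
    then show ?thesis by (simp add: ac_simps)
  qed
  have pdint: "integrable M (\<lambda>m. pd b (K m) x)" if "b \<in> Basis" for b
    using B(2)[OF that, of x] by (intro Bochner_Integration.integrable_bound[OF B(1)] meas that) (auto intro!: AE_I2 intro: order_trans[OF _ abs_ge_self])
  have mK': "(\<lambda>m. K' m x h) \<in> borel_measurable M" for h
    unfolding K'_def using meas by measurable
  have intK': "(\<integral>m. K' m x h \<partial>M) = (\<Sum>b\<in>Basis. of_real (h \<bullet> b) * (\<integral>m. pd b (K m) x \<partial>M))"
    and iK': "integrable M (\<lambda>m. K' m x h)" for h
    unfolding K'_def using pdint by (simp_all add: Bochner_Integration.integral_sum)
  \<comment> \<open>The normalised remainder of the first-order expansion; it tends to zero for each
    m, and the claim is that its integral does too.\<close>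
  let ?q = "\<lambda>y m. ((K m y - K m x) - K' m x (y - x)) /\<^sub>R norm (y - x)"
  show ?thesis
    unfolding has_derivative_at_within
  proof
    show "bounded_linear (\<lambda>h. \<Sum>b\<in>Basis. of_real (h \<bullet> b) * (\<integral>m. pd b (K m) x \<partial>M))"
      by (intro bounded_linear_sum bounded_linear_mult_left[THEN bounded_linear_compose]
          bounded_linear_of_real[THEN bounded_linear_compose] bounded_linear_inner_left)
    have eq: "(\<integral>m. ?q y m \<partial>M) = (((\<integral>m. K m y \<partial>M) - (\<integral>m. K m x \<partial>M))
        - (\<Sum>b\<in>Basis. of_real ((y - x) \<bullet> b) * (\<integral>m. pd b (K m) x \<partial>M))) /\<^sub>R norm (y - x)" for y
      using int iK' by (simp add: intK'[symmetric] Bochner_Integration.integral_diff)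
    have "((\<lambda>y. \<integral>m. ?q y m \<partial>M) \<longlongrightarrow> 0) (at x)"
      unfolding tendsto_at_iff_sequentially o_def
    proof (intro allI impI)
      fix X :: "nat \<Rightarrow> 'a" assume X: "\<forall>i. X i \<in> UNIV - {x}" "X \<longlonglongrightarrow> x"
      \<comment> \<open>The sequence is shifted so that all its points lie in the unit ball around
        x, where the domination holds.\<close>
      obtain N where N: "\<And>n. N \<le> n \<Longrightarrow> dist (X n) x < 1"
        using X(2) by (metis lim_sequentially zero_less_one)
      have "(\<lambda>i. \<integral>m. ?q (X (i + N)) m \<partial>M) \<longlonglongrightarrow> (\<integral>m. 0 \<partial>M)"
      proof (rule integral_dominated_convergence[where w = "\<lambda>m. 2 * (DIM('a) * B m)"])
        show "(\<lambda>m. ?q (X (i + N)) m) \<in> borel_measurable M" for i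
          using int mK' by (intro borel_measurable_scaleR borel_measurable_diff borel_measurable_const
              borel_measurable_integrable[OF int])
        show "integrable M (\<lambda>m. 2 * (DIM('a) * B m))" using B(1) by simp
        show "AE m in M. (\<lambda>i. ?q (X (i + N)) m) \<longlonglongrightarrow> 0"
        proof (intro AE_I2)
          fix m
          have "((\<lambda>y. ?q y m) \<longlongrightarrow> 0) (at x)" using der[of m x] unfolding has_derivative_at_within by simp
          then have "(\<lambda>i. ?q (X i) m) \<longlonglongrightarrow> 0"
            using X unfolding tendsto_at_iff_sequentially o_def by blast
          then show "(\<lambda>i. ?q (X (i + N)) m) \<longlonglongrightarrow> 0" by (rule LIMSEQ_ignore_initial_segment)
        qed
        show "AE m in M. norm (?q (X (i + N)) m) \<le> 2 * (DIM('a) * B m)" for i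
        proof (intro AE_I2)
          fix m
          let ?y = "X (i + N)"
          have d: "dist ?y x < 1" using N by simp
          have ne: "0 < norm (?y - x)" using X(1) by auto
          have "norm (K m ?y - K m x) \<le> DIM('a) * B m * norm (?y - x)"
          proof (rule differentiable_bound[of "ball x 1"])
            show "onorm (K' m z) \<le> DIM('a) * B m" if "z \<in> ball x 1" for z
              using K'_le that by (intro onorm_le) (auto simp: dist_commute)
            show "(K m has_derivative K' m z) (at z within ball x 1)" for z
              using der has_derivative_at_withinI by blast
          qed (use d in \<open>auto simp: dist_commute\<close>)
          moreover have "norm (K' m x (?y - x)) \<le> DIM('a) * B m * norm (?y - x)" by (rule K'_le) simp
          ultimately have "norm ((K m ?y - K m x) - K' m x (?y - x)) \<le> 2 * (DIM('a) * B m) * norm (?y - x)"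
            using norm_triangle_ineq4[of "K m ?y - K m x" "K' m x (?y - x)"] by linarith
          then show "norm (?q ?y m) \<le> 2 * (DIM('a) * B m)"
            using ne by (simp add: divide_inverse_commute[symmetric] pos_divide_le_eq)
        qed
      qed simp
      then show "(\<lambda>i. \<integral>m. ?q (X i) m \<partial>M) \<longlonglongrightarrow> 0"
        by (simp add: LIMSEQ_offset)
    qed
    then show "((\<lambda>y. (((\<integral>m. K m y \<partial>M) - (\<integral>m. K m x \<partial>M))
        - (\<Sum>b\<in>Basis. of_real ((y - x) \<bullet> b) * (\<integral>m. pd b (K m) x \<partial>M))) /\<^sub>R norm (y - x)) \<longlongrightarrow> 0) (at x)"
      by (simp only: eq)
  qed
qed

lemma pd_of_sum_derivative:
  assumes "\<And>x. (F has_derivative (\<lambda>h. \<Sum>b\<in>Basis. of_real (h \<bullet> b) * G b x)) (at x)" "b \<in> Basis"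
  shows "pd b F = G b"
proof -
  have "pd b F = (\<lambda>x. \<Sum>b'\<in>Basis. of_real (b \<bullet> b') * G b' x)"
    by (rule pd_eqI) (rule assms)
  also have "\<dots> = G b"
    using assms(2) by (simp add: fun_eq_iff inner_Basis if_distrib[of of_real] if_distrib[of "\<lambda>c. c * _"] cong: if_cong)
  finally show ?thesis .
qed

lemma lborel_integral_shift:
  fixes f :: "'a::euclidean_space \<Rightarrow> 'b::{banach, second_countable_topology}"
  assumes [measurable]: "f \<in> borel_measurable borel"
  shows "(\<integral>x. f (x + c) \<partial>lborel) = (\<integral>x. f x \<partial>lborel)"
    and "(\<integral>x. f (x - c) \<partial>lborel) = (\<integral>x. f x \<partial>lborel)"
    and "(\<integral>x. f (c - x) \<partial>lborel) = (\<integral>x. f x \<partial>lborel)"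
proof -
  have *: "(\<integral>x. f (c + x) \<partial>lborel) = (\<integral>x. f x \<partial>lborel)" for c
    by (subst (2) lborel_distr_plus[of c, symmetric], subst integral_distr) auto
  show "(\<integral>x. f (x + c) \<partial>lborel) = (\<integral>x. f x \<partial>lborel)"
    using *[of c] by (simp add: add.commute)
  show "(\<integral>x. f (x - c) \<partial>lborel) = (\<integral>x. f x \<partial>lborel)"
    using *[of "- c"] by simp
  show "(\<integral>x. f (c - x) \<partial>lborel) = (\<integral>x. f x \<partial>lborel)"
    by (subst (2) lborel_distr_reflect[of c, symmetric], subst integral_distr) auto
qed

text \<open>By translation invariance \<open>\<integral> f (t + h) dt\<close> does not depend on \<open>h\<close>.\<close>

lemma integral_pd_eq_0:
  fixes f :: "'a::euclidean_space \<Rightarrow> complex"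
  assumes f: "f \<in> schwartz" and b: "b \<in> Basis"
  shows "(\<integral>x. pd b f x \<partial>lborel) = 0"
proof -
  have tr: "(\<lambda>h. f (t + h)) = translation (- t) f" for t by (simp add: translation_def add.commute)
  have pdK: "pd b (\<lambda>h. f (t + h)) y = pd b f (t + y)" if "b \<in> Basis" for b t y
    using that f by (simp add: tr pd_translation) (simp add: translation_def add.commute)
  have "\<exists>C. \<forall>b\<in>Basis. \<forall>x. norm (pd b f x) \<le> C * wt x"
  proof -
    have "\<forall>b\<in>Basis. \<exists>C. 0 \<le> C \<and> (\<forall>x. norm (pd b f x) \<le> C * wt x)"
      using schwartz_wt_bound0[OF schwartz_pd[OF f]] by metis
    then obtain C where C: "\<And>b. b \<in> Basis \<Longrightarrow> 0 \<le> C b" "\<And>b x. b \<in> Basis \<Longrightarrow> norm (pd b f x) \<le> C b * wt x" by metis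
    have "norm (pd b f x) \<le> (\<Sum>b\<in>Basis. C b) * wt x" if "b \<in> Basis" for b x
      using C that by (intro order_trans[OF C(2)] mult_right_mono member_le_sum) auto
    then show ?thesis by blast
  qed
  then obtain C where C: "\<And>b x. b \<in> Basis \<Longrightarrow> norm (pd b f x) \<le> C * wt x" by blast
  have C0: "0 \<le> C" using C[OF b, of 0] norm_ge_zero[of "pd b f 0"] wt_pos[of "0::'a"]
    by (metis order_trans zero_le_mult_iff not_less)
  have "((\<lambda>h. \<integral>t. f (t + h) \<partial>lborel) has_derivative
    (\<lambda>h. \<Sum>b\<in>Basis. of_real (h \<bullet> b) * (\<integral>t. pd b (\<lambda>h. f (t + h)) x \<partial>lborel))) (at x)" for x
  \<comment> \<open>For y within distance one of x the norm of y is at most 1 + |x|, so Peetre's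
    inequality dominates all shifted weights by one multiple of \<open>wt t\<close>.\<close>
  proof (rule integral_pd[where B = "\<lambda>t. C * ((2 + norm x) ^ (2 * DIM('a)) * wt t)"])
    show "(\<lambda>h. f (t + h)) differentiable at y" for t y
      unfolding tr by (intro schwartz_differentiable schwartz_translation f)
    show "integrable lborel (\<lambda>t. f (t + y))" for y
      using schwartz_integrable[OF schwartz_translation[OF f, of "- y"]] by (simp add: translation_def)
    show "(\<lambda>t. pd b (\<lambda>h. f (t + h)) x) \<in> borel_measurable lborel" if "b \<in> Basis" for b
      unfolding pdK[OF that] using schwartz_borel[OF schwartz_pd[OF f that]] by measurable
    show "integrable lborel (\<lambda>t. C * ((2 + norm x) ^ (2 * DIM('a)) * wt t))"
      by simp
    fix b t y :: 'a assume b: "b \<in> Basis" and y: "dist y x < 1"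
    have "norm y \<le> 1 + norm x" using y norm_triangle_ineq2[of y x] by (simp add: dist_norm)
    then have "wt (t + y) \<le> (2 + norm x) ^ (2 * DIM('a)) * wt t"
      by (intro order_trans[OF wt_peetre] mult_right_mono power_mono) auto
    then show "norm (pd b (\<lambda>h. f (t + h)) y) \<le> C * ((2 + norm x) ^ (2 * DIM('a)) * wt t)"
      using C0 unfolding pdK[OF b] by (intro order_trans[OF C[OF b]] mult_left_mono)
  qed
  then have "pd b (\<lambda>h. \<integral>t. f (t + h) \<partial>lborel) = (\<lambda>x. \<integral>t. pd b (\<lambda>h. f (t + h)) x \<partial>lborel)"
    by (rule pd_of_sum_derivative) (rule b)
  moreover have "(\<lambda>h. \<integral>t. f (t + h) \<partial>lborel) = (\<lambda>h. \<integral>t. f t \<partial>lborel)"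
    using lborel_integral_shift(1)[OF schwartz_borel[OF f]] by simp
  ultimately have "pd b (\<lambda>h. \<integral>t. f t \<partial>lborel) 0 = (\<integral>t. pd b f t \<partial>lborel)"
    using pdK[OF b] by simp
  then show ?thesis by (simp add: pd_def)
qed

section \<open>The partial Fourier transform\<close>

text \<open>The Fourier transform in the second variable only. Short-time Fourier transforms and
  Wigner distributions are both of this form after a linear change of variables, so one inversion
  formula and one Parseval identity serve both.\<close>

definition pft :: "('a::euclidean_space \<times> 'a \<Rightarrow> complex) \<Rightarrow> 'a \<times> 'a \<Rightarrow> complex" where
  "pft H = (\<lambda>(x, \<xi>). \<integral>t. H (x, t) * ex2 (- (\<xi> \<bullet> t)) \<partial>lborel)"

lemma pft_integrable:
  assumes "H \<in> schwartz"
  shows "integrable lborel (\<lambda>t. H (x, t) * ex2 (- (\<xi> \<bullet> t)))"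
proof -
  have "integrable lborel (modulation (- \<xi>) (\<lambda>t. H (x, t)))"
    by (intro schwartz_integrable schwartz_modulation schwartz_section assms)
  then show ?thesis by (simp add: modulation_eq mult.commute inner_commute)
qed

lemma schwartz_section_wt_bound:
  fixes H :: "'a::euclidean_space \<times> 'b::euclidean_space \<Rightarrow> complex"
  assumes "H \<in> schwartz"
  obtains C where "0 \<le> C" "\<And>x t. norm (H (x, t)) \<le> C * wt t"
proof -
  obtain C where C: "0 \<le> C" "\<And>z. (1 + norm z) ^ (2 * DIM('b)) * norm (H z) \<le> C"
    using schwartz_bound[OF assms] by blast
  have "norm (H (x, t)) \<le> C * wt t" for x t
  proof -
    have "norm t \<le> norm (x, t)" using norm_snd_le[of t x] by simp
    then have "(1 + norm t) ^ (2 * DIM('b)) * norm (H (x, t)) \<le> (1 + norm (x, t)) ^ (2 * DIM('b)) * norm (H (x, t))"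
      by (intro mult_right_mono power_mono) auto
    also have "\<dots> \<le> C" by (rule C)
    finally have *: "(1 + norm t) ^ (2 * DIM('b)) * norm (H (x, t)) \<le> C" .
    have "0 < (1 + norm t) ^ (2 * DIM('b))" by (intro zero_less_power add_pos_nonneg) auto
    then show ?thesis using * by (simp add: wt_def field_simps)
  qed
  then show ?thesis using C that by blast
qed

lemma pd_pft:
  fixes H :: "'a::euclidean_space \<times> 'a \<Rightarrow> complex"
  assumes H: "H \<in> schwartz"
  shows "pft H differentiable at z"
    and "b \<in> Basis \<Longrightarrow> pd (b, 0) (pft H) = pft (pd (b, 0) H)"
    and "b \<in> Basis \<Longrightarrow> pd (0, b) (pft H) = pft (\<lambda>z. - 2 * pi * \<i> * (of_real (z \<bullet> (0, b)) * H z))"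
proof -
  \<comment> \<open>The function whose transform is the derivative in direction b: a derivative of H
    for directions of the first factor, multiplication by -2 \<pi> i times a coordinate for those of
    the second. A basis vector of the product has exactly one zero component, which justifies the
    case distinction.\<close>
  define G where "G b = (case b of (u, v) \<Rightarrow> if v = 0 then pd (u, 0) H
      else (\<lambda>z. - 2 * pi * \<i> * (of_real (z \<bullet> (0, v)) * H z)))" for b :: "'a \<times> 'a"
  define K where "K t = (\<lambda>z. H (fst z, t) * ex2 (- (snd z \<bullet> t)))" for t :: 'a
  have GS: "G b \<in> schwartz" if "b \<in> Basis" for b
    using that unfolding G_def
    by (auto simp: Basis_prod_def split: prod.splits intro!: schwartz_pd[OF H] schwartz_uminus schwartz_cmult schwartz_coord H)
  have derK: "(K t has_derivative (\<lambda>u. H (fst z, t) * (ex2 (- (snd z \<bullet> t)) * (- 2 * pi * \<i> * of_real (snd u \<bullet> t)))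
      + frechet_derivative H (at (fst z, t)) (fst u, 0) * ex2 (- (snd z \<bullet> t)))) (at z)" for t z
    unfolding K_def
  proof (rule has_derivative_mult)
    have "((\<lambda>z. (fst z, t)) has_derivative (\<lambda>u. (fst u, 0))) (at z)"
      by (auto intro!: derivative_eq_intros)
    then show "((\<lambda>z. H (fst z, t)) has_derivative (\<lambda>u. frechet_derivative H (at (fst z, t)) (fst u, 0))) (at z)"
      by (rule has_derivative_compose[OF _ schwartz_has_derivative[OF H]])
    have "((\<lambda>z. 2 * pi * \<i> * complex_of_real (- (snd z \<bullet> t))) has_derivative
        (\<lambda>u. - 2 * pi * \<i> * complex_of_real (snd u \<bullet> t))) (at z)"
      by (auto intro!: derivative_eq_intros)
    from has_derivative_compose[OF this has_field_derivative_imp_has_derivative[OF DERIV_exp]]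
    show "((\<lambda>z. ex2 (- (snd z \<bullet> t))) has_derivative (\<lambda>u. ex2 (- (snd z \<bullet> t)) * (- 2 * pi * \<i> * of_real (snd u \<bullet> t)))) (at z)"
      by (simp add: ex2_def)
  qed
  have 0: "frechet_derivative H (at w) (0, 0) = 0" for w
    using linear_0[OF bounded_linear.linear[OF has_derivative_bounded_linear[OF schwartz_has_derivative[OF H]]]]
    by (simp add: zero_prod_def)
  have pdK: "pd b (K t) z = G b (fst z, t) * ex2 (- (snd z \<bullet> t))" if "b \<in> Basis" for b t z
    using that pd_eqI[OF derK, of b t] 0
    by (auto simp: Basis_prod_def G_def pd_def inner_commute)
  have pft_K: "pft F z = (\<integral>t. F (fst z, t) * ex2 (- (snd z \<bullet> t)) \<partial>lborel)" for F z
    by (simp add: pft_def case_prod_beta')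
  have "\<exists>C. \<forall>b\<in>Basis. \<forall>x t. norm (G b (x, t)) \<le> C * wt t"
  proof -
    have "\<forall>b\<in>Basis. \<exists>C. 0 \<le> C \<and> (\<forall>x t. norm (G b (x, t)) \<le> C * wt t)"
      using schwartz_section_wt_bound[OF GS] by metis
    then obtain C where C: "\<And>b. b \<in> Basis \<Longrightarrow> 0 \<le> C b" "\<And>b x t. b \<in> Basis \<Longrightarrow> norm (G b (x, t)) \<le> C b * wt t" by metis
    have "norm (G b (x, t)) \<le> (\<Sum>b\<in>Basis. C b) * wt t" if "b \<in> Basis" for b x t
      using C that by (intro order_trans[OF C(2)] mult_right_mono member_le_sum) auto
    then show ?thesis by blast
  qed
  then obtain C where C: "\<And>b x t. b \<in> Basis \<Longrightarrow> norm (G b (x, t)) \<le> C * wt t" by blast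
  have der: "(pft H has_derivative (\<lambda>h. \<Sum>b\<in>Basis. of_real (h \<bullet> b) * pft (G b) z)) (at z)" for z
  proof -
    have "((\<lambda>z. \<integral>t. K t z \<partial>lborel) has_derivative
      (\<lambda>h. \<Sum>b\<in>Basis. of_real (h \<bullet> b) * (\<integral>t. pd b (K t) z \<partial>lborel))) (at z)"
    proof (rule integral_pd[where B = "\<lambda>t. C * wt t"])
      show "K t differentiable at y" for t y using derK differentiableI by blast
      show "integrable lborel (\<lambda>t. K t y)" for y unfolding K_def using pft_integrable[OF H] by simp
      show "(\<lambda>t. pd b (K t) z) \<in> borel_measurable lborel" if "b \<in> Basis" for b
        unfolding pdK[OF that] using borel_measurable_integrable[OF pft_integrable[OF GS[OF that]]] by simp
      show "integrable lborel (\<lambda>t::'a. C * wt t)" by simp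
      show "norm (pd b (K t) y) \<le> C * wt t" if "b \<in> Basis" for b t y
        unfolding pdK[OF that] using C[OF that] by (simp add: norm_mult)
    qed
    moreover have "(\<lambda>z. \<integral>t. K t z \<partial>lborel) = pft H" by (simp add: fun_eq_iff pft_K K_def)
    ultimately show ?thesis by (simp add: pdK pft_K)
  qed
  then show "pft H differentiable at z" using differentiableI by blast
  show "pd (b, 0) (pft H) = pft (pd (b, 0) H)" if "b \<in> Basis"
    using pd_of_sum_derivative[OF der, of "(b, 0)"] that by (simp add: G_def Basis_prod_def)
  show "pd (0, b) (pft H) = pft (\<lambda>z. - 2 * pi * \<i> * (of_real (z \<bullet> (0, b)) * H z))" if "b \<in> Basis"
    using pd_of_sum_derivative[OF der, of "(0, b)"] that by (auto simp: G_def Basis_prod_def)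
qed

text \<open>The first coordinate is a parameter of the integral. For the second, the modulated
  section has a derivative with integral zero, which is integration by parts.\<close>

lemma pft_coord:
  fixes H :: "'a::euclidean_space \<times> 'a \<Rightarrow> complex"
  assumes H: "H \<in> schwartz" and b: "b \<in> Basis"
  shows "of_real (z \<bullet> (b, 0)) * pft H z = pft (\<lambda>z. of_real (z \<bullet> (b, 0)) * H z) z"
    and "of_real (z \<bullet> (0, b)) * pft H z = pft (\<lambda>z. (1 / (2 * pi * \<i>)) * pd (0, b) H z) z"
proof -
  show "of_real (z \<bullet> (b, 0)) * pft H z = pft (\<lambda>z. of_real (z \<bullet> (b, 0)) * H z) z"
    by (cases z) (simp add: pft_def mult.assoc)
  obtain x \<xi> where z: "z = (x, \<xi>)" by force
  define h where "h = (\<lambda>t. H (x, t))"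
  have hS: "h \<in> schwartz" unfolding h_def by (rule schwartz_section[OF H])
  have pdh: "pd b h t = pd (0, b) H (x, t)" for t
  proof -
    have "bounded_linear (\<lambda>t::'a. (0::'a, t))" by (intro bounded_linear_Pair bounded_linear_ident bounded_linear_zero)
    from pd_affine(1)[OF H this, of b "(x, 0)"]
    have "pd b h t = (\<Sum>b'\<in>Basis. of_real ((0, b) \<bullet> b') * pd b' H (x, t))"
      by (simp add: h_def)
    also have "\<dots> = pd (0, b) H (x, t)"
    proof -
      have "(0, b) \<in> (Basis :: ('a \<times> 'a) set)" using b by (simp add: Basis_prod_def)
      then show ?thesis
        by (simp add: inner_Basis if_distrib[of of_real] if_distrib[of "\<lambda>c. c * _"] cong: if_cong)
    qed
    finally show ?thesis .
  qed
  have i1: "integrable lborel (\<lambda>t. ex2 (- (\<xi> \<bullet> t)) * h t)"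
    using pft_integrable[OF H, of x \<xi>] by (simp add: h_def mult.commute)
  have i2: "integrable lborel (\<lambda>t. ex2 (- (\<xi> \<bullet> t)) * pd b h t)"
    using pft_integrable[OF schwartz_pd[OF H], of "(0, b)" x \<xi>] b by (simp add: pdh mult.commute Basis_prod_def)
  have "0 = (\<integral>t. pd b (modulation (- \<xi>) h) t \<partial>lborel)"
    by (rule integral_pd_eq_0[symmetric]) (intro schwartz_modulation hS b)+
  also have "\<dots> = (\<integral>t. - 2 * pi * \<i> * of_real (b \<bullet> \<xi>) * (ex2 (- (\<xi> \<bullet> t)) * h t) + ex2 (- (\<xi> \<bullet> t)) * pd b h t \<partial>lborel)"
    unfolding pd_modulation[OF hS] by (simp add: modulation_eq algebra_simps inner_commute)
  also have "\<dots> = - 2 * pi * \<i> * of_real (b \<bullet> \<xi>) * (\<integral>t. ex2 (- (\<xi> \<bullet> t)) * h t \<partial>lborel) + (\<integral>t. ex2 (- (\<xi> \<bullet> t)) * pd b h t \<partial>lborel)"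
    using i1 i2 by (subst Bochner_Integration.integral_add) (auto simp: integral_mult_right_zero)
  finally have *: "2 * pi * \<i> * of_real (b \<bullet> \<xi>) * (\<integral>t. ex2 (- (\<xi> \<bullet> t)) * h t \<partial>lborel) = (\<integral>t. ex2 (- (\<xi> \<bullet> t)) * pd b h t \<partial>lborel)"
    by (simp add: algebra_simps eq_neg_iff_add_eq_0)
  have l: "pft H z = (\<integral>t. ex2 (- (\<xi> \<bullet> t)) * h t \<partial>lborel)"
    by (simp add: z pft_def h_def mult.commute)
  have r: "pft (\<lambda>z. (1 / (2 * pi * \<i>)) * pd (0, b) H z) z = (1 / (2 * pi * \<i>)) * (\<integral>t. ex2 (- (\<xi> \<bullet> t)) * pd b h t \<partial>lborel)"
    by (simp add: z pft_def pdh integral_mult_right_zero[symmetric] ac_simps del: integral_mult_right_zero)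
  show "of_real (z \<bullet> (0, b)) * pft H z = pft (\<lambda>z. (1 / (2 * pi * \<i>)) * pd (0, b) H z) z"
    unfolding r *[symmetric] l by (simp add: z inner_commute)
qed

text \<open>Decay is proved by induction on the power k for all H at once: 1 + |z| is at most one
  plus the sum of the |z_b|, and a coordinate times a transform is again the transform of a Schwartz
  function.\<close>

lemma pft_schwartz:
  fixes H :: "'a::euclidean_space \<times> 'a \<Rightarrow> complex"
  assumes "H \<in> schwartz"
  shows "pft H \<in> schwartz"
proof (rule schwartz_coinduct[where X = "pft ` schwartz"])
  show "pft H \<in> pft ` (schwartz :: ('a \<times> 'a \<Rightarrow> complex) set)" using assms by blast
next
  fix f :: "'a \<times> 'a \<Rightarrow> complex" assume "f \<in> pft ` schwartz"
  then obtain H where f: "f = pft H" and H: "H \<in> schwartz" by blast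
  show "f differentiable at x" for x unfolding f using pd_pft(1)[OF H] .
  show "pd b f \<in> pft ` schwartz" if b: "b \<in> Basis" for b
  proof -
    consider u where "b = (u, 0)" "u \<in> Basis" | v where "b = (0, v)" "v \<in> Basis"
      using b by (auto simp: Basis_prod_def)
    then show ?thesis
    proof cases
      case 1
      then show ?thesis unfolding f using pd_pft(2)[OF H] schwartz_pd[OF H b] by auto
    next
      case 2
      then show ?thesis unfolding f using pd_pft(3)[OF H] by (auto intro!: imageI schwartz_uminus schwartz_cmult schwartz_coord H)
    qed
  qed
  show "\<exists>C. \<forall>x. (1 + norm x) ^ k * norm (f x) \<le> C" for k
    unfolding f using H
  proof (induction k arbitrary: H)
    case 0
    obtain C where C: "0 \<le> C" "\<And>x t. norm (H (x, t)) \<le> C * wt t"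
      using schwartz_section_wt_bound[OF 0] by blast
    have "norm (pft H z) \<le> (\<integral>t. C * wt t \<partial>(lborel :: 'a measure))" for z
    proof -
      obtain x \<xi> where z: "z = (x, \<xi>)" by force
      have "norm (\<integral>t. H (x, t) * ex2 (- (\<xi> \<bullet> t)) \<partial>lborel) \<le> (\<integral>t. C * wt t \<partial>(lborel :: 'a measure))"
        by (rule Bochner_Integration.integral_norm_bound_integral[OF pft_integrable[OF 0]]) (simp_all add: norm_mult C(2))
      then show ?thesis by (simp add: z pft_def)
    qed
    then show ?case by auto
  next
    case (Suc k)
    have step: "\<exists>C. \<forall>z. (1 + norm z) ^ k * (\<bar>z \<bullet> b\<bar> * norm (pft H z)) \<le> C" if b: "b \<in> Basis" for b
    proof -
      consider u where "b = (u, 0)" "u \<in> Basis" | v where "b = (0, v)" "v \<in> Basis"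
        using b by (auto simp: Basis_prod_def)
      then obtain H' where H': "H' \<in> schwartz" "\<And>z. of_real (z \<bullet> b) * pft H z = pft H' z"
      proof cases
        case 1
        then show ?thesis using pft_coord(1)[OF Suc.prems 1(2)] schwartz_coord[OF Suc.prems, of b] that by blast
      next
        case 2
        then show ?thesis
          using pft_coord(2)[OF Suc.prems 2(2)] schwartz_cmult[OF schwartz_pd[OF Suc.prems b], of "1 / (2 * pi * \<i>)"] that by blast
      qed
      have "\<bar>z \<bullet> b\<bar> * norm (pft H z) = norm (pft H' z)" for z
        unfolding H'(2)[symmetric] by (simp add: norm_mult)
      then show ?thesis using Suc.IH[OF H'(1)] by simp
    qed
    then obtain C where C: "\<And>b z. b \<in> Basis \<Longrightarrow> (1 + norm z) ^ k * (\<bar>z \<bullet> b\<bar> * norm (pft H z)) \<le> C b" by metis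
    obtain C0 where C0: "\<And>z. (1 + norm z) ^ k * norm (pft H z) \<le> C0" using Suc.IH[OF Suc.prems] by blast
    have "(1 + norm z) ^ Suc k * norm (pft H z) \<le> C0 + (\<Sum>b\<in>Basis. C b)" for z
    proof -
      have "(1 + norm z) ^ Suc k * norm (pft H z) = (1 + norm z) ^ k * norm (pft H z) * (1 + norm z)"
        by simp
      also have "\<dots> \<le> (1 + norm z) ^ k * norm (pft H z) * (1 + (\<Sum>b\<in>Basis. \<bar>z \<bullet> b\<bar>))"
        by (intro mult_left_mono add_left_mono norm_le_l1) auto
      also have "\<dots> = (1 + norm z) ^ k * norm (pft H z) + (\<Sum>b\<in>Basis. (1 + norm z) ^ k * (\<bar>z \<bullet> b\<bar> * norm (pft H z)))"
        by (simp add: distrib_left sum_distrib_left ac_simps)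
      also have "\<dots> \<le> C0 + (\<Sum>b\<in>Basis. C b)" by (intro add_mono sum_mono C C0)
      finally show ?thesis .
    qed
    then show ?case by blast
  qed
qed

section \<open>The Gaussian\<close>

definition gauss :: "'a::euclidean_space \<Rightarrow> complex" where
  "gauss x = of_real (exp (- pi * (x \<bullet> x)))"

text \<open>The polynomial functions, generated in the way in which differentiating the Gaussian
  produces them; only closure under derivatives and polynomial growth will be used.\<close>

inductive_set polyf :: "('a::euclidean_space \<Rightarrow> complex) set" where
  const: "(\<lambda>x. c) \<in> polyf"
| coord: "q \<in> polyf \<Longrightarrow> (\<lambda>x. of_real (x \<bullet> v) * q x) \<in> polyf"
| add: "q \<in> polyf \<Longrightarrow> r \<in> polyf \<Longrightarrow> (\<lambda>x. q x + r x) \<in> polyf"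

lemma differentiable_has_frechet:
  "f differentiable at x \<Longrightarrow> (f has_derivative frechet_derivative f (at x)) (at x)"
  using frechet_derivative_works by blast

lemma polyf_props:
  "q \<in> polyf \<Longrightarrow> (\<forall>x. q differentiable at x) \<and> (\<forall>b. pd b q \<in> polyf)
    \<and> (\<exists>C k. 0 \<le> C \<and> (\<forall>x. norm (q x) \<le> C * (1 + norm x) ^ k))"
proof (induction rule: polyf.induct)
  case (const c)
  have "pd b (\<lambda>x::'a. c) = (\<lambda>x. 0)" for b by (simp add: pd_def)
  then show ?case using polyf.const by (auto intro!: exI[of _ "norm c"] exI[of _ "0::nat"])
next
  case (coord q v)
  have der: "((\<lambda>x. of_real (x \<bullet> v) * q x) has_derivative
      (\<lambda>u. of_real (x \<bullet> v) * frechet_derivative q (at x) u + of_real (u \<bullet> v) * q x)) (at x)" for x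
  proof (rule has_derivative_mult)
    show "((\<lambda>x. complex_of_real (x \<bullet> v)) has_derivative (\<lambda>u. of_real (u \<bullet> v))) (at x)"
      by (auto intro!: derivative_eq_intros)
    show "(q has_derivative frechet_derivative q (at x)) (at x)"
      by (rule differentiable_has_frechet) (use coord in blast)
  qed
  have "pd b (\<lambda>x. of_real (x \<bullet> v) * q x) \<in> polyf" for b
  proof -
    have c: "(\<lambda>x. of_real (b \<bullet> v) * q x) \<in> polyf"
    proof -
      have "(\<lambda>x. c * q x) \<in> polyf" if "q \<in> polyf" for c and q :: "'a \<Rightarrow> complex" using that
      proof (induction rule: polyf.induct)
        case (coord q v)
        then show ?case using polyf.coord[of "\<lambda>x. c * q x" v] by (simp add: ac_simps)
      next
        case (add q r)
        then show ?case using polyf.add[of "\<lambda>x. c * q x" "\<lambda>x. c * r x"] by (simp add: distrib_left)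
      qed (rule polyf.const)
      then show ?thesis using coord by blast
    qed
    have "pd b (\<lambda>x. of_real (x \<bullet> v) * q x) = (\<lambda>x. of_real (x \<bullet> v) * pd b q x + of_real (b \<bullet> v) * q x)"
      using pd_eqI[OF der, of b] by (simp add: pd_def)
    then show ?thesis using polyf.add[OF polyf.coord c] coord by simp
  qed
  moreover obtain C k where C: "0 \<le> C" "\<And>x. norm (q x) \<le> C * (1 + norm x) ^ k" using coord by blast
  have "norm (of_real (x \<bullet> v) * q x) \<le> (norm v * C) * (1 + norm x) ^ Suc k" for x
  proof -
    have "norm (of_real (x \<bullet> v) * q x) \<le> (norm v * (1 + norm x)) * (C * (1 + norm x) ^ k)"
      unfolding norm_mult norm_of_real using C Cauchy_Schwarz_ineq2[of x v]
      by (intro mult_mono) (auto simp: algebra_simps intro: add_increasing)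
    then show ?thesis by (simp add: ac_simps)
  qed
  then have "\<exists>C k. 0 \<le> C \<and> (\<forall>x. norm (of_real (x \<bullet> v) * q x) \<le> C * (1 + norm x) ^ k)"
    using C(1) by (intro exI[of _ "norm v * C"] exI[of _ "Suc k"]) auto
  moreover have "(\<lambda>x. of_real (x \<bullet> v) * q x) differentiable at x" for x
    using der differentiableI by blast
  ultimately show ?case by blast
next
  case (add q r)
  obtain C k where C1: "0 \<le> C" "\<And>x. norm (q x) \<le> C * (1 + norm x) ^ k" using add by blast
  obtain D l where D1: "0 \<le> D" "\<And>x. norm (r x) \<le> D * (1 + norm x) ^ l" using add by blast
  note C = C1 D1
  have "norm (q x + r x) \<le> (C + D) * (1 + norm x) ^ max k l" for x
  proof -
    have "norm (q x) \<le> C * (1 + norm x) ^ max k l"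
      using C(1) by (intro order_trans[OF C(2)] mult_left_mono power_increasing) auto
    moreover have "norm (r x) \<le> D * (1 + norm x) ^ max k l"
      using C(3) by (intro order_trans[OF C(4)] mult_left_mono power_increasing) auto
    ultimately show ?thesis using norm_triangle_ineq[of "q x" "r x"] by (simp add: distrib_right)
  qed
  then have "\<exists>C k. 0 \<le> C \<and> (\<forall>x. norm (q x + r x) \<le> C * (1 + norm x) ^ k)"
    using C by (intro exI[of _ "C + D"] exI[of _ "max k l"]) auto
  moreover have der: "((\<lambda>x. q x + r x) has_derivative (\<lambda>u. frechet_derivative q (at x) u + frechet_derivative r (at x) u)) (at x)" for x
    using add by (intro has_derivative_add differentiable_has_frechet) auto
  moreover have "pd b (\<lambda>x. q x + r x) = (\<lambda>x. pd b q x + pd b r x)" for b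
    using pd_eqI[OF der, of b] by (simp add: pd_def)
  moreover have "(\<lambda>x. pd b q x + pd b r x) \<in> polyf" for b
    using add by (intro polyf.add) auto
  moreover have "(\<lambda>x. q x + r x) differentiable at x" for x
    using der differentiableI by blast
  ultimately show ?case by simp
qed

lemma power_le_fact_exp: "0 \<le> x \<Longrightarrow> x ^ n \<le> fact n * exp (x::real)"
proof -
  assume x: "0 \<le> x"
  have "x ^ n /\<^sub>R fact n = (\<Sum>k\<in>{n}. x ^ k /\<^sub>R fact k)" by simp
  also have "\<dots> \<le> exp x"
    unfolding exp_def using x by (intro sum_le_suminf summable_exp_generic) auto
  finally show ?thesis by (simp add: field_simps)
qed

text \<open>(1 + r)^n is at most n! exp(1 + r), and since \<pi> > 1 the exponent 1 + r - \<pi> r^2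
  never exceeds 2.\<close>

lemma poly_times_gauss_bound: "(1 + norm x) ^ n * norm (gauss x) \<le> fact n * exp 2"
proof -
  let ?r = "norm x"
  have "?r - pi * ?r\<^sup>2 \<le> ?r - 1 * ?r\<^sup>2"
    using pi_gt3 by (intro diff_left_mono mult_right_mono) auto
  also have "\<dots> \<le> 1"
    using zero_le_power2[of "?r - 1/2"] by (simp add: power2_eq_square algebra_simps)
  finally have r: "1 + ?r - pi * ?r\<^sup>2 \<le> 2" by simp
  have "(1 + ?r) ^ n * norm (gauss x) \<le> (fact n * exp (1 + ?r)) * exp (- pi * (x \<bullet> x))"
    by (auto simp: gauss_def intro!: mult_right_mono power_le_fact_exp)
  also have "\<dots> = fact n * exp (1 + ?r - pi * ?r\<^sup>2)"
    by (simp add: exp_add[symmetric] power2_norm_eq_inner mult.assoc)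
  also have "\<dots> \<le> fact n * exp 2" using r by simp
  finally show ?thesis .
qed

lemma gauss_has_derivative:
  "(gauss has_derivative (\<lambda>u. of_real (- 2 * pi * (x \<bullet> u)) * gauss x)) (at x)"
proof -
  have "((\<lambda>x. exp (- pi * (x \<bullet> x))) has_derivative (\<lambda>u. (- 2 * pi * (x \<bullet> u)) * exp (- pi * (x \<bullet> x)))) (at x)"
    by (auto intro!: derivative_eq_intros simp: inner_commute algebra_simps)
  from has_derivative_of_real[OF this, where 'a = complex]
  show ?thesis by (simp add: gauss_def[abs_def])
qed

text \<open>Polynomial multiples of the Gaussian form a class closed under partial derivatives,
  because a derivative of the Gaussian is a linear function times the Gaussian.\<close>

lemma gauss_schwartz: "gauss \<in> schwartz"
proof (rule schwartz_coinduct[where X = "{\<lambda>x. q x * gauss x | q. q \<in> polyf}"])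
  show "gauss \<in> {\<lambda>x. q x * gauss x | q. q \<in> polyf}"
    using polyf.const[of 1] by (auto intro!: exI[of _ "\<lambda>x. 1"])
next
  fix f :: "'a \<Rightarrow> complex" assume "f \<in> {\<lambda>x. q x * gauss x | q. q \<in> polyf}"
  then obtain q where f: "f = (\<lambda>x. q x * gauss x)" and q: "q \<in> polyf" by blast
  have der: "(f has_derivative (\<lambda>u. q x * (of_real (- 2 * pi * (x \<bullet> u)) * gauss x)
      + frechet_derivative q (at x) u * gauss x)) (at x)" for x
    unfolding f using polyf_props[OF q]
    by (intro has_derivative_mult gauss_has_derivative differentiable_has_frechet) auto
  show "f differentiable at x" for x using der differentiableI by blast
  show "\<exists>C. \<forall>x. (1 + norm x) ^ k * norm (f x) \<le> C" for k
  proof -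
    obtain C l where C: "0 \<le> C" "\<And>x. norm (q x) \<le> C * (1 + norm x) ^ l" using polyf_props[OF q] by blast
    have "(1 + norm x) ^ k * norm (f x) \<le> C * (fact (k + l) * exp 2)" for x
    proof -
      have "(1 + norm x) ^ k * norm (f x) \<le> (1 + norm x) ^ k * ((C * (1 + norm x) ^ l) * norm (gauss x))"
        unfolding f norm_mult by (intro mult_left_mono mult_right_mono C) auto
      also have "\<dots> = C * ((1 + norm x) ^ (k + l) * norm (gauss x))" by (simp add: power_add ac_simps)
      also have "\<dots> \<le> C * (fact (k + l) * exp 2)" by (intro mult_left_mono poly_times_gauss_bound C)
      finally show ?thesis .
    qed
    then show ?thesis by blast
  qed
  show "pd b f \<in> {\<lambda>x. q x * gauss x | q. q \<in> polyf}" if "b \<in> Basis" for b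
  proof -
    have "pd b f = (\<lambda>x. (of_real (x \<bullet> ((- 2 * pi) *\<^sub>R b)) * q x + pd b q x) * gauss x)"
      using pd_eqI[OF der, of b] by (simp add: pd_def algebra_simps)
    moreover have "(\<lambda>x. of_real (x \<bullet> ((- 2 * pi) *\<^sub>R b)) * q x + pd b q x) \<in> polyf"
      using polyf_props[OF q] by (intro polyf.add polyf.coord q) auto
    ultimately show ?thesis
      by (intro CollectI exI[of _ "\<lambda>x. of_real (x \<bullet> ((- 2 * pi) *\<^sub>R b)) * q x + pd b q x"] conjI)
  qed
qed

lemma gauss_fourier_real:
  "integrable lborel (\<lambda>y. of_real (exp (- pi * y\<^sup>2)) * ex2 (y * v))"
  "(\<integral>y. of_real (exp (- pi * y\<^sup>2)) * ex2 (y * v) \<partial>lborel) = of_real (exp (- pi * v\<^sup>2))"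
proof -
  have eq: "(\<lambda>y. of_real (exp (- pi * y\<^sup>2)) * ex2 (y * v)) = (\<lambda>y::real. modulation v gauss y)"
    by (simp add: fun_eq_iff modulation_eq gauss_def power2_eq_square mult.commute)
  show "integrable lborel (\<lambda>y. of_real (exp (- pi * y\<^sup>2)) * ex2 (y * v))"
    unfolding eq by (intro schwartz_integrable schwartz_modulation gauss_schwartz)
  \<comment> \<open>The characteristic function of the standard normal law, evaluated at this
    multiple of v; substituting x = \<open>?c\<close> y changes the density into exp(-\<pi> y^2) and
    the phase into 2 \<pi> y v.\<close>
  let ?c = "sqrt (2 * pi)"
  let ?f = "\<lambda>x. std_normal_density x *\<^sub>R iexp (?c * v * x)"
  have "of_real (exp (- (?c * v)\<^sup>2 / 2)) = char std_normal_distribution (?c * v)"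
    by (simp add: char_std_normal_distribution)
  also have "\<dots> = (\<integral>x. ?f x \<partial>lborel)"
    unfolding char_def by (subst integral_density) (auto simp: normal_density_nonneg)
  also have "\<dots> = \<bar>?c\<bar> *\<^sub>R (\<integral>y. ?f (0 + ?c * y) \<partial>lborel)"
    by (rule lborel_integral_real_affine) simp
  also have "\<dots> = (\<integral>y. \<bar>?c\<bar> *\<^sub>R ?f (0 + ?c * y) \<partial>lborel)" by (rule integral_scaleR_right[symmetric])
  also have "\<dots> = (\<integral>y. of_real (exp (- pi * y\<^sup>2)) * ex2 (y * v) \<partial>lborel)"
  proof (intro Bochner_Integration.integral_cong refl)
    fix y
    have c2: "?c * ?c = 2 * pi" by simp
    have "?c * v * (?c * y) = 2 * pi * (y * v)" using c2 by (simp add: mult_ac)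
    then have "iexp (?c * v * (0 + ?c * y)) = ex2 (y * v)" by (simp add: ex2_def mult_ac)
    moreover have "- (0 + ?c * y - 0)\<^sup>2 / (2 * 1\<^sup>2) = - pi * y\<^sup>2" by (simp add: power_mult_distrib)
    then have "\<bar>?c\<bar> * std_normal_density (0 + ?c * y) = exp (- pi * y\<^sup>2)"
      by (simp add: std_normal_density_def power_mult_distrib)
    ultimately show "\<bar>?c\<bar> *\<^sub>R ?f (0 + ?c * y) = of_real (exp (- pi * y\<^sup>2)) * ex2 (y * v)"
      by (metis scaleR_conv_of_real scaleR_scaleR)
  qed
  finally show "(\<integral>y. of_real (exp (- pi * y\<^sup>2)) * ex2 (y * v) \<partial>lborel) = of_real (exp (- pi * v\<^sup>2))"
    by (simp add: power_mult_distrib)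
qed

lemma ex2_sum: "ex2 (\<Sum>i\<in>I. f i) = (\<Prod>i\<in>I. ex2 (f i))"
  by (induction I rule: infinite_finite_induct) (auto simp: ex2_add)

lemma gauss_fourier:
  fixes v :: "'a::euclidean_space"
  shows "(\<integral>x. gauss x * ex2 (x \<bullet> v) \<partial>lborel) = gauss v"
proof -
  interpret product_sigma_finite "\<lambda>_::'a. lborel :: real measure" by standard
  define f where "f b y = complex_of_real (exp (- pi * y\<^sup>2)) * ex2 (y * (v \<bullet> b))" for b y
  have eq: "gauss x * ex2 (x \<bullet> v) = (\<Prod>b\<in>Basis. f b (x \<bullet> b))" for x
  proof -
    have "gauss x = (\<Prod>b\<in>Basis. complex_of_real (exp (- pi * (x \<bullet> b)\<^sup>2)))"
      unfolding gauss_def of_real_prod[symmetric]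
      by (subst exp_sum[symmetric], simp) (simp add: euclidean_inner[of x x] sum_distrib_left power2_eq_square sum_negf)
    moreover have "ex2 (x \<bullet> v) = (\<Prod>b\<in>Basis. ex2 ((x \<bullet> b) * (v \<bullet> b)))"
      by (subst euclidean_inner) (rule ex2_sum)
    ultimately show ?thesis by (simp add: f_def prod.distrib)
  qed
  have [measurable]: "f b \<in> borel_measurable borel" for b unfolding f_def by measurable
  have "(\<integral>x. gauss x * ex2 (x \<bullet> v) \<partial>lborel) = (\<integral>x. (\<Prod>b\<in>Basis. f b (x \<bullet> b)) \<partial>lborel)"
    by (simp add: eq)
  also have "\<dots> = (\<integral>g. (\<Prod>b\<in>Basis. f b ((\<Sum>b\<in>Basis. g b *\<^sub>R b) \<bullet> b)) \<partial>(\<Pi>\<^sub>M b\<in>Basis. lborel))"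
    by (subst lborel_eq, subst integral_distr) auto
  also have "\<dots> = (\<integral>g. (\<Prod>b\<in>Basis. f b (g b)) \<partial>(\<Pi>\<^sub>M b\<in>(Basis::'a set). lborel))"
    by (intro Bochner_Integration.integral_cong refl prod.cong arg_cong2[where f = f]) simp
  also have "\<dots> = (\<Prod>b\<in>(Basis::'a set). integral\<^sup>L lborel (f b))"
    by (rule product_integral_prod, simp) (unfold f_def[abs_def], rule gauss_fourier_real)
  also have "\<dots> = (\<Prod>b\<in>(Basis::'a set). complex_of_real (exp (- pi * (v \<bullet> b)\<^sup>2)))"
    by (intro prod.cong refl) (unfold f_def[abs_def], rule gauss_fourier_real)
  also have "\<dots> = gauss v"
    unfolding gauss_def of_real_prod[symmetric]
    by (subst exp_sum[symmetric], simp) (simp add: euclidean_inner[of v v] sum_distrib_left power2_eq_square sum_negf)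
  finally show ?thesis .
qed

lemma integral_gauss: "(\<integral>x. gauss (x::'a::euclidean_space) \<partial>lborel) = 1"
  using gauss_fourier[of 0] by (simp add: gauss_def)

lemma lborel_integral_scale:
  fixes f :: "'a::euclidean_space \<Rightarrow> complex"
  assumes [measurable]: "f \<in> borel_measurable borel" and c: "0 < c"
  shows "(\<integral>x. f x \<partial>lborel) = (\<integral>x. of_real (c ^ DIM('a)) * f (c *\<^sub>R x) \<partial>lborel)"
proof -
  have "(\<integral>x. f x \<partial>lborel) = (\<integral>x. f x \<partial>density (distr lborel borel (\<lambda>x. 0 + c *\<^sub>R x)) (\<lambda>_. ennreal (\<bar>c\<bar> ^ DIM('a))))"
    using lborel_affine[of c "0::'a"] c by simp
  also have "\<dots> = (\<integral>x. of_real (c ^ DIM('a)) * f (c *\<^sub>R x) \<partial>lborel)"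
    using c by (subst integral_density) (auto simp: integral_distr scaleR_conv_of_real)
  finally show ?thesis .
qed

section \<open>Fourier inversion and Moyal identities\<close>

lemma integrable_product_bound:
  fixes F :: "'a::euclidean_space \<times> 'b::euclidean_space \<Rightarrow> complex"
  assumes F [measurable]: "F \<in> borel_measurable borel"
    and a: "integrable lborel a" "\<And>x. 0 \<le> a x" and b: "integrable lborel b" "\<And>y. 0 \<le> b y"
    and le: "\<And>x y. norm (F (x, y)) \<le> a x * b y"
  shows "integrable (lborel \<Otimes>\<^sub>M lborel) F"
proof (rule integrableI_bounded)
  show "F \<in> borel_measurable (lborel \<Otimes>\<^sub>M lborel)" by (simp add: lborel_prod)
  note [measurable] = borel_measurable_integrable[OF a(1)] borel_measurable_integrable[OF b(1)]
  have "(\<integral>\<^sup>+z. ennreal (norm (F z)) \<partial>(lborel \<Otimes>\<^sub>M lborel)) = (\<integral>\<^sup>+x. \<integral>\<^sup>+y. ennreal (norm (F (x, y))) \<partial>lborel \<partial>lborel)"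
    by (rule lborel.nn_integral_fst[symmetric]) (simp add: lborel_prod)
  also have "\<dots> \<le> (\<integral>\<^sup>+x. \<integral>\<^sup>+y. ennreal (a x) * ennreal (b y) \<partial>lborel \<partial>lborel)"
    using le a b by (intro nn_integral_mono) (simp add: ennreal_mult[symmetric] ennreal_leI)
  also have "\<dots> = (\<integral>\<^sup>+x. ennreal (a x) \<partial>lborel) * (\<integral>\<^sup>+y. ennreal (b y) \<partial>lborel)"
    by (simp add: nn_integral_cmult nn_integral_multc)
  also have "\<dots> < \<infinity>"
    using a b by (simp add: nn_integral_eq_integral ennreal_mult_less_top)
  finally show "(\<integral>\<^sup>+z. ennreal (norm (F z)) \<partial>(lborel \<Otimes>\<^sub>M lborel)) < \<infinity>" .
qed

lemma lborel_Fubini_bound: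
  fixes F :: "'a::euclidean_space \<Rightarrow> 'b::euclidean_space \<Rightarrow> complex"
  assumes F: "(\<lambda>(x, y). F x y) \<in> borel_measurable borel"
    and a: "integrable lborel a" "\<And>x. 0 \<le> a x" and b: "integrable lborel b" "\<And>y. 0 \<le> b y"
    and le: "\<And>x y. norm (F x y) \<le> a x * b y"
  shows "(\<integral>x. \<integral>y. F x y \<partial>lborel \<partial>lborel) = (\<integral>y. \<integral>x. F x y \<partial>lborel \<partial>lborel)"
  by (rule lborel_pair.Fubini_integral[symmetric])
    (rule integrable_product_bound[OF F a b], use le in auto)

lemma lborel_integral_prod:
  fixes F :: "'a::euclidean_space \<times> 'b::euclidean_space \<Rightarrow> complex"
  assumes "integrable lborel F"
  shows "(\<integral>z. F z \<partial>lborel) = (\<integral>x. \<integral>y. F (x, y) \<partial>lborel \<partial>lborel)"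
    and "(\<integral>z. F z \<partial>lborel) = (\<integral>y. \<integral>x. F (x, y) \<partial>lborel \<partial>lborel)"
proof -
  have i: "integrable (lborel \<Otimes>\<^sub>M lborel) F" using assms by (simp add: lborel_prod)
  show 1: "(\<integral>z. F z \<partial>lborel) = (\<integral>x. \<integral>y. F (x, y) \<partial>lborel \<partial>lborel)"
    using lborel_pair.integral_fst'[OF i] by (simp add: lborel_prod)
  show "(\<integral>z. F z \<partial>lborel) = (\<integral>y. \<integral>x. F (x, y) \<partial>lborel \<partial>lborel)"
    unfolding 1 using lborel_pair.Fubini_integral[of "\<lambda>x y. F (x, y)"] i by simp
qed

lemma borel_measurable_cnj [measurable (raw)]:
  "f \<in> borel_measurable M \<Longrightarrow> (\<lambda>x. cnj (f x)) \<in> borel_measurable M"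
  by (rule borel_measurable_continuous_on[OF continuous_on_cnj[OF continuous_on_id]])

lemma schwartz_norm_integrable: "f \<in> schwartz \<Longrightarrow> integrable lborel (\<lambda>x. norm (f x))"
  by (intro integrable_norm schwartz_integrable)

text \<open>A Gaussian regulariser makes the double integral absolutely convergent. Removing it by
  dominated convergence gives the left side; exchanging the integrals first gives a convolution of
  the section with narrowing Gaussians, which tends to H (x, t).\<close>

lemma pft_inversion:
  fixes H :: "'a::euclidean_space \<times> 'a \<Rightarrow> complex"
  assumes H: "H \<in> schwartz"
  shows "(\<integral>\<xi>. pft H (x, \<xi>) * ex2 (\<xi> \<bullet> t) \<partial>lborel) = H (x, t)"
proof -
  define h where "h s = H (x, s)" for s
  define hh where "hh \<xi> = pft H (x, \<xi>)" for \<xi>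
  have h: "h \<in> schwartz" unfolding h_def[abs_def] by (rule schwartz_section[OF H])
  have hh: "hh \<in> schwartz" unfolding hh_def[abs_def] by (rule schwartz_section[OF pft_schwartz[OF H]])
  note [measurable] = schwartz_borel[OF h] schwartz_borel[OF hh] schwartz_borel[OF gauss_schwartz]
  have gc: "(\<lambda>n. gauss (c n)) \<longlonglongrightarrow> gauss c0" if "c \<longlonglongrightarrow> c0" for c and c0 :: 'a
    using that schwartz_continuous[OF gauss_schwartz, of UNIV] continuous_on_tendsto_compose by fastforce
  have hc: "(\<lambda>n. h (c n)) \<longlonglongrightarrow> h c0" if "c \<longlonglongrightarrow> c0" for c and c0 :: 'a
    using that schwartz_continuous[OF h, of UNIV] continuous_on_tendsto_compose by fastforce
  have inv: "(\<lambda>n. inverse (real (Suc n)) *\<^sub>R y) \<longlonglongrightarrow> 0" for y :: 'a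
    using tendsto_scaleR[OF LIMSEQ_inverse_real_of_nat tendsto_const[of y]] by simp
  \<comment> \<open>The inversion integral damped by a Gaussian of width n + 1; its limit is
    computed in two ways.\<close>
  define A where "A n = (\<integral>\<xi>. hh \<xi> * ex2 (\<xi> \<bullet> t) * gauss (inverse (real (Suc n)) *\<^sub>R \<xi>) \<partial>lborel)" for n
  have g1: "norm (gauss y) \<le> 1" for y :: 'a by (simp add: gauss_def)
  have "A \<longlonglongrightarrow> (\<integral>\<xi>. hh \<xi> * ex2 (\<xi> \<bullet> t) \<partial>lborel)"
    unfolding A_def
  proof (rule integral_dominated_convergence[where w = "\<lambda>\<xi>. norm (hh \<xi>)"])
    show "AE \<xi> in lborel. (\<lambda>n. hh \<xi> * ex2 (\<xi> \<bullet> t) * gauss (inverse (real (Suc n)) *\<^sub>R \<xi>)) \<longlonglongrightarrow> hh \<xi> * ex2 (\<xi> \<bullet> t)"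
    proof (intro AE_I2)
      fix \<xi> :: 'a
      have "gauss (0::'a) = 1" by (simp add: gauss_def)
      then show "(\<lambda>n. hh \<xi> * ex2 (\<xi> \<bullet> t) * gauss (inverse (real (Suc n)) *\<^sub>R \<xi>)) \<longlonglongrightarrow> hh \<xi> * ex2 (\<xi> \<bullet> t)"
        using tendsto_mult[OF tendsto_const[of "hh \<xi> * ex2 (\<xi> \<bullet> t)"] gc[OF inv, of \<xi>]] by simp
    qed
    show "AE \<xi> in lborel. norm (hh \<xi> * ex2 (\<xi> \<bullet> t) * gauss (inverse (real (Suc n)) *\<^sub>R \<xi>)) \<le> norm (hh \<xi>)" for n
      using g1 by (intro AE_I2) (simp add: norm_mult mult_left_le)
  qed (use schwartz_norm_integrable[OF hh] in \<open>auto intro!: borel_measurable_times\<close>)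
  moreover have "A \<longlonglongrightarrow> h t"
  proof -
    have A: "A n = (\<integral>y. h (t - inverse (real (Suc n)) *\<^sub>R y) * gauss y \<partial>lborel)" for n
    proof -
      let ?c = "inverse (real (Suc n))" and ?N = "real (Suc n)" and ?d = "complex_of_real (real (Suc n) ^ DIM('a))"
      have N: "0 < ?N" "?c *\<^sub>R ?N *\<^sub>R y = y" for y :: 'a by auto
      have gi: "integrable lborel (\<lambda>\<xi>::'a. norm (gauss (?c *\<^sub>R \<xi>)))"
      proof -
        have "(\<lambda>\<xi>::'a. gauss (?c *\<^sub>R \<xi> + 0)) \<in> schwartz"
          by (rule schwartz_affine[OF gauss_schwartz, of _ ?N]) (auto intro: bounded_linear_scaleR_right simp: field_simps)
        then show ?thesis using schwartz_norm_integrable by force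
      qed
      have "A n = (\<integral>\<xi>. (\<integral>s. h s * (ex2 (\<xi> \<bullet> (t - s)) * gauss (?c *\<^sub>R \<xi>)) \<partial>lborel) \<partial>lborel)"
      proof -
        have "hh \<xi> * ex2 (\<xi> \<bullet> t) * gauss (?c *\<^sub>R \<xi>) = (\<integral>s. h s * (ex2 (\<xi> \<bullet> (t - s)) * gauss (?c *\<^sub>R \<xi>)) \<partial>lborel)" for \<xi>
        proof -
          have "ex2 (\<xi> \<bullet> (t - s)) = ex2 (- (\<xi> \<bullet> s)) * ex2 (\<xi> \<bullet> t)" for s
            unfolding ex2_add[symmetric] by (simp add: inner_diff_right)
          then show ?thesis
            by (simp add: hh_def pft_def h_def integral_mult_left_zero[symmetric] mult.assoc del: integral_mult_left_zero)
        qed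
        then show ?thesis by (simp add: A_def)
      qed
      also have "\<dots> = (\<integral>s. (\<integral>\<xi>. h s * (ex2 (\<xi> \<bullet> (t - s)) * gauss (?c *\<^sub>R \<xi>)) \<partial>lborel) \<partial>lborel)"
      proof (rule lborel_Fubini_bound[where a = "\<lambda>\<xi>. norm (gauss (?c *\<^sub>R \<xi>))" and b = "\<lambda>s. norm (h s)"])
        show "(\<lambda>(\<xi>, s). h s * (ex2 (\<xi> \<bullet> (t - s)) * gauss (?c *\<^sub>R \<xi>))) \<in> borel_measurable borel"
          unfolding case_prod_beta' borel_prod[symmetric] by measurable
      qed (use gi schwartz_norm_integrable[OF h] in \<open>auto simp: norm_mult\<close>)
      also have "\<dots> = (\<integral>s. h s * (?d * gauss (?N *\<^sub>R (t - s))) \<partial>lborel)"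
      proof (intro Bochner_Integration.integral_cong refl)
        fix s
        have "(\<integral>\<xi>. ex2 (\<xi> \<bullet> (t - s)) * gauss (?c *\<^sub>R \<xi>) \<partial>lborel)
          = (\<integral>\<xi>. ?d * (ex2 ((?N *\<^sub>R \<xi>) \<bullet> (t - s)) * gauss (?c *\<^sub>R ?N *\<^sub>R \<xi>)) \<partial>lborel)"
          by (rule lborel_integral_scale) auto
        also have "\<dots> = ?d * (\<integral>\<xi>. gauss \<xi> * ex2 (\<xi> \<bullet> (?N *\<^sub>R (t - s))) \<partial>lborel)"
          unfolding N by (simp add: mult.commute)
        also have "\<dots> = ?d * gauss (?N *\<^sub>R (t - s))"
          by (simp only: gauss_fourier)
        finally show "(\<integral>\<xi>. h s * (ex2 (\<xi> \<bullet> (t - s)) * gauss (?c *\<^sub>R \<xi>)) \<partial>lborel) = h s * (?d * gauss (?N *\<^sub>R (t - s)))"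
          by (simp only: integral_mult_right_zero)
      qed
      also have "\<dots> = (\<integral>u. h (t - u) * (?d * gauss (?N *\<^sub>R (t - (t - u)))) \<partial>lborel)"
        by (rule lborel_integral_shift(3)[symmetric]) measurable
      also have "\<dots> = (\<integral>u. ?d * (h (t - ?c *\<^sub>R (?N *\<^sub>R u)) * gauss (?N *\<^sub>R u)) \<partial>lborel)"
        unfolding N by (simp add: ac_simps)
      also have "\<dots> = (\<integral>y. h (t - ?c *\<^sub>R y) * gauss y \<partial>lborel)"
        by (rule lborel_integral_scale[symmetric]) (auto intro!: borel_measurable_times)
      finally show ?thesis .
    qed
    obtain C where C: "0 \<le> C" "\<And>y. norm (h y) \<le> C" using schwartz_bound[OF h, of 0] by auto
    \<comment> \<open>After rescaling, the Gaussian no longer depends on n, and the shrinking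
      argument of h carries the limit; h is bounded, so a multiple of the Gaussian
      dominates.\<close>
    have "(\<lambda>n. \<integral>y. h (t - inverse (real (Suc n)) *\<^sub>R y) * gauss y \<partial>lborel) \<longlonglongrightarrow> (\<integral>y. h t * gauss (y::'a) \<partial>lborel)"
    proof (rule integral_dominated_convergence[where w = "\<lambda>y::'a. C * norm (gauss y)"])
      show "AE y in lborel. (\<lambda>n. h (t - inverse (real (Suc n)) *\<^sub>R y) * gauss y) \<longlonglongrightarrow> h t * gauss y"
      proof (intro AE_I2 tendsto_mult tendsto_const hc)
        fix y :: 'a
        show "(\<lambda>n. t - inverse (real (Suc n)) *\<^sub>R y) \<longlonglongrightarrow> t"
          using tendsto_diff[OF tendsto_const[of t] inv[of y]] by simp
      qed
    qed (use schwartz_norm_integrable[OF gauss_schwartz] C in \<open>auto simp: norm_mult intro!: mult_right_mono borel_measurable_times\<close>)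
    then show ?thesis using A by (simp add: integral_gauss A_def[abs_def] del: of_nat_Suc)
  qed
  ultimately show ?thesis using LIMSEQ_unique by (auto simp: hh_def h_def)
qed

text \<open>Proved in each fibre over x: the transform of H2 is written out, the integrals are
  exchanged, and the inversion formula recovers H1.\<close>

lemma pft_parseval:
  fixes H1 H2 :: "'a::euclidean_space \<times> 'a \<Rightarrow> complex"
  assumes H: "H1 \<in> schwartz" "H2 \<in> schwartz"
  shows "(\<integral>z. pft H1 z * cnj (pft H2 z) \<partial>lborel) = (\<integral>z. H1 z * cnj (H2 z) \<partial>lborel)"
proof -
  have fib: "(\<integral>\<xi>. pft H1 (x, \<xi>) * cnj (pft H2 (x, \<xi>)) \<partial>lborel) = (\<integral>t. H1 (x, t) * cnj (H2 (x, t)) \<partial>lborel)" for x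
  proof -
    have s: "(\<lambda>\<xi>. pft H1 (x, \<xi>)) \<in> schwartz" "(\<lambda>t. H2 (x, t)) \<in> schwartz"
      using H by (auto intro: schwartz_section pft_schwartz)
    have m: "(\<lambda>(\<xi>, t). cnj (g t) * (f \<xi> * ex2 (\<xi> \<bullet> t))) \<in> borel_measurable borel"
      if [measurable]: "f \<in> borel_measurable borel" "g \<in> borel_measurable borel" for f g :: "'a \<Rightarrow> complex"
      unfolding case_prod_beta' borel_prod[symmetric] by measurable
    have "(\<integral>\<xi>. pft H1 (x, \<xi>) * cnj (pft H2 (x, \<xi>)) \<partial>lborel)
      = (\<integral>\<xi>. (\<integral>t. cnj (H2 (x, t)) * (pft H1 (x, \<xi>) * ex2 (\<xi> \<bullet> t)) \<partial>lborel) \<partial>lborel)"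
    proof (intro Bochner_Integration.integral_cong refl)
      fix \<xi>
      have "cnj (pft H2 (x, \<xi>)) = (\<integral>t. cnj (H2 (x, t)) * ex2 (\<xi> \<bullet> t) \<partial>lborel)"
      proof -
        have *: "(\<lambda>t. cnj (H2 (x, t)) * ex2 (\<xi> \<bullet> t)) = (\<lambda>t. cnj (H2 (x, t) * ex2 (- (\<xi> \<bullet> t))))"
          by (simp add: cnj_ex2)
        show ?thesis unfolding pft_def prod.case * by (rule Bochner_Integration.integral_cnj[symmetric])
      qed
      then have "pft H1 (x, \<xi>) * cnj (pft H2 (x, \<xi>)) = (\<integral>t. pft H1 (x, \<xi>) * (cnj (H2 (x, t)) * ex2 (\<xi> \<bullet> t)) \<partial>lborel)"
        by simp
      then show "pft H1 (x, \<xi>) * cnj (pft H2 (x, \<xi>)) = (\<integral>t. cnj (H2 (x, t)) * (pft H1 (x, \<xi>) * ex2 (\<xi> \<bullet> t)) \<partial>lborel)"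
        by (simp add: ac_simps)
    qed
    also have "\<dots> = (\<integral>t. (\<integral>\<xi>. cnj (H2 (x, t)) * (pft H1 (x, \<xi>) * ex2 (\<xi> \<bullet> t)) \<partial>lborel) \<partial>lborel)"
    proof (rule lborel_Fubini_bound[where a = "\<lambda>\<xi>. norm (pft H1 (x, \<xi>))" and b = "\<lambda>t. norm (H2 (x, t))"])
      show "(\<lambda>(\<xi>, t). cnj (H2 (x, t)) * (pft H1 (x, \<xi>) * ex2 (\<xi> \<bullet> t))) \<in> borel_measurable borel"
        using m[OF schwartz_borel[OF s(1)] schwartz_borel[OF s(2)]] .
    qed (use s in \<open>auto simp: norm_mult intro: schwartz_norm_integrable\<close>)
    also have "\<dots> = (\<integral>t. H1 (x, t) * cnj (H2 (x, t)) \<partial>lborel)"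
      by (simp add: pft_inversion[OF H(1)]) (simp add: mult.commute)
    finally show ?thesis .
  qed
  have "integrable lborel (\<lambda>z. pft H1 z * cnj (pft H2 z))" "integrable lborel (\<lambda>z. H1 z * cnj (H2 z))"
    using H by (auto intro!: schwartz_integrable schwartz_mult schwartz_cnj pft_schwartz)
  then show ?thesis by (simp add: lborel_integral_prod(1) fib)
qed

section \<open>Inner products, time-frequency shifts and short-time Fourier transforms of
  functions\<close>

definition ip :: "('a::euclidean_space \<Rightarrow> complex) \<Rightarrow> ('a \<Rightarrow> complex) \<Rightarrow> complex" where
  "ip f g = (\<integral>x. f x * cnj (g x) \<partial>lborel)"

definition tfs :: "'a::euclidean_space \<times> 'a \<Rightarrow> ('a \<Rightarrow> complex) \<Rightarrow> 'a \<Rightarrow> complex" where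
  "tfs w f = modulation (snd w) (translation (fst w) f)"

definition stf :: "('a::euclidean_space \<Rightarrow> complex) \<Rightarrow> ('a \<Rightarrow> complex) \<Rightarrow> 'a \<times> 'a \<Rightarrow> complex" where
  "stf \<phi> f w = ip f (tfs w \<phi>)"

lemma tfs_apply: "tfs w f t = ex2 (t \<bullet> snd w) * f (t - fst w)"
  by (simp add: tfs_def modulation_eq translation_def)

lemma tfs_schwartz: "f \<in> schwartz \<Longrightarrow> tfs w f \<in> schwartz"
  unfolding tfs_def by (intro schwartz_modulation schwartz_translation)

lemma ip_integrable:
  "f \<in> schwartz \<Longrightarrow> g \<in> schwartz \<Longrightarrow> integrable lborel (\<lambda>x. f x * cnj (g x))"
  by (intro schwartz_integrable schwartz_mult schwartz_cnj)

lemma cnj_ip: "cnj (ip f g) = ip g f"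
  unfolding ip_def
  by (subst Bochner_Integration.integral_cnj[symmetric]) (simp add: mult.commute)

lemma ip_self: "ip f f = of_real (\<integral>x. (norm (f x))\<^sup>2 \<partial>lborel)"
  unfolding ip_def complex_norm_square[symmetric] by (rule integral_complex_of_real)

text \<open>A continuous function that is nonzero at a point is nonzero on a ball, and balls have
  positive measure.\<close>

lemma ip_self_ne_0:
  assumes f: "f \<in> schwartz" "f \<noteq> (\<lambda>x. 0)"
  shows "ip f f \<noteq> 0"
proof
  assume 0: "ip f f = 0"
  have i: "integrable lborel (\<lambda>x. (norm (f x))\<^sup>2)"
    using integrable_norm[OF ip_integrable[OF f(1) f(1)]] by (simp add: norm_mult power2_eq_square)
  have "(\<integral>x. (norm (f x))\<^sup>2 \<partial>lborel) = 0" using 0 unfolding ip_self by simp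
  then have "AE x in lborel. (norm (f x))\<^sup>2 = 0"
    by (subst (asm) integral_nonneg_eq_0_iff_AE[OF i]) auto
  then have ae: "AE x in lborel. f x = 0" by simp
  obtain x where x: "f x \<noteq> 0" using f(2) by (auto simp: fun_eq_iff)
  have "open (f -` (- {0}))"
    by (rule open_vimage) (use schwartz_continuous[OF f(1)] in auto)
  then obtain e where e: "0 < e" "ball x e \<subseteq> f -` (- {0})" by (rule openE) (use x in auto)
  have "AE y in lborel. y \<notin> ball x e" using ae
  proof eventually_elim
    fix y assume "f y = 0"
    then show "y \<notin> ball x e" using e(2) by auto
  qed
  then have "emeasure lborel (ball x e) = 0"
    by (subst (asm) AE_iff_measurable[OF _ refl]) (auto simp: ball_def)
  moreover have "0 < unit_ball_vol (real DIM('a)) * e ^ DIM('a)"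
    using e(1) by (intro mult_pos_pos unit_ball_vol_pos zero_less_power) auto
  ultimately show False using emeasure_ball[OF less_imp_le[OF e(1)], of x] by (metis ennreal_eq_0_iff not_le)
qed

lemma stf_window_schwartz:
  fixes f \<phi> :: "'a::euclidean_space \<Rightarrow> complex"
  assumes "f \<in> schwartz" "\<phi> \<in> schwartz"
  shows "(\<lambda>(x, t). f t * cnj (\<phi> (t - x))) \<in> schwartz"
proof -
  let ?L = "\<lambda>z::'a \<times> 'a. (snd z, snd z - fst z)"
  have "norm z \<le> 3 * norm (?L z)" for z
  proof -
    have 1: "norm (snd z) \<le> norm (?L z)" "norm (snd z - fst z) \<le> norm (?L z)"
      using norm_fst_le[of "snd z" "snd z - fst z"] norm_snd_le[of "snd z - fst z" "snd z"] by auto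
    have "norm (fst z) \<le> norm (snd z) + norm (snd z - fst z)"
      using norm_triangle_ineq4[of "snd z" "snd z - fst z"] by simp
    moreover have "norm z \<le> norm (fst z) + norm (snd z)"
      using norm_Pair_le[of "fst z" "snd z"] by simp
    ultimately show ?thesis using 1 by simp
  qed
  from schwartz_affine[OF schwartz_tensor[OF assms(1) schwartz_cnj[OF assms(2)]] _ this, of 0]
  show ?thesis
    by (simp add: case_prod_beta' bounded_linear_Pair bounded_linear_snd bounded_linear_fst bounded_linear_sub)
qed

lemma stf_eq_pft: "stf \<phi> f = pft (\<lambda>(x, t). f t * cnj (\<phi> (t - x)))"
proof
  fix w :: "'a \<times> 'a"
  show "stf \<phi> f w = pft (\<lambda>(x, t). f t * cnj (\<phi> (t - x))) w"
    by (cases w) (simp add: stf_def ip_def pft_def tfs_apply cnj_ex2 inner_commute ac_simps)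
qed

lemma stf_schwartz: "f \<in> schwartz \<Longrightarrow> \<phi> \<in> schwartz \<Longrightarrow> stf \<phi> f \<in> schwartz"
  unfolding stf_eq_pft by (intro pft_schwartz stf_window_schwartz)

text \<open>Pointwise inversion: for fixed x the frequency integral is evaluated by
  \<open>pft_inversion\<close>, and what is left is the integral of |\<phi>(t - x)|^2 over
  x.\<close>

lemma stf_inversion:
  fixes f \<phi> :: "'a::euclidean_space \<Rightarrow> complex"
  assumes S: "f \<in> schwartz" "\<phi> \<in> schwartz"
  shows "(\<integral>w. stf \<phi> f w * tfs w \<phi> t \<partial>lborel) = f t * ip \<phi> \<phi>"
proof -
  let ?H = "\<lambda>(x, t). f t * cnj (\<phi> (t - x))"
  have HS: "?H \<in> schwartz" using S by (rule stf_window_schwartz)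
  have sS: "stf \<phi> f \<in> schwartz" using S by (rule stf_schwartz)
  note [measurable (raw)] = measurable_compose[OF _ schwartz_borel[OF S(2)]]
  have m: "(\<lambda>w. tfs w \<phi> t) \<in> borel_measurable borel"
    unfolding tfs_apply borel_prod[symmetric] by measurable
  obtain C where C: "\<And>y. norm (\<phi> y) \<le> C" using schwartz_bound[OF S(2), of 0] by auto
  have int: "integrable lborel (\<lambda>w. stf \<phi> f w * tfs w \<phi> t)"
  proof (rule Bochner_Integration.integrable_bound)
    show "integrable lborel (\<lambda>w. C * norm (stf \<phi> f w))"
      using schwartz_norm_integrable[OF sS] by simp
    show "AE w in lborel. norm (stf \<phi> f w * tfs w \<phi> t) \<le> norm (C * norm (stf \<phi> f w))"
    proof (intro AE_I2)
      fix w
      have "norm (stf \<phi> f w * tfs w \<phi> t) \<le> norm (stf \<phi> f w) * C"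
        unfolding norm_mult tfs_apply by (intro mult_left_mono) (auto simp: C)
      then show "norm (stf \<phi> f w * tfs w \<phi> t) \<le> norm (C * norm (stf \<phi> f w))"
        by (auto simp: mult.commute intro: order_trans[OF _ abs_ge_self])
    qed
    show "(\<lambda>w. stf \<phi> f w * tfs w \<phi> t) \<in> borel_measurable lborel"
      using m schwartz_borel[OF sS] by (intro borel_measurable_times) auto
  qed
  have "(\<integral>w. stf \<phi> f w * tfs w \<phi> t \<partial>lborel) = (\<integral>x. \<integral>\<xi>. \<phi> (t - x) * (pft ?H (x, \<xi>) * ex2 (\<xi> \<bullet> t)) \<partial>lborel \<partial>lborel)"
    by (subst lborel_integral_prod(1)[OF int]) (simp add: stf_eq_pft tfs_apply ac_simps inner_commute)
  also have "\<dots> = (\<integral>x. f t * (\<phi> (t - x) * cnj (\<phi> (t - x))) \<partial>lborel)"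
  proof (intro Bochner_Integration.integral_cong refl)
    fix x
    show "(\<integral>\<xi>. \<phi> (t - x) * (pft ?H (x, \<xi>) * ex2 (\<xi> \<bullet> t)) \<partial>lborel) = f t * (\<phi> (t - x) * cnj (\<phi> (t - x)))"
      unfolding integral_mult_right_zero pft_inversion[OF HS] by simp
  qed
  also have "\<dots> = f t * (\<integral>x. \<phi> x * cnj (\<phi> x) \<partial>lborel)"
    using lborel_integral_shift(3)[of "\<lambda>x. \<phi> x * cnj (\<phi> x)" t] borel_measurable_integrable[OF ip_integrable[OF S(2,2)]]
    by simp
  finally show ?thesis by (simp add: ip_def)
qed

text \<open>Covariance under time-frequency shifts, by translating the integration variable. The
  phase is recorded because it has to be seen to be measurable and, for Gaussians along a line, to
  be one.\<close>

lemma stf_tfs: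
  assumes "f \<in> schwartz" "\<phi> \<in> schwartz"
  shows "stf \<phi> (tfs w f) w' = ex2 (fst w \<bullet> (snd w - snd w')) * stf \<phi> f (w' - w)"
proof -
  have m: "(\<lambda>t. tfs w f t * cnj (tfs w' \<phi> t)) \<in> borel_measurable borel"
    using borel_measurable_integrable[OF ip_integrable[OF tfs_schwartz[OF assms(1)] tfs_schwartz[OF assms(2)]]] by simp
  have "stf \<phi> (tfs w f) w' = (\<integral>t. tfs w f (t + fst w) * cnj (tfs w' \<phi> (t + fst w)) \<partial>lborel)"
    unfolding stf_def ip_def by (rule lborel_integral_shift(1)[OF m, symmetric])
  also have "\<dots> = (\<integral>t. ex2 (fst w \<bullet> (snd w - snd w')) * (f t * cnj (tfs (w' - w) \<phi> t)) \<partial>lborel)"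
  proof (intro Bochner_Integration.integral_cong refl)
    fix t
    have "ex2 ((t + fst w) \<bullet> snd w) * ex2 (- ((t + fst w) \<bullet> snd w'))
      = ex2 (fst w \<bullet> (snd w - snd w')) * ex2 (- (t \<bullet> (snd w' - snd w)))"
      unfolding ex2_add[symmetric] by (rule arg_cong[of _ _ ex2]) (simp add: inner_simps algebra_simps)
    then show "tfs w f (t + fst w) * cnj (tfs w' \<phi> (t + fst w)) = ex2 (fst w \<bullet> (snd w - snd w')) * (f t * cnj (tfs (w' - w) \<phi> t))"
      using arg_cong[of "t + fst w - fst w'" "t - (fst w' - fst w)" \<phi>]
      by (simp add: tfs_apply cnj_ex2 ac_simps)
  qed
  finally show ?thesis by (simp add: stf_def ip_def)
qed

lemma norm_stf_tfs: "f \<in> schwartz \<Longrightarrow> \<phi> \<in> schwartz \<Longrightarrow> norm (stf \<phi> (tfs w f) w') = norm (stf \<phi> f (w' - w))"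
  by (simp add: stf_tfs norm_mult)

section \<open>Cross-Wigner distributions\<close>

lemma tau_wigner_eq_pft:
  "tau_wigner \<tau> f1 f2 = pft (\<lambda>(x, t). f1 (x + \<tau> *\<^sub>R t) * cnj (f2 (x - (1 - \<tau>) *\<^sub>R t)))"
  by (simp add: tau_wigner_def pft_def ex2_def fun_eq_iff)

lemma wigner_kernel_schwartz:
  fixes f1 f2 :: "'a::euclidean_space \<Rightarrow> complex"
  assumes "f1 \<in> schwartz" "f2 \<in> schwartz"
  shows "(\<lambda>(x, t). f1 (x + \<tau> *\<^sub>R t) * cnj (f2 (x - (1 - \<tau>) *\<^sub>R t))) \<in> schwartz"
proof -
  let ?L = "\<lambda>z::'a \<times> 'a. (fst z + \<tau> *\<^sub>R snd z, fst z - (1 - \<tau>) *\<^sub>R snd z)"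
  \<comment> \<open>The change of variables is inverted explicitly: with u and v its two components,
    t = u - v and x = u - \<tau> t.\<close>
  have n: "norm z \<le> (3 + 2 * \<bar>\<tau>\<bar>) * norm (?L z)" for z
  proof -
    let ?u = "fst z + \<tau> *\<^sub>R snd z" and ?v = "fst z - (1 - \<tau>) *\<^sub>R snd z"
    have 1: "norm ?u \<le> norm (?L z)" "norm ?v \<le> norm (?L z)"
      using norm_fst_le[of ?u ?v] norm_snd_le[of ?v ?u] by auto
    have "snd z = ?u - ?v" by (simp add: algebra_simps)
    then have t: "norm (snd z) \<le> 2 * norm (?L z)"
      using norm_triangle_ineq4[of ?u ?v] 1 by simp
    have "norm (fst z) \<le> norm ?u + \<bar>\<tau>\<bar> * norm (snd z)"
      using norm_triangle_ineq4[of ?u "\<tau> *\<^sub>R snd z"] by simp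
    also have "\<dots> \<le> norm (?L z) + \<bar>\<tau>\<bar> * (2 * norm (?L z))"
      using 1 t by (intro add_mono mult_left_mono) auto
    finally have "norm (fst z) \<le> norm (?L z) + \<bar>\<tau>\<bar> * (2 * norm (?L z))" .
    moreover have "norm z \<le> norm (fst z) + norm (snd z)"
      using norm_Pair_le[of "fst z" "snd z"] by simp
    ultimately show ?thesis using t by (simp add: algebra_simps)
  qed
  have bl: "bounded_linear ?L"
    by (intro bounded_linear_Pair bounded_linear_add bounded_linear_sub bounded_linear_fst
        bounded_linear_snd bounded_linear_const_scaleR)
  show ?thesis
    using schwartz_affine[OF schwartz_tensor[OF assms(1) schwartz_cnj[OF assms(2)]] bl n, of 0]
    by (simp add: case_prod_beta')
qed

lemma tau_wigner_schwartz: "f1 \<in> schwartz \<Longrightarrow> f2 \<in> schwartz \<Longrightarrow> tau_wigner \<tau> f1 f2 \<in> schwartz"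
  unfolding tau_wigner_eq_pft by (intro pft_schwartz wigner_kernel_schwartz)

text \<open>Parseval removes the Fourier transform. Translating x by \<tau> t then removes \<tau>
  altogether, and the remaining double integral is a product of two inner products.\<close>

lemma tau_wigner_moyal:
  fixes f1 f2 g1 g2 :: "'a::euclidean_space \<Rightarrow> complex"
  assumes S: "f1 \<in> schwartz" "f2 \<in> schwartz" "g1 \<in> schwartz" "g2 \<in> schwartz"
  shows "ip (tau_wigner \<tau> f1 f2) (tau_wigner \<tau> g1 g2) = ip f1 g1 * cnj (ip f2 g2)"
proof -
  let ?H = "\<lambda>f1 f2. \<lambda>(x, t). f1 (x + \<tau> *\<^sub>R t) * cnj (f2 (x - (1 - \<tau>) *\<^sub>R t))"
  have HS: "?H f1 f2 \<in> schwartz" "?H g1 g2 \<in> schwartz" using S by (auto intro: wigner_kernel_schwartz)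
  define a where "a x = f1 x * cnj (g1 x)" for x
  define b where "b x = g2 x * cnj (f2 x)" for x
  have ab: "integrable lborel a" "integrable lborel b"
    unfolding a_def b_def using S by (auto intro: ip_integrable)
  note [measurable] = borel_measurable_integrable[OF ab(1), simplified] borel_measurable_integrable[OF ab(2), simplified]
  have am [measurable]: "a \<in> borel_measurable borel" and bm [measurable]: "b \<in> borel_measurable borel"
    using borel_measurable_integrable[OF ab(1)] borel_measurable_integrable[OF ab(2)] by auto
  have "ip (tau_wigner \<tau> f1 f2) (tau_wigner \<tau> g1 g2) = (\<integral>z. ?H f1 f2 z * cnj (?H g1 g2 z) \<partial>lborel)"
    unfolding tau_wigner_eq_pft ip_def by (rule pft_parseval[OF HS])
  also have "\<dots> = (\<integral>t. \<integral>x. a (x + \<tau> *\<^sub>R t) * b (x - (1 - \<tau>) *\<^sub>R t) \<partial>lborel \<partial>lborel)"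
    using lborel_integral_prod(2)[OF ip_integrable[OF HS]] by (simp add: a_def b_def ac_simps)
  also have "\<dots> = (\<integral>t. \<integral>x. a x * b (x - t) \<partial>lborel \<partial>lborel)"
  proof (rule Bochner_Integration.integral_cong[OF refl])
    fix t :: 'a
    have "(\<integral>x. a (x + \<tau> *\<^sub>R t) * b (x - (1 - \<tau>) *\<^sub>R t) \<partial>lborel)
      = (\<integral>x. (\<lambda>x. a x * b (x - t)) (x + \<tau> *\<^sub>R t) \<partial>lborel)"
      by (simp add: algebra_simps)
    also have "\<dots> = (\<integral>x. a x * b (x - t) \<partial>lborel)"
      by (rule lborel_integral_shift(1)) measurable
    finally show "(\<integral>x. a (x + \<tau> *\<^sub>R t) * b (x - (1 - \<tau>) *\<^sub>R t) \<partial>lborel) = (\<integral>x. a x * b (x - t) \<partial>lborel)" .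
  qed
  also have "\<dots> = (\<integral>x. \<integral>t. a x * b (x - t) \<partial>lborel \<partial>lborel)"
  proof (rule lborel_pair.Fubini_integral)
    have m: "(\<lambda>(x, t). a x * b (x - t)) \<in> borel_measurable (lborel \<Otimes>\<^sub>M lborel)"
      unfolding case_prod_beta' by measurable
    show "integrable (lborel \<Otimes>\<^sub>M lborel) (\<lambda>(x, t). a x * b (x - t))"
    proof (rule lborel_pair.Fubini_integrable[OF m])
      have "(\<integral>t. norm (a x * b (x - t)) \<partial>lborel) = norm (a x) * (\<integral>t. norm (b t) \<partial>lborel)" for x
        using lborel_integral_shift(3)[of "\<lambda>t. norm (b t)" x] by (simp add: norm_mult)
      then show "integrable lborel (\<lambda>x. \<integral>t. norm (case (x, t) of (x, t) \<Rightarrow> a x * b (x - t)) \<partial>lborel)"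
        using integrable_norm[OF ab(1)] by simp
      have "integrable lborel (\<lambda>t. b (x - t))" for x
      proof -
        have "integrable (distr lborel borel (\<lambda>t. x - t)) b" using ab(2) by (simp add: lborel_distr_reflect)
        then show ?thesis by (subst (asm) integrable_distr_eq) auto
      qed
      then show "AE x in lborel. integrable lborel (\<lambda>t. case (x, t) of (x, t) \<Rightarrow> a x * b (x - t))" by simp
    qed
  qed
  also have "\<dots> = ip f1 g1 * ip g2 f2"
    using lborel_integral_shift(3)[OF bm] by (simp add: ip_def a_def[symmetric] b_def[symmetric])
  finally show ?thesis by (simp add: cnj_ip)
qed

text \<open>\<open>wig_b\<close> and \<open>wig_a\<close> are the phase-space shifts that a shift of
  the Wigner distribution induces on its first and second argument. Their difference
  \<open>wig_a \<tau> w - wig_b \<tau> w\<close> is (\<zeta>2, - \<zeta>1) for every \<tau>, which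
  is why \<tau> does not appear in the final conditions.\<close>

definition wig_a :: "real \<Rightarrow> ('a::euclidean_space \<times> 'a) \<times> 'a \<times> 'a \<Rightarrow> 'a \<times> 'a" where
  "wig_a \<tau> = (\<lambda>((z1, z2), (\<zeta>1, \<zeta>2)). (z1 + (1 - \<tau>) *\<^sub>R \<zeta>2, z2 - \<tau> *\<^sub>R \<zeta>1))"

definition wig_b :: "real \<Rightarrow> ('a::euclidean_space \<times> 'a) \<times> 'a \<times> 'a \<Rightarrow> 'a \<times> 'a" where
  "wig_b \<tau> = (\<lambda>((z1, z2), (\<zeta>1, \<zeta>2)). (z1 - \<tau> *\<^sub>R \<zeta>2, z2 + (1 - \<tau>) *\<^sub>R \<zeta>1))"

text \<open>Shifting the integration variable by \<open>\<zeta>2\<close> turns a time-frequency shift of the Wigner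
  distribution into time-frequency shifts of its two arguments.\<close>

lemma tfs_tau_wigner:
  fixes f1 f2 :: "'a::euclidean_space \<Rightarrow> complex"
  assumes S: "f1 \<in> schwartz" "f2 \<in> schwartz"
  shows "tfs ((z1, z2), (\<zeta>1, \<zeta>2)) (tau_wigner \<tau> f1 f2)
    = (\<lambda>p. ex2 (z2 \<bullet> \<zeta>2) * tau_wigner \<tau> (tfs (wig_b \<tau> ((z1, z2), (\<zeta>1, \<zeta>2))) f1) (tfs (wig_a \<tau> ((z1, z2), (\<zeta>1, \<zeta>2))) f2) p)"
proof
  fix p :: "'a \<times> 'a"
  obtain x \<xi> where p: "p = (x, \<xi>)" by force
  let ?k = "\<lambda>t. f1 (x - z1 + \<tau> *\<^sub>R t) * cnj (f2 (x - z1 - (1 - \<tau>) *\<^sub>R t)) * ex2 (- ((\<xi> - z2) \<bullet> t))"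
  have km: "?k \<in> borel_measurable borel"
    using borel_measurable_integrable[OF pft_integrable[OF wigner_kernel_schwartz[OF S, of \<tau>], where x = "x - z1" and \<xi> = "\<xi> - z2"]]
    by simp
  have "tfs ((z1, z2), (\<zeta>1, \<zeta>2)) (tau_wigner \<tau> f1 f2) p = ex2 (x \<bullet> \<zeta>1 + \<xi> \<bullet> \<zeta>2) * (\<integral>t. ?k t \<partial>lborel)"
    by (simp add: p tfs_apply tau_wigner_eq_pft pft_def)
  also have "(\<integral>t. ?k t \<partial>lborel) = (\<integral>t. ?k (t + \<zeta>2) \<partial>lborel)"
    by (rule lborel_integral_shift(1)[OF km, symmetric])
  also have "ex2 (x \<bullet> \<zeta>1 + \<xi> \<bullet> \<zeta>2) * (\<integral>t. ?k (t + \<zeta>2) \<partial>lborel) = (\<integral>t. ex2 (x \<bullet> \<zeta>1 + \<xi> \<bullet> \<zeta>2) * ?k (t + \<zeta>2) \<partial>lborel)"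
    by simp
  also have "\<dots> = (\<integral>t. ex2 (z2 \<bullet> \<zeta>2) * (tfs (wig_b \<tau> ((z1, z2), (\<zeta>1, \<zeta>2))) f1 (x + \<tau> *\<^sub>R t)
      * cnj (tfs (wig_a \<tau> ((z1, z2), (\<zeta>1, \<zeta>2))) f2 (x - (1 - \<tau>) *\<^sub>R t)) * ex2 (- (\<xi> \<bullet> t))) \<partial>lborel)"
  proof (intro Bochner_Integration.integral_cong refl)
    fix t :: 'a
    let ?A = "f1 (x - z1 + \<tau> *\<^sub>R (t + \<zeta>2))" and ?B = "cnj (f2 (x - z1 - (1 - \<tau>) *\<^sub>R (t + \<zeta>2)))"
    have e: "ex2 (x \<bullet> \<zeta>1 + \<xi> \<bullet> \<zeta>2) * ex2 (- ((\<xi> - z2) \<bullet> (t + \<zeta>2)))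
      = ex2 (z2 \<bullet> \<zeta>2) * (ex2 ((x + \<tau> *\<^sub>R t) \<bullet> (z2 + (1 - \<tau>) *\<^sub>R \<zeta>1)) * ex2 (- ((x - (1 - \<tau>) *\<^sub>R t) \<bullet> (z2 - \<tau> *\<^sub>R \<zeta>1))) * ex2 (- (\<xi> \<bullet> t)))"
      unfolding ex2_add[symmetric]
      by (rule arg_cong[of _ _ ex2]) (simp add: inner_simps inner_commute algebra_simps)
    have a: "tfs (wig_b \<tau> ((z1, z2), (\<zeta>1, \<zeta>2))) f1 (x + \<tau> *\<^sub>R t) = ex2 ((x + \<tau> *\<^sub>R t) \<bullet> (z2 + (1 - \<tau>) *\<^sub>R \<zeta>1)) * ?A"
      by (simp add: tfs_apply wig_b_def algebra_simps)
    have b: "cnj (tfs (wig_a \<tau> ((z1, z2), (\<zeta>1, \<zeta>2))) f2 (x - (1 - \<tau>) *\<^sub>R t)) = ex2 (- ((x - (1 - \<tau>) *\<^sub>R t) \<bullet> (z2 - \<tau> *\<^sub>R \<zeta>1))) * ?B"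
      by (simp add: tfs_apply wig_a_def cnj_ex2) (simp add: algebra_simps)
    have "ex2 (x \<bullet> \<zeta>1 + \<xi> \<bullet> \<zeta>2) * ?k (t + \<zeta>2) = (ex2 (x \<bullet> \<zeta>1 + \<xi> \<bullet> \<zeta>2) * ex2 (- ((\<xi> - z2) \<bullet> (t + \<zeta>2)))) * (?A * ?B)"
      by (simp only: ac_simps)
    then show "ex2 (x \<bullet> \<zeta>1 + \<xi> \<bullet> \<zeta>2) * ?k (t + \<zeta>2) = ex2 (z2 \<bullet> \<zeta>2) * (tfs (wig_b \<tau> ((z1, z2), (\<zeta>1, \<zeta>2))) f1 (x + \<tau> *\<^sub>R t)
      * cnj (tfs (wig_a \<tau> ((z1, z2), (\<zeta>1, \<zeta>2))) f2 (x - (1 - \<tau>) *\<^sub>R t)) * ex2 (- (\<xi> \<bullet> t)))"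
      unfolding e a b by (simp only: ac_simps)
  qed
  also have "\<dots> = ex2 (z2 \<bullet> \<zeta>2) * tau_wigner \<tau> (tfs (wig_b \<tau> ((z1, z2), (\<zeta>1, \<zeta>2))) f1) (tfs (wig_a \<tau> ((z1, z2), (\<zeta>1, \<zeta>2))) f2) p"
    by (simp add: p tau_wigner_eq_pft pft_def)
  finally show "tfs ((z1, z2), (\<zeta>1, \<zeta>2)) (tau_wigner \<tau> f1 f2) p
    = ex2 (z2 \<bullet> \<zeta>2) * tau_wigner \<tau> (tfs (wig_b \<tau> ((z1, z2), (\<zeta>1, \<zeta>2))) f1) (tfs (wig_a \<tau> ((z1, z2), (\<zeta>1, \<zeta>2))) f2) p" .
qed

text \<open>The shifted window is, up to a phase, again a Wigner distribution, so Moyal's identity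
  factorises the inner product.\<close>

lemma stf_tau_wigner:
  fixes f g \<phi>1 \<phi>2 :: "'a::euclidean_space \<Rightarrow> complex"
  assumes S: "f \<in> schwartz" "g \<in> schwartz" "\<phi>1 \<in> schwartz" "\<phi>2 \<in> schwartz"
  shows "stf (tau_wigner \<tau> \<phi>1 \<phi>2) (tau_wigner \<tau> g f) w
    = ex2 (- (snd (fst w) \<bullet> snd (snd w))) * (stf \<phi>1 g (wig_b \<tau> w) * cnj (stf \<phi>2 f (wig_a \<tau> w)))"
proof -
  obtain z1 z2 \<zeta>1 \<zeta>2 where w: "w = ((z1, z2), (\<zeta>1, \<zeta>2))" by (cases w) auto
  have "stf (tau_wigner \<tau> \<phi>1 \<phi>2) (tau_wigner \<tau> g f) w
    = ex2 (- (z2 \<bullet> \<zeta>2)) * ip (tau_wigner \<tau> g f) (tau_wigner \<tau> (tfs (wig_b \<tau> w) \<phi>1) (tfs (wig_a \<tau> w) \<phi>2))"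
    unfolding stf_def w tfs_tau_wigner[OF S(3,4)] ip_def
    by (subst integral_mult_right_zero[symmetric]) (simp add: cnj_ex2 ac_simps)
  also have "\<dots> = ex2 (- (z2 \<bullet> \<zeta>2)) * (stf \<phi>1 g (wig_b \<tau> w) * cnj (stf \<phi>2 f (wig_a \<tau> w)))"
    using S by (simp add: tau_wigner_moyal tfs_schwartz stf_def)
  finally show ?thesis by (simp add: w)
qed

section \<open>Pairing tempered distributions with integrals of Schwartz functions\<close>

text \<open>Continuity of a family with values in the Schwartz space, expressed seminorm by seminorm
  through \<open>sbd\<close>.\<close>

definition scont :: "('w::metric_space \<Rightarrow> 'a::euclidean_space \<Rightarrow> complex) \<Rightarrow> bool" where
  "scont Y \<longleftrightarrow> (\<forall>w. Y w \<in> schwartz) \<and>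
    (\<forall>w K L e. 0 < e \<longrightarrow> (\<exists>\<delta>>0. \<forall>w'. dist w' w < \<delta> \<longrightarrow> sbd K L e (\<lambda>x. Y w' x - Y w x)))"

lemma scontD:
  assumes "scont Y" "0 < e"
  obtains \<delta> where "0 < \<delta>" "\<And>w'. dist w' w < \<delta> \<Longrightarrow> sbd K L e (\<lambda>x. Y w' x - Y w x)"
  using assms unfolding scont_def by blast

lemma scont_schwartz: "scont Y \<Longrightarrow> Y w \<in> schwartz"
  by (simp add: scont_def)

text \<open>Translation and modulation are varied one after the other: a small change of the
  translation under the new modulation, and a small change of the modulation on the old translate.
  Both difference lemmas apply since \<delta> \<le> 1.\<close>

lemma scont_tfs:
  fixes \<phi> :: "'a::euclidean_space \<Rightarrow> complex"
  assumes \<phi>: "\<phi> \<in> schwartz"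
  shows "scont (\<lambda>w. tfs w \<phi>)"
  unfolding scont_def
proof (intro conjI allI impI tfs_schwartz \<phi>)
  fix w :: "'a \<times> 'a" and K L :: nat and e :: real assume e: "0 < e"
  obtain x \<xi> where w: "w = (x, \<xi>)" by force
  obtain C where C: "0 < C" "sbd K (Suc L) C \<phi>" using sbd_exists[OF \<phi>] by metis
  have hS: "translation x \<phi> \<in> schwartz" by (rule schwartz_translation[OF \<phi>])
  obtain D where D: "0 < D" "sbd (Suc K) L D (translation x \<phi>)" using sbd_exists[OF hS] by metis
  \<comment> \<open>A and B are the Lipschitz constants of the two changes near w; A already allows
    for the new frequency, whose norm is at most |\<xi>| + 1.\<close>
  define A where "A = (1 + 2 * pi * (norm \<xi> + 1)) ^ L * ((1 + norm x) ^ K * (2 ^ K * DIM('a) * C))"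
  define B where "B = (1 + 2 * pi * norm \<xi>) ^ L * (real (Suc L) * (1 + 2 * pi) ^ Suc L * D)"
  have A: "0 \<le> A" using C unfolding A_def by (intro mult_nonneg_nonneg zero_le_power) auto
  have B: "0 \<le> B" using D unfolding B_def by (intro mult_nonneg_nonneg zero_le_power add_nonneg_nonneg) auto
  define \<delta> where "\<delta> = min 1 (e / (A + B + 1))"
  have \<delta>: "0 < \<delta>" using A B e by (simp add: \<delta>_def)
  have "sbd K L e (\<lambda>t. tfs w' \<phi> t - tfs w \<phi> t)" if d: "dist w' w < \<delta>" for w'
  proof -
    obtain x' \<xi>' where w': "w' = (x', \<xi>')" by force
    let ?y = "x' - x" and ?\<eta> = "\<xi>' - \<xi>"
    have "dist x' x \<le> dist w' w" "dist \<xi>' \<xi> \<le> dist w' w"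
      using dist_fst_le[of w' w] dist_snd_le[of w' w] by (auto simp: w w')
    then have y: "norm ?y < \<delta>" "norm ?\<eta> < \<delta>" using d by (auto simp: dist_norm)
    then have y1: "norm ?y \<le> 1" "norm ?\<eta> \<le> 1" by (auto simp: \<delta>_def)
    let ?d1 = "\<lambda>t. translation ?y \<phi> t - \<phi> t"
    have d1S: "?d1 \<in> schwartz" by (intro schwartz_diff schwartz_translation \<phi>)
    have "sbd K L (2 ^ K * DIM('a) * norm ?y * C) ?d1" by (rule sbd_translation_diff[OF \<phi> y1(1) C(2)])
    from sbd_modulation[OF schwartz_translation[OF d1S] sbd_translation[OF d1S this], of \<xi>' x]
    have "sbd K L ((1 + 2 * pi * norm \<xi>') ^ L * ((1 + norm x) ^ K * (2 ^ K * DIM('a) * norm ?y * C)))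
      (modulation \<xi>' (translation x ?d1))" .
    moreover have "(1 + 2 * pi * norm \<xi>') ^ L * ((1 + norm x) ^ K * (2 ^ K * DIM('a) * norm ?y * C)) \<le> A * \<delta>"
    proof -
      have "norm \<xi>' \<le> norm \<xi> + 1" using y1(2) norm_triangle_ineq2[of \<xi>' \<xi>] by simp
      then have "(1 + 2 * pi * norm \<xi>') ^ L \<le> (1 + 2 * pi * (norm \<xi> + 1)) ^ L"
        by (intro power_mono add_left_mono mult_left_mono) auto
      then have "(1 + 2 * pi * norm \<xi>') ^ L * ((1 + norm x) ^ K * (2 ^ K * DIM('a) * norm ?y * C))
        \<le> (1 + 2 * pi * (norm \<xi> + 1)) ^ L * ((1 + norm x) ^ K * (2 ^ K * DIM('a) * norm ?y * C))"
        using C by (intro mult_right_mono) (auto intro!: mult_nonneg_nonneg)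
      also have "\<dots> = A * norm ?y" by (simp add: A_def ac_simps)
      also have "\<dots> \<le> A * \<delta>" using A y by (intro mult_left_mono) auto
      finally show ?thesis .
    qed
    ultimately have 1: "sbd K L (A * \<delta>) (modulation \<xi>' (translation x ?d1))"
      by (rule sbd_mono[OF _ order_refl order_refl])
    let ?d2 = "\<lambda>t. modulation ?\<eta> (translation x \<phi>) t - translation x \<phi> t"
    have d2S: "?d2 \<in> schwartz" by (intro schwartz_diff schwartz_modulation hS)
    have "sbd K L (real (Suc L) * (1 + 2 * pi) ^ Suc L * norm ?\<eta> * D) ?d2"
      by (rule sbd_modulation_diff[OF hS y1(2) D(2)])
    from sbd_modulation[OF d2S this, of \<xi>]
    have "sbd K L ((1 + 2 * pi * norm \<xi>) ^ L * (real (Suc L) * (1 + 2 * pi) ^ Suc L * norm ?\<eta> * D)) (modulation \<xi> ?d2)" .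
    moreover have "(1 + 2 * pi * norm \<xi>) ^ L * (real (Suc L) * (1 + 2 * pi) ^ Suc L * norm ?\<eta> * D) \<le> B * \<delta>"
    proof -
      have "(1 + 2 * pi * norm \<xi>) ^ L * (real (Suc L) * (1 + 2 * pi) ^ Suc L * norm ?\<eta> * D) = B * norm ?\<eta>"
        by (simp add: B_def ac_simps)
      also have "\<dots> \<le> B * \<delta>" using B y by (intro mult_left_mono) auto
      finally show ?thesis .
    qed
    ultimately have 2: "sbd K L (B * \<delta>) (modulation \<xi> ?d2)"
      by (rule sbd_mono[OF _ order_refl order_refl])
    have eq: "(\<lambda>t. tfs w' \<phi> t - tfs w \<phi> t) = (\<lambda>t. modulation \<xi>' (translation x ?d1) t + modulation \<xi> ?d2 t)"
    proof
      fix t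
      have "ex2 (t \<bullet> \<xi>) * ex2 (t \<bullet> ?\<eta>) = ex2 (t \<bullet> \<xi>')"
        unfolding ex2_add[symmetric] by (simp add: inner_diff_right)
      then show "tfs w' \<phi> t - tfs w \<phi> t = modulation \<xi>' (translation x ?d1) t + modulation \<xi> ?d2 t"
        by (simp add: w w' tfs_apply modulation_eq translation_def algebra_simps)
    qed
    have "sbd K L (A * \<delta> + B * \<delta>) (\<lambda>t. tfs w' \<phi> t - tfs w \<phi> t)"
      unfolding eq by (intro sbd_add 1 2 schwartz_modulation schwartz_translation d1S d2S)
    moreover have "A * \<delta> + B * \<delta> \<le> e"
    proof -
      have "(A + B + 1) * \<delta> \<le> (A + B + 1) * (e / (A + B + 1))"
        using A B by (intro mult_left_mono) (auto simp: \<delta>_def)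
      also have "\<dots> = e" using A B by simp
      finally show ?thesis using \<delta> by (simp add: algebra_simps)
    qed
    ultimately show ?thesis by (rule sbd_mono[OF _ order_refl order_refl])
  qed
  then show "\<exists>\<delta>>0. \<forall>w'. dist w' w < \<delta> \<longrightarrow> sbd K L e (\<lambda>t. tfs w' \<phi> t - tfs w \<phi> t)"
    using \<delta> by blast
qed

lemma scont_mult:
  fixes Y :: "'w::metric_space \<Rightarrow> 'a::euclidean_space \<Rightarrow> complex"
  assumes Y: "scont Y" and c: "continuous_on UNIV c"
  shows "scont (\<lambda>w x. c w * Y w x)"
  unfolding scont_def
proof (intro conjI allI impI schwartz_cmult scont_schwartz[OF Y])
  fix w :: 'w and K L :: nat and e :: real assume e: "0 < e"
  have YS: "Y v \<in> schwartz" for v by (rule scont_schwartz[OF Y])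
  obtain C where C: "0 < C" "sbd K L C (Y w)" using sbd_exists[OF YS] by metis
  define e1 where "e1 = e / (2 * (norm (c w) + 1))"
  have np: "0 < norm (c w) + 1" by (intro add_nonneg_pos) auto
  have e1: "0 < e1" using e np by (simp add: e1_def)
  obtain \<delta>1 where \<delta>1: "0 < \<delta>1" "\<And>w'. dist w' w < \<delta>1 \<Longrightarrow> sbd K L e1 (\<lambda>x. Y w' x - Y w x)"
    using scontD[OF Y e1] by metis
  define e2 where "e2 = min 1 (e / (2 * C))"
  have e2: "0 < e2" using e C by (simp add: e2_def)
  have "isCont c w" using c by (simp add: continuous_on_eq_continuous_at)
  then obtain \<delta>2 where \<delta>2: "0 < \<delta>2" "\<And>w'. dist w' w < \<delta>2 \<Longrightarrow> dist (c w') (c w) < e2"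
    using e2 unfolding continuous_at_eps_delta by metis
  have "sbd K L e (\<lambda>x. c w' * Y w' x - c w * Y w x)" if d: "dist w' w < min \<delta>1 \<delta>2" for w'
  proof -
    have cc: "norm (c w' - c w) < e2" using \<delta>2(2)[of w'] d by (simp add: dist_norm)
    have "norm (c w') \<le> norm (c w) + 1"
      using cc norm_triangle_ineq2[of "c w'" "c w"] by (simp add: e2_def)
    then have "norm (c w') * e1 \<le> (norm (c w) + 1) * e1" using e1 by (intro mult_right_mono) auto
    also have "\<dots> = e / 2" using np by (simp add: e1_def field_simps)
    finally have "sbd K L (e / 2) (\<lambda>x. c w' * (Y w' x - Y w x))"
      using \<delta>1(2)[of w'] d by (intro sbd_cmult[OF schwartz_diff[OF YS YS]]) auto
    moreover have "norm (c w' - c w) * C \<le> e / 2"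
    proof -
      have "norm (c w' - c w) * C \<le> (e / (2 * C)) * C"
        using cc C by (intro mult_right_mono) (auto simp: e2_def)
      then show ?thesis using C by simp
    qed
    then have "sbd K L (e / 2) (\<lambda>x. (c w' - c w) * Y w x)"
      by (rule sbd_cmult[OF YS C(2)])
    ultimately have "sbd K L (e / 2 + e / 2) (\<lambda>x. c w' * (Y w' x - Y w x) + (c w' - c w) * Y w x)"
      by (intro sbd_add schwartz_cmult schwartz_diff YS)
    then show ?thesis by (simp add: algebra_simps)
  qed
  then show "\<exists>\<delta>>0. \<forall>w'. dist w' w < \<delta> \<longrightarrow> sbd K L e (\<lambda>x. c w' * Y w' x - c w * Y w x)"
    using \<delta>1(1) \<delta>2(1) by (intro exI[of _ "min \<delta>1 \<delta>2"]) auto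
qed

lemma tempered_scont_continuous:
  assumes u: "u \<in> tempered" and Y: "scont Y"
  shows "continuous_on UNIV (\<lambda>w. u (Y w))"
proof -
  obtain K L C where C: "0 < C" "\<And>f c. f \<in> schwartz \<Longrightarrow> 0 < c \<Longrightarrow> sbd K L c f \<Longrightarrow> norm (u f) \<le> C * c"
    using tempered_bound[OF u] by metis
  have YS: "Y v \<in> schwartz" for v by (rule scont_schwartz[OF Y])
  have "\<exists>d>0. \<forall>w'. dist w' w < d \<longrightarrow> dist (u (Y w')) (u (Y w)) < e" if e: "0 < e" for w e
  proof -
    have e': "0 < e / (2 * C)" using e C by simp
    obtain \<delta> where \<delta>: "0 < \<delta>" "\<And>w'. dist w' w < \<delta> \<Longrightarrow> sbd K L (e / (2 * C)) (\<lambda>x. Y w' x - Y w x)"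
      using scontD[OF Y e'] by metis
    have "dist (u (Y w')) (u (Y w)) < e" if "dist w' w < \<delta>" for w'
    proof -
      have "norm (u (\<lambda>x. Y w' x - Y w x)) \<le> C * (e / (2 * C))"
        by (rule C(2)[OF schwartz_diff[OF YS YS] e' \<delta>(2)[OF that]])
      then have "norm (u (Y w') - u (Y w)) \<le> e / 2" using C by (simp add: tempered_diff[OF u YS YS])
      then show ?thesis using e by (simp add: dist_norm)
    qed
    then show ?thesis using \<delta>(1) by blast
  qed
  then show ?thesis unfolding continuous_on_iff by auto
qed

lemma iter_partial_scont_continuous:
  assumes Y: "scont Y" and bs: "bs \<in> lists Basis"
  shows "continuous_on UNIV (\<lambda>w. iter_partial bs (Y w) x)"
proof -
  have "\<exists>d>0. \<forall>w'. dist w' w < d \<longrightarrow> dist (iter_partial bs (Y w') x) (iter_partial bs (Y w) x) < e"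
    if e: "0 < e" for w e
  proof -
    obtain \<delta> where \<delta>: "0 < \<delta>" "\<And>w'. dist w' w < \<delta> \<Longrightarrow> sbd 0 (length bs) (e / 2) (\<lambda>x. Y w' x - Y w x)"
      using scontD[OF Y, of "e / 2"] e by (metis half_gt_zero)
    have "dist (iter_partial bs (Y w') x) (iter_partial bs (Y w) x) < e" if "dist w' w < \<delta>" for w'
    proof -
      have "norm (iter_partial bs (\<lambda>x. Y w' x - Y w x) x) \<le> e / 2"
        using \<delta>(2)[OF that] bs by (auto simp: sbd_def)
      then show ?thesis
        using e by (simp add: iter_partial_diff[OF scont_schwartz[OF Y] scont_schwartz[OF Y] bs] dist_norm)
    qed
    then show ?thesis using \<delta>(1) by blast
  qed
  then show ?thesis unfolding continuous_on_iff by auto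
qed

text \<open>The best constant in \<open>sbd\<close>. The Riemann sum argument needs the seminorm of
  an error as a measurable real function, which a predicate cannot provide.\<close>

definition snorm :: "nat \<Rightarrow> nat \<Rightarrow> ('a::euclidean_space \<Rightarrow> complex) \<Rightarrow> real" where
  "snorm K L f = Inf {c. sbd K L c f}"

lemma snorm_le: "sbd K L c f \<Longrightarrow> snorm K L f \<le> c"
  unfolding snorm_def by (rule cInf_lower) (auto intro!: bdd_belowI[of _ 0] sbd_nonneg)

lemma snorm_nonneg: "f \<in> schwartz \<Longrightarrow> 0 \<le> snorm K L f"
  unfolding snorm_def by (rule cInf_greatest) (use sbd_exists[of f K L] in \<open>auto intro: sbd_nonneg\<close>)

lemma sbd_snorm:
  assumes "f \<in> schwartz"
  shows "sbd K L (snorm K L f) f"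
  unfolding sbd_def
proof (intro ballI impI allI)
  fix bs x assume bs: "bs \<in> lists (Basis :: 'a set)" "length bs \<le> L"
  obtain C where "sbd K L C f" using sbd_exists[OF assms] by blast
  then have "{c. sbd K L c f} \<noteq> {}" by blast
  then show "(1 + norm x) ^ K * norm (iter_partial bs f x) \<le> snorm K L f"
    unfolding snorm_def by (rule cInf_greatest) (use bs in \<open>auto simp: sbd_def\<close>)
qed

lemma snorm_triangle:
  assumes "f \<in> schwartz" "g \<in> schwartz"
  shows "snorm K L (\<lambda>x. f x + g x) \<le> snorm K L f + snorm K L g"
  by (intro snorm_le sbd_add sbd_snorm assms)

lemma snorm_minus_commute:
  assumes "f \<in> schwartz" "g \<in> schwartz"
  shows "snorm K L (\<lambda>x. f x - g x) = snorm K L (\<lambda>x. g x - f x)"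
proof -
  have "snorm K L (\<lambda>x. f x - g x) \<le> snorm K L (\<lambda>x. g x - f x)"
    if "f \<in> schwartz" "g \<in> schwartz" for f g :: "'a \<Rightarrow> complex"
    using sbd_cmult[OF schwartz_diff[OF that(2,1)] sbd_snorm[OF schwartz_diff[OF that(2,1)]], of "-1" K L]
    by (intro snorm_le) simp
  then show ?thesis using assms by (intro antisym)
qed

text \<open>Joint continuity in both parameters, so that substituting a measurable map for one of
  them leaves a measurable function.\<close>

lemma scont_snorm_diff_continuous:
  fixes Y Z :: "'w::euclidean_space \<Rightarrow> 'a::euclidean_space \<Rightarrow> complex"
  assumes Y: "scont Y" and Z: "scont Z"
  shows "continuous_on UNIV (\<lambda>p. snorm K L (\<lambda>x. Y (fst p) x - Z (snd p) x))"
proof -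
  have YS: "Y v \<in> schwartz" "Z v \<in> schwartz" for v using Y Z by (auto intro: scont_schwartz)
  let ?q = "\<lambda>p. snorm K L (\<lambda>x. Y (fst p) x - Z (snd p) x)"
  have tri: "?q p' - ?q p \<le> snorm K L (\<lambda>x. Y (fst p') x - Y (fst p) x) + snorm K L (\<lambda>x. Z (snd p) x - Z (snd p') x)" for p p'
  proof -
    have "?q p' = snorm K L (\<lambda>x. (Y (fst p') x - Y (fst p) x) + ((Y (fst p) x - Z (snd p) x) + (Z (snd p) x - Z (snd p') x)))"
      by simp
    also have "\<dots> \<le> snorm K L (\<lambda>x. Y (fst p') x - Y (fst p) x) + snorm K L (\<lambda>x. (Y (fst p) x - Z (snd p) x) + (Z (snd p) x - Z (snd p') x))"
      by (intro snorm_triangle schwartz_add schwartz_diff YS)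
    also have "snorm K L (\<lambda>x. (Y (fst p) x - Z (snd p) x) + (Z (snd p) x - Z (snd p') x)) \<le> ?q p + snorm K L (\<lambda>x. Z (snd p) x - Z (snd p') x)"
      by (intro snorm_triangle schwartz_add schwartz_diff YS)
    finally show ?thesis by simp
  qed
  have "\<exists>d>0. \<forall>p'. dist p' p < d \<longrightarrow> dist (?q p') (?q p) < e" if e: "0 < e" for p e
  proof -
    have e3: "0 < e / 3" using e by simp
    obtain d1 where d1: "0 < d1" "\<And>w'. dist w' (fst p) < d1 \<Longrightarrow> sbd K L (e / 3) (\<lambda>x. Y w' x - Y (fst p) x)"
      using scontD[OF Y e3] by metis
    obtain d2 where d2: "0 < d2" "\<And>w'. dist w' (snd p) < d2 \<Longrightarrow> sbd K L (e / 3) (\<lambda>x. Z w' x - Z (snd p) x)"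
      using scontD[OF Z e3] by metis
    have "dist (?q p') (?q p) < e" if d: "dist p' p < min d1 d2" for p'
    proof -
      have "snorm K L (\<lambda>x. Y (fst p') x - Y (fst p) x) \<le> e / 3"
        using d dist_fst_le[of p' p] by (intro snorm_le d1) auto
      moreover have "snorm K L (\<lambda>x. Z (snd p') x - Z (snd p) x) \<le> e / 3"
        using d dist_snd_le[of p' p] by (intro snorm_le d2) auto
      ultimately show ?thesis
        using tri[of p' p] tri[of p p'] e
          snorm_minus_commute[OF YS(1) YS(1), of K L "fst p'" "fst p"] snorm_minus_commute[OF YS(2) YS(2), of K L "snd p'" "snd p"]
        by (simp add: dist_real_def)
    qed
    then show ?thesis using d1(1) d2(1) by (intro exI[of _ "min d1 d2"]) auto
  qed
  then show ?thesis unfolding continuous_on_iff by auto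
qed

lemma scont_zero: "scont (\<lambda>w x. 0)"
  using schwartz_zero by (auto simp: scont_def sbd_def iter_partial_zero intro!: exI[of _ "1::real"])

lemma snorm_zero: "snorm K L (\<lambda>x. 0) = 0"
proof (rule antisym)
  show "snorm K L (\<lambda>x. 0) \<le> 0"
    by (rule snorm_le) (simp add: sbd_def iter_partial_zero)
  show "0 \<le> snorm K L (\<lambda>x. 0)" by (rule snorm_nonneg[OF schwartz_zero])
qed

text \<open>A Riemann sum written as an integral: the cells are the fibres of s inside A, and the
  values of s serve as the sample points. Both readings are needed, the sum for linearity and the
  integral for convergence.\<close>

lemma integral_simple_compose:
  fixes s :: "'w::euclidean_space \<Rightarrow> 'w" and \<psi> :: "'w \<Rightarrow> complex"
  assumes s: "simple_function lborel s" and A: "A \<in> sets borel" "emeasure lborel A < \<infinity>"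
  shows "(\<integral>w. indicator A w * \<psi> (s w) \<partial>lborel) = (\<Sum>v\<in>range s. of_real (measure lborel (A \<inter> s -` {v})) * \<psi> v)"
    and "(\<lambda>w. indicator A w * \<psi> (s w)) \<in> borel_measurable lborel"
proof -
  have fin: "finite (range s)" using simple_functionD(1)[OF s] by simp
  have ms: "A \<inter> s -` {v} \<in> sets lborel" for v
    using simple_functionD(2)[OF s, of "{v}"] A by auto
  have em: "emeasure lborel (A \<inter> s -` {v}) < \<infinity>" for v
    using emeasure_mono[of "A \<inter> s -` {v}" A lborel] A by (auto intro: le_less_trans)
  have eq: "indicator A w * \<psi> (s w) = (\<Sum>v\<in>range s. indicator (A \<inter> s -` {v}) w * \<psi> v)" for w
  proof -
    have "(\<Sum>v\<in>range s. indicator (A \<inter> s -` {v}) w * \<psi> v) = (\<Sum>v\<in>range s. if v = s w then indicator A w * \<psi> v else 0)"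
      by (intro sum.cong) (auto simp: indicator_def)
    then show ?thesis using fin by simp
  qed
  show "(\<integral>w. indicator A w * \<psi> (s w) \<partial>lborel) = (\<Sum>v\<in>range s. of_real (measure lborel (A \<inter> s -` {v})) * \<psi> v)"
  proof -
    have hb: "has_bochner_integral lborel (\<lambda>w. indicator (A \<inter> s -` {v}) w * \<psi> v) (of_real (measure lborel (A \<inter> s -` {v})) * \<psi> v)" for v
    proof -
      have "(\<lambda>w. indicator (A \<inter> s -` {v}) w * \<psi> v) = (\<lambda>w. indicator (A \<inter> s -` {v}) w *\<^sub>R \<psi> v)"
        by (auto simp: fun_eq_iff indicator_def)
      then show ?thesis
        using has_bochner_integral_indicator[OF ms em, of v "\<psi> v"] by (simp add: scaleR_conv_of_real)
    qed
    show ?thesis unfolding eq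
      by (subst Bochner_Integration.integral_sum)
        (use hb in \<open>auto simp: has_bochner_integral_iff intro!: sum.cong\<close>)
  qed
  show "(\<lambda>w. indicator A w * \<psi> (s w)) \<in> borel_measurable lborel"
    unfolding eq using ms by (intro borel_measurable_sum borel_measurable_times borel_measurable_indicator borel_measurable_const)
qed

text \<open>A continuous family whose seminorms are all dominated by multiples of the integrable
  weight, together with its pointwise integral F. These are the hypotheses under which F is also the
  integral of Y in the Schwartz topology.\<close>

locale schwartz_family =
  fixes Y :: "'w::euclidean_space \<Rightarrow> 'a::euclidean_space \<Rightarrow> complex" and F
  assumes cont: "scont Y"
    and decay: "\<And>K L. \<exists>C>0. \<forall>w. sbd K L (C * wt w) (Y w)"
    and F: "F \<in> schwartz" "\<And>x. F x = (\<integral>w. Y w x \<partial>lborel)"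
begin

lemma YS: "Y w \<in> schwartz"
  using cont by (rule scont_schwartz)

lemma iter_bound:
  assumes "bs \<in> lists Basis"
  shows "\<exists>C>0. \<forall>w x. norm (iter_partial bs (Y w) x) \<le> C * wt w"
proof -
  obtain C where C: "0 < C" "\<forall>w. sbd 0 (length bs) (C * wt w) (Y w)"
    using decay[of 0 "length bs"] by blast
  have "norm (iter_partial bs (Y w) x) \<le> C * wt w" for w x
    using C(2)[rule_format, of w] assms by (simp add: sbd_def)
  then show ?thesis using C(1) by (intro exI[of _ C]) simp
qed

lemma iter_integrable:
  assumes bs: "bs \<in> lists Basis"
  shows "integrable lborel (\<lambda>w. iter_partial bs (Y w) x)"
proof -
  obtain C where C: "\<forall>w x. norm (iter_partial bs (Y w) x) \<le> C * wt w"
    using iter_bound[OF bs] by blast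
  from C[rule_format] show ?thesis
    by (rule integrable_wt_bound[OF borel_measurable_continuous_onI[OF iter_partial_scont_continuous[OF cont bs]]])
qed

text \<open>The seminorms of a Riemann sum error involve derivatives of F, which must therefore be
  integrals of the derivatives of Y.\<close>

lemma iter_integral:
  assumes "bs \<in> lists Basis"
  shows "iter_partial bs F x = (\<integral>w. iter_partial bs (Y w) x \<partial>lborel)"
  using assms
proof (induction bs arbitrary: x)
  case Nil
  then show ?case by (simp add: F)
next
  case (Cons b bs)
  then have b: "b \<in> Basis" and bs: "bs \<in> lists Basis" by auto
  have "\<forall>b\<in>Basis. \<exists>C. 0 < C \<and> (\<forall>w x. norm (pd b (iter_partial bs (Y w)) x) \<le> C * wt w)"
  proof
    fix b :: 'a assume "b \<in> Basis"
    then have "b # bs \<in> lists Basis" using bs by simp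
    from iter_bound[OF this] show "\<exists>C. 0 < C \<and> (\<forall>w x. norm (pd b (iter_partial bs (Y w)) x) \<le> C * wt w)"
      by simp
  qed
  then obtain C where C0: "\<forall>b\<in>Basis. 0 < C b \<and> (\<forall>w x. norm (pd b (iter_partial bs (Y w)) x) \<le> C b * wt w)"
    by (rule bchoice[THEN exE])
  then have C: "\<And>b. b \<in> Basis \<Longrightarrow> 0 < C b"
    "\<And>b w x. b \<in> Basis \<Longrightarrow> norm (pd b (iter_partial bs (Y w)) x) \<le> C b * wt w" by auto
  have C': "norm (pd b (iter_partial bs (Y w)) x) \<le> (\<Sum>b\<in>Basis. C b) * wt w" if "b \<in> Basis" for b w x
    using C(1) that by (intro order_trans[OF C(2)] mult_right_mono member_le_sum) (auto intro: less_imp_le)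
  have "((\<lambda>x. \<integral>w. iter_partial bs (Y w) x \<partial>lborel) has_derivative
      (\<lambda>h. \<Sum>b\<in>Basis. of_real (h \<bullet> b) * (\<integral>w. pd b (iter_partial bs (Y w)) x \<partial>lborel))) (at x)" for x
  proof (rule integral_pd[where B = "\<lambda>w. (\<Sum>b\<in>Basis. C b) * wt w"])
    show "iter_partial bs (Y m) differentiable at y" for m y
      by (intro schwartz_differentiable iter_partial_schwartz YS bs)
    show "integrable lborel (\<lambda>m. iter_partial bs (Y m) y)" for y by (rule iter_integrable[OF bs])
    show "(\<lambda>m. pd b (iter_partial bs (Y m)) x) \<in> borel_measurable lborel" if "b \<in> Basis" for b
      using borel_measurable_integrable[OF iter_integrable[of "b # bs" x]] bs that by simp
    show "integrable lborel (\<lambda>w::'w. (\<Sum>b\<in>Basis. C b) * wt w)" by simp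
  qed (rule C')
  then have "pd b (\<lambda>x. \<integral>w. iter_partial bs (Y w) x \<partial>lborel) = (\<lambda>x. \<integral>w. pd b (iter_partial bs (Y w)) x \<partial>lborel)"
    by (rule pd_of_sum_derivative) (rule b)
  moreover have "iter_partial bs F = (\<lambda>x. \<integral>w. iter_partial bs (Y w) x \<partial>lborel)"
    by (rule ext) (rule Cons.IH)
  ultimately show ?case by simp
qed

lemma tempered_integrable:
  assumes u: "u \<in> tempered"
  shows "integrable lborel (\<lambda>w. u (Y w))"
proof -
  obtain K L C where C: "0 < C" "\<And>f c. f \<in> schwartz \<Longrightarrow> 0 < c \<Longrightarrow> sbd K L c f \<Longrightarrow> norm (u f) \<le> C * c"
    using tempered_bound[OF u] by metis
  obtain D where D: "0 < D" "\<And>w. sbd K L (D * wt w) (Y w)" using decay by blast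
  have "norm (u (Y w)) \<le> (C * D) * wt w" for w
    using C(2)[OF YS _ D(2)] D(1) wt_pos[of w] by (simp add: mult.assoc)
  then show ?thesis
    by (rule integrable_wt_bound[OF borel_measurable_continuous_onI[OF tempered_scont_continuous[OF u cont]]])
qed

text \<open>Riemann sums converge in every Schwartz seminorm and, by continuity, after applying \<open>u\<close>.\<close>

lemma tempered_integral:
  assumes u: "u \<in> tempered"
  shows "u F = (\<integral>w. u (Y w) \<partial>lborel)"
proof -
  obtain K L C where C: "0 < C" "\<And>f c. f \<in> schwartz \<Longrightarrow> 0 < c \<Longrightarrow> sbd K L c f \<Longrightarrow> norm (u f) \<le> C * c"
    using tempered_bound[OF u] by metis
  obtain D where D: "0 < D" "\<And>w. sbd K L (D * wt w) (Y w)" using decay by blast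
  \<comment> \<open>Simple functions approximating the identity map; they provide cells and sample
    points at the same time.\<close>
  obtain s :: "nat \<Rightarrow> 'w \<Rightarrow> 'w" where s0: "\<forall>i. simple_function lborel (s i)" "\<forall>w. (\<lambda>i. s i w) \<longlonglongrightarrow> w"
    using borel_measurable_implies_sequence_metric[of "\<lambda>w::'w. w" lborel 0] by auto
  note s = s0[rule_format]
  have sm [measurable]: "s i \<in> borel_measurable borel" for i
    using borel_measurable_simple_function[OF s(1)[of i]] by simp
  \<comment> \<open>On this bounded set the sample point lies within distance one of w, so the cells
    have finite measure and the weight at the sample point is comparable with
    \<open>wt w\<close>.\<close>
  define A where "A i = {w. norm w \<le> real i \<and> dist (s i w) w \<le> 1}" for i
  have Am [measurable]: "A i \<in> sets borel" for i unfolding A_def by measurable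
  have Afin: "emeasure lborel (A i) < \<infinity>" for i
  proof -
    have "emeasure lborel (A i) \<le> emeasure lborel (cball (0::'w) (real i))"
      by (intro emeasure_mono) (auto simp: A_def)
    then show ?thesis using emeasure_lborel_cball_finite[of "0::'w" "real i"] by (rule le_less_trans)
  qed
  have Aev: "\<forall>\<^sub>F i in sequentially. w \<in> A i" for w
  proof -
    have "\<forall>\<^sub>F i in sequentially. dist (s i w) w < 1" using s(2)[of w] by (auto simp: tendsto_iff)
    moreover have "\<forall>\<^sub>F i in sequentially. norm w \<le> real i"
      using eventually_ge_at_top[of "nat \<lceil>norm w\<rceil>"] by eventually_elim linarith
    ultimately show ?thesis by eventually_elim (simp add: A_def)
  qed
  have wtA: "wt (s i w) \<le> 2 ^ (2 * DIM('w)) * wt w" if "w \<in> A i" for i w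
  proof -
    have "norm (s i w - w) \<le> 1" using that by (simp add: A_def dist_norm)
    then have "(1 + norm (s i w - w)) ^ (2 * DIM('w)) \<le> 2 ^ (2 * DIM('w))" by (intro power_mono) auto
    then have "(1 + norm (s i w - w)) ^ (2 * DIM('w)) * wt w \<le> 2 ^ (2 * DIM('w)) * wt w" by (intro mult_right_mono) auto
    then show ?thesis using wt_peetre[of w "s i w - w"] by simp
  qed
  define E where "E = (2::real) ^ (2 * DIM('w))"
  have E: "0 < E" by (simp add: E_def)
  define m where "m i v = measure lborel (A i \<inter> s i -` {v})" for i v
  define FF where "FF i = (\<lambda>x. \<Sum>v\<in>range (s i). of_real (m i v) * Y v x)" for i
  have fin: "finite (range (s i))" for i using simple_functionD(1)[OF s(1)[of i]] by simp
  have FFS: "FF i \<in> schwartz" for i unfolding FF_def by (intro schwartz_sum schwartz_cmult YS)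
  have uFF: "u (FF i) = (\<integral>w. indicator (A i) w * u (Y (s i w)) \<partial>lborel)" for i
  proof -
    have "u (FF i) = (\<Sum>v\<in>range (s i). u (\<lambda>x. of_real (m i v) * Y v x))"
      unfolding FF_def by (rule tempered_sum[OF u schwartz_cmult[OF YS] fin])
    also have "\<dots> = (\<Sum>v\<in>range (s i). of_real (m i v) * u (Y v))"
      by (simp only: tempered_cmult[OF u YS] complex_cnj_complex_of_real)
    also have "\<dots> = (\<integral>w. indicator (A i) w * u (Y (s i w)) \<partial>lborel)"
      unfolding m_def by (rule integral_simple_compose(1)[OF s(1) Am Afin, symmetric])
    finally show ?thesis .
  qed
  have "(\<lambda>i. u (FF i)) \<longlonglongrightarrow> (\<integral>w. u (Y w) \<partial>lborel)"
    unfolding uFF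
  proof (rule integral_dominated_convergence[where w = "\<lambda>w. C * (D * (E * wt w))"])
    show "(\<lambda>w. indicator (A i) w * u (Y (s i w))) \<in> borel_measurable lborel" for i
      by (rule integral_simple_compose(2)[OF s(1) Am Afin])
    show "AE w in lborel. (\<lambda>i. indicator (A i) w * u (Y (s i w))) \<longlonglongrightarrow> u (Y w)"
    proof (intro AE_I2)
      fix w
      have "(\<lambda>i. u (Y (s i w))) \<longlonglongrightarrow> u (Y w)"
        using continuous_on_tendsto_compose[OF tempered_scont_continuous[OF u cont] s(2)[of w]] by simp
      moreover have "\<forall>\<^sub>F i in sequentially. u (Y (s i w)) = indicator (A i) w * u (Y (s i w))"
        using Aev[of w] by eventually_elim simp
      ultimately show "(\<lambda>i. indicator (A i) w * u (Y (s i w))) \<longlonglongrightarrow> u (Y w)"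
        by (rule Lim_transform_eventually)
    qed
    show "AE w in lborel. norm (indicator (A i) w * u (Y (s i w))) \<le> C * (D * (E * wt w))" for i
    proof (intro AE_I2)
      fix w
      show "norm (indicator (A i) w * u (Y (s i w))) \<le> C * (D * (E * wt w))"
      proof (cases "w \<in> A i")
        case True
        have "norm (u (Y (s i w))) \<le> C * (D * wt (s i w))"
          using C(2)[OF YS _ D(2)] D(1) wt_pos[of "s i w"] by simp
        also have "\<dots> \<le> C * (D * (E * wt w))"
          using wtA[OF True] C(1) D(1) unfolding E_def by (intro mult_left_mono) simp_all
        finally show ?thesis using True by simp
      qed (use C(1) D(1) E in simp)
    qed
  qed (use borel_measurable_integrable[OF tempered_integrable[OF u]] in auto)
  moreover have "(\<lambda>i. u (FF i)) \<longlonglongrightarrow> u F"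
  proof -
    \<comment> \<open>The error density: on A i the distance between the sampled and the true value,
      elsewhere the part of the integral that the sum omits.\<close>
    define d where "d i w = (if w \<in> A i then snorm K L (\<lambda>x. Y (s i w) x - Y w x) else snorm K L (Y w))" for i w
    have m1: "(\<lambda>w. snorm K L (\<lambda>x. Y (s i w) x - Y w x)) \<in> borel_measurable borel" for i
      using measurable_compose[OF _ borel_measurable_continuous_onI[OF scont_snorm_diff_continuous[OF cont cont, of K L]],
          of "\<lambda>w. (s i w, w)" borel] by (simp add: borel_prod[symmetric])
    have m2: "(\<lambda>w. snorm K L (Y w)) \<in> borel_measurable borel"
      using measurable_compose[OF _ borel_measurable_continuous_onI[OF scont_snorm_diff_continuous[OF cont scont_zero, of K L]],
          of "\<lambda>w. (w, w)" borel] by (simp add: borel_prod[symmetric])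
    have dm [measurable]: "d i \<in> borel_measurable borel" for i
      unfolding d_def by (intro measurable_If m1 m2) simp
    have d_le: "norm (d i w) \<le> (D * (E + 1)) * wt w" for i w
    proof -
      have 1: "sbd K L (D * wt w) (Y w)" by (rule D)
      have "d i w \<le> (D * (E + 1)) * wt w"
      proof (cases "w \<in> A i")
        case True
        have "sbd K L (D * wt (s i w) + D * wt w) (\<lambda>x. Y (s i w) x + (-1) * Y w x)"
          by (intro sbd_add D schwartz_cmult YS sbd_cmult[OF YS 1]) simp
        then have "snorm K L (\<lambda>x. Y (s i w) x - Y w x) \<le> D * wt (s i w) + D * wt w"
          by (intro snorm_le) simp
        also have "\<dots> \<le> D * (E * wt w) + D * wt w"
          using wtA[OF True] D(1) by (intro add_right_mono mult_left_mono) (auto simp: E_def)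
        finally show ?thesis using True by (simp add: d_def algebra_simps)
      next
        case False
        then have "d i w \<le> D * wt w" by (simp add: d_def snorm_le[OF 1])
        also have "\<dots> \<le> D * (E + 1) * wt w" using D(1) E by (intro mult_right_mono) auto
        finally show ?thesis .
      qed
      moreover have "0 \<le> d i w" by (simp add: d_def snorm_nonneg schwartz_diff YS)
      ultimately show ?thesis by simp
    qed
    have d_int: "integrable lborel (d i)" for i
      by (rule integrable_wt_bound[OF dm d_le])
    have "(\<lambda>i. \<integral>w. d i w \<partial>lborel) \<longlonglongrightarrow> (\<integral>w. 0 \<partial>(lborel :: 'w measure))"
    proof (rule integral_dominated_convergence[where w = "\<lambda>w. (D * (E + 1)) * wt w"])
      show "AE w in lborel. (\<lambda>i. d i w) \<longlonglongrightarrow> 0"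
      proof (intro AE_I2)
        fix w
        have "(\<lambda>i. snorm K L (\<lambda>x. Y (s i w) x - Y w x)) \<longlonglongrightarrow> snorm K L (\<lambda>x. Y w x - Y w x)"
          using continuous_on_tendsto_compose[OF scont_snorm_diff_continuous[OF cont cont, of K L]
              tendsto_Pair[OF s(2)[of w] tendsto_const[of w]]] by simp
        moreover have "snorm K L (\<lambda>x. Y w x - Y w x) = 0"
          by (simp add: snorm_zero)
        moreover have "\<forall>\<^sub>F i in sequentially. snorm K L (\<lambda>x. Y (s i w) x - Y w x) = d i w"
          using Aev[of w] by eventually_elim (simp add: d_def)
        ultimately show "(\<lambda>i. d i w) \<longlonglongrightarrow> 0" using Lim_transform_eventually by fastforce
      qed
    qed (use d_le in simp_all)
    then have dlim: "(\<lambda>i. \<integral>w. d i w \<partial>lborel) \<longlonglongrightarrow> 0" by simp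
    have dnn: "0 \<le> d i w" for i w by (simp add: d_def snorm_nonneg schwartz_diff YS)
    \<comment> \<open>The seminorm is moved inside the integral, so that the i-th error is at most
      the integral of d i.\<close>
    have sb: "sbd K L (\<integral>w. d i w \<partial>lborel) (\<lambda>x. FF i x - F x)" for i
      unfolding sbd_def
    proof (intro ballI impI allI)
      fix bs x assume bs: "bs \<in> lists (Basis :: 'a set)" "length bs \<le> L"
      let ?g = "\<lambda>w. indicator (A i) w * iter_partial bs (Y (s i w)) x - iter_partial bs (Y w) x"
      have i1: "integrable lborel (\<lambda>w. indicator (A i) w * iter_partial bs (Y (s i w)) x)"
      proof -
        obtain D' where D'0: "0 < D'" "\<forall>w x. norm (iter_partial bs (Y w) x) \<le> D' * wt w"
          using iter_bound[OF bs(1)] by blast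
        note D' = D'0(1) D'0(2)[rule_format]
        show ?thesis
        proof (rule integrable_wt_bound)
          show "(\<lambda>w. indicator (A i) w * iter_partial bs (Y (s i w)) x) \<in> borel_measurable borel"
            using integral_simple_compose(2)[OF s(1) Am Afin] by simp
          show "norm (indicator (A i) w * iter_partial bs (Y (s i w)) x) \<le> (D' * E) * wt w" for w
          proof (cases "w \<in> A i")
            case True
            have "norm (iter_partial bs (Y (s i w)) x) \<le> D' * wt (s i w)" by (rule D')
            also have "\<dots> \<le> D' * (E * wt w)" using wtA[OF True] D'(1) unfolding E_def by (intro mult_left_mono) simp_all
            finally show ?thesis using True by (simp add: mult.assoc)
          qed (use D'(1) E in simp)
        qed
      qed
      have "iter_partial bs (FF i) x = (\<Sum>v\<in>range (s i). iter_partial bs (\<lambda>x. of_real (m i v) * Y v x) x)"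
        unfolding FF_def by (rule fun_cong[OF iter_partial_sum[OF schwartz_cmult[OF YS] bs(1)]])
      also have "\<dots> = (\<Sum>v\<in>range (s i). of_real (m i v) * iter_partial bs (Y v) x)"
        by (simp only: iter_partial_cmult[OF YS bs(1)])
      also have "\<dots> = (\<integral>w. indicator (A i) w * iter_partial bs (Y (s i w)) x \<partial>lborel)"
        unfolding m_def by (rule integral_simple_compose(1)[OF s(1) Am Afin, symmetric])
      finally have "iter_partial bs (FF i) x = (\<integral>w. indicator (A i) w * iter_partial bs (Y (s i w)) x \<partial>lborel)" .
      then have "iter_partial bs (\<lambda>x. FF i x - F x) x = (\<integral>w. ?g w \<partial>lborel)"
        using i1 iter_integrable[OF bs(1)] by (simp add: iter_partial_diff[OF FFS F(1) bs(1)] iter_integral[OF bs(1)])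
      moreover have "norm (\<integral>w. of_real ((1 + norm x) ^ K) * ?g w \<partial>lborel) \<le> (\<integral>w. d i w \<partial>lborel)"
      proof (rule Bochner_Integration.integral_norm_bound_integral[OF _ d_int])
        show "integrable lborel (\<lambda>w. complex_of_real ((1 + norm x) ^ K) * ?g w)"
          using i1 iter_integrable[OF bs(1)] by (intro integrable_mult_right) auto
        fix w
        have n: "norm (complex_of_real ((1 + norm x) ^ K) * ?g w) = (1 + norm x) ^ K * norm (?g w)"
          unfolding norm_mult norm_of_real by (simp add: abs_of_nonneg)
        show "norm (complex_of_real ((1 + norm x) ^ K) * ?g w) \<le> d i w"
        proof (cases "w \<in> A i")
          case True
          then show ?thesis unfolding n
            using sbd_snorm[OF schwartz_diff[OF YS YS], of K L "s i w" w] bs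
            by (auto simp: sbd_def d_def iter_partial_diff[OF YS YS bs(1)])
        next
          case False
          then show ?thesis unfolding n
            using sbd_snorm[OF YS, of K L w] bs by (auto simp: sbd_def d_def)
        qed
      qed
      moreover have "norm (\<integral>w. of_real ((1 + norm x) ^ K) * ?g w \<partial>lborel) = (1 + norm x) ^ K * norm (\<integral>w. ?g w \<partial>lborel)"
        unfolding integral_mult_right_zero norm_mult norm_of_real by (simp add: abs_of_nonneg)
      ultimately show "(1 + norm x) ^ K * norm (iter_partial bs (\<lambda>x. FF i x - F x) x) \<le> (\<integral>w. d i w \<partial>lborel)"
        by simp
    qed
    \<comment> \<open>The bound for u is stated for strictly positive constants, and the integral of
      d i may vanish; the vanishing summand 1 / (i + 1) repairs this.\<close>
    have le: "norm (u (FF i) - u F) \<le> C * ((\<integral>w. d i w \<partial>lborel) + inverse (real (Suc i)))" for i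
    proof -
      have nn: "0 \<le> (\<integral>w. d i w \<partial>lborel)" by (intro Bochner_Integration.integral_nonneg dnn)
      have "norm (u (\<lambda>x. FF i x - F x)) \<le> C * ((\<integral>w. d i w \<partial>lborel) + inverse (real (Suc i)))"
        by (rule C(2)[OF schwartz_diff[OF FFS F(1)]])
          (use nn in \<open>auto intro!: add_nonneg_pos sbd_mono[OF sb order_refl order_refl]\<close>)
      then show ?thesis by (simp add: tempered_diff[OF u FFS F(1)])
    qed
    have "(\<lambda>i. C * ((\<integral>w. d i w \<partial>lborel) + inverse (real (Suc i)))) \<longlonglongrightarrow> C * (0 + 0)"
      by (intro tendsto_mult tendsto_add tendsto_const dlim LIMSEQ_inverse_real_of_nat)
    then have lim: "(\<lambda>i. C * ((\<integral>w. d i w \<partial>lborel) + inverse (real (Suc i)))) \<longlonglongrightarrow> 0"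
      by simp
    have "(\<lambda>i. u (FF i) - u F) \<longlonglongrightarrow> 0"
      by (rule Lim_null_comparison[OF _ lim]) (rule always_eventually, rule allI, rule le)
    then show ?thesis by (simp add: LIM_zero_iff)
  qed
  ultimately show ?thesis using LIMSEQ_unique by blast
qed

end

text \<open>The growth in w is only polynomial, so it is outweighed by the decay of the short-time
  Fourier transform of a Schwartz function.\<close>

lemma sbd_tfs_growth:
  assumes \<phi>: "\<phi> \<in> schwartz"
  obtains C where "0 < C" "\<And>w. sbd K L (C * (1 + norm w) ^ (K + L)) (tfs w \<phi>)"
proof -
  obtain C where C: "0 < C" "sbd K L C \<phi>" using sbd_exists[OF \<phi>] by metis
  have "sbd K L (((1 + 2 * pi) ^ L * C) * (1 + norm w) ^ (K + L)) (tfs w \<phi>)" for w :: "'a \<times> 'a"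
  proof -
    have 1: "sbd K L ((1 + 2 * pi * norm (snd w)) ^ L * ((1 + norm (fst w)) ^ K * C)) (tfs w \<phi>)"
      unfolding tfs_def by (intro sbd_modulation sbd_translation C \<phi> schwartz_translation)
    have 2: "(1 + 2 * pi * norm (snd w)) ^ L * ((1 + norm (fst w)) ^ K * C) \<le> ((1 + 2 * pi) ^ L * (1 + norm w) ^ L) * ((1 + norm w) ^ K * C)"
    proof (rule mult_mono)
      have n: "norm (fst w) \<le> norm w" "norm (snd w) \<le> norm w"
        using norm_fst_le[of "fst w" "snd w"] norm_snd_le[of "snd w" "fst w"] by auto
      have "1 + 2 * pi * norm (snd w) \<le> 1 + 2 * pi * norm w" using n by (intro add_left_mono mult_left_mono) auto
      also have "\<dots> \<le> (1 + 2 * pi) * (1 + norm w)" by (simp add: algebra_simps)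
      finally show "(1 + 2 * pi * norm (snd w)) ^ L \<le> (1 + 2 * pi) ^ L * (1 + norm w) ^ L"
        unfolding power_mult_distrib[symmetric] by (intro power_mono) auto
      show "(1 + norm (fst w)) ^ K * C \<le> (1 + norm w) ^ K * C"
        using n C by (intro mult_right_mono power_mono) auto
    qed (use C in auto)
    show ?thesis using sbd_mono[OF 1 order_refl order_refl 2] by (simp add: power_add ac_simps)
  qed
  moreover have "0 < (1 + 2 * pi) ^ L * C" using C by (intro mult_pos_pos zero_less_power add_pos_pos) auto
  ultimately show ?thesis using that by blast
qed

text \<open>u is applied to the pointwise inversion formula; the conjugates come from conjugate
  linearity. Every later estimate of a value of a distribution starts from this identity.\<close>

lemma tempered_stf_inversion:
  fixes u :: "('a::euclidean_space \<Rightarrow> complex) \<Rightarrow> complex"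
  assumes u: "u \<in> tempered" and S: "F \<in> schwartz" "\<phi> \<in> schwartz"
  shows "cnj (ip \<phi> \<phi>) * u F = (\<integral>w. u (tfs w \<phi>) * cnj (stf \<phi> F w) \<partial>lborel)"
    and "integrable lborel (\<lambda>w. u (tfs w \<phi>) * cnj (stf \<phi> F w))"
proof -
  have sS: "stf \<phi> F \<in> schwartz" using S by (rule stf_schwartz)
  interpret schwartz_family "\<lambda>w t. stf \<phi> F w * tfs w \<phi> t" "\<lambda>t. ip \<phi> \<phi> * F t"
  proof
    show "scont (\<lambda>w t. stf \<phi> F w * tfs w \<phi> t)"
      by (intro scont_mult scont_tfs S schwartz_continuous sS)
    show "(\<lambda>t. ip \<phi> \<phi> * F t) \<in> schwartz" by (intro schwartz_cmult S)
    show "ip \<phi> \<phi> * F t = (\<integral>w. stf \<phi> F w * tfs w \<phi> t \<partial>lborel)" for t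
      using stf_inversion[OF S] by (simp add: mult.commute)
    fix K L
    obtain C where C: "0 < C" "\<And>w. sbd K L (C * (1 + norm w) ^ (K + L)) (tfs w \<phi>)"
      using sbd_tfs_growth[OF S(2)] by blast
    obtain D where D: "0 \<le> D" "\<And>w. (1 + norm w) ^ (K + L) * norm (stf \<phi> F w) \<le> D * wt w"
      using schwartz_wt_bound[OF sS] by blast
    have "sbd K L ((C * (D + 1)) * wt w) (\<lambda>t. stf \<phi> F w * tfs w \<phi> t)" for w
    proof (rule sbd_cmult[OF tfs_schwartz[OF S(2)] C(2)])
      have "norm (stf \<phi> F w) * (C * (1 + norm w) ^ (K + L)) = C * ((1 + norm w) ^ (K + L) * norm (stf \<phi> F w))"
        by (simp add: ac_simps)
      also have "\<dots> \<le> C * (D * wt w)" using C D by (intro mult_left_mono) auto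
      also have "\<dots> \<le> C * (D + 1) * wt w" using C by (simp add: algebra_simps)
      finally show "norm (stf \<phi> F w) * (C * (1 + norm w) ^ (K + L)) \<le> C * (D + 1) * wt w" .
    qed
    moreover have "0 < C * (D + 1)" using C D by simp
    ultimately show "\<exists>C>0. \<forall>w. sbd K L (C * wt w) (\<lambda>t. stf \<phi> F w * tfs w \<phi> t)" by blast
  qed
  have eq: "u (\<lambda>t. stf \<phi> F w * tfs w \<phi> t) = u (tfs w \<phi>) * cnj (stf \<phi> F w)" for w
    by (simp add: tempered_cmult[OF u tfs_schwartz[OF S(2)]])
  show "cnj (ip \<phi> \<phi>) * u F = (\<integral>w. u (tfs w \<phi>) * cnj (stf \<phi> F w) \<partial>lborel)"
    using tempered_integral[OF u] by (simp add: eq tempered_cmult[OF u S(1)])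
  show "integrable lborel (\<lambda>w. u (tfs w \<phi>) * cnj (stf \<phi> F w))"
    using tempered_integrable[OF u] by (simp add: eq)
qed

section \<open>Smoothing by a rapidly decaying weight\<close>

text \<open>Convolution with the weight on phase space. The result is nearly constant on unit balls
  whatever F is, which gives access to the embeddings between mixed norms.\<close>

definition smooth :: "('a::euclidean_space \<Rightarrow> 'b::euclidean_space \<Rightarrow> ennreal) \<Rightarrow> 'a \<Rightarrow> 'b \<Rightarrow> ennreal" where
  "smooth F x \<xi> = (\<integral>\<^sup>+\<eta>. \<integral>\<^sup>+y. F y \<eta> * ennreal (wt (x - y, \<xi> - \<eta>)) \<partial>lborel \<partial>lborel)"

lemma wt_minus: "wt (- x) = wt x"
  by (simp add: wt_def)

lemma wt_minus_commute: "wt (x - y) = wt (y - x)"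
  by (simp add: wt_def norm_minus_commute)

lemma wt_Pair_measurable: "(\<lambda>(x, y). ennreal (wt (x, y))) \<in> borel_measurable (borel \<Otimes>\<^sub>M borel)"
  unfolding borel_prod by (simp add: case_prod_beta')

lemmas wt_pair_comp = measurable_curried_comp[OF wt_Pair_measurable]

lemma smooth_measurable:
  assumes F: "(\<lambda>(x, y). F x y) \<in> borel_measurable (borel \<Otimes>\<^sub>M borel)"
  shows "(\<lambda>(x, y). smooth F x y) \<in> borel_measurable (borel \<Otimes>\<^sub>M borel)"
proof -
  note [measurable (raw)] = measurable_curried_comp[OF F] wt_pair_comp
  show ?thesis unfolding smooth_def case_prod_beta' by measurable
qed

lemma nn_integral_wt_finite: "(\<integral>\<^sup>+\<eta>. \<integral>\<^sup>+y. ennreal (wt (y::'a::euclidean_space, \<eta>::'b::euclidean_space)) \<partial>lborel \<partial>lborel) < \<infinity>"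
proof -
  have "(\<integral>\<^sup>+\<eta>. \<integral>\<^sup>+y. ennreal (wt (y::'a, \<eta>::'b)) \<partial>lborel \<partial>lborel) = (\<integral>\<^sup>+z. ennreal (wt (z::'a \<times> 'b)) \<partial>(lborel \<Otimes>\<^sub>M lborel))"
    by (rule lborel_pair.nn_integral_snd) (simp add: lborel_prod)
  also have "\<dots> < \<infinity>"
    using integrableD(2)[OF wt_integrable[where 'a = "'a \<times> 'b"]] by (simp add: lborel_prod less_top)
  finally show ?thesis .
qed

lemma MN_smooth:
  assumes \<theta>: "0 \<le> \<theta>1" "\<theta>1 \<le> 1" "0 \<le> \<theta>2" "\<theta>2 \<le> 1"
  obtains C where "0 \<le> C"
    "\<And>F :: 'a::euclidean_space \<Rightarrow> 'b::euclidean_space \<Rightarrow> ennreal.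
      (\<lambda>(x, y). F x y) \<in> borel_measurable (borel \<Otimes>\<^sub>M borel) \<Longrightarrow>
      MN \<theta>1 \<theta>2 (smooth F) \<le> ennreal C * MN \<theta>1 \<theta>2 F"
proof -
  define c where "c = (\<integral>\<^sup>+\<eta>. \<integral>\<^sup>+y. ennreal (wt (y::'a, \<eta>::'b)) \<partial>lborel \<partial>lborel)"
  have c: "c < \<infinity>" unfolding c_def by (rule nn_integral_wt_finite)
  have "MN \<theta>1 \<theta>2 (smooth F) \<le> c * MN \<theta>1 \<theta>2 F"
    if F: "(\<lambda>(x, y). F x y) \<in> borel_measurable (borel \<Otimes>\<^sub>M borel)" for F :: "'a \<Rightarrow> 'b \<Rightarrow> ennreal"
  proof -
    note [measurable (raw)] = measurable_curried_comp[OF F] wt_pair_comp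
    have "smooth F x \<xi> = (\<integral>\<^sup>+\<eta>. \<integral>\<^sup>+y. F (x - y) (\<xi> - \<eta>) * ennreal (wt (y, \<eta>)) \<partial>lborel \<partial>lborel)" for x \<xi>
    proof -
      have "(\<integral>\<^sup>+\<eta>. \<integral>\<^sup>+y. F (x - y) (\<xi> - \<eta>) * ennreal (wt (y, \<eta>)) \<partial>lborel \<partial>lborel)
        = (\<integral>\<^sup>+\<eta>. (\<lambda>\<eta>. \<integral>\<^sup>+y. F (x - y) \<eta> * ennreal (wt (y, \<xi> - \<eta>)) \<partial>lborel) (\<xi> - \<eta>) \<partial>lborel)"
        by simp
      also have "\<dots> = (\<integral>\<^sup>+\<eta>. \<integral>\<^sup>+y. F (x - y) \<eta> * ennreal (wt (y, \<xi> - \<eta>)) \<partial>lborel \<partial>lborel)"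
        by (rule nn_integral_shift(4)) measurable
      also have "\<dots> = (\<integral>\<^sup>+\<eta>. \<integral>\<^sup>+y. (\<lambda>y. F y \<eta> * ennreal (wt (x - y, \<xi> - \<eta>))) (x - y) \<partial>lborel \<partial>lborel)"
        by simp
      also have "\<dots> = smooth F x \<xi>"
        unfolding smooth_def by (rule nn_integral_cong, rule nn_integral_shift(4)) measurable
      finally show ?thesis ..
    qed
    then have eq: "smooth F = (\<lambda>x \<xi>. \<integral>\<^sup>+\<eta>. \<integral>\<^sup>+y. F (x - y) (\<xi> - \<eta>) * ennreal (wt (y, \<eta>)) \<partial>lborel \<partial>lborel)"
      by (intro ext)
    show ?thesis unfolding eq c_def by (rule MN_conv[OF F wt_Pair_measurable \<theta>])
  qed
  moreover have "c = ennreal (enn2real c)" using c by (simp add: less_top)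
  ultimately show ?thesis using that[of "enn2real c"] by (metis enn2real_nonneg)
qed

text \<open>Peetre's inequality for a displacement of length at most 2 in the product space; the
  constant is independent of F.\<close>

lemma smooth_moderate:
  obtains C where "0 \<le> C"
    "\<And>F x y \<xi> \<eta>. (\<lambda>(x, y). F x y) \<in> borel_measurable (borel \<Otimes>\<^sub>M borel) \<Longrightarrow>
       dist x y \<le> 1 \<Longrightarrow> dist \<xi> \<eta> \<le> 1 \<Longrightarrow>
       smooth F (x :: 'a::euclidean_space) (\<xi> :: 'b::euclidean_space) \<le> ennreal C * smooth F y \<eta>"
proof (rule that[of "3 ^ (2 * DIM('a \<times> 'b))"])
  let ?C = "(3::real) ^ (2 * DIM('a \<times> 'b))"
  fix F :: "'a \<Rightarrow> 'b \<Rightarrow> ennreal" and x y :: 'a and \<xi> \<eta> :: 'b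
  assume F: "(\<lambda>(x, y). F x y) \<in> borel_measurable (borel \<Otimes>\<^sub>M borel)" and d: "dist x y \<le> 1" "dist \<xi> \<eta> \<le> 1"
  note [measurable (raw)] = measurable_curried_comp[OF F] wt_pair_comp
  have le: "wt (x - y', \<xi> - \<eta>') \<le> ?C * wt (y - y', \<eta> - \<eta>')" for y' \<eta>'
  proof -
    have "norm (x - y, \<xi> - \<eta>) \<le> 2"
      using norm_Pair_le[of "x - y" "\<xi> - \<eta>"] d by (simp add: dist_norm)
    then have "(1 + norm (x - y, \<xi> - \<eta>)) ^ (2 * DIM('a \<times> 'b)) \<le> ?C"
      by (intro power_mono) auto
    then have "(1 + norm (x - y, \<xi> - \<eta>)) ^ (2 * DIM('a \<times> 'b)) * wt (y - y', \<eta> - \<eta>') \<le> ?C * wt (y - y', \<eta> - \<eta>')"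
      by (intro mult_right_mono) auto
    then show ?thesis using wt_peetre[of "(y - y', \<eta> - \<eta>')" "(x - y, \<xi> - \<eta>)"] by simp
  qed
  have "smooth F x \<xi> \<le> (\<integral>\<^sup>+\<eta>'. \<integral>\<^sup>+y'. ennreal ?C * (F y' \<eta>' * ennreal (wt (y - y', \<eta> - \<eta>'))) \<partial>lborel \<partial>lborel)"
    unfolding smooth_def
  proof (intro nn_integral_mono)
    fix \<eta>' :: 'b and y' :: 'a
    have "F y' \<eta>' * ennreal (wt (x - y', \<xi> - \<eta>')) \<le> F y' \<eta>' * ennreal (?C * wt (y - y', \<eta> - \<eta>'))"
      by (intro mult_left_mono ennreal_leI le) simp
    then show "F y' \<eta>' * ennreal (wt (x - y', \<xi> - \<eta>')) \<le> ennreal ?C * (F y' \<eta>' * ennreal (wt (y - y', \<eta> - \<eta>')))"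
      by (simp add: ennreal_mult ac_simps)
  qed
  also have "\<dots> = ennreal ?C * smooth F y \<eta>"
    unfolding smooth_def by (simp add: nn_integral_cmult)
  finally show "smooth F x \<xi> \<le> ennreal ?C * smooth F y \<eta>" .
qed simp

text \<open>Smoothing is bounded in every mixed norm and makes the function nearly constant, so
  afterwards the reciprocals of the exponents may be lowered.\<close>

lemma MN_smooth_embed:
  assumes \<theta>: "0 \<le> \<theta>1'" "\<theta>1' \<le> \<theta>1" "\<theta>1 \<le> 1" "0 \<le> \<theta>2'" "\<theta>2' \<le> \<theta>2" "\<theta>2 \<le> 1"
  obtains C where "0 \<le> C"
    "\<And>F :: 'a::euclidean_space \<Rightarrow> 'b::euclidean_space \<Rightarrow> ennreal.
      (\<lambda>(x, y). F x y) \<in> borel_measurable (borel \<Otimes>\<^sub>M borel) \<Longrightarrow>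
      MN \<theta>1' \<theta>2' (smooth F) \<le> ennreal C * MN \<theta>1 \<theta>2 F"
proof -
  obtain C0 where C0: "0 \<le> C0" "\<And>F x y \<xi> \<eta>. (\<lambda>(x, y). F x y) \<in> borel_measurable (borel \<Otimes>\<^sub>M borel) \<Longrightarrow>
       dist x y \<le> 1 \<Longrightarrow> dist \<xi> \<eta> \<le> 1 \<Longrightarrow>
       smooth F (x :: 'a) (\<xi> :: 'b) \<le> ennreal C0 * smooth F y \<eta>"
    using smooth_moderate by metis
  obtain D where D: "D < \<infinity>" "\<And>k :: 'a \<Rightarrow> 'b \<Rightarrow> ennreal.
      (\<lambda>(x, y). k x y) \<in> borel_measurable (borel \<Otimes>\<^sub>M borel) \<Longrightarrow>
      (\<And>x y \<xi> \<eta>. dist x y \<le> 1 \<Longrightarrow> dist \<xi> \<eta> \<le> 1 \<Longrightarrow> k x \<xi> \<le> ennreal C0 * k y \<eta>) \<Longrightarrow>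
      MN \<theta>1' \<theta>2' k \<le> D * MN \<theta>1 \<theta>2 k"
    using MN_embed[OF \<theta>(1,2,4,5) C0(1)] by metis
  have "0 \<le> \<theta>1" "0 \<le> \<theta>2" using \<theta> by auto
  then obtain C where C: "0 \<le> C" "\<And>F :: 'a \<Rightarrow> 'b \<Rightarrow> ennreal.
      (\<lambda>(x, y). F x y) \<in> borel_measurable (borel \<Otimes>\<^sub>M borel) \<Longrightarrow>
      MN \<theta>1 \<theta>2 (smooth F) \<le> ennreal C * MN \<theta>1 \<theta>2 F"
    using MN_smooth[OF _ \<theta>(3) _ \<theta>(6)] by metis
  show ?thesis
  proof (rule that[of "enn2real D * C"])
    show "0 \<le> enn2real D * C" using C by simp
    fix F :: "'a \<Rightarrow> 'b \<Rightarrow> ennreal" assume F: "(\<lambda>(x, y). F x y) \<in> borel_measurable (borel \<Otimes>\<^sub>M borel)"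
    have "MN \<theta>1' \<theta>2' (smooth F) \<le> D * MN \<theta>1 \<theta>2 (smooth F)"
      by (rule D(2)[OF smooth_measurable[OF F] C0(2)[OF F]])
    also have "\<dots> \<le> D * (ennreal C * MN \<theta>1 \<theta>2 F)" by (intro mult_left_mono C(2) F) simp
    also have "D = ennreal (enn2real D)" using D(1) by (simp add: less_top)
    finally show "MN \<theta>1' \<theta>2' (smooth F) \<le> ennreal (enn2real D * C) * MN \<theta>1 \<theta>2 F"
      using C(1) by (simp add: ennreal_mult mult.assoc)
  qed
qed

section \<open>Short-time Fourier transforms of tempered distributions\<close>

definition astft :: "('a::euclidean_space \<Rightarrow> complex) \<Rightarrow> (('a \<Rightarrow> complex) \<Rightarrow> complex) \<Rightarrow> 'a \<Rightarrow> 'a \<Rightarrow> ennreal" where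
  "astft \<phi> u x \<xi> = ennreal (norm (u (tfs (x, \<xi>) \<phi>)))"

lemma modulation_norm_eq_MN:
  assumes "1 \<le> p" "1 \<le> q"
  shows "modulation_norm \<phi> p q u = MN (enn2real (inverse p)) (enn2real (inverse q)) (astft \<phi> u)"
  using assms by (simp add: modulation_norm_def Lp_norm_eq_Nm MN_def astft_def stft_def tfs_def)

lemma tempered_tfs_measurable:
  assumes "u \<in> tempered" "\<phi> \<in> schwartz"
  shows "(\<lambda>w. u (tfs w \<phi>)) \<in> borel_measurable borel"
  by (intro borel_measurable_continuous_onI tempered_scont_continuous scont_tfs assms)

lemma astft_measurable:
  assumes "u \<in> tempered" "\<phi> \<in> schwartz"
  shows "(\<lambda>(x, y). astft \<phi> u x y) \<in> borel_measurable (borel \<Otimes>\<^sub>M borel)"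
  using tempered_tfs_measurable[OF assms]
  unfolding astft_def borel_prod by (simp add: case_prod_beta')

lemma nn_integral_lborel_pair:
  fixes F :: "'a::euclidean_space \<times> 'b::euclidean_space \<Rightarrow> ennreal"
  assumes "F \<in> borel_measurable borel"
  shows "(\<integral>\<^sup>+z. F z \<partial>lborel) = (\<integral>\<^sup>+\<eta>. \<integral>\<^sup>+y. F (y, \<eta>) \<partial>lborel \<partial>lborel)"
  using lborel_pair.nn_integral_snd[of F] assms by (simp add: lborel_prod)

text \<open>The inversion formula reproduces the transform with window \<gamma> from the one with
  window \<phi>, with a kernel V_\<phi> \<gamma> that decays like \<open>wt\<close>. The case
  \<gamma> = \<phi> is of interest too: it bounds a transform by its own smoothing.\<close>

lemma astft_window_change:
  fixes \<phi> \<gamma> :: "'a::euclidean_space \<Rightarrow> complex"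
  assumes S: "\<phi> \<in> schwartz" "\<gamma> \<in> schwartz" and ne: "\<phi> \<noteq> (\<lambda>x. 0)"
  obtains C where "0 \<le> C" "\<And>u x \<xi>. u \<in> tempered \<Longrightarrow> astft \<gamma> u x \<xi> \<le> ennreal C * smooth (astft \<phi> u) x \<xi>"
proof -
  obtain D where D: "0 \<le> D" "\<And>w. norm (stf \<phi> \<gamma> w) \<le> D * wt w"
    using schwartz_wt_bound0[OF stf_schwartz[OF S(2,1)]] by metis
  define n where "n = norm (ip \<phi> \<phi>)"
  have n: "0 < n" using ip_self_ne_0[OF S(1) ne] by (simp add: n_def)
  show ?thesis
  proof (rule that[of "D / n"])
    show "0 \<le> D / n" using D n by simp
    fix u :: "('a \<Rightarrow> complex) \<Rightarrow> complex" and x \<xi> :: 'a assume u: "u \<in> tempered"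
    let ?w = "(x, \<xi>)"
    have [measurable]: "(\<lambda>w. u (tfs w \<phi>)) \<in> borel_measurable borel" by (rule tempered_tfs_measurable[OF u S(1)])
    have "ennreal n * astft \<gamma> u x \<xi> = ennreal (norm (cnj (ip \<phi> \<phi>) * u (tfs ?w \<gamma>)))"
      by (simp add: astft_def n_def norm_mult ennreal_mult)
    also have "\<dots> = ennreal (norm (\<integral>w. u (tfs w \<phi>) * cnj (stf \<phi> (tfs ?w \<gamma>) w) \<partial>lborel))"
      by (simp only: tempered_stf_inversion(1)[OF u tfs_schwartz[OF S(2)] S(1)])
    also have "\<dots> \<le> (\<integral>\<^sup>+w. ennreal (norm (u (tfs w \<phi>) * cnj (stf \<phi> (tfs ?w \<gamma>) w))) \<partial>lborel)"
      by (rule integral_norm_bound_ennreal[OF tempered_stf_inversion(2)[OF u tfs_schwartz[OF S(2)] S(1)]])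
    also have "\<dots> \<le> (\<integral>\<^sup>+w. ennreal D * (ennreal (norm (u (tfs w \<phi>))) * ennreal (wt (?w - w))) \<partial>lborel)"
    proof (intro nn_integral_mono)
      fix w
      have "norm (stf \<phi> (tfs ?w \<gamma>) w) \<le> D * wt (?w - w)"
        unfolding norm_stf_tfs[OF S(2,1)] using D(2)[of "w - ?w"] by (simp add: wt_minus_commute)
      then have "norm (u (tfs w \<phi>)) * norm (stf \<phi> (tfs ?w \<gamma>) w) \<le> norm (u (tfs w \<phi>)) * (D * wt (?w - w))"
        by (intro mult_left_mono) auto
      then show "ennreal (norm (u (tfs w \<phi>) * cnj (stf \<phi> (tfs ?w \<gamma>) w)))
        \<le> ennreal D * (ennreal (norm (u (tfs w \<phi>))) * ennreal (wt (?w - w)))"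
        using D(1) by (simp add: norm_mult ennreal_mult[symmetric] ac_simps ennreal_leI)
    qed
    also have "\<dots> = ennreal D * (\<integral>\<^sup>+w. ennreal (norm (u (tfs w \<phi>))) * ennreal (wt (?w - w)) \<partial>lborel)"
      by (rule nn_integral_cmult) measurable
    also have "(\<integral>\<^sup>+w. ennreal (norm (u (tfs w \<phi>))) * ennreal (wt (?w - w)) \<partial>lborel) = smooth (astft \<phi> u) x \<xi>"
      by (subst nn_integral_lborel_pair) (auto simp: smooth_def astft_def)
    finally have "ennreal (1 / n) * (ennreal n * astft \<gamma> u x \<xi>) \<le> ennreal (1 / n) * (ennreal D * smooth (astft \<phi> u) x \<xi>)"
      by (rule mult_left_mono) simp
    then show "astft \<gamma> u x \<xi> \<le> ennreal (D / n) * smooth (astft \<phi> u) x \<xi>"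
      using n D(1) by (simp add: mult.assoc[symmetric] ennreal_mult[symmetric])
  qed
qed

lemma distribution_of_tempered:
  fixes f :: "'a::euclidean_space \<Rightarrow> complex"
  assumes f: "f \<in> schwartz"
  shows "distribution_of f \<in> tempered"
proof (rule tempered_intro[where K = 0 and L = 0])
  show "distribution_of f \<in> extensional schwartz"
    by (auto simp: distribution_of_def extensional_def)
  show "distribution_of f (\<lambda>x. g x + h x) = distribution_of f g + distribution_of f h"
    if "g \<in> schwartz" "h \<in> schwartz" for g h
    using that ip_integrable[OF f that(1)] ip_integrable[OF f that(2)]
    by (simp add: distribution_of_def schwartz_add distrib_left)
  show "distribution_of f (\<lambda>x. c * g x) = cnj c * distribution_of f g" if "g \<in> schwartz" for c g
    using that by (simp add: distribution_of_def schwartz_cmult mult.left_commute)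
  show "0 \<le> (\<integral>x. norm (f x) \<partial>lborel)" by simp
  fix g :: "'a \<Rightarrow> complex" and c assume g: "g \<in> schwartz" "0 < c" "sbd 0 0 c g"
  have "norm (distribution_of f g) \<le> (\<integral>x. c * norm (f x) \<partial>lborel)"
  proof -
    have "norm (\<integral>x. f x * cnj (g x) \<partial>lborel) \<le> (\<integral>x. c * norm (f x) \<partial>lborel)"
    proof (rule Bochner_Integration.integral_norm_bound_integral[OF ip_integrable[OF f g(1)]])
      show "integrable lborel (\<lambda>x. c * norm (f x))" using schwartz_norm_integrable[OF f] by simp
      show "norm (f x * cnj (g x)) \<le> c * norm (f x)" for x
        using mult_right_mono[of "norm (g x)" c "norm (f x)"] g(3) by (simp add: sbd_0 norm_mult mult.commute)
    qed
    then show ?thesis using g(1) by (simp add: distribution_of_def)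
  qed
  then show "norm (distribution_of f g) \<le> (\<integral>x. norm (f x) \<partial>lborel) * c" by (simp add: mult.commute)
qed

section \<open>The boundedness estimate\<close>

text \<open>Here u is the point \<open>wig_b\<close>, at which the test function is seen; expressed
  through u and \<zeta>, the symbol sits at u + (\<tau> \<zeta>2, - (1 - \<tau>) \<zeta>1) and the
  input at \<open>wig_a\<close>, that is at u + (\<zeta>2, - \<zeta>1).\<close>

definition skew_op :: "real \<Rightarrow> ('a::euclidean_space \<times> 'a \<Rightarrow> 'a \<times> 'a \<Rightarrow> ennreal) \<Rightarrow> ('a \<Rightarrow> 'a \<Rightarrow> ennreal) \<Rightarrow> 'a \<Rightarrow> 'a \<Rightarrow> ennreal" where
  "skew_op \<tau> S F u1 u2 = (\<integral>\<^sup>+\<zeta>1. \<integral>\<^sup>+\<zeta>2. S (u1 + \<tau> *\<^sub>R \<zeta>2, u2 - (1 - \<tau>) *\<^sub>R \<zeta>1) (\<zeta>1, \<zeta>2) * F (u1 + \<zeta>2) (u2 - \<zeta>1) \<partial>lborel \<partial>lborel)"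

lemma skew_op_measurable:
  assumes S: "(\<lambda>(z, \<zeta>). S z \<zeta>) \<in> borel_measurable (borel \<Otimes>\<^sub>M borel)"
    and F: "(\<lambda>(x, y). F x y) \<in> borel_measurable (borel \<Otimes>\<^sub>M borel)"
  shows "(\<lambda>(x, y). skew_op \<tau> S F x y) \<in> borel_measurable (borel \<Otimes>\<^sub>M borel)"
proof -
  note [measurable (raw)] = measurable_curried_comp[OF F] measurable_curried_comp[OF S, unfolded borel_prod[symmetric]]
  show ?thesis unfolding skew_op_def case_prod_beta' by measurable
qed

text \<open>In phase space the operator is an integral over \<open>\<zeta> = (\<zeta>1, \<zeta>2)\<close> which decouples into the pairs
  \<open>(u1, \<zeta>2)\<close> and \<open>(u2, \<zeta>1)\<close>; each pair is an instance of the bilinear skew estimate.\<close>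

lemma skew_op_bound:
  fixes S :: "'a::euclidean_space \<times> 'a \<Rightarrow> 'a \<times> 'a \<Rightarrow> ennreal"
  assumes e1: "exponents P Q \<alpha>1 \<beta>1" and e2: "exponents P Q \<alpha>2 \<beta>2"
    and S: "(\<lambda>(z, \<zeta>). S z \<zeta>) \<in> borel_measurable (borel \<Otimes>\<^sub>M borel)"
    and F: "(\<lambda>(x, y). F x y) \<in> borel_measurable (borel \<Otimes>\<^sub>M borel)"
  shows "MN (1 - \<beta>1) (1 - \<beta>2) (skew_op \<tau> S F) \<le> MN P Q S * MN \<alpha>1 \<alpha>2 F"
proof -
  interpret e1: exponents P Q \<alpha>1 \<beta>1 by fact
  interpret e2: exponents P Q \<alpha>2 \<beta>2 by fact
  have par: "0 \<le> P" "P \<le> Q" "0 \<le> Q" "0 \<le> 1 - \<beta>1" "1 - \<beta>1 \<le> 1" "0 \<le> 1 - \<beta>2" "1 - \<beta>2 \<le> 1"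
    using e1.PQ e1.\<alpha>\<beta> e2.\<alpha>\<beta> by auto
  have F0 [measurable (raw)]: "(\<lambda>z. F (f z) (g z)) \<in> borel_measurable N"
    if "f \<in> measurable N borel" "g \<in> measurable N borel" for f g and N :: "'c measure"
    using measurable_curried_comp[OF F that] .
  note [measurable (raw)] = measurable_curried_comp[OF F] measurable_curried_comp[OF S, unfolded borel_prod[symmetric]]
  define N where "N z2 \<zeta>1 = Nm lborel Q (\<lambda>s. Nm lborel P (\<lambda>x. S (x, z2) (\<zeta>1, s)))" for z2 \<zeta>1
  define G where "G y = Nm lborel \<alpha>1 (\<lambda>x. F x y)" for y
  have N_m [measurable]: "(\<lambda>(x, s). N x s) \<in> borel_measurable (borel \<Otimes>\<^sub>M borel)"
    unfolding N_def case_prod_beta' by measurable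
  have G_m [measurable]: "G \<in> borel_measurable borel"
    unfolding G_def by measurable
  have step1: "Nm lborel (1 - \<beta>1) (\<lambda>u1. skew_op \<tau> S F u1 u2)
    \<le> (\<integral>\<^sup>+\<zeta>1. N (u2 - (1 - \<tau>) *\<^sub>R \<zeta>1) \<zeta>1 * G (u2 - \<zeta>1) \<partial>lborel)" for u2
  proof -
    have "Nm lborel (1 - \<beta>1) (\<lambda>u1. skew_op \<tau> S F u1 u2)
      \<le> (\<integral>\<^sup>+\<zeta>1. Nm lborel (1 - \<beta>1) (\<lambda>u1. \<integral>\<^sup>+\<zeta>2. S (u1 + \<tau> *\<^sub>R \<zeta>2, u2 - (1 - \<tau>) *\<^sub>R \<zeta>1) (\<zeta>1, \<zeta>2) * F (u1 + \<zeta>2) (u2 - \<zeta>1) \<partial>lborel) \<partial>lborel)"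
      unfolding skew_op_def
      by (rule Nm_minkowski[OF lborel_sf lborel_sf _ par(4,5)]) measurable
    also have "\<dots> \<le> (\<integral>\<^sup>+\<zeta>1. N (u2 - (1 - \<tau>) *\<^sub>R \<zeta>1) \<zeta>1 * G (u2 - \<zeta>1) \<partial>lborel)"
    proof (rule nn_integral_mono)
      fix \<zeta>1 :: 'a
      \<comment> \<open>The pair (u1, \<zeta>2) is the bilinear estimate with c = 1 - \<tau> and c'
        = - \<tau>.\<close>
      have "Nm lborel (1 - \<beta>1) (\<lambda>y. \<integral>\<^sup>+s. S (y - (- \<tau>) *\<^sub>R s, u2 - (1 - \<tau>) *\<^sub>R \<zeta>1) (\<zeta>1, s) * F (y + ((1 - \<tau>) - (- \<tau>)) *\<^sub>R s) (u2 - \<zeta>1) \<partial>lborel)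
        \<le> Nm lborel Q (\<lambda>s. Nm lborel P (\<lambda>x. S (x, u2 - (1 - \<tau>) *\<^sub>R \<zeta>1) (\<zeta>1, s))) * Nm lborel \<alpha>1 (\<lambda>x. F x (u2 - \<zeta>1))"
      proof (rule e1.skew_bilinear[where S = "\<lambda>x s. S (x, u2 - (1 - \<tau>) *\<^sub>R \<zeta>1) (\<zeta>1, s)" and F = "\<lambda>x. F x (u2 - \<zeta>1)"])
        show "(\<lambda>(x, s). S (x, u2 - (1 - \<tau>) *\<^sub>R \<zeta>1) (\<zeta>1, s)) \<in> borel_measurable (borel \<Otimes>\<^sub>M borel)"
          unfolding case_prod_beta' by measurable
        show "(\<lambda>x. F x (u2 - \<zeta>1)) \<in> borel_measurable borel" by measurable
      qed simp
      then show "Nm lborel (1 - \<beta>1) (\<lambda>u1. \<integral>\<^sup>+\<zeta>2. S (u1 + \<tau> *\<^sub>R \<zeta>2, u2 - (1 - \<tau>) *\<^sub>R \<zeta>1) (\<zeta>1, \<zeta>2) * F (u1 + \<zeta>2) (u2 - \<zeta>1) \<partial>lborel)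
        \<le> N (u2 - (1 - \<tau>) *\<^sub>R \<zeta>1) \<zeta>1 * G (u2 - \<zeta>1)"
        by (simp add: N_def G_def)
    qed
    finally show ?thesis .
  qed
  have sk: "(\<lambda>(x, y). skew_op \<tau> S F x y) \<in> borel_measurable (borel \<Otimes>\<^sub>M borel)"
    by (rule skew_op_measurable[OF S F])
  have "MN (1 - \<beta>1) (1 - \<beta>2) (skew_op \<tau> S F)
    \<le> Nm lborel (1 - \<beta>2) (\<lambda>u2. \<integral>\<^sup>+\<zeta>1. N (u2 - (1 - \<tau>) *\<^sub>R \<zeta>1) \<zeta>1 * G (u2 - \<zeta>1) \<partial>lborel)"
    unfolding MN_def using MN_inner_measurable[OF sk] par by (intro Nm_mono step1) auto
  \<comment> \<open>The pair (u2, \<zeta>1) enters with the opposite sign, hence c = - \<tau> and c'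
    = 1 - \<tau>.\<close>
  also have "\<dots> \<le> Nm lborel Q (\<lambda>s. Nm lborel P (\<lambda>x. N x s)) * Nm lborel \<alpha>2 G"
    using e2.skew_bilinear[OF N_m G_m, of "- \<tau>" "1 - \<tau>"] by simp
  also have "\<dots> \<le> MN P Q S * MN \<alpha>1 \<alpha>2 F"
  proof (rule mult_mono)
    show "Nm lborel \<alpha>2 G \<le> MN \<alpha>1 \<alpha>2 F" by (simp add: G_def[abs_def] MN_def)
    have P_eq: "Nm lborel P (\<lambda>z2. Nm lborel P (\<lambda>x. S (x, z2) \<zeta>)) = Nm lborel P (\<lambda>z. S z \<zeta>)" for \<zeta>
      by (rule Nm_lborel_prod(2)[symmetric]) (use par measurable_curried_comp[OF S, of "\<lambda>z. z" borel "\<lambda>_. \<zeta>"] in auto)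
    \<comment> \<open>The two applications leave the norms of S in the order x, \<zeta>2, z2,
      \<zeta>1. Moving the z2-norm inside the \<zeta>2-norm is Minkowski's inequality, and this is
      the place where P \<le> Q is required.\<close>
    have "Nm lborel Q (\<lambda>s. Nm lborel P (\<lambda>x. N x s))
      \<le> Nm lborel Q (\<lambda>\<zeta>1. Nm lborel Q (\<lambda>\<zeta>2. Nm lborel P (\<lambda>z2. Nm lborel P (\<lambda>x. S (x, z2) (\<zeta>1, \<zeta>2)))))"
    proof (rule Nm_mono)
      show "(\<lambda>s. Nm lborel P (\<lambda>x. N x s)) \<in> borel_measurable lborel"
        using MN_inner_measurable[OF N_m] by simp
      show "Nm lborel P (\<lambda>x. N x \<zeta>1) \<le> Nm lborel Q (\<lambda>\<zeta>2. Nm lborel P (\<lambda>z2. Nm lborel P (\<lambda>x. S (x, z2) (\<zeta>1, \<zeta>2))))" for \<zeta>1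
        unfolding N_def by (rule Nm_swap_le[OF lborel_sf lborel_sf _ par(1,2)]) measurable
    qed (use par in auto)
    also have "\<dots> = MN P Q S"
    proof -
      have "(\<lambda>\<zeta>. Nm lborel P (\<lambda>z. S z \<zeta>)) \<in> borel_measurable borel"
        by (rule MN_inner_measurable[OF S])
      then show ?thesis
        unfolding P_eq MN_def using par by (subst Nm_lborel_prod(1)[of "\<lambda>\<zeta>. Nm lborel P (\<lambda>z. S z \<zeta>)"]) auto
    qed
    finally show "Nm lborel Q (\<lambda>s. Nm lborel P (\<lambda>x. N x s)) \<le> MN P Q S" .
  qed auto
  finally show ?thesis .
qed

text \<open>Stated for arbitrary majorants S and F of the two transforms, so that their smoothings
  can be inserted. The shifted window contributes the kernel \<open>wt\<close>, which is why a
  smoothing of \<open>skew_op\<close> appears.\<close>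

lemma tau_op_pointwise_bound:
  fixes \<phi> :: "'a::euclidean_space \<Rightarrow> complex" and \<tau> :: real
  assumes \<phi>: "\<phi> \<in> schwartz" "\<phi> \<noteq> (\<lambda>x. 0)"
  defines "\<Gamma> \<equiv> tau_wigner \<tau> \<phi> \<phi>"
  obtains C where "0 \<le> C"
    "\<And>\<sigma> f S F x \<xi>. \<sigma> \<in> tempered \<Longrightarrow> f \<in> schwartz \<Longrightarrow>
      (\<lambda>(z, \<zeta>). S z \<zeta>) \<in> borel_measurable (borel \<Otimes>\<^sub>M borel) \<Longrightarrow>
      (\<lambda>(x, y). F x y) \<in> borel_measurable (borel \<Otimes>\<^sub>M borel) \<Longrightarrow>
      (\<And>z \<zeta>. astft \<Gamma> \<sigma> z \<zeta> \<le> S z \<zeta>) \<Longrightarrow> (\<And>x \<xi>. astft \<phi> (distribution_of f) x \<xi> \<le> F x \<xi>) \<Longrightarrow>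
      astft \<phi> (tau_op \<tau> \<sigma> f) x \<xi> \<le> ennreal C * smooth (skew_op \<tau> S F) x \<xi>"
proof -
  have \<Gamma>: "\<Gamma> \<in> schwartz" unfolding \<Gamma>_def by (intro tau_wigner_schwartz \<phi>)
  have ip\<Gamma>: "ip \<Gamma> \<Gamma> = ip \<phi> \<phi> * cnj (ip \<phi> \<phi>)" unfolding \<Gamma>_def by (intro tau_wigner_moyal \<phi>)
  define n where "n = norm (ip \<Gamma> \<Gamma>)"
  have n: "0 < n" using ip_self_ne_0[OF \<phi>] by (simp add: n_def ip\<Gamma>)
  obtain D where D: "0 \<le> D" "\<And>w. norm (stf \<phi> \<phi> w) \<le> D * wt w"
    using schwartz_wt_bound0[OF stf_schwartz[OF \<phi>(1) \<phi>(1)]] by metis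
  show ?thesis
  proof (rule that[of "D / n"])
    show "0 \<le> D / n" using D n by simp
    fix \<sigma> :: "('a \<times> 'a \<Rightarrow> complex) \<Rightarrow> complex" and f :: "'a \<Rightarrow> complex" and S F and x \<xi> :: 'a
    assume \<sigma>: "\<sigma> \<in> tempered" and f: "f \<in> schwartz"
      and S: "(\<lambda>(z, \<zeta>). S z \<zeta>) \<in> borel_measurable (borel \<Otimes>\<^sub>M borel)"
      and F: "(\<lambda>(x, y). F x y) \<in> borel_measurable (borel \<Otimes>\<^sub>M borel)"
      and leS: "\<And>z \<zeta>. astft \<Gamma> \<sigma> z \<zeta> \<le> S z \<zeta>" and leF: "\<And>x \<xi>. astft \<phi> (distribution_of f) x \<xi> \<le> F x \<xi>"
    let ?w = "(x, \<xi>)"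
    let ?W = "tau_wigner \<tau> (tfs ?w \<phi>) f"
    note [measurable (raw)] = measurable_curried_comp[OF F] measurable_curried_comp[OF S, unfolded borel_prod[symmetric]]
      wt_pair_comp measurable_curried_comp[OF skew_op_measurable[OF S F]]
    have g: "tfs ?w \<phi> \<in> schwartz" by (rule tfs_schwartz[OF \<phi>(1)])
    have W: "?W \<in> schwartz" by (intro tau_wigner_schwartz g f)
    define I where "I \<zeta>1 \<zeta>2 u1 u2 = S (u1 + \<tau> *\<^sub>R \<zeta>2, u2 - (1 - \<tau>) *\<^sub>R \<zeta>1) (\<zeta>1, \<zeta>2) * F (u1 + \<zeta>2) (u2 - \<zeta>1) * ennreal (wt (x - u1, \<xi> - u2))" for \<zeta>1 \<zeta>2 u1 u2
    \<comment> \<open>The majorant of the integrand in the original variables: symbol, input at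
      \<open>wig_a\<close>, and the decay of the window transform at \<open>wig_b\<close>.\<close>
    define J where "J = (\<lambda>(v :: ('a \<times> 'a) \<times> 'a \<times> 'a). case v of ((z1, z2), (\<zeta>1, \<zeta>2)) \<Rightarrow> S (z1, z2) (\<zeta>1, \<zeta>2) * F (z1 + (1 - \<tau>) *\<^sub>R \<zeta>2) (z2 - \<tau> *\<^sub>R \<zeta>1)
      * ennreal (wt (x - (z1 - \<tau> *\<^sub>R \<zeta>2), \<xi> - (z2 + (1 - \<tau>) *\<^sub>R \<zeta>1))))"
    have I_m [measurable (raw)]: "(\<lambda>p. I (a p) (b p) (c p) (d p)) \<in> borel_measurable N"
      if [measurable]: "a \<in> measurable N borel" "b \<in> measurable N borel" "c \<in> measurable N borel" "d \<in> measurable N borel"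
      for a b c d and N :: "'m measure"
      unfolding I_def by measurable
    have J_m: "J \<in> borel_measurable borel"
      unfolding J_def case_prod_beta' borel_prod[symmetric] by measurable
    have "ennreal n * astft \<phi> (tau_op \<tau> \<sigma> f) x \<xi> = ennreal (norm (cnj (ip \<Gamma> \<Gamma>) * \<sigma> ?W))"
      using g by (simp add: astft_def tau_op_def n_def norm_mult ennreal_mult)
    also have "\<dots> = ennreal (norm (\<integral>v. \<sigma> (tfs v \<Gamma>) * cnj (stf \<Gamma> ?W v) \<partial>lborel))"
      by (simp only: tempered_stf_inversion(1)[OF \<sigma> W \<Gamma>])
    also have "\<dots> \<le> (\<integral>\<^sup>+v. ennreal (norm (\<sigma> (tfs v \<Gamma>) * cnj (stf \<Gamma> ?W v))) \<partial>lborel)"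
      by (rule integral_norm_bound_ennreal[OF tempered_stf_inversion(2)[OF \<sigma> W \<Gamma>]])
    also have "\<dots> \<le> (\<integral>\<^sup>+v. ennreal D * J v \<partial>lborel)"
    proof (rule nn_integral_mono)
      fix v :: "('a \<times> 'a) \<times> 'a \<times> 'a"
      obtain z1 z2 \<zeta>1 \<zeta>2 where v: "v = ((z1, z2), (\<zeta>1, \<zeta>2))" by (cases v) auto
      have "norm (stf \<phi> (tfs ?w \<phi>) (wig_b \<tau> v)) \<le> D * wt (?w - wig_b \<tau> v)"
        unfolding norm_stf_tfs[OF \<phi>(1) \<phi>(1)] using D(2)[of "wig_b \<tau> v - ?w"] by (simp add: wt_minus_commute)
      then have "norm (stf \<Gamma> ?W v) \<le> (D * wt (?w - wig_b \<tau> v)) * norm (stf \<phi> f (wig_a \<tau> v))"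
        unfolding \<Gamma>_def stf_tau_wigner[OF f g \<phi>(1) \<phi>(1)] by (simp add: norm_mult mult_right_mono)
      then have "ennreal (norm (\<sigma> (tfs v \<Gamma>) * cnj (stf \<Gamma> ?W v)))
        \<le> ennreal (norm (\<sigma> (tfs v \<Gamma>))) * (ennreal D * ennreal (wt (?w - wig_b \<tau> v)) * ennreal (norm (stf \<phi> f (wig_a \<tau> v))))"
        using D(1) by (simp add: norm_mult ennreal_mult[symmetric] ennreal_leI mult_left_mono)
      also have "\<dots> \<le> S (z1, z2) (\<zeta>1, \<zeta>2) * (ennreal D * ennreal (wt (?w - wig_b \<tau> v)) * F (z1 + (1 - \<tau>) *\<^sub>R \<zeta>2) (z2 - \<tau> *\<^sub>R \<zeta>1))"
      proof (intro mult_mono order_refl)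
        show "ennreal (norm (\<sigma> (tfs v \<Gamma>))) \<le> S (z1, z2) (\<zeta>1, \<zeta>2)"
          using leS[of "(z1, z2)" "(\<zeta>1, \<zeta>2)"] by (simp add: astft_def v)
        have "distribution_of f (tfs (wig_a \<tau> v) \<phi>) = stf \<phi> f (wig_a \<tau> v)"
          using tfs_schwartz[OF \<phi>(1), of "wig_a \<tau> v"] by (simp add: distribution_of_def stf_def ip_def)
        then show "ennreal (norm (stf \<phi> f (wig_a \<tau> v))) \<le> F (z1 + (1 - \<tau>) *\<^sub>R \<zeta>2) (z2 - \<tau> *\<^sub>R \<zeta>1)"
          using leF[of "z1 + (1 - \<tau>) *\<^sub>R \<zeta>2" "z2 - \<tau> *\<^sub>R \<zeta>1"] by (simp add: astft_def v wig_a_def)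
      qed auto
      also have "\<dots> = ennreal D * J v"
        by (simp add: J_def v wig_b_def ac_simps)
      finally show "ennreal (norm (\<sigma> (tfs v \<Gamma>) * cnj (stf \<Gamma> ?W v))) \<le> ennreal D * J v" .
    qed
    also have "\<dots> = ennreal D * (\<integral>\<^sup>+v. J v \<partial>lborel)"
      using J_m by (simp add: nn_integral_cmult)
    also have "(\<integral>\<^sup>+v. J v \<partial>lborel) = (\<integral>\<^sup>+\<zeta>. \<integral>\<^sup>+z. J (z, \<zeta>) \<partial>lborel \<partial>lborel)"
      by (rule nn_integral_lborel_pair[OF J_m])
    \<comment> \<open>For fixed \<zeta> the variable z is translated so that u =
      \<open>wig_b\<close> becomes the variable; the weight then depends on u only and turns into a
      convolution kernel.\<close>
    also have "\<dots> = (\<integral>\<^sup>+\<zeta>. \<integral>\<^sup>+u. I (fst \<zeta>) (snd \<zeta>) (fst u) (snd u) \<partial>lborel \<partial>lborel)"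
    proof (rule nn_integral_cong)
      fix \<zeta> :: "'a \<times> 'a"
      obtain \<zeta>1 \<zeta>2 where \<zeta>: "\<zeta> = (\<zeta>1, \<zeta>2)" by force
      have m: "(\<lambda>z. J (z, \<zeta>)) \<in> borel_measurable borel"
        using J_m by measurable
      have "(\<integral>\<^sup>+z. J (z, \<zeta>) \<partial>lborel) = (\<integral>\<^sup>+u. J (u + (\<tau> *\<^sub>R \<zeta>2, - ((1 - \<tau>) *\<^sub>R \<zeta>1)), \<zeta>) \<partial>lborel)"
        by (rule nn_integral_shift(1)[OF m, symmetric])
      also have "\<dots> = (\<integral>\<^sup>+u. I (fst \<zeta>) (snd \<zeta>) (fst u) (snd u) \<partial>lborel)"
      proof (rule nn_integral_cong)
        fix u :: "'a \<times> 'a"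
        obtain u1 u2 where u: "u = (u1, u2)" by force
        have "u1 + \<tau> *\<^sub>R \<zeta>2 + (1 - \<tau>) *\<^sub>R \<zeta>2 = u1 + \<zeta>2" "u2 + - ((1 - \<tau>) *\<^sub>R \<zeta>1) - \<tau> *\<^sub>R \<zeta>1 = u2 - \<zeta>1"
          "x - (u1 + \<tau> *\<^sub>R \<zeta>2 - \<tau> *\<^sub>R \<zeta>2) = x - u1" "\<xi> - (u2 + - ((1 - \<tau>) *\<^sub>R \<zeta>1) + (1 - \<tau>) *\<^sub>R \<zeta>1) = \<xi> - u2"
          "u2 + - ((1 - \<tau>) *\<^sub>R \<zeta>1) = u2 - (1 - \<tau>) *\<^sub>R \<zeta>1"
          by (simp_all add: algebra_simps)
        then show "J (u + (\<tau> *\<^sub>R \<zeta>2, - ((1 - \<tau>) *\<^sub>R \<zeta>1)), \<zeta>) = I (fst \<zeta>) (snd \<zeta>) (fst u) (snd u)"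
          unfolding u \<zeta> J_def I_def by (simp only: add_Pair prod.case fst_conv snd_conv)
      qed
      finally show "(\<integral>\<^sup>+z. J (z, \<zeta>) \<partial>lborel) = (\<integral>\<^sup>+u. I (fst \<zeta>) (snd \<zeta>) (fst u) (snd u) \<partial>lborel)" .
    qed
    also have "\<dots> = (\<integral>\<^sup>+u. \<integral>\<^sup>+\<zeta>. I (fst \<zeta>) (snd \<zeta>) (fst u) (snd u) \<partial>lborel \<partial>lborel)"
    proof (rule lborel_pair.Fubini')
      have "(\<lambda>p :: ('a \<times> 'a) \<times> 'a \<times> 'a. I (fst (fst p)) (snd (fst p)) (fst (snd p)) (snd (snd p))) \<in> borel_measurable borel"
        unfolding borel_prod[symmetric] by measurable
      then have 1: "(\<lambda>p :: ('a \<times> 'a) \<times> 'a \<times> 'a. I (fst (fst p)) (snd (fst p)) (fst (snd p)) (snd (snd p))) \<in> borel_measurable (lborel \<Otimes>\<^sub>M lborel)"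
        by (simp add: lborel_prod)
      have "(\<lambda>p :: ('a \<times> 'a) \<times> 'a \<times> 'a. I (fst (snd p)) (snd (snd p)) (fst (fst p)) (snd (fst p))) \<in> borel_measurable borel"
        unfolding borel_prod[symmetric] by measurable
      then have 2: "(\<lambda>p :: ('a \<times> 'a) \<times> 'a \<times> 'a. I (fst (snd p)) (snd (snd p)) (fst (fst p)) (snd (fst p))) \<in> borel_measurable (lborel \<Otimes>\<^sub>M lborel)"
        by (simp add: lborel_prod)
      from 1 2 show "(\<lambda>(u, \<zeta>). I (fst \<zeta>) (snd \<zeta>) (fst u) (snd u)) \<in> borel_measurable (lborel \<Otimes>\<^sub>M lborel)"
        by (simp add: case_prod_beta')
    qed
    also have "\<dots> = (\<integral>\<^sup>+u. skew_op \<tau> S F (fst u) (snd u) * ennreal (wt (x - fst u, \<xi> - snd u)) \<partial>lborel)"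
    proof (rule nn_integral_cong)
      fix u :: "'a \<times> 'a"
      have "(\<integral>\<^sup>+\<zeta>. I (fst \<zeta>) (snd \<zeta>) (fst u) (snd u) \<partial>lborel) = (\<integral>\<^sup>+\<zeta>1. \<integral>\<^sup>+\<zeta>2. I \<zeta>1 \<zeta>2 (fst u) (snd u) \<partial>lborel \<partial>lborel)"
      proof -
        have m: "(\<lambda>\<zeta>. I (fst \<zeta>) (snd \<zeta>) (fst u) (snd u)) \<in> borel_measurable (lborel \<Otimes>\<^sub>M lborel)"
          by measurable
        show ?thesis using lborel.nn_integral_fst[OF m] by (simp add: lborel_prod)
      qed
      also have "\<dots> = skew_op \<tau> S F (fst u) (snd u) * ennreal (wt (x - fst u, \<xi> - snd u))"
        unfolding I_def skew_op_def by (simp add: nn_integral_multc)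
      finally show "(\<integral>\<^sup>+\<zeta>. I (fst \<zeta>) (snd \<zeta>) (fst u) (snd u) \<partial>lborel)
        = skew_op \<tau> S F (fst u) (snd u) * ennreal (wt (x - fst u, \<xi> - snd u))" .
    qed
    also have "\<dots> = smooth (skew_op \<tau> S F) x \<xi>"
    proof -
      have "(\<lambda>u :: 'a \<times> 'a. skew_op \<tau> S F (fst u) (snd u) * ennreal (wt (x - fst u, \<xi> - snd u))) \<in> borel_measurable borel"
        unfolding borel_prod[symmetric] by measurable
      from nn_integral_lborel_pair[OF this] show ?thesis unfolding smooth_def by simp
    qed
    finally have "ennreal n * astft \<phi> (tau_op \<tau> \<sigma> f) x \<xi> \<le> ennreal D * smooth (skew_op \<tau> S F) x \<xi>" .
    from mult_left_mono[OF this, of "ennreal (1 / n)"]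
    show "astft \<phi> (tau_op \<tau> \<sigma> f) x \<xi> \<le> ennreal (D / n) * smooth (skew_op \<tau> S F) x \<xi>"
      using n D(1) by (simp add: mult.assoc[symmetric] ennreal_mult[symmetric])
  qed
qed

text \<open>Measurability is read off from the integral representation of the values, as a parameter
  integral of a jointly measurable function, instead of being derived from temperedness of the
  image.\<close>

lemma tau_op_astft_measurable:
  fixes \<phi> :: "'a::euclidean_space \<Rightarrow> complex" and \<tau> :: real
  assumes \<phi>: "\<phi> \<in> schwartz" "\<phi> \<noteq> (\<lambda>x. 0)" and \<sigma>: "\<sigma> \<in> tempered" and f: "f \<in> schwartz"
  shows "(\<lambda>(x, \<xi>). astft \<phi> (tau_op \<tau> \<sigma> f) x \<xi>) \<in> borel_measurable (borel \<Otimes>\<^sub>M borel)"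
proof -
  define \<Gamma> where "\<Gamma> = tau_wigner \<tau> \<phi> \<phi>"
  have \<Gamma>: "\<Gamma> \<in> schwartz" unfolding \<Gamma>_def by (intro tau_wigner_schwartz \<phi>)
  have ip\<Gamma>: "ip \<Gamma> \<Gamma> = ip \<phi> \<phi> * cnj (ip \<phi> \<phi>)" unfolding \<Gamma>_def by (intro tau_wigner_moyal \<phi>)
  have ne: "cnj (ip \<Gamma> \<Gamma>) \<noteq> 0" using ip_self_ne_0[OF \<phi>] by (simp add: ip\<Gamma>)
  have s1 [measurable]: "stf \<phi> \<phi> \<in> borel_measurable (borel \<Otimes>\<^sub>M borel)" "stf \<phi> f \<in> borel_measurable (borel \<Otimes>\<^sub>M borel)"
    using \<phi> f unfolding borel_prod by (auto intro: schwartz_borel stf_schwartz)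
  have s2 [measurable]: "(\<lambda>v. \<sigma> (tfs v \<Gamma>)) \<in> borel_measurable ((borel \<Otimes>\<^sub>M borel) \<Otimes>\<^sub>M (borel \<Otimes>\<^sub>M borel))"
    using tempered_tfs_measurable[OF \<sigma> \<Gamma>] by (simp only: borel_prod)
  have "tau_op \<tau> \<sigma> f (tfs w \<phi>) = (1 / cnj (ip \<Gamma> \<Gamma>)) * (\<integral>v. \<sigma> (tfs v \<Gamma>) * cnj (ex2 (- (snd (fst v) \<bullet> snd (snd v))) *
      ((ex2 (fst w \<bullet> (snd w - snd (wig_b \<tau> v))) * stf \<phi> \<phi> (wig_b \<tau> v - w)) * cnj (stf \<phi> f (wig_a \<tau> v)))) \<partial>lborel)" for w
  proof -
    have g: "tfs w \<phi> \<in> schwartz" by (rule tfs_schwartz[OF \<phi>(1)])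
    have "cnj (ip \<Gamma> \<Gamma>) * tau_op \<tau> \<sigma> f (tfs w \<phi>) = (\<integral>v. \<sigma> (tfs v \<Gamma>) * cnj (stf \<Gamma> (tau_wigner \<tau> (tfs w \<phi>) f) v) \<partial>lborel)"
      using g tempered_stf_inversion(1)[OF \<sigma> tau_wigner_schwartz[OF g f] \<Gamma>] by (simp add: tau_op_def)
    then show ?thesis
      unfolding \<Gamma>_def stf_tau_wigner[OF f g \<phi>(1) \<phi>(1)] stf_tfs[OF \<phi>(1) \<phi>(1)]
      using ne by (simp add: \<Gamma>_def field_simps)
  qed
  moreover have "(\<lambda>w. \<integral>v. \<sigma> (tfs v \<Gamma>) * cnj (ex2 (- (snd (fst v) \<bullet> snd (snd v))) *
      ((ex2 (fst w \<bullet> (snd w - snd (wig_b \<tau> v))) * stf \<phi> \<phi> (wig_b \<tau> v - w)) * cnj (stf \<phi> f (wig_a \<tau> v)))) \<partial>lborel) \<in> borel_measurable borel"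
  proof (rule lborel.borel_measurable_lebesgue_integral)
    have wb: "wig_b \<tau> v = (fst (fst v) - \<tau> *\<^sub>R snd (snd v), snd (fst v) + (1 - \<tau>) *\<^sub>R fst (snd v))"
      and wa: "wig_a \<tau> v = (fst (fst v) + (1 - \<tau>) *\<^sub>R snd (snd v), snd (fst v) - \<tau> *\<^sub>R fst (snd v))" for v :: "('a \<times> 'a) \<times> 'a \<times> 'a"
      by (simp_all add: wig_a_def wig_b_def case_prod_beta')
    have dif: "(a, b) - w = (a - fst w, b - snd w)" for a b :: 'a and w by (simp add: prod_eq_iff)
    have sl: "sets (lborel :: (('a \<times> 'a) \<times> 'a \<times> 'a) measure) = sets ((borel \<Otimes>\<^sub>M borel) \<Otimes>\<^sub>M (borel \<Otimes>\<^sub>M borel))"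
      by (simp only: borel_prod sets_lborel)
    have sb: "sets ((borel :: ('a \<times> 'a) measure) \<Otimes>\<^sub>M (lborel :: (('a \<times> 'a) \<times> 'a \<times> 'a) measure))
      = sets ((borel \<Otimes>\<^sub>M borel) \<Otimes>\<^sub>M ((borel \<Otimes>\<^sub>M borel) \<Otimes>\<^sub>M (borel \<Otimes>\<^sub>M borel)))"
      by (intro sets_pair_measure_cong sl) (simp only: borel_prod)
    show "(\<lambda>(w, v). \<sigma> (tfs v \<Gamma>) * cnj (ex2 (- (snd (fst v) \<bullet> snd (snd v))) *
      ((ex2 (fst w \<bullet> (snd w - snd (wig_b \<tau> v))) * stf \<phi> \<phi> (wig_b \<tau> v - w)) * cnj (stf \<phi> f (wig_a \<tau> v)))))
      \<in> borel_measurable (borel \<Otimes>\<^sub>M lborel)"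
      unfolding measurable_cong_sets[OF sb refl] case_prod_beta' wb wa dif by measurable
  qed
  ultimately have "(\<lambda>w. tau_op \<tau> \<sigma> f (tfs w \<phi>)) \<in> borel_measurable borel" by simp
  then show ?thesis unfolding astft_def borel_prod by (simp add: case_prod_beta')
qed

text \<open>Exponents are encoded by their reciprocals: \<open>P = 1 / p\<close> and so on.\<close>

theorem tau_op_bounded:
  fixes \<phi> :: "'a::euclidean_space \<Rightarrow> complex" and \<Phi> :: "'a \<times> 'a \<Rightarrow> complex"
  assumes \<phi>: "\<phi> \<in> schwartz" "\<phi> \<noteq> (\<lambda>x. 0)" and \<Phi>: "\<Phi> \<in> schwartz" "\<Phi> \<noteq> (\<lambda>x. 0)"
    and r: "P \<in> {0..1}" "Q \<in> {0..1}" "P1 \<in> {0..1}" "Q1 \<in> {0..1}" "P2 \<in> {0..1}" "Q2 \<in> {0..1}"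
    and k: "1 - Q \<le> P1" "1 - Q \<le> Q1" "P2 \<le> Q" "Q2 \<le> Q"
    and s: "(1 - P) + (1 - Q) \<le> P1 + (1 - P2)" "(1 - P) + (1 - Q) \<le> Q1 + (1 - Q2)"
  obtains C where "0 \<le> C" "\<And>\<sigma> f. \<sigma> \<in> tempered \<Longrightarrow> f \<in> schwartz \<Longrightarrow>
    MN P2 Q2 (astft \<phi> (tau_op \<tau> \<sigma> f)) \<le> ennreal C * MN P Q (astft \<Phi> \<sigma>) * MN P1 Q1 (astft \<phi> (distribution_of f))"
proof -
  \<comment> \<open>The multilinear estimate is for P \<le> Q. If P > Q, the parameter is lowered to
    Q at the price of one smoothing; the sum conditions with P0 in place of P then follow from
    \<open>k\<close>.\<close>
  define P0 where "P0 = min P Q"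
  \<comment> \<open>The largest admissible input parameter: at most P1, so that the input norm
    controls it, and at most 1 - P0, so that \<beta>1 \<ge> 1 - Q. If the minimum is 1 - P0, the
    output parameter 1 - \<beta>1 equals Q; otherwise the sum condition gives P2 \<le> 1 -
    \<beta>1.\<close>
  define \<alpha>1 where "\<alpha>1 = min P1 (1 - P0)"
  define \<beta>1 where "\<beta>1 = (1 - P0) + (1 - Q) - \<alpha>1"
  define \<alpha>2 where "\<alpha>2 = min Q1 (1 - P0)"
  define \<beta>2 where "\<beta>2 = (1 - P0) + (1 - Q) - \<alpha>2"
  have e1: "exponents P0 Q \<alpha>1 \<beta>1" and e2: "exponents P0 Q \<alpha>2 \<beta>2"
    using r k by (auto simp: exponents_def P0_def \<alpha>1_def \<beta>1_def \<alpha>2_def \<beta>2_def min_def)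
  have out: "P2 \<le> 1 - \<beta>1" "Q2 \<le> 1 - \<beta>2" "1 - \<beta>1 \<le> 1" "1 - \<beta>2 \<le> 1"
    using r k s by (auto simp: P0_def \<alpha>1_def \<beta>1_def \<alpha>2_def \<beta>2_def min_def)
  have inn: "0 \<le> \<alpha>1" "\<alpha>1 \<le> P1" "0 \<le> \<alpha>2" "\<alpha>2 \<le> Q1" "0 \<le> P0" "P0 \<le> P"
    using r by (auto simp: P0_def \<alpha>1_def \<alpha>2_def min_def)
  have r': "0 \<le> P2" "0 \<le> Q2" "P1 \<le> 1" "Q1 \<le> 1" "0 \<le> Q" "Q \<le> 1" "P \<le> 1" using r by auto
  define \<Gamma> where "\<Gamma> = tau_wigner \<tau> \<phi> \<phi>"
  have \<Gamma>: "\<Gamma> \<in> schwartz" unfolding \<Gamma>_def by (intro tau_wigner_schwartz \<phi>)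
  obtain C1 where C1: "0 \<le> C1" "\<And>u x \<xi>. u \<in> tempered \<Longrightarrow> astft \<Gamma> u x \<xi> \<le> ennreal C1 * smooth (astft \<Phi> u) x \<xi>"
    using astft_window_change[OF \<Phi>(1) \<Gamma> \<Phi>(2)] by blast
  \<comment> \<open>The window stays the same: the purpose is to replace the transform of the input
    by a majorant that is nearly constant on unit balls.\<close>
  obtain C2 where C2: "0 \<le> C2" "\<And>u x \<xi>. u \<in> tempered \<Longrightarrow> astft \<phi> u x \<xi> \<le> ennreal C2 * smooth (astft \<phi> u) x \<xi>"
    using astft_window_change[OF \<phi>(1) \<phi>(1) \<phi>(2)] by blast
  obtain C3 where C3: "0 \<le> C3" "\<And>F :: 'a \<times> 'a \<Rightarrow> 'a \<times> 'a \<Rightarrow> ennreal.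
      (\<lambda>(x, y). F x y) \<in> borel_measurable (borel \<Otimes>\<^sub>M borel) \<Longrightarrow> MN P0 Q (smooth F) \<le> ennreal C3 * MN P Q F"
    using MN_smooth_embed[OF inn(5,6) r'(7,5) order_refl r'(6)] by blast
  obtain C4 where C4: "0 \<le> C4" "\<And>F :: 'a \<Rightarrow> 'a \<Rightarrow> ennreal.
      (\<lambda>(x, y). F x y) \<in> borel_measurable (borel \<Otimes>\<^sub>M borel) \<Longrightarrow> MN \<alpha>1 \<alpha>2 (smooth F) \<le> ennreal C4 * MN P1 Q1 F"
    using MN_smooth_embed[OF inn(1,2) r'(3) inn(3,4) r'(4)] by blast
  obtain C5 where C5: "0 \<le> C5" "\<And>F :: 'a \<Rightarrow> 'a \<Rightarrow> ennreal.
      (\<lambda>(x, y). F x y) \<in> borel_measurable (borel \<Otimes>\<^sub>M borel) \<Longrightarrow> MN P2 Q2 (smooth F) \<le> ennreal C5 * MN (1 - \<beta>1) (1 - \<beta>2) F"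
    using MN_smooth_embed[OF r'(1) out(1,3) r'(2) out(2,4)] by blast
  obtain C6 where C6: "0 \<le> C6"
    "\<And>\<sigma> f S F x \<xi>. \<sigma> \<in> tempered \<Longrightarrow> f \<in> schwartz \<Longrightarrow>
      (\<lambda>(z, \<zeta>). S z \<zeta>) \<in> borel_measurable (borel \<Otimes>\<^sub>M borel) \<Longrightarrow>
      (\<lambda>(x, y). F x y) \<in> borel_measurable (borel \<Otimes>\<^sub>M borel) \<Longrightarrow>
      (\<And>z \<zeta>. astft \<Gamma> \<sigma> z \<zeta> \<le> S z \<zeta>) \<Longrightarrow> (\<And>x \<xi>. astft \<phi> (distribution_of f) x \<xi> \<le> F x \<xi>) \<Longrightarrow>
      astft \<phi> (tau_op \<tau> \<sigma> f) x \<xi> \<le> ennreal C6 * smooth (skew_op \<tau> S F) x \<xi>"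
    using tau_op_pointwise_bound[OF \<phi>, of \<tau>] unfolding \<Gamma>_def by blast
  show ?thesis
  proof (rule that[of "C6 * C5 * (C1 * C3) * (C2 * C4)"])
    show "0 \<le> C6 * C5 * (C1 * C3) * (C2 * C4)" using C1(1) C2(1) C3(1) C4(1) C5(1) C6(1) by simp
    fix \<sigma> :: "('a \<times> 'a \<Rightarrow> complex) \<Rightarrow> complex" and f :: "'a \<Rightarrow> complex"
    assume \<sigma>: "\<sigma> \<in> tempered" and f: "f \<in> schwartz"
    let ?d = "distribution_of f"
    have d: "?d \<in> tempered" by (rule distribution_of_tempered[OF f])
    define S where "S z \<zeta> = ennreal C1 * smooth (astft \<Phi> \<sigma>) z \<zeta>" for z \<zeta>
    define F where "F x \<xi> = ennreal C2 * smooth (astft \<phi> ?d) x \<xi>" for x \<xi>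
    have sm: "(\<lambda>(x, y). smooth (astft \<Phi> \<sigma>) x y) \<in> borel_measurable (borel \<Otimes>\<^sub>M borel)"
      "(\<lambda>(x, y). smooth (astft \<phi> ?d) x y) \<in> borel_measurable (borel \<Otimes>\<^sub>M borel)"
      by (intro smooth_measurable astft_measurable \<sigma> d \<Phi> \<phi>)+
    have S_m: "(\<lambda>(x, y). S x y) \<in> borel_measurable (borel \<Otimes>\<^sub>M borel)"
      using sm(1) unfolding S_def case_prod_beta' by measurable
    have F_m: "(\<lambda>(x, y). F x y) \<in> borel_measurable (borel \<Otimes>\<^sub>M borel)"
      using sm(2) unfolding F_def case_prod_beta' by measurable
    have K_m: "(\<lambda>(x, y). skew_op \<tau> S F x y) \<in> borel_measurable (borel \<Otimes>\<^sub>M borel)"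
      by (rule skew_op_measurable[OF S_m F_m])
    have bS: "MN P0 Q S \<le> ennreal C1 * (ennreal C3 * MN P Q (astft \<Phi> \<sigma>))"
    proof -
      have "MN P0 Q S = ennreal C1 * MN P0 Q (smooth (astft \<Phi> \<sigma>))"
        unfolding S_def by (rule MN_cmult_le[OF sm(1) inn(5) r'(5) C1(1)])
      also have "\<dots> \<le> ennreal C1 * (ennreal C3 * MN P Q (astft \<Phi> \<sigma>))"
        by (intro mult_left_mono C3(2) astft_measurable \<sigma> \<Phi>) simp
      finally show ?thesis .
    qed
    have bF: "MN \<alpha>1 \<alpha>2 F \<le> ennreal C2 * (ennreal C4 * MN P1 Q1 (astft \<phi> ?d))"
    proof -
      have "MN \<alpha>1 \<alpha>2 F = ennreal C2 * MN \<alpha>1 \<alpha>2 (smooth (astft \<phi> ?d))"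
        unfolding F_def by (rule MN_cmult_le[OF sm(2) inn(1,3) C2(1)])
      also have "\<dots> \<le> ennreal C2 * (ennreal C4 * MN P1 Q1 (astft \<phi> ?d))"
        by (intro mult_left_mono C4(2) astft_measurable d \<phi>) simp
      finally show ?thesis .
    qed
    have "MN P2 Q2 (astft \<phi> (tau_op \<tau> \<sigma> f)) \<le> MN P2 Q2 (\<lambda>x \<xi>. ennreal C6 * smooth (skew_op \<tau> S F) x \<xi>)"
    proof (rule MN_mono[OF tau_op_astft_measurable[OF \<phi> \<sigma> f] r'(1,2)])
      show "astft \<phi> (tau_op \<tau> \<sigma> f) x \<xi> \<le> ennreal C6 * smooth (skew_op \<tau> S F) x \<xi>" for x \<xi>
        by (rule C6(2)[OF \<sigma> f S_m F_m]) (auto simp: S_def F_def intro: C1(2)[OF \<sigma>] C2(2)[OF d])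
    qed
    also have "\<dots> = ennreal C6 * MN P2 Q2 (smooth (skew_op \<tau> S F))"
      by (rule MN_cmult_le[OF smooth_measurable[OF K_m] r'(1,2) C6(1)])
    also have "\<dots> \<le> ennreal C6 * (ennreal C5 * MN (1 - \<beta>1) (1 - \<beta>2) (skew_op \<tau> S F))"
      by (intro mult_left_mono C5(2) K_m) simp
    also have "\<dots> \<le> ennreal C6 * (ennreal C5 * (MN P0 Q S * MN \<alpha>1 \<alpha>2 F))"
      by (intro mult_left_mono skew_op_bound[OF e1 e2 S_m F_m]) auto
    also have "\<dots> \<le> ennreal C6 * (ennreal C5 * ((ennreal C1 * (ennreal C3 * MN P Q (astft \<Phi> \<sigma>))) * (ennreal C2 * (ennreal C4 * MN P1 Q1 (astft \<phi> ?d)))))"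
      by (intro mult_left_mono mult_mono bS bF) auto
    also have "\<dots> = ennreal (C6 * C5 * (C1 * C3) * (C2 * C4)) * MN P Q (astft \<Phi> \<sigma>) * MN P1 Q1 (astft \<phi> ?d)"
      using C1(1) C2(1) C3(1) C4(1) C5(1) C6(1) by (simp add: ennreal_mult ac_simps)
    finally show "MN P2 Q2 (astft \<phi> (tau_op \<tau> \<sigma> f))
      \<le> ennreal (C6 * C5 * (C1 * C3) * (C2 * C4)) * MN P Q (astft \<Phi> \<sigma>) * MN P1 Q1 (astft \<phi> ?d)" .
  qed
qed

section \<open>Weighted sums of time-frequency shifts\<close>

text \<open>The derivative of the product of F with the conjugated shifted window has integral zero;
  a frequency factor is thus traded for a derivative on F or on the window.\<close>

lemma stf_by_parts:
  fixes F \<gamma> :: "'a::euclidean_space \<Rightarrow> complex"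
  assumes F: "F \<in> schwartz" and \<gamma>: "\<gamma> \<in> schwartz" and b: "b \<in> Basis"
  shows "2 * pi * \<i> * of_real (b \<bullet> snd w) * stf \<gamma> F w = stf \<gamma> (pd b F) w + stf (pd b \<gamma>) F w"
proof -
  have T: "translation (fst w) \<gamma> \<in> schwartz" and T': "translation (fst w) (pd b \<gamma>) \<in> schwartz"
    by (intro schwartz_translation schwartz_pd \<gamma> b)+
  have t: "tfs w \<gamma> \<in> schwartz" "tfs w (pd b \<gamma>) \<in> schwartz"
    by (intro tfs_schwartz schwartz_pd \<gamma> b)+
  have c: "(\<lambda>x. cnj (tfs w \<gamma> x)) \<in> schwartz" by (rule schwartz_cnj[OF t(1)])
  have "pd b (tfs w \<gamma>) x = 2 * pi * \<i> * of_real (b \<bullet> snd w) * tfs w \<gamma> x + tfs w (pd b \<gamma>) x" for x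
    unfolding tfs_def pd_modulation[OF T] pd_translation[OF \<gamma> b] by (simp add: modulation_eq algebra_simps)
  then have "pd b (\<lambda>x. F x * cnj (tfs w \<gamma> x)) x
    = (pd b F x * cnj (tfs w \<gamma> x) + F x * cnj (tfs w (pd b \<gamma>) x)) - 2 * pi * \<i> * of_real (b \<bullet> snd w) * (F x * cnj (tfs w \<gamma> x))" for x
    unfolding pd_mult[OF F c] pd_cnj[OF t(1)] by (simp add: algebra_simps)
  then have "pd b (\<lambda>x. F x * cnj (tfs w \<gamma> x)) = (\<lambda>x.
      (pd b F x * cnj (tfs w \<gamma> x) + F x * cnj (tfs w (pd b \<gamma>) x)) - 2 * pi * \<i> * of_real (b \<bullet> snd w) * (F x * cnj (tfs w \<gamma> x)))"
    by (rule ext)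
  with integral_pd_eq_0[OF schwartz_mult[OF F c] b]
  have "0 = (\<integral>x. (pd b F x * cnj (tfs w \<gamma> x) + F x * cnj (tfs w (pd b \<gamma>) x)) - 2 * pi * \<i> * of_real (b \<bullet> snd w) * (F x * cnj (tfs w \<gamma> x)) \<partial>lborel)"
    by simp
  also have "\<dots> = stf \<gamma> (pd b F) w + stf (pd b \<gamma>) F w - 2 * pi * \<i> * of_real (b \<bullet> snd w) * stf \<gamma> F w"
    using ip_integrable[OF schwartz_pd[OF F b] t(1)] ip_integrable[OF F t(2)] ip_integrable[OF F t(1)]
    by (simp add: stf_def ip_def)
  finally show ?thesis by simp
qed

text \<open>The weight at the translation splits into the weight at t, carried by F, and the weight
  at t minus the translation, carried by \<gamma>. The bound is linear in the seminorm constant of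
  F, as needed to prove series of shifts tempered.\<close>

lemma stf_translation_decay:
  fixes \<gamma> :: "'a::euclidean_space \<Rightarrow> complex"
  assumes \<gamma>: "\<gamma> \<in> schwartz"
  obtains C where "0 \<le> C"
    "\<And>F c w. F \<in> schwartz \<Longrightarrow> sbd K 0 c F \<Longrightarrow> (1 + norm (fst w)) ^ K * norm (stf \<gamma> F w) \<le> C * c"
proof -
  obtain D where D: "0 \<le> D" "\<And>x. (1 + norm x) ^ K * norm (\<gamma> x) \<le> D * wt x"
    using schwartz_wt_bound[OF \<gamma>] by metis
  show ?thesis
  proof (rule that[of "D * (\<integral>x. wt (x::'a) \<partial>lborel)"])
    show "0 \<le> D * (\<integral>x. wt (x::'a) \<partial>lborel)" using D(1) by (simp add: integral_nonneg_AE)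
    fix F :: "'a \<Rightarrow> complex" and c and w :: "'a \<times> 'a"
    assume F: "F \<in> schwartz" and s: "sbd K 0 c F"
    let ?k = "(1 + norm (fst w)) ^ K"
    have c: "0 \<le> c" by (rule sbd_nonneg[OF s])
    have wi: "integrable lborel (\<lambda>t. c * (D * wt (t - fst w)))"
    proof -
      have "integrable lborel (\<lambda>t. wt (t - fst w))"
        using wt_peetre[of _ "- fst w"] by (intro integrable_wt_bound[where C = "(1 + norm (fst w)) ^ (2 * DIM('a))"]) auto
      then show ?thesis by simp
    qed
    have "?k * norm (stf \<gamma> F w) \<le> ?k * (\<integral>t. norm (F t * cnj (tfs w \<gamma> t)) \<partial>lborel)"
      unfolding stf_def ip_def by (intro mult_left_mono Bochner_Integration.integral_norm_bound) auto
    also have "\<dots> = (\<integral>t. ?k * norm (F t * cnj (tfs w \<gamma> t)) \<partial>lborel)" by simp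
    also have "\<dots> \<le> (\<integral>t. c * (D * wt (t - fst w)) \<partial>lborel)"
    proof (rule integral_mono[OF _ wi])
      show "integrable lborel (\<lambda>t. ?k * norm (F t * cnj (tfs w \<gamma> t)))"
        using ip_integrable[OF F tfs_schwartz[OF \<gamma>], of w] by (intro integrable_mult_right integrable_norm)
      fix t :: 'a
      have "?k \<le> ((1 + norm t) * (1 + norm (t - fst w))) ^ K"
        using one_plus_norm_mult[of t "fst w - t"] by (intro power_mono) (auto simp: norm_minus_commute)
      then have "?k * norm (F t * cnj (tfs w \<gamma> t)) \<le> ((1 + norm t) * (1 + norm (t - fst w))) ^ K * norm (F t * cnj (tfs w \<gamma> t))"
        by (rule mult_right_mono) simp
      also have "\<dots> = ((1 + norm t) ^ K * norm (F t)) * ((1 + norm (t - fst w)) ^ K * norm (\<gamma> (t - fst w)))"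
        by (simp add: tfs_apply norm_mult power_mult_distrib)
      also have "\<dots> \<le> c * (D * wt (t - fst w))"
        using s c by (intro mult_mono[OF _ D(2)]) (auto simp: sbd_0)
      finally show "?k * norm (F t * cnj (tfs w \<gamma> t)) \<le> c * (D * wt (t - fst w))" .
    qed
    also have "\<dots> = D * (\<integral>x. wt (x::'a) \<partial>lborel) * c"
      using lborel_integral_shift(2)[of wt "fst w"] by simp
    finally show "?k * norm (stf \<gamma> F w) \<le> D * (\<integral>x. wt (x::'a) \<partial>lborel) * c" .
  qed
qed

text \<open>Two integrations by parts in the single direction b. Quadratic decay in the translation
  and in one frequency coordinate is all that summation over a two-parameter lattice
  requires.\<close>

lemma stf_decay:
  fixes \<gamma> :: "'a::euclidean_space \<Rightarrow> complex"
  assumes \<gamma>: "\<gamma> \<in> schwartz" and b: "b \<in> Basis"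
  obtains C where "0 \<le> C"
    "\<And>F c w. F \<in> schwartz \<Longrightarrow> sbd 2 2 c F \<Longrightarrow>
      norm (stf \<gamma> F w) \<le> C * c / ((1 + norm (fst w))\<^sup>2 * (1 + \<bar>b \<bullet> snd w\<bar>)\<^sup>2)"
proof -
  have S: "pd b \<gamma> \<in> schwartz" "pd b (pd b \<gamma>) \<in> schwartz" by (intro schwartz_pd \<gamma> b)+
  obtain C0 where C0: "0 \<le> C0" "\<And>F c w. F \<in> schwartz \<Longrightarrow> sbd 2 0 c F \<Longrightarrow> (1 + norm (fst w)) ^ 2 * norm (stf \<gamma> F w) \<le> C0 * c"
    using stf_translation_decay[OF \<gamma>, of 2] by metis
  obtain C1 where C1: "0 \<le> C1" "\<And>F c w. F \<in> schwartz \<Longrightarrow> sbd 2 0 c F \<Longrightarrow> (1 + norm (fst w)) ^ 2 * norm (stf (pd b \<gamma>) F w) \<le> C1 * c"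
    using stf_translation_decay[OF S(1), of 2] by metis
  obtain C2 where C2: "0 \<le> C2" "\<And>F c w. F \<in> schwartz \<Longrightarrow> sbd 2 0 c F \<Longrightarrow> (1 + norm (fst w)) ^ 2 * norm (stf (pd b (pd b \<gamma>)) F w) \<le> C2 * c"
    using stf_translation_decay[OF S(2), of 2] by metis
  define C where "C = 3 * C0 + 2 * C1 + C2"
  show ?thesis
  proof (rule that[of "2 * C"])
    show "0 \<le> 2 * C" using C0 C1 C2 by (simp add: C_def)
    fix F :: "'a \<Rightarrow> complex" and c and w :: "'a \<times> 'a"
    assume F: "F \<in> schwartz" and s: "sbd 2 2 c F"
    have c: "0 \<le> c" by (rule sbd_nonneg[OF s])
    have FS: "pd b F \<in> schwartz" "pd b (pd b F) \<in> schwartz" by (intro schwartz_pd F b)+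
    have sb: "sbd 2 0 c F" "sbd 2 0 c (pd b F)" "sbd 2 0 c (pd b (pd b F))"
      using s b by (simp_all add: numeral_2_eq_2 sbd_Suc sbd_0)
    define k where "k = (1 + norm (fst w)) ^ 2"
    define r where "r = \<bar>b \<bullet> snd w\<bar>"
    have k: "0 < k" unfolding k_def by (intro zero_less_power add_pos_nonneg) auto
    have r: "0 \<le> r" by (simp add: r_def)
    \<comment> \<open>The second integration by parts acts on each term of the first, which yields
      the binomial coefficients 1, 2, 1.\<close>
    have eq: "(2 * pi * \<i> * of_real (b \<bullet> snd w))\<^sup>2 * stf \<gamma> F w
      = stf \<gamma> (pd b (pd b F)) w + 2 * stf (pd b \<gamma>) (pd b F) w + stf (pd b (pd b \<gamma>)) F w"
      unfolding power2_eq_square mult.assoc[of "2 * pi * \<i> * of_real (b \<bullet> snd w)" "2 * pi * \<i> * of_real (b \<bullet> snd w)"]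
        stf_by_parts[OF F \<gamma> b] distrib_left stf_by_parts[OF FS(1) \<gamma> b] stf_by_parts[OF F S(1) b] by simp
    have "r\<^sup>2 * (k * norm (stf \<gamma> F w)) \<le> (2 * pi * r)\<^sup>2 * (k * norm (stf \<gamma> F w))"
    proof (rule mult_right_mono)
      have "1 * r \<le> 2 * pi * r" using pi_ge_two r by (intro mult_right_mono) auto
      then show "r\<^sup>2 \<le> (2 * pi * r)\<^sup>2" using r by (intro power_mono) auto
    qed (use k in simp)
    also have "\<dots> = k * norm ((2 * pi * \<i> * of_real (b \<bullet> snd w))\<^sup>2 * stf \<gamma> F w)"
      by (simp add: norm_mult norm_power r_def power_mult_distrib)
    also have "\<dots> \<le> k * (norm (stf \<gamma> (pd b (pd b F)) w) + 2 * norm (stf (pd b \<gamma>) (pd b F) w) + norm (stf (pd b (pd b \<gamma>)) F w))"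
      unfolding eq using k by (intro mult_left_mono order.trans[OF norm_triangle_ineq] add_mono order_refl) (auto simp: norm_mult)
    also have "\<dots> = k * norm (stf \<gamma> (pd b (pd b F)) w) + 2 * (k * norm (stf (pd b \<gamma>) (pd b F) w)) + k * norm (stf (pd b (pd b \<gamma>)) F w)"
      by (simp add: algebra_simps)
    also have "\<dots> \<le> C0 * c + 2 * (C1 * c) + C2 * c"
      unfolding k_def by (intro add_mono mult_left_mono C0(2) C1(2) C2(2) F FS sb) auto
    finally have r2: "r\<^sup>2 * (k * norm (stf \<gamma> F w)) \<le> C0 * c + 2 * (C1 * c) + C2 * c" .
    have r0: "k * norm (stf \<gamma> F w) \<le> C0 * c" unfolding k_def by (rule C0(2)[OF F sb(1)])
    have "(1 + r)\<^sup>2 \<le> 2 * (1 + r\<^sup>2)" using sum_squares_bound[of 1 r] by (simp add: power2_eq_square algebra_simps)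
    then have "(1 + r)\<^sup>2 * (k * norm (stf \<gamma> F w)) \<le> 2 * (1 + r\<^sup>2) * (k * norm (stf \<gamma> F w))"
      using k by (intro mult_right_mono) auto
    also have "\<dots> = 2 * (k * norm (stf \<gamma> F w) + r\<^sup>2 * (k * norm (stf \<gamma> F w)))" by (simp add: algebra_simps)
    also have "\<dots> \<le> 2 * (C0 * c + (C0 * c + 2 * (C1 * c) + C2 * c))" using r0 r2 by simp
    also have "\<dots> \<le> 2 * C * c" using C0(1) c by (simp add: C_def algebra_simps)
    finally have "(1 + r)\<^sup>2 * (k * norm (stf \<gamma> F w)) \<le> 2 * C * c" .
    moreover have "0 < (1 + r)\<^sup>2" using r by (intro zero_less_power) simp
    ultimately show "norm (stf \<gamma> F w) \<le> 2 * C * c / ((1 + norm (fst w))\<^sup>2 * (1 + \<bar>b \<bullet> snd w\<bar>)\<^sup>2)"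
      using k unfolding k_def[symmetric] r_def[symmetric] by (simp add: field_simps)
  qed
qed

text \<open>This functional is the series of the d i times \<open>tfs (w i) \<gamma>\<close>, as
  each shift acts on F by \<open>cnj (stf \<gamma> F (w i))\<close>. The weights in the hypothesis
  are those of \<open>stf_decay\<close>, which gives absolute convergence with a seminorm
  bound.\<close>

lemma tempered_weighted_sum:
  fixes \<gamma> :: "'a::euclidean_space \<Rightarrow> complex" and w :: "'i \<Rightarrow> 'a \<times> 'a" and d :: "'i \<Rightarrow> complex"
  assumes \<gamma>: "\<gamma> \<in> schwartz" and b: "b \<in> Basis"
    and d: "integrable (count_space UNIV) (\<lambda>i. norm (d i) / ((1 + norm (fst (w i)))\<^sup>2 * (1 + \<bar>b \<bullet> snd (w i)\<bar>)\<^sup>2))"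
  shows "(\<lambda>F\<in>schwartz. \<integral>i. d i * cnj (stf \<gamma> F (w i)) \<partial>count_space UNIV) \<in> tempered"
    and "F \<in> schwartz \<Longrightarrow> integrable (count_space UNIV) (\<lambda>i. d i * cnj (stf \<gamma> F (w i)))"
proof -
  obtain C where C: "0 \<le> C" "\<And>F c w. F \<in> schwartz \<Longrightarrow> sbd 2 2 c F \<Longrightarrow>
      norm (stf \<gamma> F w) \<le> C * c / ((1 + norm (fst w))\<^sup>2 * (1 + \<bar>b \<bullet> snd w\<bar>)\<^sup>2)"
    using stf_decay[OF \<gamma> b] by metis
  define R where "R i = norm (d i) / ((1 + norm (fst (w i)))\<^sup>2 * (1 + \<bar>b \<bullet> snd (w i)\<bar>)\<^sup>2)" for i
  have R: "integrable (count_space UNIV) R" using d unfolding R_def .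
  have le: "norm (d i * cnj (stf \<gamma> F (w i))) \<le> C * c * R i" if "F \<in> schwartz" "sbd 2 2 c F" for F c i
    using mult_left_mono[OF C(2)[OF that, of "w i"], of "norm (d i)"] by (simp add: norm_mult R_def field_simps)
  show int: "integrable (count_space UNIV) (\<lambda>i. d i * cnj (stf \<gamma> F (w i)))" if F: "F \<in> schwartz" for F
  proof -
    obtain c where c: "0 < c" "sbd 2 2 c F" using sbd_exists[OF F] by blast
    show ?thesis
      by (rule Bochner_Integration.integrable_bound[of _ "\<lambda>i. C * c * R i"])
        (use R le[OF F c(2)] in \<open>auto intro!: AE_I2 order.trans[OF _ abs_ge_self]\<close>)
  qed
  have stf_add: "stf \<gamma> (\<lambda>x. f x + g x) v = stf \<gamma> f v + stf \<gamma> g v" if "f \<in> schwartz" "g \<in> schwartz" for f g v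
    using ip_integrable[OF that(1) tfs_schwartz[OF \<gamma>]] ip_integrable[OF that(2) tfs_schwartz[OF \<gamma>]]
    by (simp add: stf_def ip_def distrib_right)
  have stf_cm: "stf \<gamma> (\<lambda>x. a * f x) v = a * stf \<gamma> f v" for f v a
    by (simp add: stf_def ip_def mult.assoc)
  show "(\<lambda>F\<in>schwartz. \<integral>i. d i * cnj (stf \<gamma> F (w i)) \<partial>count_space UNIV) \<in> tempered"
  proof (rule tempered_intro[where C = "C * integral\<^sup>L (count_space UNIV) R" and K = 2 and L = 2])
    show "0 \<le> C * integral\<^sup>L (count_space UNIV) R" using C(1) by (auto simp: R_def intro!: mult_nonneg_nonneg integral_nonneg_AE)
    fix f :: "'a \<Rightarrow> complex" assume f: "f \<in> schwartz"
    show "(\<lambda>F\<in>schwartz. \<integral>i. d i * cnj (stf \<gamma> F (w i)) \<partial>count_space UNIV) (\<lambda>x. c * f x)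
      = cnj c * (\<lambda>F\<in>schwartz. \<integral>i. d i * cnj (stf \<gamma> F (w i)) \<partial>count_space UNIV) f" for c
      using f schwartz_cmult[OF f, of c] by (simp add: stf_cm mult.left_commute)
    show "(\<lambda>F\<in>schwartz. \<integral>i. d i * cnj (stf \<gamma> F (w i)) \<partial>count_space UNIV) (\<lambda>x. f x + g x)
      = (\<lambda>F\<in>schwartz. \<integral>i. d i * cnj (stf \<gamma> F (w i)) \<partial>count_space UNIV) f
      + (\<lambda>F\<in>schwartz. \<integral>i. d i * cnj (stf \<gamma> F (w i)) \<partial>count_space UNIV) g" if g: "g \<in> schwartz" for g
      using f g schwartz_add[OF f g] int[OF f] int[OF g] by (simp add: stf_add distrib_left)
    show "norm ((\<lambda>F\<in>schwartz. \<integral>i. d i * cnj (stf \<gamma> F (w i)) \<partial>count_space UNIV) f)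
      \<le> C * integral\<^sup>L (count_space UNIV) R * c" if s: "sbd 2 2 c f" for c
    proof -
      have "norm (\<integral>i. d i * cnj (stf \<gamma> f (w i)) \<partial>count_space UNIV) \<le> (\<integral>i. C * c * R i \<partial>count_space UNIV)"
        by (intro order.trans[OF integral_norm_bound] integral_mono integrable_norm int f integrable_mult_right R le s)
      then show ?thesis using f by (simp add: ac_simps)
    qed
  qed auto
qed

section \<open>Lattice sums in mixed norms\<close>

lemma measurable_pair_count_space:
  fixes F :: "'a \<Rightarrow> 'i::countable \<Rightarrow> ennreal"
  assumes "\<And>n. (\<lambda>x. F x n) \<in> borel_measurable M"
  shows "(\<lambda>(x, n). F x n) \<in> borel_measurable (M \<Otimes>\<^sub>M count_space UNIV)"
proof (rule measurable_curried_swap)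
  show "(\<lambda>(n, x). F x n) \<in> borel_measurable (count_space UNIV \<Otimes>\<^sub>M M)"
    by (rule measurable_pair_measure_countable1) (use assms in auto)
qed

lemma measurable_nn_integral_count_space:
  fixes F :: "'a \<Rightarrow> 'i::countable \<Rightarrow> ennreal"
  assumes "\<And>n. (\<lambda>x. F x n) \<in> borel_measurable M"
  shows "(\<lambda>x. \<integral>\<^sup>+n. F x n \<partial>count_space UNIV) \<in> borel_measurable M"
proof -
  interpret sigma_finite_measure "count_space (UNIV :: 'i set)" by (rule sigma_finite_measure_count_space)
  show ?thesis using measurable_pair_count_space[of F M, OF assms] by (rule borel_measurable_nn_integral)
qed

lemma nn_integral_count_space_swap:
  fixes F :: "'a \<Rightarrow> nat \<Rightarrow> ennreal"
  assumes "\<And>n. (\<lambda>x. F x n) \<in> borel_measurable M"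
  shows "(\<integral>\<^sup>+x. \<integral>\<^sup>+n. F x n \<partial>count_space UNIV \<partial>M) = (\<integral>\<^sup>+n. \<integral>\<^sup>+x. F x n \<partial>M \<partial>count_space UNIV)"
  unfolding nn_integral_count_space_nat by (rule nn_integral_suminf) (rule assms)

lemma Nm_minkowski_count_space:
  fixes F :: "'a::euclidean_space \<Rightarrow> nat \<Rightarrow> ennreal"
  assumes "\<And>n. (\<lambda>x. F x n) \<in> borel_measurable borel" "0 \<le> \<theta>" "\<theta> \<le> 1"
  shows "Nm lborel \<theta> (\<lambda>x. \<integral>\<^sup>+n. F x n \<partial>count_space UNIV) \<le> (\<integral>\<^sup>+n. Nm lborel \<theta> (\<lambda>x. F x n) \<partial>count_space UNIV)"
  using assms by (intro Nm_minkowski lborel_sf sigma_finite_measure_count_space measurable_pair_count_space) auto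

text \<open>Comparison with an integral: balls of radius 1/2 around the multiples of a unit vector
  are disjoint, and on each of them the weight is nearly constant. The bound is uniform in x and
  e.\<close>

lemma wt_lattice_sum:
  obtains S where "S < \<infinity>"
    "\<And>x e :: 'a::euclidean_space. norm e = 1 \<Longrightarrow> (\<integral>\<^sup>+n. ennreal (wt (x - real n *\<^sub>R e)) \<partial>count_space UNIV) \<le> S"
proof -
  define W where "W = (\<integral>\<^sup>+y. ennreal (wt (y::'a)) \<partial>lborel)"
  have W: "W < \<infinity>" unfolding W_def using wt_integrable[where 'a='a] by (simp add: nn_integral_eq_integral)
  define V where "V = unit_ball_vol (DIM('a)) * (1/2) ^ DIM('a)"
  have V: "0 < V" by (simp add: V_def)
  \<comment> \<open>Peetre's inequality for displacements below 1/2, rounded up to the base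
    2.\<close>
  define c :: real where "c = 2 ^ (2 * DIM('a))"
  have c: "0 \<le> c" by (simp add: c_def)
  have *: "ennreal V * (\<integral>\<^sup>+n. ennreal (wt (x - real n *\<^sub>R e)) \<partial>count_space UNIV) \<le> ennreal c * W"
    if e: "norm e = 1" for x e :: 'a
  proof -
    let ?B = "\<lambda>n::nat. ball (real n *\<^sub>R e) (1/2)"
    have "ennreal V * (\<integral>\<^sup>+n. ennreal (wt (x - real n *\<^sub>R e)) \<partial>count_space UNIV)
      = (\<integral>\<^sup>+n. \<integral>\<^sup>+y. ennreal (wt (x - real n *\<^sub>R e)) * indicator (?B n) y \<partial>lborel \<partial>count_space UNIV)"
    proof -
      have "emeasure lborel (?B n) = ennreal V" for n
        using emeasure_ball[of "1/2" "real n *\<^sub>R e"] by (simp add: V_def)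
      then show ?thesis by (simp add: nn_integral_cmult nn_integral_cmult_indicator mult.commute)
    qed
    also have "\<dots> \<le> (\<integral>\<^sup>+n. \<integral>\<^sup>+y. ennreal c * ennreal (wt (x - y)) * indicator (?B n) y \<partial>lborel \<partial>count_space UNIV)"
    proof (intro nn_integral_mono)
      fix n and y :: 'a
      have "wt (x - real n *\<^sub>R e) \<le> c * wt (x - y)" if "y \<in> ?B n"
      proof -
        have "wt ((x - y) + (y - real n *\<^sub>R e)) \<le> (1 + norm (y - real n *\<^sub>R e)) ^ (2 * DIM('a)) * wt (x - y)" by (rule wt_peetre)
        also have "\<dots> \<le> c * wt (x - y)"
          unfolding c_def using that by (intro mult_right_mono power_mono) (auto simp: dist_norm norm_minus_commute)
        finally show ?thesis by simp
      qed
      then show "ennreal (wt (x - real n *\<^sub>R e)) * indicator (?B n) y \<le> ennreal c * ennreal (wt (x - y)) * indicator (?B n) y"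
        using c by (auto simp: ennreal_mult[symmetric] ennreal_leI split: split_indicator)
    qed
    also have "\<dots> = (\<integral>\<^sup>+y. \<integral>\<^sup>+n. ennreal c * ennreal (wt (x - y)) * indicator (?B n) y \<partial>count_space UNIV \<partial>lborel)"
      by (rule nn_integral_count_space_swap[symmetric]) (intro borel_measurable_times_ennreal borel_measurable_indicator, auto)
    also have "\<dots> \<le> (\<integral>\<^sup>+y. ennreal c * ennreal (wt (x - y)) \<partial>lborel)"
    proof (rule nn_integral_mono)
      fix y :: 'a
      let ?A = "{n. y \<in> ?B n}"
      have one: "m = n" if "m \<in> ?A" "n \<in> ?A" for m n
      proof -
        have "dist (real m *\<^sub>R e) (real n *\<^sub>R e) < 1"
          using that dist_triangle_half_l[of "real m *\<^sub>R e" y 1 "real n *\<^sub>R e"] by (simp add: dist_commute)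
        moreover have "dist (real m *\<^sub>R e) (real n *\<^sub>R e) = \<bar>real m - real n\<bar>"
          by (simp add: dist_norm scaleR_diff_left[symmetric] e)
        ultimately show ?thesis by linarith
      qed
      have "\<exists>m. ?A \<subseteq> {m}" using one by blast
      then obtain m where m: "?A \<subseteq> {m}" ..
      have A: "finite ?A" "card ?A \<le> 1"
        using finite_subset[OF m] card_mono[OF _ m] by simp_all
      have "(\<integral>\<^sup>+n. ennreal c * ennreal (wt (x - y)) * indicator (?B n) y \<partial>count_space UNIV)
        = ennreal c * ennreal (wt (x - y)) * (\<integral>\<^sup>+n. indicator ?A n \<partial>count_space UNIV)"
        by (subst nn_integral_cmult[symmetric]) (auto intro!: nn_integral_cong split: split_indicator)
      also have "(\<integral>\<^sup>+n. indicator ?A n \<partial>count_space UNIV) = ennreal (card ?A)"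
        using A(1) by (simp add: emeasure_count_space_finite ennreal_of_nat_eq_real_of_nat)
      also have "ennreal c * ennreal (wt (x - y)) * ennreal (card ?A) \<le> ennreal c * ennreal (wt (x - y)) * 1"
        using A(2) by (intro mult_left_mono) (auto simp: ennreal_le_1)
      finally show "(\<integral>\<^sup>+n. ennreal c * ennreal (wt (x - y)) * indicator (?B n) y \<partial>count_space UNIV) \<le> ennreal c * ennreal (wt (x - y))"
        by simp
    qed
    also have "\<dots> = ennreal c * W"
      using nn_integral_shift(4)[of "\<lambda>y. ennreal (wt y)" x] by (simp add: nn_integral_cmult W_def)
    finally show ?thesis .
  qed
  show ?thesis
  proof (rule that[of "ennreal (1 / V) * (ennreal c * W)"])
    show "ennreal (1 / V) * (ennreal c * W) < \<infinity>" using W by (simp add: ennreal_mult_less_top)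
    fix x e :: 'a assume "norm e = 1"
    from mult_left_mono[OF *[OF this, of x], of "ennreal (1 / V)"]
    show "(\<integral>\<^sup>+n. ennreal (wt (x - real n *\<^sub>R e)) \<partial>count_space UNIV) \<le> ennreal (1 / V) * (ennreal c * W)"
      using V by (simp add: mult.assoc[symmetric] ennreal_mult[symmetric])
  qed
qed

text \<open>A Schur test: splitting the kernel into its powers \<theta> and 1 - \<theta> and using
  Hoelder for the sum, one factor is bounded by the uniform lattice sum and the other by the mass of
  the weight.\<close>

lemma Nm_lattice:
  assumes \<theta>: "0 \<le> \<theta>" "\<theta> \<le> 1"
  obtains D where "D < \<infinity>"
    "\<And>u (e :: 'a::euclidean_space). norm e = 1 \<Longrightarrow> (\<And>n. u n \<le> 1) \<Longrightarrow>
      Nm lborel \<theta> (\<lambda>x. \<integral>\<^sup>+n. u n * ennreal (wt (x - real n *\<^sub>R e)) \<partial>count_space UNIV)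
        \<le> D * epow (\<integral>\<^sup>+n. epow (u n) (1 / \<theta>) \<partial>count_space UNIV) \<theta>"
proof -
  obtain S where S: "S < \<infinity>"
    "\<And>x e :: 'a. norm e = 1 \<Longrightarrow> (\<integral>\<^sup>+n. ennreal (wt (x - real n *\<^sub>R e)) \<partial>count_space UNIV) \<le> S"
    using wt_lattice_sum[where 'a='a] by blast
  show ?thesis
  proof (cases "\<theta> = 0")
    case True
    show ?thesis
    proof (rule that[OF S(1)])
      fix u :: "nat \<Rightarrow> ennreal" and e :: 'a assume e: "norm e = 1" and u: "\<And>n. u n \<le> 1"
      \<comment> \<open>For \<theta> = 0 the sum on the right is raised to the power zero and equals
        one; the hypothesis u n \<le> 1 stands in for the supremum of the sequence.\<close>
      have "(\<integral>\<^sup>+n. u n * ennreal (wt (x - real n *\<^sub>R e)) \<partial>count_space UNIV) \<le> S" for x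
        using mult_right_mono[OF u] by (intro order.trans[OF nn_integral_mono S(2)[OF e, of x]]) auto
      moreover have "(\<lambda>x. \<integral>\<^sup>+n. u n * ennreal (wt (x - real n *\<^sub>R e)) \<partial>count_space UNIV) \<in> borel_measurable lborel"
        by (rule measurable_nn_integral_count_space) measurable
      ultimately show "Nm lborel \<theta> (\<lambda>x. \<integral>\<^sup>+n. u n * ennreal (wt (x - real n *\<^sub>R e)) \<partial>count_space UNIV)
          \<le> S * epow (\<integral>\<^sup>+n. epow (u n) (1 / \<theta>) \<partial>count_space UNIV) \<theta>"
        unfolding True by (subst Nm_0_le_iff) auto
    qed
  next
    case False
    then have pos: "0 < \<theta>" using \<theta> by simp
    define W where "W = (\<integral>\<^sup>+y. ennreal (wt (y::'a)) \<partial>lborel)"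
    have W: "W < \<infinity>" unfolding W_def using wt_integrable[where 'a='a] by (simp add: nn_integral_eq_integral)
    show ?thesis
    proof (rule that[of "epow S (1 - \<theta>) * epow W \<theta>"])
      show "epow S (1 - \<theta>) * epow W \<theta> < \<infinity>"
        using epow_lt_top[OF S(1), of "1 - \<theta>"] epow_lt_top[OF W, of \<theta>] \<theta> by (simp add: ennreal_mult_less_top)
      fix u :: "nat \<Rightarrow> ennreal" and e :: 'a assume e: "norm e = 1" and u: "\<And>n. u n \<le> 1"
      let ?w = "\<lambda>x n. ennreal (wt (x - real n *\<^sub>R e))"
      define J where "J x = (\<integral>\<^sup>+n. epow (u n) (1 / \<theta>) * ?w x n \<partial>count_space UNIV)" for x
      have Jm [measurable]: "J \<in> borel_measurable borel"
        unfolding J_def by (rule measurable_nn_integral_count_space) measurable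
      have "(\<integral>\<^sup>+n. u n * ?w x n \<partial>count_space UNIV) \<le> epow (J x) \<theta> * epow S (1 - \<theta>)" for x
      proof -
        have "u n * ?w x n = epow (epow (u n) (1 / \<theta>) * ?w x n) \<theta> * epow (?w x n) (1 - \<theta>)" for n
        proof -
          have "epow (?w x n) \<theta> * epow (?w x n) (1 - \<theta>) = ?w x n"
            using epow_add[of \<theta> "1 - \<theta>" "?w x n"] \<theta> by simp
          then show ?thesis using \<theta> pos by (simp add: epow_mult epow_inv mult.assoc)
        qed
        then have "(\<integral>\<^sup>+n. u n * ?w x n \<partial>count_space UNIV)
          = (\<integral>\<^sup>+n. epow (epow (u n) (1 / \<theta>) * ?w x n) \<theta> * epow (?w x n) (1 - \<theta>) \<partial>count_space UNIV)"
          by simp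
        also have "\<dots> \<le> epow (J x) \<theta> * epow (\<integral>\<^sup>+n. ?w x n \<partial>count_space UNIV) (1 - \<theta>)"
          unfolding J_def using \<theta> by (intro nn_holder) auto
        also have "\<dots> \<le> epow (J x) \<theta> * epow S (1 - \<theta>)"
          using \<theta> by (intro mult_left_mono epow_mono S(2) e) auto
        finally show ?thesis .
      qed
      then have "Nm lborel \<theta> (\<lambda>x. \<integral>\<^sup>+n. u n * ?w x n \<partial>count_space UNIV) \<le> Nm lborel \<theta> (\<lambda>x. epow S (1 - \<theta>) * epow (J x) \<theta>)"
        using \<theta>(1) by (intro Nm_mono measurable_nn_integral_count_space) (measurable, simp add: mult.commute)
      also have "\<dots> \<le> epow S (1 - \<theta>) * Nm lborel \<theta> (\<lambda>x. epow (J x) \<theta>)"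
        using \<theta>(1) by (intro Nm_cmult_le) auto
      also have "Nm lborel \<theta> (\<lambda>x. epow (J x) \<theta>) = epow (\<integral>\<^sup>+x. J x \<partial>lborel) \<theta>"
        using pos by (simp add: Nm_pos epow_inv)
      also have "(\<integral>\<^sup>+x. J x \<partial>lborel) = W * (\<integral>\<^sup>+n. epow (u n) (1 / \<theta>) \<partial>count_space UNIV)"
      proof -
        have "(\<integral>\<^sup>+x. J x \<partial>lborel) = (\<integral>\<^sup>+n. \<integral>\<^sup>+x. epow (u n) (1 / \<theta>) * ?w x n \<partial>lborel \<partial>count_space UNIV)"
          unfolding J_def by (rule nn_integral_count_space_swap) measurable
        also have "\<dots> = (\<integral>\<^sup>+n. epow (u n) (1 / \<theta>) * W \<partial>count_space UNIV)"
          using nn_integral_shift(3)[of "\<lambda>y::'a. ennreal (wt y)"] by (simp add: nn_integral_cmult W_def)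
        also have "\<dots> = W * (\<integral>\<^sup>+n. epow (u n) (1 / \<theta>) \<partial>count_space UNIV)"
          by (subst nn_integral_multc) (auto simp: mult.commute)
        finally show ?thesis .
      qed
      finally show "Nm lborel \<theta> (\<lambda>x. \<integral>\<^sup>+n. u n * ?w x n \<partial>count_space UNIV)
        \<le> epow S (1 - \<theta>) * epow W \<theta> * epow (\<integral>\<^sup>+n. epow (u n) (1 / \<theta>) \<partial>count_space UNIV) \<theta>"
        using \<theta> by (simp add: epow_mult mult.assoc)
    qed
  qed
qed

text \<open>The shear by \<kappa> k displaces the inner function for each k by a fixed vector, which
  the inner norm ignores. Hence the double sum factorises into two one-dimensional lattice
  estimates, uniformly in \<kappa>.\<close>

lemma MN_lattice:
  assumes \<theta>: "0 \<le> \<theta>1" "\<theta>1 \<le> 1" "0 \<le> \<theta>2" "\<theta>2 \<le> 1"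
  obtains D where "D < \<infinity>"
    "\<And>\<kappa> u v (e1 :: 'a::euclidean_space) (e2 :: 'b::euclidean_space). norm e1 = 1 \<Longrightarrow> norm e2 = 1 \<Longrightarrow>
      (\<And>n. u n \<le> 1) \<Longrightarrow> (\<And>n. v n \<le> 1) \<Longrightarrow>
      MN \<theta>1 \<theta>2 (\<lambda>x \<xi>. \<integral>\<^sup>+k. \<integral>\<^sup>+n. u n * v k * ennreal (wt (x - (real n + \<kappa> * real k) *\<^sub>R e1) * wt (\<xi> - real k *\<^sub>R e2))
          \<partial>count_space UNIV \<partial>count_space UNIV)
        \<le> D * epow (\<integral>\<^sup>+n. epow (u n) (1 / \<theta>1) \<partial>count_space UNIV) \<theta>1
            * epow (\<integral>\<^sup>+n. epow (v n) (1 / \<theta>2) \<partial>count_space UNIV) \<theta>2"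
proof -
  obtain D1 where D1: "D1 < \<infinity>"
    "\<And>u (e :: 'a). norm e = 1 \<Longrightarrow> (\<And>n. u n \<le> 1) \<Longrightarrow>
      Nm lborel \<theta>1 (\<lambda>x. \<integral>\<^sup>+n. u n * ennreal (wt (x - real n *\<^sub>R e)) \<partial>count_space UNIV)
        \<le> D1 * epow (\<integral>\<^sup>+n. epow (u n) (1 / \<theta>1) \<partial>count_space UNIV) \<theta>1"
    using Nm_lattice[OF \<theta>(1,2), where 'a='a] by blast
  obtain D2 where D2: "D2 < \<infinity>"
    "\<And>u (e :: 'b). norm e = 1 \<Longrightarrow> (\<And>n. u n \<le> 1) \<Longrightarrow>
      Nm lborel \<theta>2 (\<lambda>x. \<integral>\<^sup>+n. u n * ennreal (wt (x - real n *\<^sub>R e)) \<partial>count_space UNIV)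
        \<le> D2 * epow (\<integral>\<^sup>+n. epow (u n) (1 / \<theta>2) \<partial>count_space UNIV) \<theta>2"
    using Nm_lattice[OF \<theta>(3,4), where 'a='b] by blast
  show ?thesis
  proof (rule that[of "D1 * D2"])
    show "D1 * D2 < \<infinity>" using D1(1) D2(1) by (simp add: ennreal_mult_less_top)
    fix \<kappa> :: real and u v :: "nat \<Rightarrow> ennreal" and e1 :: 'a and e2 :: 'b
    assume e: "norm e1 = 1" "norm e2 = 1" and u: "\<And>n. u n \<le> 1" and v: "\<And>n. v n \<le> 1"
    define G where "G x = (\<integral>\<^sup>+n. u n * ennreal (wt (x - real n *\<^sub>R e1)) \<partial>count_space UNIV)" for x
    have Gm [measurable]: "G \<in> borel_measurable borel"
      unfolding G_def by (rule measurable_nn_integral_count_space) measurable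
    define A where "A = D1 * epow (\<integral>\<^sup>+n. epow (u n) (1 / \<theta>1) \<partial>count_space UNIV) \<theta>1"
    have A: "Nm lborel \<theta>1 G \<le> A" unfolding G_def A_def by (rule D1(2)[OF e(1) u])
    have eq: "(\<integral>\<^sup>+k. \<integral>\<^sup>+n. u n * v k * ennreal (wt (x - (real n + \<kappa> * real k) *\<^sub>R e1) * wt (\<xi> - real k *\<^sub>R e2))
          \<partial>count_space UNIV \<partial>count_space UNIV)
      = (\<integral>\<^sup>+k. (v k * ennreal (wt (\<xi> - real k *\<^sub>R e2))) * G (x - (\<kappa> * real k) *\<^sub>R e1) \<partial>count_space UNIV)" for x \<xi>
    proof (rule nn_integral_cong)
      fix k :: nat
      have "(v k * ennreal (wt (\<xi> - real k *\<^sub>R e2))) * G (x - (\<kappa> * real k) *\<^sub>R e1)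
        = (\<integral>\<^sup>+n. (v k * ennreal (wt (\<xi> - real k *\<^sub>R e2))) * (u n * ennreal (wt (x - (\<kappa> * real k) *\<^sub>R e1 - real n *\<^sub>R e1))) \<partial>count_space UNIV)"
        unfolding G_def by (rule nn_integral_cmult[symmetric]) simp
      also have "\<dots> = (\<integral>\<^sup>+n. u n * v k * ennreal (wt (x - (real n + \<kappa> * real k) *\<^sub>R e1) * wt (\<xi> - real k *\<^sub>R e2)) \<partial>count_space UNIV)"
        by (rule nn_integral_cong) (simp add: ennreal_mult scaleR_add_left algebra_simps)
      finally show "(\<integral>\<^sup>+n. u n * v k * ennreal (wt (x - (real n + \<kappa> * real k) *\<^sub>R e1) * wt (\<xi> - real k *\<^sub>R e2)) \<partial>count_space UNIV)
        = (v k * ennreal (wt (\<xi> - real k *\<^sub>R e2))) * G (x - (\<kappa> * real k) *\<^sub>R e1)" by simp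
    qed
    have inner: "Nm lborel \<theta>1 (\<lambda>x. \<integral>\<^sup>+k. (v k * ennreal (wt (\<xi> - real k *\<^sub>R e2))) * G (x - (\<kappa> * real k) *\<^sub>R e1) \<partial>count_space UNIV)
      \<le> A * (\<integral>\<^sup>+k. v k * ennreal (wt (\<xi> - real k *\<^sub>R e2)) \<partial>count_space UNIV)" for \<xi>
    proof -
      have "Nm lborel \<theta>1 (\<lambda>x. \<integral>\<^sup>+k. (v k * ennreal (wt (\<xi> - real k *\<^sub>R e2))) * G (x - (\<kappa> * real k) *\<^sub>R e1) \<partial>count_space UNIV)
        \<le> (\<integral>\<^sup>+k. Nm lborel \<theta>1 (\<lambda>x. (v k * ennreal (wt (\<xi> - real k *\<^sub>R e2))) * G (x - (\<kappa> * real k) *\<^sub>R e1)) \<partial>count_space UNIV)"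
        by (rule Nm_minkowski_count_space[OF _ \<theta>(1,2)]) measurable
      also have "\<dots> \<le> (\<integral>\<^sup>+k. (v k * ennreal (wt (\<xi> - real k *\<^sub>R e2))) * A \<partial>count_space UNIV)"
      proof (rule nn_integral_mono)
        fix k :: nat
        have "Nm lborel \<theta>1 (\<lambda>x. (v k * ennreal (wt (\<xi> - real k *\<^sub>R e2))) * G (x - (\<kappa> * real k) *\<^sub>R e1))
          \<le> (v k * ennreal (wt (\<xi> - real k *\<^sub>R e2))) * Nm lborel \<theta>1 (\<lambda>x. G (x - (\<kappa> * real k) *\<^sub>R e1))"
          by (rule Nm_cmult_le[OF \<theta>(1)]) measurable
        also have "\<dots> \<le> (v k * ennreal (wt (\<xi> - real k *\<^sub>R e2))) * A"
          using A by (simp add: Nm_shift(3)[OF Gm] mult_left_mono)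
        finally show "Nm lborel \<theta>1 (\<lambda>x. (v k * ennreal (wt (\<xi> - real k *\<^sub>R e2))) * G (x - (\<kappa> * real k) *\<^sub>R e1))
          \<le> (v k * ennreal (wt (\<xi> - real k *\<^sub>R e2))) * A" .
      qed
      also have "\<dots> = A * (\<integral>\<^sup>+k. v k * ennreal (wt (\<xi> - real k *\<^sub>R e2)) \<partial>count_space UNIV)"
        by (subst nn_integral_multc) (auto simp: mult.commute)
      finally show ?thesis .
    qed
    have m1: "(\<lambda>\<xi>. Nm lborel \<theta>1 (\<lambda>x. \<integral>\<^sup>+k. (v k * ennreal (wt (\<xi> - real k *\<^sub>R e2))) * G (x - (\<kappa> * real k) *\<^sub>R e1) \<partial>count_space UNIV)) \<in> borel_measurable borel"
    proof (rule MN_inner_measurable, unfold case_prod_beta', rule measurable_nn_integral_count_space)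
      show "(\<lambda>p. v k * ennreal (wt (snd p - real k *\<^sub>R e2)) * G (fst p - (\<kappa> * real k) *\<^sub>R e1)) \<in> borel_measurable (borel \<Otimes>\<^sub>M borel)" for k
        by measurable
    qed
    have m2: "(\<lambda>\<xi>. \<integral>\<^sup>+k. v k * ennreal (wt (\<xi> - real k *\<^sub>R e2)) \<partial>count_space UNIV) \<in> borel_measurable borel"
      by (rule measurable_nn_integral_count_space) measurable
    have "MN \<theta>1 \<theta>2 (\<lambda>x \<xi>. \<integral>\<^sup>+k. (v k * ennreal (wt (\<xi> - real k *\<^sub>R e2))) * G (x - (\<kappa> * real k) *\<^sub>R e1) \<partial>count_space UNIV)
      \<le> Nm lborel \<theta>2 (\<lambda>\<xi>. A * (\<integral>\<^sup>+k. v k * ennreal (wt (\<xi> - real k *\<^sub>R e2)) \<partial>count_space UNIV))"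
      unfolding MN_def using m1 by (intro Nm_mono \<theta>(3) inner) simp
    also have "\<dots> \<le> A * Nm lborel \<theta>2 (\<lambda>\<xi>. \<integral>\<^sup>+k. v k * ennreal (wt (\<xi> - real k *\<^sub>R e2)) \<partial>count_space UNIV)"
      using m2 by (intro Nm_cmult_le \<theta>(3)) simp
    also have "\<dots> \<le> A * (D2 * epow (\<integral>\<^sup>+n. epow (v n) (1 / \<theta>2) \<partial>count_space UNIV) \<theta>2)"
      by (intro mult_left_mono D2(2)[OF e(2) v]) simp
    finally show "MN \<theta>1 \<theta>2 (\<lambda>x \<xi>. \<integral>\<^sup>+k. \<integral>\<^sup>+n. u n * v k * ennreal (wt (x - (real n + \<kappa> * real k) *\<^sub>R e1) * wt (\<xi> - real k *\<^sub>R e2))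
          \<partial>count_space UNIV \<partial>count_space UNIV)
        \<le> D1 * D2 * epow (\<integral>\<^sup>+n. epow (u n) (1 / \<theta>1) \<partial>count_space UNIV) \<theta>1
            * epow (\<integral>\<^sup>+n. epow (v n) (1 / \<theta>2) \<partial>count_space UNIV) \<theta>2"
      unfolding eq A_def by (simp add: ac_simps)
  qed
qed

lemma epow_sum_indicator:
  assumes "finite (A :: nat set)" "A \<noteq> {}" "0 \<le> \<theta>"
  shows "epow (\<integral>\<^sup>+n. epow (indicator A n) (1 / \<theta>) \<partial>count_space UNIV) \<theta> = ennreal (real (card A) powr \<theta>)"
proof (cases "\<theta> = 0")
  case True
  have "card A \<noteq> 0" using assms by simp
  then show ?thesis using True by simp
next
  case False
  then have "(\<integral>\<^sup>+n. epow (indicator A n) (1 / \<theta>) \<partial>count_space UNIV) = (\<integral>\<^sup>+n. indicator A n \<partial>count_space UNIV)"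
    by (intro nn_integral_cong) (auto split: split_indicator)
  also have "\<dots> = ennreal (real (card A))"
    using assms(1) by (simp add: emeasure_count_space_finite ennreal_of_nat_eq_real_of_nat)
  finally show ?thesis using False by (simp add: epow_ennreal)
qed

lemma epow_sum_powr:
  assumes "0 \<le> \<theta>" "\<theta> < \<gamma>"
  shows "epow (\<integral>\<^sup>+n. epow (ennreal (real (Suc n) powr - \<gamma>)) (1 / \<theta>) \<partial>count_space UNIV) \<theta> < \<infinity>"
proof (cases "\<theta> = 0")
  case False
  have "summable (\<lambda>n. real n powr (- \<gamma> / \<theta>))"
    using assms False by (simp add: summable_real_powr_iff field_simps)
  then have s: "summable (\<lambda>n. real (Suc n) powr (- \<gamma> / \<theta>))"
    by (subst summable_Suc_iff)
  have "(\<integral>\<^sup>+n. epow (ennreal (real (Suc n) powr - \<gamma>)) (1 / \<theta>) \<partial>count_space UNIV) = (\<Sum>n. ennreal (real (Suc n) powr (- \<gamma> / \<theta>)))"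
    unfolding nn_integral_count_space_nat using False by (simp add: epow_ennreal powr_powr)
  also have "\<dots> < \<infinity>" unfolding infinity_ennreal_def less_top[symmetric] by (rule ennreal_suminf_neq_top[OF s]) simp
  finally show ?thesis using assms by (intro epow_lt_top)
qed simp

section \<open>Gaussian test functions on a lattice\<close>

text \<open>Decay in the product form that the lattice estimates ask for, obtained from decay of the
  doubled order in the pair.\<close>

lemma stf_product_bound:
  fixes F \<gamma> :: "'a::euclidean_space \<Rightarrow> complex"
  assumes "F \<in> schwartz" "\<gamma> \<in> schwartz"
  obtains D where "0 \<le> D" "\<And>x \<xi>. norm (stf \<gamma> F (x, \<xi>)) \<le> D * (wt x * wt \<xi>)"
proof -
  let ?k = "2 * DIM('a)"
  obtain D where D: "0 \<le> D" "\<And>w. (1 + norm w) ^ (?k + ?k) * norm (stf \<gamma> F w) \<le> D"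
    using schwartz_bound[OF stf_schwartz[OF assms]] by metis
  show ?thesis
  proof (rule that[OF D(1)])
    fix x \<xi> :: 'a
    have p: "0 < (1 + norm x) ^ ?k * (1 + norm \<xi>) ^ ?k"
      by (intro mult_pos_pos zero_less_power add_pos_nonneg) auto
    have "(1 + norm x) ^ ?k * (1 + norm \<xi>) ^ ?k \<le> (1 + norm (x, \<xi>)) ^ ?k * (1 + norm (x, \<xi>)) ^ ?k"
      using norm_fst_le[of x \<xi>] norm_snd_le[of \<xi> x] by (intro mult_mono power_mono) auto
    then have "(1 + norm x) ^ ?k * (1 + norm \<xi>) ^ ?k * norm (stf \<gamma> F (x, \<xi>)) \<le> (1 + norm (x, \<xi>)) ^ (?k + ?k) * norm (stf \<gamma> F (x, \<xi>))"
      unfolding power_add by (rule mult_right_mono) simp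
    also have "\<dots> \<le> D" by (rule D(2))
    finally show "norm (stf \<gamma> F (x, \<xi>)) \<le> D * (wt x * wt \<xi>)"
      using p unfolding wt_def by (simp add: field_simps)
  qed
qed

lemma stf_sum:
  assumes "\<And>i. i \<in> I \<Longrightarrow> f i \<in> schwartz" "\<gamma> \<in> schwartz"
  shows "stf \<gamma> (\<lambda>x. \<Sum>i\<in>I. f i x) w = (\<Sum>i\<in>I. stf \<gamma> (f i) w)"
  unfolding stf_def ip_def sum_distrib_right
  by (intro Bochner_Integration.integral_sum ip_integrable tfs_schwartz assms)

lemma stf_gauss_gauss_translation:
  "\<exists>r\<ge>0. stf gauss gauss (x, 0::'a::euclidean_space) = of_real r"
proof -
  have "stf gauss gauss (x, 0) = (\<integral>t. of_real (exp (- pi * (t \<bullet> t)) * exp (- pi * ((t - x) \<bullet> (t - x)))) \<partial>lborel)"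
    unfolding stf_def ip_def tfs_apply gauss_def by simp
  also have "\<dots> = of_real (\<integral>t. exp (- pi * (t \<bullet> t)) * exp (- pi * ((t - x) \<bullet> (t - x))) \<partial>lborel)"
    by (rule integral_complex_of_real)
  finally show ?thesis by (auto intro!: exI[of _ "\<integral>t. exp (- pi * (t \<bullet> t)) * exp (- pi * ((t - x) \<bullet> (t - x))) \<partial>lborel"] integral_nonneg_AE)
qed

text \<open>The square of the Gaussian is a Gaussian rescaled by sqrt 2, and its Fourier transform
  is positive. For translations positivity is immediate from the integrand.\<close>

lemma stf_gauss_gauss_modulation:
  "\<exists>r\<ge>0. stf gauss gauss (0::'a::euclidean_space, \<xi>) = of_real r"
proof -
  let ?c = "sqrt 2" and ?v = "- (1 / sqrt 2) *\<^sub>R \<xi>"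
  have m: "(\<lambda>x::'a. gauss x * ex2 (x \<bullet> ?v)) \<in> borel_measurable borel"
    using schwartz_borel[OF gauss_schwartz] by measurable
  have "gauss ?v = (\<integral>x. gauss x * ex2 (x \<bullet> ?v) \<partial>lborel)" by (rule gauss_fourier[symmetric])
  also have "\<dots> = (\<integral>x. of_real (?c ^ DIM('a)) * (gauss (?c *\<^sub>R x) * ex2 ((?c *\<^sub>R x) \<bullet> ?v)) \<partial>lborel)"
    by (rule lborel_integral_scale[OF m]) simp
  also have "\<dots> = of_real (?c ^ DIM('a)) * (\<integral>x. gauss (?c *\<^sub>R x) * ex2 ((?c *\<^sub>R x) \<bullet> ?v) \<partial>lborel)"
    by simp
  also have "(\<integral>x. gauss (?c *\<^sub>R x) * ex2 ((?c *\<^sub>R x) \<bullet> ?v) \<partial>lborel) = stf gauss gauss (0, \<xi>)"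
    unfolding stf_def ip_def tfs_apply
  proof (rule Bochner_Integration.integral_cong[OF refl])
    fix x :: 'a
    have "gauss (?c *\<^sub>R x) = gauss x * gauss x"
      unfolding gauss_def of_real_mult[symmetric] exp_add[symmetric] by (simp add: algebra_simps)
    then show "gauss (?c *\<^sub>R x) * ex2 ((?c *\<^sub>R x) \<bullet> ?v) = gauss x * cnj (ex2 (x \<bullet> snd (0, \<xi>)) * gauss (x - fst (0, \<xi>)))"
      by (simp add: cnj_ex2 gauss_def)
  qed
  finally have "of_real (?c ^ DIM('a)) * stf gauss gauss (0, \<xi>) = gauss ?v" by simp
  then have "stf gauss gauss (0, \<xi>) = of_real (exp (- pi * (?v \<bullet> ?v)) / ?c ^ DIM('a))"
    by (simp add: gauss_def field_simps)
  then show ?thesis by (intro exI[of _ "exp (- pi * (?v \<bullet> ?v)) / ?c ^ DIM('a)"]) simp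
qed

text \<open>Bounds the norm of u from below by its value on a test function: the inversion formula
  followed by Hoelder's inequality in both variables.\<close>

lemma tempered_norm_duality:
  fixes u :: "('a::euclidean_space \<Rightarrow> complex) \<Rightarrow> complex"
  assumes u: "u \<in> tempered" and h: "h \<in> schwartz" and \<phi>: "\<phi> \<in> schwartz"
    and \<theta>: "0 \<le> \<theta>1" "\<theta>1 \<le> 1" "0 \<le> \<theta>2" "\<theta>2 \<le> 1"
  shows "ennreal (norm (ip \<phi> \<phi>) * norm (u h))
    \<le> MN \<theta>1 \<theta>2 (astft \<phi> u) * MN (1 - \<theta>1) (1 - \<theta>2) (astft \<phi> (distribution_of h))"
proof -
  let ?d = "distribution_of h"
  have d: "?d \<in> tempered" by (rule distribution_of_tempered[OF h])
  have dh: "?d (tfs w \<phi>) = stf \<phi> h w" for w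
    using tfs_schwartz[OF \<phi>, of w] by (simp add: distribution_of_def stf_def ip_def)
  note um = astft_measurable[OF u \<phi>] and dm = astft_measurable[OF d \<phi>]
  have s: "(\<lambda>x. astft \<phi> w x \<xi>) \<in> borel_measurable lborel" if "w \<in> tempered" for w \<xi>
    using measurable_curried_comp[OF astft_measurable[OF that \<phi>], of "\<lambda>x. x" borel "\<lambda>_. \<xi>"] by simp
  have "ennreal (norm (ip \<phi> \<phi>) * norm (u h)) = ennreal (norm (cnj (ip \<phi> \<phi>) * u h))" by (simp add: norm_mult)
  also have "\<dots> = ennreal (norm (\<integral>w. u (tfs w \<phi>) * cnj (stf \<phi> h w) \<partial>lborel))"
    by (simp only: tempered_stf_inversion(1)[OF u h \<phi>])
  also have "\<dots> \<le> (\<integral>\<^sup>+w. ennreal (norm (u (tfs w \<phi>) * cnj (stf \<phi> h w))) \<partial>lborel)"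
    by (rule integral_norm_bound_ennreal[OF tempered_stf_inversion(2)[OF u h \<phi>]])
  also have "\<dots> = (\<integral>\<^sup>+\<xi>. \<integral>\<^sup>+x. ennreal (norm (u (tfs (x, \<xi>) \<phi>) * cnj (stf \<phi> h (x, \<xi>)))) \<partial>lborel \<partial>lborel)"
    using tempered_tfs_measurable[OF u \<phi>] schwartz_borel[OF stf_schwartz[OF h \<phi>]]
    by (intro nn_integral_lborel_pair measurable_compose[OF _ measurable_ennreal] measurable_compose[OF _ borel_measurable_norm] borel_measurable_times borel_measurable_cnj)
  also have "\<dots> = (\<integral>\<^sup>+\<xi>. \<integral>\<^sup>+x. astft \<phi> u x \<xi> * astft \<phi> ?d x \<xi> \<partial>lborel \<partial>lborel)"
    by (simp add: astft_def dh norm_mult ennreal_mult)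
  also have "\<dots> \<le> (\<integral>\<^sup>+\<xi>. Nm lborel \<theta>1 (\<lambda>x. astft \<phi> u x \<xi>) * Nm lborel (1 - \<theta>1) (\<lambda>x. astft \<phi> ?d x \<xi>) \<partial>lborel)"
    by (intro nn_integral_mono Nm_holder s u d \<theta>)
  also have "\<dots> \<le> MN \<theta>1 \<theta>2 (astft \<phi> u) * MN (1 - \<theta>1) (1 - \<theta>2) (astft \<phi> ?d)"
    unfolding MN_def using MN_inner_measurable[OF um] MN_inner_measurable[OF dm] by (intro Nm_holder \<theta>) auto
  finally show ?thesis .
qed

section \<open>Sums of shifted Gaussians and lattice symbols\<close>

definition step :: "'a::euclidean_space \<times> 'a \<Rightarrow> nat \<Rightarrow> 'a \<times> 'a" where
  "step E m = real m *\<^sub>R E"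

definition lattice_fun :: "'a::euclidean_space \<times> 'a \<Rightarrow> nat \<Rightarrow> 'a \<Rightarrow> complex" where
  "lattice_fun E N = (\<lambda>x. \<Sum>i<N. tfs (step E i) gauss x)"

lemma lattice_fun_schwartz: "lattice_fun E N \<in> schwartz"
  unfolding lattice_fun_def by (intro schwartz_sum tfs_schwartz gauss_schwartz)

lemma stf_lattice_fun:
  "\<phi> \<in> schwartz \<Longrightarrow> stf \<phi> (lattice_fun E N) w = (\<Sum>i<N. stf \<phi> (tfs (step E i) gauss) w)"
  unfolding lattice_fun_def by (intro stf_sum tfs_schwartz gauss_schwartz)

text \<open>Along a pure time or pure frequency line the covariance phase is one, so each inner
  product depends on the difference of the indices and is nonnegative. For m < N the diagonal term
  alone gives the lower bound.\<close>

lemma stf_gauss_lattice_fun: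
  fixes E :: "'a::euclidean_space \<times> 'a"
  assumes "fst E = 0 \<or> snd E = 0"
  obtains r where "0 \<le> r" "stf gauss (lattice_fun E N) (step E m) = of_real r"
    "m < N \<Longrightarrow> norm (ip gauss (gauss :: 'a \<Rightarrow> complex)) \<le> r"
proof -
  have "\<exists>r\<ge>0. stf gauss (tfs (step E i) gauss) (step E m) = of_real r" for i
  proof -
    have "stf gauss (tfs (step E i) gauss) (step E m) = stf gauss gauss (step E m - step E i)"
      using assms by (auto simp: stf_tfs[OF gauss_schwartz gauss_schwartz] step_def)
    moreover have "step E m - step E i = ((real m - real i) *\<^sub>R fst E, (real m - real i) *\<^sub>R snd E)"
      by (simp add: step_def prod_eq_iff scaleR_diff_left)
    ultimately show ?thesis
      using assms stf_gauss_gauss_translation[of "(real m - real i) *\<^sub>R fst E"]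
        stf_gauss_gauss_modulation[of "(real m - real i) *\<^sub>R snd E"] by auto
  qed
  then obtain r where r: "\<And>i. 0 \<le> r i" "\<And>i. stf gauss (tfs (step E i) gauss) (step E m) = of_real (r i)"
    by metis
  show ?thesis
  proof (rule that[of "\<Sum>i<N. r i"])
    show "0 \<le> (\<Sum>i<N. r i)" by (intro sum_nonneg r)
    show "stf gauss (lattice_fun E N) (step E m) = of_real (\<Sum>i<N. r i)"
      by (simp add: stf_lattice_fun[OF gauss_schwartz] r(2))
    assume "m < N"
    then have "r m \<le> (\<Sum>i<N. r i)" using r(1) by (intro member_le_sum) auto
    moreover have "r m = norm (ip gauss (gauss :: 'a \<Rightarrow> complex))"
    proof -
      have "stf gauss (tfs (step E m) gauss) (step E m) = stf gauss gauss (0 :: 'a \<times> 'a)"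
        by (simp add: stf_tfs[OF gauss_schwartz gauss_schwartz])
      also have "\<dots> = ip gauss (gauss :: 'a \<Rightarrow> complex)" by (simp add: stf_def tfs_apply[abs_def])
      finally show ?thesis using r(1)[of m] unfolding r(2) by (metis abs_of_nonneg norm_of_real)
    qed
    ultimately show "norm (ip gauss (gauss :: 'a \<Rightarrow> complex)) \<le> (\<Sum>i<N. r i)" by simp
  qed
qed

text \<open>N separated bumps along one axis: the norm grows like N to the parameter of that axis.
  In \<open>MN_lattice\<close> the sequence for the other axis is a unit mass at zero.\<close>

lemma lattice_fun_norm:
  fixes \<phi> :: "'a::euclidean_space \<Rightarrow> complex"
  assumes \<phi>: "\<phi> \<in> schwartz" and \<theta>: "0 \<le> \<theta>1" "\<theta>1 \<le> 1" "0 \<le> \<theta>2" "\<theta>2 \<le> 1"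
    and E: "norm E = 1" "fst E = 0 \<or> snd E = 0"
  obtains D :: real where "0 \<le> D" "\<And>N. 0 < N \<Longrightarrow> MN \<theta>1 \<theta>2 (astft \<phi> (distribution_of (lattice_fun E N)))
    \<le> ennreal (D * real N powr (if snd E = 0 then \<theta>1 else \<theta>2))"
proof -
  obtain B where B: "0 \<le> B" "\<And>x \<xi>. norm (stf \<phi> gauss (x, \<xi>)) \<le> B * (wt x * wt \<xi>)"
    using stf_product_bound[OF gauss_schwartz \<phi>] by metis
  obtain D where D: "D < \<infinity>"
    "\<And>\<kappa> u v (e1 :: 'a) (e2 :: 'a). norm e1 = 1 \<Longrightarrow> norm e2 = 1 \<Longrightarrow>
      (\<And>n. u n \<le> 1) \<Longrightarrow> (\<And>n. v n \<le> 1) \<Longrightarrow>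
      MN \<theta>1 \<theta>2 (\<lambda>x \<xi>. \<integral>\<^sup>+k. \<integral>\<^sup>+n. u n * v k * ennreal (wt (x - (real n + \<kappa> * real k) *\<^sub>R e1) * wt (\<xi> - real k *\<^sub>R e2))
          \<partial>count_space UNIV \<partial>count_space UNIV)
        \<le> D * epow (\<integral>\<^sup>+n. epow (u n) (1 / \<theta>1) \<partial>count_space UNIV) \<theta>1
            * epow (\<integral>\<^sup>+n. epow (v n) (1 / \<theta>2) \<partial>count_space UNIV) \<theta>2"
    using MN_lattice[OF \<theta>, where 'a='a and 'b='a] by blast
  \<comment> \<open>The nonzero component of E. It serves as the direction on both axes, since the
    idle axis occurs with index zero only.\<close>
  define e where "e = fst E + snd E"
  have e: "norm e = 1" using E by (cases E) (auto simp: e_def)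
  define p where "p = (if snd E = 0 then \<theta>1 else \<theta>2)"
  show ?thesis
  proof (rule that[of "B * enn2real D"])
    show "0 \<le> B * enn2real D" using B(1) by simp
    fix N :: nat assume N: "0 < N"
    let ?u = "if snd E = 0 then indicator {..<N} else indicator {0} :: nat \<Rightarrow> ennreal"
    let ?v = "if snd E = 0 then indicator {0} else indicator {..<N} :: nat \<Rightarrow> ennreal"
    let ?L = "\<lambda>(x::'a) (\<xi>::'a). \<integral>\<^sup>+k. \<integral>\<^sup>+n. ?u n * ?v k * ennreal (wt (x - (real n + 0 * real k) *\<^sub>R e) * wt (\<xi> - real k *\<^sub>R e))
          \<partial>count_space UNIV \<partial>count_space UNIV"
    have ind: "(\<integral>\<^sup>+n. indicator A n * f n \<partial>count_space UNIV) = sum f A" if "finite A" for f and A :: "nat set"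
      using that by (subst nn_integral_count_space'[of A]) (auto intro!: sum.cong)
    have d: "distribution_of (lattice_fun E N) (tfs w \<phi>) = stf \<phi> (lattice_fun E N) w" for w
      using tfs_schwartz[OF \<phi>, of w] by (simp add: distribution_of_def stf_def ip_def)
    have Lm: "(\<lambda>(x, \<xi>). ?L x \<xi>) \<in> borel_measurable (borel \<Otimes>\<^sub>M borel)"
      unfolding case_prod_beta' by (intro measurable_nn_integral_count_space) measurable
    have le: "astft \<phi> (distribution_of (lattice_fun E N)) x \<xi> \<le> ennreal B * ?L x \<xi>" for x \<xi>
    proof -
      have b: "norm (stf \<phi> (tfs (step E i) gauss) (x, \<xi>)) \<le> B * (wt (x - real i *\<^sub>R fst E) * wt (\<xi> - real i *\<^sub>R snd E))" for i
        using B(2)[of "x - real i *\<^sub>R fst E" "\<xi> - real i *\<^sub>R snd E"]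
        unfolding norm_stf_tfs[OF gauss_schwartz \<phi>] by (cases E) (simp add: step_def)
      have "norm (stf \<phi> (lattice_fun E N) (x, \<xi>)) \<le> (\<Sum>i<N. B * (wt (x - real i *\<^sub>R fst E) * wt (\<xi> - real i *\<^sub>R snd E)))"
        unfolding stf_lattice_fun[OF \<phi>] by (rule sum_norm_le) (rule b)
      then have "astft \<phi> (distribution_of (lattice_fun E N)) x \<xi> \<le> ennreal (B * (\<Sum>i<N. wt (x - real i *\<^sub>R fst E) * wt (\<xi> - real i *\<^sub>R snd E)))"
        unfolding astft_def d by (intro ennreal_leI) (simp add: sum_distrib_left)
      also have "\<dots> = ennreal B * (\<Sum>i<N. ennreal (wt (x - real i *\<^sub>R fst E) * wt (\<xi> - real i *\<^sub>R snd E)))"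
        using B(1) by (subst sum_ennreal) (auto simp: ennreal_mult[symmetric] sum_nonneg)
      also have "(\<Sum>i<N. ennreal (wt (x - real i *\<^sub>R fst E) * wt (\<xi> - real i *\<^sub>R snd E))) = ?L x \<xi>"
      proof (cases "snd E = 0")
        case True
        then have "?L x \<xi> = (\<Sum>k\<in>{0}. \<Sum>n<N. ennreal (wt (x - real n *\<^sub>R e) * wt (\<xi> - real k *\<^sub>R e)))"
          by (subst nn_integral_count_space'[of "{0}"]) (auto simp: ind)
        then show ?thesis using True by (simp add: e_def)
      next
        case False
        then have "?L x \<xi> = (\<Sum>k<N. \<Sum>n\<in>{0::nat}. ennreal (wt (x - real n *\<^sub>R e) * wt (\<xi> - real k *\<^sub>R e)))"
          by (subst nn_integral_count_space'[of "{..<N}"]) (auto simp: ind)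
        then show ?thesis using False E(2) by (simp add: e_def)
      qed
      finally show ?thesis .
    qed
    have "MN \<theta>1 \<theta>2 (astft \<phi> (distribution_of (lattice_fun E N))) \<le> MN \<theta>1 \<theta>2 (\<lambda>x \<xi>. ennreal B * ?L x \<xi>)"
      by (intro MN_mono astft_measurable distribution_of_tempered lattice_fun_schwartz \<phi> \<theta> le)
    also have "\<dots> = ennreal B * MN \<theta>1 \<theta>2 ?L"
      by (rule MN_cmult_le[OF Lm \<theta>(1,3) B(1)])
    also have "\<dots> \<le> ennreal B * (D * epow (\<integral>\<^sup>+n. epow (?u n) (1 / \<theta>1) \<partial>count_space UNIV) \<theta>1
            * epow (\<integral>\<^sup>+n. epow (?v n) (1 / \<theta>2) \<partial>count_space UNIV) \<theta>2)"
      by (intro mult_left_mono D(2) e) (auto split: split_indicator)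
    also have "\<dots> = ennreal B * (D * ennreal (real N powr p))"
    proof (cases "snd E = 0")
      case True
      then show ?thesis using N \<theta> epow_sum_indicator[of "{..<N}" \<theta>1] epow_sum_indicator[of "{0}" \<theta>2]
        by (simp add: p_def lessThan_empty_iff)
    next
      case False
      then show ?thesis using N \<theta> epow_sum_indicator[of "{..<N}" \<theta>2] epow_sum_indicator[of "{0}" \<theta>1]
        by (simp add: p_def lessThan_empty_iff)
    qed
    also have "\<dots> = ennreal (B * enn2real D * real N powr p)"
    proof -
      have "D = ennreal (enn2real D)" using D(1) by simp
      then show ?thesis using B(1) by (metis ennreal_mult enn2real_nonneg powr_ge_zero mult_nonneg_nonneg mult.assoc)
    qed
    finally show "MN \<theta>1 \<theta>2 (astft \<phi> (distribution_of (lattice_fun E N))) \<le> ennreal (B * enn2real D * real N powr (if snd E = 0 then \<theta>1 else \<theta>2))"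
      unfolding p_def .
  qed
qed

lemma integrable_pair_weights:
  "integrable (count_space UNIV) (\<lambda>(n::nat, k::nat). 1 / ((1 + real n)\<^sup>2 * (1 + real k)\<^sup>2))"
proof -
  define r where "r n = 1 / (1 + real n)\<^sup>2" for n
  have r0: "0 \<le> r n" for n by (simp add: r_def)
  have "summable (\<lambda>n. inverse (real (Suc n) ^ 2))"
    by (subst summable_Suc_iff) (rule inverse_power_summable, simp)
  then have "summable r" by (simp add: r_def[abs_def] inverse_eq_divide add.commute)
  then have "(\<Sum>n. ennreal (r n)) \<noteq> top" by (rule ennreal_suminf_neq_top) (rule r0)
  then have fin: "(\<integral>\<^sup>+n. ennreal (r n) \<partial>count_space UNIV) < \<infinity>"
    unfolding nn_integral_count_space_nat infinity_ennreal_def less_top[symmetric] .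
  have "(\<integral>\<^sup>+i. ennreal (r (fst i) * r (snd i)) \<partial>count_space UNIV)
    = (\<integral>\<^sup>+n. \<integral>\<^sup>+k. ennreal (r n) * ennreal (r k) \<partial>count_space UNIV \<partial>count_space UNIV)"
    by (subst nn_integral_fst_count_space[symmetric]) (simp add: ennreal_mult r0)
  also have "\<dots> = (\<integral>\<^sup>+n. ennreal (r n) \<partial>count_space UNIV) * (\<integral>\<^sup>+k. ennreal (r k) \<partial>count_space UNIV)"
    by (simp add: nn_integral_cmult nn_integral_multc)
  also have "\<dots> < \<infinity>" using fin by (simp add: ennreal_mult_less_top)
  finally have "integrable (count_space UNIV) (\<lambda>i. r (fst i) * r (snd i))"
    by (intro integrableI_bounded) (auto simp: r0)
  then show ?thesis by (simp add: r_def case_prod_beta')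
qed

text \<open>The points at which both arguments of the Wigner distribution are shifted along the line
  \<open>\<real> E\<close>, by \<open>n + b' k\<close> and \<open>n + b k\<close> steps respectively.\<close>

definition lattice_point :: "real \<Rightarrow> 'a::euclidean_space \<times> 'a \<Rightarrow> nat \<Rightarrow> nat \<Rightarrow> nat \<times> nat \<Rightarrow> ('a \<times> 'a) \<times> 'a \<times> 'a" where
  "lattice_point \<tau> E b b' i =
    ((real (fst i) + (real b + (real b' - real b) * (if snd E = 0 then \<tau> else 1 - \<tau>)) * real (snd i)) *\<^sub>R E,
      real (snd i) *\<^sub>R ((real b' - real b) *\<^sub>R (- snd E, fst E)))"

text \<open>Inverts the linear maps \<open>wig_a\<close> and \<open>wig_b\<close> at points of the
  line. The third equation makes the phase in \<open>stf_tau_wigner\<close> equal to one, so that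
  the signs survive.\<close>

lemma wig_lattice_point:
  assumes "fst E = 0 \<or> snd E = 0"
  shows "wig_b \<tau> (lattice_point \<tau> E b b' i) = step E (fst i + b * snd i)"
    and "wig_a \<tau> (lattice_point \<tau> E b b' i) = step E (fst i + b' * snd i)"
    and "snd (fst (lattice_point \<tau> E b b' i)) \<bullet> snd (snd (lattice_point \<tau> E b b' i)) = 0"
proof -
  obtain n k where i: "i = (n, k)" by force
  from assms consider x where "E = (x, 0)" | y where "E = (0, y)" "y \<noteq> 0" by (cases E) auto
  note cases = this
  show "wig_b \<tau> (lattice_point \<tau> E b b' i) = step E (fst i + b * snd i)"
    by (cases rule: cases) (simp_all add: i lattice_point_def wig_b_def step_def algebra_simps)
  show "wig_a \<tau> (lattice_point \<tau> E b b' i) = step E (fst i + b' * snd i)"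
    by (cases rule: cases) (simp_all add: i lattice_point_def wig_a_def step_def algebra_simps)
  show "snd (fst (lattice_point \<tau> E b b' i)) \<bullet> snd (snd (lattice_point \<tau> E b b' i)) = 0"
    by (cases rule: cases) (simp_all add: lattice_point_def)
qed

text \<open>The choice of b and b' decides whether the index k displaces the output or the input.
  The sequences u and v fix the symbol and thereby the constant, so that A, M and N remain
  free.\<close>

lemma necessity_core:
  fixes \<phi> :: "'a::euclidean_space \<Rightarrow> complex" and \<Phi> :: "'a \<times> 'a \<Rightarrow> complex" and u v :: "nat \<Rightarrow> real"
    and E :: "'a \<times> 'a" and e :: 'a
  assumes \<phi>: "\<phi> \<in> schwartz" "\<phi> \<noteq> (\<lambda>x. 0)" and \<Phi>: "\<Phi> \<in> schwartz"
    and r: "P \<in> {0..1}" "Q \<in> {0..1}" "P1 \<in> {0..1}" "Q1 \<in> {0..1}" "P2 \<in> {0..1}" "Q2 \<in> {0..1}"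
    and \<tau>: "\<tau> \<in> {0..1}"
    and hyp: "\<And>\<sigma>. \<sigma> \<in> tempered \<Longrightarrow> MN P Q (astft \<Phi> \<sigma>) < \<infinity> \<Longrightarrow>
      \<exists>C::real. \<forall>f\<in>schwartz. MN P2 Q2 (astft \<phi> (tau_op \<tau> \<sigma> f)) \<le> ennreal C * MN P1 Q1 (astft \<phi> (distribution_of f))"
    and e: "e \<in> Basis" and E: "E = (e, 0) \<or> E = (0, e)"
    and bb: "b = 0 \<and> b' = 1 \<or> b = 1 \<and> b' = (0::nat)"
    and u: "\<And>n. 0 \<le> u n" "\<And>n. u n \<le> 1" and v: "\<And>n. 0 \<le> v n" "\<And>n. v n \<le> 1"
    and fin: "epow (\<integral>\<^sup>+n. epow (ennreal (u n)) (1 / P) \<partial>count_space UNIV) P < \<infinity>"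
      "epow (\<integral>\<^sup>+n. epow (ennreal (v n)) (1 / Q) \<partial>count_space UNIV) Q < \<infinity>"
  obtains C :: real where "\<And>A M N. finite A \<Longrightarrow> 0 < M \<Longrightarrow> 0 < N \<Longrightarrow>
    (\<And>i. i \<in> A \<Longrightarrow> fst i + b * snd i < M \<and> fst i + b' * snd i < N) \<Longrightarrow>
    (\<Sum>i\<in>A. u (fst i) * v (snd i))
      \<le> C * (real N powr (if snd E = 0 then P1 else Q1) * real M powr (1 - (if snd E = 0 then P2 else Q2)))"
proof -
  let ?g = "gauss :: 'a \<Rightarrow> complex"
  let ?cs = "count_space (UNIV :: (nat \<times> nat) set)"
  note g = gauss_schwartz[where 'a='a]
  have e1: "norm e = 1" using e by simp
  then have e0: "e \<noteq> 0" by auto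
  have EE: "norm E = 1" "fst E = 0 \<or> snd E = 0" using E e1 by auto
  define \<Gamma> where "\<Gamma> = tau_wigner \<tau> ?g ?g"
  have \<Gamma>: "\<Gamma> \<in> schwartz" unfolding \<Gamma>_def by (intro tau_wigner_schwartz g)
  define \<omega> where "\<omega> = lattice_point \<tau> E b b'"
  \<comment> \<open>The shear of the lattice caused by \<tau>. It is nonnegative, hence the first
    component of the n-th point has norm at least n.\<close>
  define \<kappa> where "\<kappa> = real b + (real b' - real b) * (if snd E = 0 then \<tau> else 1 - \<tau>)"
  have \<kappa>: "0 \<le> \<kappa>" using bb \<tau> by (auto simp: \<kappa>_def)
  define E' where "E' = (real b' - real b) *\<^sub>R (- snd E, fst E)"
  have E': "norm E' = 1" using E bb e1 by (auto simp: E'_def)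
  have \<omega>: "\<omega> i = ((real (fst i) + \<kappa> * real (snd i)) *\<^sub>R E, real (snd i) *\<^sub>R E')" for i
    by (simp add: \<omega>_def lattice_point_def \<kappa>_def E'_def)
  \<comment> \<open>The basis direction parallel to E'; along it the frequency of the k-th point is
    exactly k, which gives summability in k.\<close>
  define B where "B = (snd E, fst E)"
  have B: "B \<in> Basis" using E e by (auto simp: B_def Basis_prod_def)
  have BE': "\<bar>B \<bullet> E'\<bar> = 1" using E bb e by (auto simp: B_def E'_def)
  define d where "d i = u (fst i) * v (snd i)" for i
  have d: "0 \<le> d i" "d i \<le> 1" for i using u[of "fst i"] v[of "snd i"] by (auto simp: d_def mult_le_one)
  define \<sigma> where "\<sigma> = (\<lambda>F\<in>schwartz. \<integral>i. of_real (d i) * cnj (stf \<Gamma> F (\<omega> i)) \<partial>?cs)"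
  have \<sigma>i: "integrable ?cs (\<lambda>i. norm (of_real (d i) :: complex) / ((1 + norm (fst (\<omega> i)))\<^sup>2 * (1 + \<bar>B \<bullet> snd (\<omega> i)\<bar>)\<^sup>2))"
  proof (rule Bochner_Integration.integrable_bound[OF integrable_pair_weights])
    show "AE i in ?cs. norm (norm (of_real (d i) :: complex) / ((1 + norm (fst (\<omega> i)))\<^sup>2 * (1 + \<bar>B \<bullet> snd (\<omega> i)\<bar>)\<^sup>2))
      \<le> norm (case i of (n, k) \<Rightarrow> 1 / ((1 + real n)\<^sup>2 * (1 + real k)\<^sup>2))"
    proof (intro AE_I2)
      fix i :: "nat \<times> nat"
      obtain n k where i: "i = (n, k)" by force
      have f: "real n \<le> norm (fst (\<omega> i))" "\<bar>B \<bullet> snd (\<omega> i)\<bar> = real k"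
        using \<kappa> BE' by (auto simp: \<omega> i EE(1) abs_mult)
      have "d i / ((1 + norm (fst (\<omega> i)))\<^sup>2 * (1 + real k)\<^sup>2) \<le> 1 / ((1 + real n)\<^sup>2 * (1 + real k)\<^sup>2)"
        using f(1) d[of i] by (intro frac_le mult_right_mono power_mono) auto
      then show "norm (norm (of_real (d i) :: complex) / ((1 + norm (fst (\<omega> i)))\<^sup>2 * (1 + \<bar>B \<bullet> snd (\<omega> i)\<bar>)\<^sup>2))
        \<le> norm (case i of (n, k) \<Rightarrow> 1 / ((1 + real n)\<^sup>2 * (1 + real k)\<^sup>2))"
        unfolding f(2) using d[of i] by (simp add: i)
    qed
  qed simp
  have \<sigma>t: "\<sigma> \<in> tempered" unfolding \<sigma>_def by (rule tempered_weighted_sum(1)[OF \<Gamma> B \<sigma>i])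
  have \<sigma>n: "MN P Q (astft \<Phi> \<sigma>) < \<infinity>"
  proof -
    obtain K where K: "0 \<le> K" "\<And>x \<xi>. norm (stf \<Gamma> \<Phi> (x, \<xi>)) \<le> K * (wt x * wt \<xi>)"
      using stf_product_bound[OF \<Phi> \<Gamma>] by metis
    obtain D where D: "D < \<infinity>"
      "\<And>\<kappa> u v (e1 :: 'a \<times> 'a) (e2 :: 'a \<times> 'a). norm e1 = 1 \<Longrightarrow> norm e2 = 1 \<Longrightarrow>
      (\<And>n. u n \<le> 1) \<Longrightarrow> (\<And>n. v n \<le> 1) \<Longrightarrow>
      MN P Q (\<lambda>x \<xi>. \<integral>\<^sup>+k. \<integral>\<^sup>+n. u n * v k * ennreal (wt (x - (real n + \<kappa> * real k) *\<^sub>R e1) * wt (\<xi> - real k *\<^sub>R e2))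
          \<partial>count_space UNIV \<partial>count_space UNIV)
        \<le> D * epow (\<integral>\<^sup>+n. epow (u n) (1 / P) \<partial>count_space UNIV) P
            * epow (\<integral>\<^sup>+n. epow (v n) (1 / Q) \<partial>count_space UNIV) Q"
      using MN_lattice[of P Q, where 'a="'a \<times> 'a" and 'b="'a \<times> 'a"] r by auto
    let ?L = "\<lambda>z \<zeta>. \<integral>\<^sup>+k. \<integral>\<^sup>+n. ennreal (u n) * ennreal (v k) * ennreal (wt (z - (real n + \<kappa> * real k) *\<^sub>R E) * wt (\<zeta> - real k *\<^sub>R E'))
          \<partial>count_space UNIV \<partial>count_space UNIV"
    have Lm: "(\<lambda>(z, \<zeta>). ?L z \<zeta>) \<in> borel_measurable (borel \<Otimes>\<^sub>M borel)"
      unfolding case_prod_beta' by (intro measurable_nn_integral_count_space) measurable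
    have le: "astft \<Phi> \<sigma> z \<zeta> \<le> ennreal K * ?L z \<zeta>" for z \<zeta>
    proof -
      let ?T = "tfs (z, \<zeta>) \<Phi>"
      have T: "?T \<in> schwartz" by (rule tfs_schwartz[OF \<Phi>])
      have "astft \<Phi> \<sigma> z \<zeta> = ennreal (norm (\<integral>i. of_real (d i) * cnj (stf \<Gamma> ?T (\<omega> i)) \<partial>?cs))"
        using T by (simp add: astft_def \<sigma>_def)
      also have "\<dots> \<le> (\<integral>\<^sup>+i. ennreal (norm (of_real (d i) * cnj (stf \<Gamma> ?T (\<omega> i)))) \<partial>?cs)"
        by (rule integral_norm_bound_ennreal[OF tempered_weighted_sum(2)[OF \<Gamma> B \<sigma>i T]])
      also have "\<dots> \<le> (\<integral>\<^sup>+i. ennreal K * (ennreal (u (fst i)) * ennreal (v (snd i))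
          * ennreal (wt (z - (real (fst i) + \<kappa> * real (snd i)) *\<^sub>R E) * wt (\<zeta> - real (snd i) *\<^sub>R E'))) \<partial>?cs)"
      proof (rule nn_integral_mono)
        fix i :: "nat \<times> nat"
        let ?z = "z - (real (fst i) + \<kappa> * real (snd i)) *\<^sub>R E" and ?\<zeta> = "\<zeta> - real (snd i) *\<^sub>R E'"
        have "norm (stf \<Gamma> ?T (\<omega> i)) \<le> K * (wt ?z * wt ?\<zeta>)"
        proof -
          have "norm (stf \<Gamma> ?T (\<omega> i)) = norm (stf \<Gamma> \<Phi> (- ?z, - ?\<zeta>))"
            unfolding norm_stf_tfs[OF \<Phi> \<Gamma>] \<omega> by simp
          also have "\<dots> \<le> K * (wt ?z * wt ?\<zeta>)"
            using K(2)[of "- ?z" "- ?\<zeta>"] by (simp only: wt_minus)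
          finally show ?thesis .
        qed
        then have "norm (of_real (d i) * cnj (stf \<Gamma> ?T (\<omega> i))) \<le> d i * (K * (wt ?z * wt ?\<zeta>))"
          using d[of i] by (simp add: norm_mult mult_left_mono)
        then have "ennreal (norm (of_real (d i) * cnj (stf \<Gamma> ?T (\<omega> i)))) \<le> ennreal (d i * (K * (wt ?z * wt ?\<zeta>)))"
          by (rule ennreal_leI)
        also have "\<dots> = ennreal K * (ennreal (u (fst i)) * ennreal (v (snd i)) * ennreal (wt ?z * wt ?\<zeta>))"
          using u(1) v(1) K(1) unfolding d_def by (simp add: ennreal_mult ac_simps)
        finally show "ennreal (norm (of_real (d i) * cnj (stf \<Gamma> ?T (\<omega> i))))
          \<le> ennreal K * (ennreal (u (fst i)) * ennreal (v (snd i)) * ennreal (wt ?z * wt ?\<zeta>))" .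
      qed
      also have "\<dots> = ennreal K * ?L z \<zeta>"
        by (subst nn_integral_cmult, simp, subst nn_integral_snd_count_space[symmetric]) simp
      finally show ?thesis .
    qed
    have "MN P Q (astft \<Phi> \<sigma>) \<le> MN P Q (\<lambda>z \<zeta>. ennreal K * ?L z \<zeta>)"
      using r by (intro MN_mono astft_measurable \<sigma>t \<Phi> le) auto
    also have "\<dots> = ennreal K * MN P Q ?L" using r by (intro MN_cmult_le[OF Lm _ _ K(1)]) auto
    also have "\<dots> \<le> ennreal K * (D * epow (\<integral>\<^sup>+n. epow (ennreal (u n)) (1 / P) \<partial>count_space UNIV) P
            * epow (\<integral>\<^sup>+n. epow (ennreal (v n)) (1 / Q) \<partial>count_space UNIV) Q)"
      using u v by (intro mult_left_mono D(2) EE(1) E') auto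
    also have "\<dots> < \<infinity>" using D(1) fin by (simp add: ennreal_mult_less_top)
    finally show ?thesis .
  qed
  obtain C where C: "\<And>f. f \<in> schwartz \<Longrightarrow>
      MN P2 Q2 (astft \<phi> (tau_op \<tau> \<sigma> f)) \<le> ennreal C * MN P1 Q1 (astft \<phi> (distribution_of f))"
    using hyp[OF \<sigma>t \<sigma>n] by blast
  let ?a = "if snd E = 0 then P1 else Q1" and ?b = "if snd E = 0 then 1 - P2 else 1 - Q2"
  obtain D1 where D1: "0 \<le> D1" "\<And>N. 0 < N \<Longrightarrow> MN P1 Q1 (astft \<phi> (distribution_of (lattice_fun E N))) \<le> ennreal (D1 * real N powr ?a)"
    using lattice_fun_norm[OF \<phi>(1) _ _ _ _ EE, of P1 Q1] r by auto
  obtain D2 where D2: "0 \<le> D2" "\<And>N. 0 < N \<Longrightarrow> MN (1 - P2) (1 - Q2) (astft \<phi> (distribution_of (lattice_fun E N))) \<le> ennreal (D2 * real N powr ?b)"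
    using lattice_fun_norm[OF \<phi>(1) _ _ _ _ EE, of "1 - P2" "1 - Q2"] r by auto
  define c0 where "c0 = norm (ip ?g ?g)"
  have c0: "0 < c0"
  proof -
    have "?g \<noteq> (\<lambda>x. 0)" by (auto simp: gauss_def fun_eq_iff)
    then show ?thesis using ip_self_ne_0[OF g] by (simp add: c0_def)
  qed
  define c1 where "c1 = norm (ip \<phi> \<phi>)"
  have c1: "0 < c1" using ip_self_ne_0[OF \<phi>] by (simp add: c1_def)
  show ?thesis
  proof (rule that)
    fix A :: "(nat \<times> nat) set" and M N :: nat
    assume A: "finite A" "0 < M" "0 < N" "\<And>i. i \<in> A \<Longrightarrow> fst i + b * snd i < M \<and> fst i + b' * snd i < N"
    let ?f = "lattice_fun E N" and ?h = "lattice_fun E M"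
    note f = lattice_fun_schwartz[of E N] and h = lattice_fun_schwartz[of E M]
    let ?m = "\<lambda>i. fst i + b * snd i" and ?m' = "\<lambda>i. fst i + b' * snd i"
    have "\<exists>r. \<forall>m. 0 \<le> r m \<and> stf ?g (lattice_fun E N) (step E m) = of_real (r m) \<and> (m < N \<longrightarrow> c0 \<le> r m)" for N
      unfolding c0_def by (intro choice allI) (metis stf_gauss_lattice_fun[OF EE(2)])
    then obtain R where R: "\<And>N m. 0 \<le> R N m" "\<And>N m. stf ?g (lattice_fun E N) (step E m) = of_real (R N m)"
      "\<And>N m. m < N \<Longrightarrow> c0 \<le> R N m"
      by metis
    define a where "a i = of_real (d i) * stf ?g ?f (step E (?m' i))" for i
    have wt_term: "of_real (d i) * cnj (stf \<Gamma> (tau_wigner \<tau> F ?f) (\<omega> i)) = a i * cnj (stf ?g F (step E (?m i)))"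
      if F: "F \<in> schwartz" for F i
      unfolding \<Gamma>_def stf_tau_wigner[OF f F g g] \<omega>_def wig_lattice_point[OF EE(2)] by (simp add: a_def)
    \<comment> \<open>Each term of the symbol maps the input to a multiple of one shifted Gaussian,
      so the image is a weighted sum of the same kind, with coefficients that contain the transform
      of the input.\<close>
    have U: "tau_op \<tau> \<sigma> ?f = (\<lambda>F\<in>schwartz. \<integral>i. a i * cnj (stf ?g F (step E (?m i))) \<partial>?cs)"
      using f by (auto simp: fun_eq_iff tau_op_def \<sigma>_def tau_wigner_schwartz wt_term)
    have ai: "integrable ?cs (\<lambda>i. norm (a i) / ((1 + norm (fst (step E (?m i))))\<^sup>2 * (1 + \<bar>e \<bullet> snd (step E (?m i))\<bar>)\<^sup>2))"
    proof -
      obtain c where c: "0 < c" "sbd 2 2 c ?f" using sbd_exists[OF f] by blast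
      obtain K where K: "0 \<le> K" "\<And>F c w. F \<in> schwartz \<Longrightarrow> sbd 2 2 c F \<Longrightarrow>
          norm (stf ?g F w) \<le> K * c / ((1 + norm (fst w))\<^sup>2 * (1 + \<bar>e \<bullet> snd w\<bar>)\<^sup>2)"
        using stf_decay[OF g e] by metis
      have den: "(1 + norm (fst (step E m)))\<^sup>2 * (1 + \<bar>e \<bullet> snd (step E m)\<bar>)\<^sup>2 = (1 + real m)\<^sup>2" for m
        using E e e1 by (auto simp: step_def)
      have na: "norm (a i) \<le> K * c / (1 + real (?m' i))\<^sup>2" for i
        using mult_mono[OF d(2)[of i] K(2)[OF f c(2), of "step E (?m' i)"]] d[of i] unfolding den
        by (simp add: a_def norm_mult)
      show ?thesis
        unfolding den
      proof (rule Bochner_Integration.integrable_bound[OF integrable_mult_right[OF integrable_pair_weights, of "K * c"]])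
        show "AE i in ?cs. norm (norm (a i) / (1 + real (?m i))\<^sup>2) \<le> norm (K * c * (case i of (n, k) \<Rightarrow> 1 / ((1 + real n)\<^sup>2 * (1 + real k)\<^sup>2)))"
        proof (intro AE_I2)
          fix i :: "nat \<times> nat"
          obtain n k where i: "i = (n, k)" by force
          have "(1 + real n)\<^sup>2 * (1 + real k)\<^sup>2 \<le> (1 + real n)\<^sup>2 * (1 + real (n + k))\<^sup>2"
            by (intro mult_left_mono power_mono) auto
          \<comment> \<open>One of the two indices is n and the other n + k, whichever way b and b'
            are chosen.\<close>
          also have "\<dots> = (1 + real (?m' i))\<^sup>2 * (1 + real (?m i))\<^sup>2"
            using bb by (auto simp: i)
          finally have m: "(1 + real n)\<^sup>2 * (1 + real k)\<^sup>2 \<le> (1 + real (?m' i))\<^sup>2 * (1 + real (?m i))\<^sup>2" .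
          have "norm (a i) / (1 + real (?m i))\<^sup>2 \<le> K * c / (1 + real (?m' i))\<^sup>2 / (1 + real (?m i))\<^sup>2"
            by (intro divide_right_mono na) simp
          also have "\<dots> = K * c / ((1 + real (?m' i))\<^sup>2 * (1 + real (?m i))\<^sup>2)" by simp
          also have "\<dots> \<le> K * c / ((1 + real n)\<^sup>2 * (1 + real k)\<^sup>2)"
            using K(1) c(1) by (intro divide_left_mono m mult_pos_pos zero_less_power add_pos_nonneg) auto
          finally show "norm (norm (a i) / (1 + real (?m i))\<^sup>2) \<le> norm (K * c * (case i of (n, k) \<Rightarrow> 1 / ((1 + real n)\<^sup>2 * (1 + real k)\<^sup>2)))"
            using K(1) c(1) by (simp add: i)
        qed
      qed simp
    qed
    have Ut: "tau_op \<tau> \<sigma> ?f \<in> tempered"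
      unfolding U by (rule tempered_weighted_sum(1)[OF g e ai])
    have hi: "integrable ?cs (\<lambda>i. a i * cnj (stf ?g ?h (step E (?m i))))"
      by (rule tempered_weighted_sum(2)[OF g e ai h])
    \<comment> \<open>All terms of the pairing are nonnegative, so dropping those outside A gives a
      lower bound; for indices in A both Gaussian factors are at least c0.\<close>
    have low: "c0\<^sup>2 * (\<Sum>i\<in>A. d i) \<le> norm (tau_op \<tau> \<sigma> ?f ?h)"
    proof -
      define t where "t i = d i * (R N (?m' i) * R M (?m i))" for i
      have t: "a i * cnj (stf ?g ?h (step E (?m i))) = of_real (t i)" for i
        by (simp add: a_def R(2) t_def)
      have ti: "integrable ?cs t" using hi unfolding t by (simp add: complex_of_real_integrable_eq)
      have t0: "0 \<le> t i" for i by (simp add: t_def R(1) d)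
      have "c0\<^sup>2 * (\<Sum>i\<in>A. d i) = (\<Sum>i\<in>A. d i * (c0 * c0))"
        by (simp add: sum_distrib_left power2_eq_square mult.commute)
      also have "\<dots> \<le> (\<Sum>i\<in>A. t i)"
        unfolding t_def using A(4) c0 by (intro sum_mono mult_left_mono mult_mono R d) auto
      also have "\<dots> = (\<integral>i. t i * indicator A i \<partial>?cs)"
      proof -
        have S: "finite {i. t i * indicator A i \<noteq> 0}" by (rule finite_subset[OF _ A(1)]) (auto simp: indicator_def)
        have "(\<integral>i. t i * indicator A i \<partial>?cs) = (\<Sum>i | t i * indicator A i \<noteq> 0. t i * indicator A i)"
          using S by (subst lebesgue_integral_count_space_finite_support) auto
        also have "\<dots> = (\<Sum>i\<in>A. t i)"
          by (intro sum.mono_neutral_cong_left A(1)) (auto simp: indicator_def)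
        finally show ?thesis by simp
      qed
      also have "\<dots> \<le> (\<integral>i. t i \<partial>?cs)"
        using t0 by (intro integral_mono integrable_real_mult_indicator ti) (auto simp: indicator_def)
      also have "\<dots> = norm (tau_op \<tau> \<sigma> ?f ?h)"
        using h t0 by (simp add: U t integral_nonneg_AE)
      finally show ?thesis .
    qed
    have "ennreal (c1 * norm (tau_op \<tau> \<sigma> ?f ?h))
      \<le> MN P2 Q2 (astft \<phi> (tau_op \<tau> \<sigma> ?f)) * MN (1 - P2) (1 - Q2) (astft \<phi> (distribution_of ?h))"
      unfolding c1_def using r by (intro tempered_norm_duality Ut h \<phi>(1)) auto
    also have "\<dots> \<le> (ennreal C * ennreal (D1 * real N powr ?a)) * ennreal (D2 * real M powr ?b)"
      by (intro mult_mono order.trans[OF C[OF f]] mult_left_mono D1(2) D2(2) A) auto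
    \<comment> \<open>The constant of the hypothesis is an arbitrary real; its absolute value is a
      bound for the embedded constant.\<close>
    also have "\<dots> \<le> ennreal (\<bar>C\<bar> * (D1 * real N powr ?a) * (D2 * real M powr ?b))"
      using D1(1) D2(1) by (simp add: ennreal_mult ennreal_leI mult_right_mono)
    finally have up: "c1 * norm (tau_op \<tau> \<sigma> ?f ?h) \<le> \<bar>C\<bar> * (D1 * real N powr ?a) * (D2 * real M powr ?b)"
      using D1(1) D2(1) by (simp add: ennreal_le_iff)
    have "c1 * c0\<^sup>2 * (\<Sum>i\<in>A. d i) \<le> c1 * norm (tau_op \<tau> \<sigma> ?f ?h)"
      using mult_left_mono[OF low, of c1] c1 by (simp add: mult.assoc)
    also note up
    also have "\<bar>C\<bar> * (D1 * real N powr ?a) * (D2 * real M powr ?b) = \<bar>C\<bar> * D1 * D2 * (real N powr ?a * real M powr ?b)" by (simp only: ac_simps)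
    finally have fin_le: "c1 * c0\<^sup>2 * (\<Sum>i\<in>A. d i) \<le> \<bar>C\<bar> * D1 * D2 * (real N powr ?a * real M powr ?b)" .
    have "(\<Sum>i\<in>A. d i) \<le> \<bar>C\<bar> * D1 * D2 / (c1 * c0\<^sup>2) * (real N powr ?a * real M powr ?b)"
    proof -
      have "x \<le> y / p * z" if "p * x \<le> y * z" "0 < p" for x y z p :: real
        using that by (simp add: field_simps)
      from this[OF fin_le] show ?thesis using c0 c1 by simp
    qed
    then show "(\<Sum>i\<in>A. u (fst i) * v (snd i))
      \<le> \<bar>C\<bar> * D1 * D2 / (c1 * c0\<^sup>2) * (real N powr ?a * real M powr (1 - (if snd E = 0 then P2 else Q2)))"
      unfolding d_def by (cases "snd E = 0") simp_all
  qed
qed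

section \<open>Necessity of the exponent conditions\<close>

text \<open>If a > b, then the power a - b of a sufficiently large K would exceed C.\<close>

lemma powr_growth_le:
  assumes le: "\<And>K::nat. 0 < K \<Longrightarrow> real K powr a \<le> C * real K powr b"
  shows "a \<le> b"
proof (rule ccontr)
  assume "\<not> a \<le> b"
  then have pos: "0 < a - b" by simp
  define X where "X = (\<bar>C\<bar> + 1) powr (1 / (a - b))"
  define K where "K = nat \<lceil>X\<rceil> + 1"
  have K: "0 < K" "X \<le> real K" unfolding K_def by linarith+
  have "\<bar>C\<bar> + 1 = X powr (a - b)" using pos by (simp add: X_def powr_powr)
  also have "\<dots> \<le> real K powr (a - b)" using K pos by (intro powr_mono2) (auto simp: X_def)
  also have "\<dots> = real K powr a / real K powr b" by (rule powr_diff)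
  also have "\<dots> \<le> C" using le[OF K(1)] K(1) by (simp add: divide_le_eq)
  finally show False by simp
qed

lemma powr_sequence_bounds:
  assumes "0 \<le> \<gamma>"
  shows "0 \<le> real (Suc n) powr - \<gamma>" "real (Suc n) powr - \<gamma> \<le> 1" "n < K \<Longrightarrow> real K powr - \<gamma> \<le> real (Suc n) powr - \<gamma>"
proof -
  show "0 \<le> real (Suc n) powr - \<gamma>" by simp
  have "real (Suc n) powr - \<gamma> \<le> real (Suc n) powr 0" using assms by (intro powr_mono) auto
  then show "real (Suc n) powr - \<gamma> \<le> 1" by simp
  show "real K powr - \<gamma> \<le> real (Suc n) powr - \<gamma>" if "n < K"
    using that assms by (intro powr_mono2') auto
qed

text \<open>A time direction E yields the conditions on p1 and p2, a frequency direction those on q1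
  and q2. The limiting exponents are reached by letting \<epsilon> tend to zero.\<close>

lemma tau_op_bounded_necessary:
  fixes \<phi> :: "'a::euclidean_space \<Rightarrow> complex" and \<Phi> :: "'a \<times> 'a \<Rightarrow> complex" and E :: "'a \<times> 'a" and e :: 'a
  assumes \<phi>: "\<phi> \<in> schwartz" "\<phi> \<noteq> (\<lambda>x. 0)" and \<Phi>: "\<Phi> \<in> schwartz"
    and r: "P \<in> {0..1}" "Q \<in> {0..1}" "P1 \<in> {0..1}" "Q1 \<in> {0..1}" "P2 \<in> {0..1}" "Q2 \<in> {0..1}"
    and \<tau>: "\<tau> \<in> {0..1}"
    and hyp: "\<And>\<sigma>. \<sigma> \<in> tempered \<Longrightarrow> MN P Q (astft \<Phi> \<sigma>) < \<infinity> \<Longrightarrow>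
      \<exists>C::real. \<forall>f\<in>schwartz. MN P2 Q2 (astft \<phi> (tau_op \<tau> \<sigma> f)) \<le> ennreal C * MN P1 Q1 (astft \<phi> (distribution_of f))"
    and e: "e \<in> Basis" and E: "E = (e, 0) \<or> E = (0, e)"
  defines "a1 \<equiv> if snd E = 0 then P1 else Q1" and "a2 \<equiv> if snd E = 0 then P2 else Q2"
  shows "1 - Q \<le> a1" "a2 \<le> Q" "(1 - P) + (1 - Q) \<le> a1 + (1 - a2)"
proof -
  note core = necessity_core[OF \<phi> \<Phi> r \<tau> hyp e E, folded a1_def a2_def]
  let ?d = "\<lambda>n. indicator {0::nat} n :: real"
  have d: "0 \<le> ?d n" "?d n \<le> 1" for n by (auto simp: indicator_def)
  have dfin: "epow (\<integral>\<^sup>+n. epow (ennreal (?d n)) (1 / P) \<partial>count_space UNIV) P < \<infinity>"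
    using epow_sum_indicator[of "{0}" P] r by (simp add: ennreal_indicator)
  have sum_row: "(\<Sum>i\<in>{0} \<times> {..<K}. ?d (fst i) * v (snd i)) = (\<Sum>k<K. v k)" for v :: "nat \<Rightarrow> real" and K
    by (subst sum.cartesian_product[symmetric, where g = "\<lambda>n k. ?d n * v k", unfolded case_prod_beta']) simp
  define w where "w \<epsilon> n = real (Suc n) powr - \<epsilon>" for \<epsilon> and n :: nat
  have w: "0 \<le> w \<gamma> n" "w \<gamma> n \<le> 1" "n < K \<Longrightarrow> real K powr - \<gamma> \<le> w \<gamma> n" if "0 \<le> \<gamma>" for n K \<gamma>
    unfolding w_def by (rule powr_sequence_bounds[OF that])+
  have wfin: "epow (\<integral>\<^sup>+n. epow (ennreal (w \<gamma> n)) (1 / \<theta>) \<partial>count_space UNIV) \<theta> < \<infinity>" if "0 \<le> \<theta>" "\<theta> < \<gamma>" for \<gamma> \<theta>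
    unfolding w_def by (rule epow_sum_powr[OF that])
  have row: "real K powr (1 - \<gamma>) \<le> (\<Sum>k<K. w \<gamma> k)" if "0 \<le> \<gamma>" "0 < K" for K \<gamma>
  proof -
    have "real K powr (1 - \<gamma>) = (\<Sum>k<K. real K powr - \<gamma>)"
      using that by (simp add: powr_diff powr_minus_divide)
    also have "\<dots> \<le> (\<Sum>k<K. w \<gamma> k)" by (intro sum_mono w(3) that) simp
    finally show ?thesis .
  qed
  show "1 - Q \<le> a1"
  proof (rule field_le_epsilon)
    fix \<epsilon> :: real assume \<epsilon>: "0 < \<epsilon>"
    \<comment> \<open>The weights (k + 1)^(-Q - \<epsilon>) are barely q-summable, while their
      partial sums grow at least like K^(1 - Q - \<epsilon>).\<close>
    let ?\<gamma> = "Q + \<epsilon>"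
    have \<gamma>: "0 \<le> ?\<gamma>" "0 \<le> Q" "Q < ?\<gamma>" using \<epsilon> r by auto
    obtain C where C: "\<And>A M N. finite A \<Longrightarrow> 0 < M \<Longrightarrow> 0 < N \<Longrightarrow>
      (\<And>i. i \<in> A \<Longrightarrow> fst i + 0 * snd i < M \<and> fst i + 1 * snd i < N) \<Longrightarrow>
      (\<Sum>i\<in>A. ?d (fst i) * w ?\<gamma> (snd i)) \<le> C * (real N powr a1 * real M powr (1 - a2))"
      using core[of 0 1 ?d "w ?\<gamma>"] d w[OF \<gamma>(1)] dfin wfin[OF \<gamma>(2,3)] by auto
    have "1 - ?\<gamma> \<le> a1"
    proof (rule powr_growth_le[of _ C])
      fix K :: nat assume K: "0 < K"
      have "real K powr (1 - ?\<gamma>) \<le> (\<Sum>i\<in>{0} \<times> {..<K}. ?d (fst i) * w ?\<gamma> (snd i))"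
        unfolding sum_row by (rule row[OF \<gamma>(1) K])
      \<comment> \<open>With n = 0 only, the output consists of the single index 0, so M = 1 and the
        whole growth falls on the input.\<close>
      also have "\<dots> \<le> C * (real K powr a1 * real 1 powr (1 - a2))"
        using K by (intro C) auto
      finally show "real K powr (1 - ?\<gamma>) \<le> C * real K powr a1" by simp
    qed
    then show "1 - Q \<le> a1 + \<epsilon>" by simp
  qed
  show "a2 \<le> Q"
  proof (rule field_le_epsilon)
    fix \<epsilon> :: real assume \<epsilon>: "0 < \<epsilon>"
    let ?\<gamma> = "Q + \<epsilon>"
    have \<gamma>: "0 \<le> ?\<gamma>" "0 \<le> Q" "Q < ?\<gamma>" using \<epsilon> r by auto
    obtain C where C: "\<And>A M N. finite A \<Longrightarrow> 0 < M \<Longrightarrow> 0 < N \<Longrightarrow>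
      (\<And>i. i \<in> A \<Longrightarrow> fst i + 1 * snd i < M \<and> fst i + 0 * snd i < N) \<Longrightarrow>
      (\<Sum>i\<in>A. ?d (fst i) * w ?\<gamma> (snd i)) \<le> C * (real N powr a1 * real M powr (1 - a2))"
      \<comment> \<open>The same test with the roles exchanged: now k displaces the output, and N =
        1.\<close>
      using core[of 1 0 ?d "w ?\<gamma>"] d w[OF \<gamma>(1)] dfin wfin[OF \<gamma>(2,3)] by auto
    have "1 - ?\<gamma> \<le> 1 - a2"
    proof (rule powr_growth_le[of _ C])
      fix K :: nat assume K: "0 < K"
      have "real K powr (1 - ?\<gamma>) \<le> (\<Sum>i\<in>{0} \<times> {..<K}. ?d (fst i) * w ?\<gamma> (snd i))"
        unfolding sum_row by (rule row[OF \<gamma>(1) K])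
      also have "\<dots> \<le> C * (real 1 powr a1 * real K powr (1 - a2))"
        using K by (intro C) auto
      finally show "real K powr (1 - ?\<gamma>) \<le> C * real K powr (1 - a2)" by simp
    qed
    then show "a2 \<le> Q + \<epsilon>" by simp
  qed
  show "(1 - P) + (1 - Q) \<le> a1 + (1 - a2)"
  proof (rule field_le_epsilon)
    fix \<epsilon> :: real assume \<epsilon>: "0 < \<epsilon>"
    let ?\<gamma> = "P + \<epsilon> / 2" and ?\<delta> = "Q + \<epsilon> / 2"
    have \<gamma>: "0 \<le> ?\<gamma>" "0 \<le> P" "P < ?\<gamma>" and \<delta>: "0 \<le> ?\<delta>" "0 \<le> Q" "Q < ?\<delta>" using \<epsilon> r by auto
    obtain C where C: "\<And>A M N. finite A \<Longrightarrow> 0 < M \<Longrightarrow> 0 < N \<Longrightarrow>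
      (\<And>i. i \<in> A \<Longrightarrow> fst i + 0 * snd i < M \<and> fst i + 1 * snd i < N) \<Longrightarrow>
      (\<Sum>i\<in>A. w ?\<gamma> (fst i) * w ?\<delta> (snd i)) \<le> C * (real N powr a1 * real M powr (1 - a2))"
      using core[of 0 1 "w ?\<gamma>" "w ?\<delta>"] w[OF \<gamma>(1)] w[OF \<delta>(1)] wfin[OF \<gamma>(2,3)] wfin[OF \<delta>(2,3)] by auto
    have "(1 - ?\<gamma>) + (1 - ?\<delta>) \<le> a1 + (1 - a2)"
    proof (rule powr_growth_le[of _ "C * 2 powr a1"])
      fix K :: nat assume K: "0 < K"
      have "real K powr ((1 - ?\<gamma>) + (1 - ?\<delta>)) = real K powr (1 - ?\<gamma>) * real K powr (1 - ?\<delta>)" by (rule powr_add)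
      also have "\<dots> \<le> (\<Sum>n<K. w ?\<gamma> n) * (\<Sum>k<K. w ?\<delta> k)"
        by (intro mult_mono row \<gamma> \<delta> K sum_nonneg w) auto
      also have "\<dots> = (\<Sum>i\<in>{..<K} \<times> {..<K}. w ?\<gamma> (fst i) * w ?\<delta> (snd i))"
        unfolding sum_product sum.cartesian_product by (simp add: case_prod_beta')
      \<comment> \<open>Both indices run below K, so the input index n + k stays below 2 K; the
        factor \<open>2 powr a1\<close> is harmless for the growth.\<close>
      also have "\<dots> \<le> C * (real (2 * K) powr a1 * real K powr (1 - a2))"
        using K by (intro C) auto
      also have "\<dots> = C * 2 powr a1 * real K powr (a1 + (1 - a2))"
        by (simp add: powr_mult powr_add)
      finally show "real K powr ((1 - ?\<gamma>) + (1 - ?\<delta>)) \<le> C * 2 powr a1 * real K powr (a1 + (1 - a2))" .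
    qed
    then show "(1 - P) + (1 - Q) \<le> a1 + (1 - a2) + \<epsilon>" by simp
  qed
qed

section \<open>From extended exponents to real reciprocals\<close>

lemma ennreal_le_iff_inverse: "a \<le> b \<longleftrightarrow> inverse b \<le> inverse (a::ennreal)"
proof -
  have "inverse y \<le> inverse x" if "x \<le> y" for x y :: ennreal
  proof (cases "x = 0 \<or> y = top")
    case False
    with that have "0 < x" "x < top" "0 < y" "y < top" by (auto simp: zero_less_iff_neq_zero top_unique less_top)
    then obtain a b where "x = ennreal a" "y = ennreal b" "0 < a" "0 < b"
      by (cases x; cases y) (auto simp: ennreal_zero_less_top)
    with that show ?thesis by (simp add: inverse_ennreal le_imp_inverse_le)
  qed auto
  moreover have "inverse (inverse x) = x" for x :: ennreal
    using one_divide_one_divide_ennreal[of x] by (simp add: divide_ennreal_def)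
  ultimately show ?thesis by metis
qed

text \<open>For exponents at least one all reciprocals are finite, and conjugation becomes a
  subtraction of real numbers.\<close>

lemma inverse_exponent:
  assumes "1 \<le> (p::ennreal)"
  shows "inverse p = ennreal (enn2real (inverse p))" "enn2real (inverse p) \<in> {0..1}"
    and "inverse (conj_exponent p) = ennreal (1 - enn2real (inverse p))"
proof -
  have "inverse p \<le> inverse 1"
    using assms by (simp only: ennreal_le_iff_inverse[of 1 p])
  then have le: "inverse p \<le> 1" by simp
  show eq: "inverse p = ennreal (enn2real (inverse p))"
    using le by (intro ennreal_enn2real[symmetric]) (simp add: le_less_trans[OF _ ennreal_one_less_top])
  show "enn2real (inverse p) \<in> {0..1}"
    using enn2real_mono[OF le] by simp
  have "inverse (conj_exponent p) = 1 - inverse p"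
    using one_divide_one_divide_ennreal[of "1 - inverse p"] by (simp add: conj_exponent_def divide_ennreal_def)
  also have "\<dots> = ennreal 1 - ennreal (enn2real (inverse p))" using eq by simp
  also have "\<dots> = ennreal (1 - enn2real (inverse p))" by (rule ennreal_minus) simp
  finally show "inverse (conj_exponent p) = ennreal (1 - enn2real (inverse p))" .
qed

theorem theorem6p3:
  fixes p q p1 p2 q1 q2 :: ennreal
    and \<tau> :: real
    and \<phi> :: "real ^ 'd \<Rightarrow> complex"
    and \<Phi> :: "(real ^ 'd) \<times> (real ^ 'd) \<Rightarrow> complex"
  assumes "1 \<le> p" "1 \<le> q" "1 \<le> p1" "1 \<le> p2" "1 \<le> q1" "1 \<le> q2"
    and "\<tau> \<in> {0..1}"
    and "\<phi> \<in> schwartz" "\<phi> \<noteq> (\<lambda>_. 0)"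
    and "\<Phi> \<in> schwartz" "\<Phi> \<noteq> (\<lambda>_. 0)"
  shows "(\<forall>\<sigma>\<in>modulation_space \<Phi> p q. \<exists>C::real. \<forall>f\<in>schwartz.
            modulation_norm \<phi> p2 q2 (tau_op \<tau> \<sigma> f)
              \<le> ennreal C * modulation_norm \<phi> p1 q1 (distribution_of f))
    \<longleftrightarrow>
      (p1 \<le> conj_exponent q \<and> q1 \<le> conj_exponent q \<and>
       conj_exponent p2 \<le> conj_exponent q \<and> conj_exponent q2 \<le> conj_exponent q) \<and>
      1 / p1 + 1 / conj_exponent p2 \<ge> 1 / conj_exponent p + 1 / conj_exponent q \<and>
      1 / q1 + 1 / conj_exponent q2 \<ge> 1 / conj_exponent p + 1 / conj_exponent q"
    (is "?bounded \<longleftrightarrow> ?exponents")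
proof -
  define P where "P = enn2real (inverse p)"
  define Q where "Q = enn2real (inverse q)"
  define P1 where "P1 = enn2real (inverse p1)"
  define Q1 where "Q1 = enn2real (inverse q1)"
  define P2 where "P2 = enn2real (inverse p2)"
  define Q2 where "Q2 = enn2real (inverse q2)"
  note defs = P_def Q_def P1_def Q1_def P2_def Q2_def
  have r: "P \<in> {0..1}" "Q \<in> {0..1}" "P1 \<in> {0..1}" "Q1 \<in> {0..1}" "P2 \<in> {0..1}" "Q2 \<in> {0..1}"
    unfolding defs by (intro inverse_exponent(2) assms)+
  have inv: "inverse p1 = ennreal P1" "inverse q1 = ennreal Q1"
    "inverse (conj_exponent p) = ennreal (1 - P)" "inverse (conj_exponent q) = ennreal (1 - Q)"
    "inverse (conj_exponent p2) = ennreal (1 - P2)" "inverse (conj_exponent q2) = ennreal (1 - Q2)"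
    unfolding defs by (intro inverse_exponent(1,3) assms)+
  have exponents: "?exponents \<longleftrightarrow> (1 - Q \<le> P1 \<and> 1 - Q \<le> Q1 \<and> P2 \<le> Q \<and> Q2 \<le> Q) \<and>
      (1 - P) + (1 - Q) \<le> P1 + (1 - P2) \<and> (1 - P) + (1 - Q) \<le> Q1 + (1 - Q2)"
    unfolding ennreal_le_iff_inverse[of _ "conj_exponent q"] divide_ennreal_def inv mult_1
    using r by (simp add: ennreal_plus[symmetric] ennreal_le_iff del: ennreal_plus)
  have norms: "modulation_norm \<Phi> p q u = MN P Q (astft \<Phi> u)"
    "modulation_norm \<phi> p1 q1 w = MN P1 Q1 (astft \<phi> w)" "modulation_norm \<phi> p2 q2 w = MN P2 Q2 (astft \<phi> w)" for u w
    unfolding defs by (intro modulation_norm_eq_MN assms)+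
  show ?thesis
  proof
    assume ?bounded
    then have hyp: "\<exists>C::real. \<forall>f\<in>schwartz. MN P2 Q2 (astft \<phi> (tau_op \<tau> \<sigma> f)) \<le> ennreal C * MN P1 Q1 (astft \<phi> (distribution_of f))"
      if "\<sigma> \<in> tempered" "MN P Q (astft \<Phi> \<sigma>) < \<infinity>" for \<sigma>
      using that unfolding modulation_space_def norms by blast
    \<comment> \<open>Any coordinate direction will do: (e, 0) tests the time exponents and (0, e)
      the frequency exponents.\<close>
    obtain e :: "real ^ 'd" where e: "e \<in> Basis" using nonempty_Basis by blast
    then have e0: "e \<noteq> 0" by auto
    note nec = tau_op_bounded_necessary[OF assms(8,9,10) r assms(7) hyp e]
    show ?exponents
      unfolding exponents using nec[of "(e, 0)"] nec[of "(0, e)"] e0 by simp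
  next
    assume ?exponents
    then have c: "1 - Q \<le> P1" "1 - Q \<le> Q1" "P2 \<le> Q" "Q2 \<le> Q"
      "(1 - P) + (1 - Q) \<le> P1 + (1 - P2)" "(1 - P) + (1 - Q) \<le> Q1 + (1 - Q2)"
      unfolding exponents by auto
    obtain C where C: "0 \<le> C" "\<And>\<sigma> f. \<sigma> \<in> tempered \<Longrightarrow> f \<in> schwartz \<Longrightarrow>
        MN P2 Q2 (astft \<phi> (tau_op \<tau> \<sigma> f)) \<le> ennreal C * MN P Q (astft \<Phi> \<sigma>) * MN P1 Q1 (astft \<phi> (distribution_of f))"
      using tau_op_bounded[OF assms(8-11) r c, of \<tau>] by blast
    show ?bounded
      unfolding norms
    proof
      fix \<sigma> assume "\<sigma> \<in> modulation_space \<Phi> p q"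
      then have \<sigma>: "\<sigma> \<in> tempered" "MN P Q (astft \<Phi> \<sigma>) < \<infinity>" by (auto simp: modulation_space_def norms)
      \<comment> \<open>The constant for a given symbol is the uniform constant times the finite
        norm of the symbol.\<close>
      then have "ennreal C * MN P Q (astft \<Phi> \<sigma>) = ennreal (C * enn2real (MN P Q (astft \<Phi> \<sigma>)))"
        using C(1) by (simp add: ennreal_mult)
      then show "\<exists>C::real. \<forall>f\<in>schwartz. MN P2 Q2 (astft \<phi> (tau_op \<tau> \<sigma> f)) \<le> ennreal C * MN P1 Q1 (astft \<phi> (distribution_of f))"
        using C(2)[OF \<sigma>(1)] by metis
    qed
  qed
qed

end
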